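(* Let $p^0\in H_0^2(\Omega)$. Assume that the saturation function $S\in C^1(\mathbb R)$, with values in $(0,1]$, is Lipschitz continuous, strictly positive and strictly monotone increasing, and that the conductivity function $K_f\in C^1(\mathbb R)$ is strictly positive, bounded and monotone increasing. Let $\psi(p)=\int_0^pK_f(S(\tau))\,d\tau$, $b=S\circ\psi^{-1}$, $u^0=\psi(p^0)$, and let $u\in H^1(\Omega\times(0,T))\cap L^2(0,T;H_0^2(\Omega))$ be the weak solution (in the sense of the context) of the transformed problem $$\partial_t b(u)+\nabla\cdot\bigl(K_f(b(u))\mathbf e_3\bigr)-\Delta u+\gamma\Delta^2u=0\ \text{ in }\Omega\times(0,T),$$ $$u(\cdot,0)=u^0\ \text{ in }\Omega,\qquad u=0,\ \ \nabla u\cdot\mathbf n=0\ \text{ on }\partial\Omega\times(0,T).$$ Then $p=\psi^{-1}(u)$ is the unique weak solution (in the sense of the context) of the fourth-order problem $$\partial_tS(p)+\nabla\cdot\bigl(K_f(S(p))\mathbf e_3\bigr)-\nabla\cdot\bigl(K_f(S(p))\nabla p\bigr)+\gamma\,\Delta\nabla\cdot\bigl(K_f(S(p))\nabla p\bigr)=0\ \text{ in }\Omega\times(0,T),$$ $$p(\cdot,0)=p^0\ \text{ in }\Omega,\qquad p=0,\ \ \nabla p\cdot\mathbf n=0\ \text{ on }\partial\Omega\times[0,T].$$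
   Context: Standing assumptions: $\Omega\subset\mathbb R^3$ is an open bounded connected set with boundary $\partial\Omega\in C^5$ and outer normal $\mathbf n$; $0<T<\infty$; $\gamma>0$ is a constant; $\mathbf e_3=(0,0,1)^T$. $K_f$ is a function of saturation, composed with $S$. The map $\psi:\mathbb R\to\mathbb R$ is Kirchhoff's transformation, and $\psi^{-1}$ is its inverse, defined on the range of $\psi$. Weak solution of the transformed problem: a function $u\in L^2(0,T;H_0^2(\Omega))$ such that 1. $K_f(b(u))\in L^2(\Omega\times(0,T))$, $\partial_t b(u)\in L^2(0,T;H^{-2}(\Omega))$, and $\int_0^T\int_\Omega\bigl(\partial_t b(u)\,\phi-K_f(b(u))\,\mathbf e_3\cdot\nabla\phi+\nabla u\cdot\nabla\phi+\gamma\,\Delta u\,\Delta\phi\bigr)\,d\mathbf x\,dt=0$ for every $\phi\in L^2(0,T;H_0^2(\Omega))$; 2. $b(u)\in L^\infty(0,T;L^1(\Omega))$, $\partial_t b(u)\in L^2(0,T;H^{-2}(\Omega))$, and $\int_0^T\int_\Omega\partial_t b(u)\,\phi\,d\mathbf x\,dt=\int_0^T\int_\Omega(b(u^0)-b(u))\,\partial_t\phi\,d\mathbf x\,dt$ for all $\phi\in L^2(0,T;H_0^2(\Omega))$ with $\partial_t\phi\in L^1(0,T;L^\infty(\Omega))$ and $\phi(\cdot,T)=0$. Here $H^{-2}(\Omega)$ is the dual of $H_0^2(\Omega)$ and integrals containing $\partial_t b(u)\,\phi$ denote the duality pairing. Weak solution of the fourth-order problem: a function $p\in H^1(\Omega\times(0,T))$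 satisfying the boundary conditions $p=0$ and $\nabla p\cdot\mathbf n=0$ on $\partial\Omega$ in the sense that $\psi(p)\in L^2(0,T;H_0^2(\Omega))$, and such that (i) $\partial_tS(p)\in L^2(\Omega\times(0,T))$, $\nabla\cdot(K_f(S(p))\nabla p)\in L^2(\Omega\times(0,T))$, and $$\int_0^T\int_\Omega\Bigl(\partial_tS(p)\,\phi-K_f(S(p))\,\mathbf e_3\cdot\nabla\phi+K_f(S(p))\nabla p\cdot\nabla\phi\Bigr)\,d\mathbf x\,dt+\gamma\int_0^T\int_\Omega\nabla\cdot\bigl(K_f(S(p))\nabla p\bigr)\,\Delta\phi\,d\mathbf x\,dt=0$$ for every $\phi\in L^2(0,T;H_0^2(\Omega))$; (ii) $S(p(0))=S(p^0)$ almost everywhere in $\Omega$ (recall $H^1(\Omega\times(0,T))\subset C([0,T];L^2(\Omega))$). *)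

theory Defs
  imports "HOL-Analysis.Analysis" "HOL-Probability.Essential_Supremum"
begin

section \<open>Smooth functions and domains with smooth boundary\<close>

text \<open>Intended for open sets \<open>U\<close>, where \<^term>\<open>frechet_derivative f (at x) v\<close> is the
  derivative of \<open>f\<close> in direction \<open>v\<close>.\<close>

primrec Ck_on :: "nat \<Rightarrow> ('a::euclidean_space \<Rightarrow> real) \<Rightarrow> 'a set \<Rightarrow> bool" where
  "Ck_on 0 f U \<longleftrightarrow> continuous_on U f"
| "Ck_on (Suc k) f U \<longleftrightarrow> f differentiable_on U \<and>
     (\<forall>i\<in>Basis. Ck_on k (\<lambda>x. frechet_derivative f (at x) i) U)"

definition test_functions :: "'a::euclidean_space set \<Rightarrow> ('a \<Rightarrow> real) set" where
  "test_functions U = {\<phi>. (\<forall>k. Ck_on k \<phi> UNIV) \<and>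
     compact (closure {x. \<phi> x \<noteq> 0}) \<and> closure {x. \<phi> x \<noteq> 0} \<subseteq> U}"

text \<open>Near each boundary point \<open>U\<close> is the strict epigraph of a \<open>C\<^sup>k\<close> function over a hyperplane:
  \<open>e\<close> is the "vertical" unit vector, \<open>x \<bullet> e\<close> the height of \<open>x\<close>, and \<open>x - (x \<bullet> e) *\<^sub>R e\<close> its
  projection to the hyperplane orthogonal to \<open>e\<close>; \<open>g\<close> is only ever evaluated on that hyperplane.\<close>

definition Ck_boundary :: "nat \<Rightarrow> 'a::euclidean_space set \<Rightarrow> bool" where
  "Ck_boundary k U \<longleftrightarrow> (\<forall>x0\<in>frontier U. \<exists>r>0. \<exists>e g. norm e = 1 \<and> Ck_on k g UNIV \<and>
     U \<inter> ball x0 r = {x \<in> ball x0 r. x \<bullet> e > g (x - (x \<bullet> e) *\<^sub>R e)})"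

section \<open>Lebesgue and Sobolev spaces\<close>

text \<open>Elements of all function spaces are represented by functions on the whole type, of which
  only the values on the respective set (up to null sets) matter.\<close>

definition L1 :: "'a::euclidean_space set \<Rightarrow> ('a \<Rightarrow> real) set" where
  "L1 U = {f. integrable (lebesgue_on U) f}"

definition L1_norm :: "'a::euclidean_space set \<Rightarrow> ('a \<Rightarrow> real) \<Rightarrow> real" where
  "L1_norm U f = integral\<^sup>L (lebesgue_on U) (\<lambda>x. \<bar>f x\<bar>)"

definition L2 :: "'a::euclidean_space set \<Rightarrow> ('a \<Rightarrow> real) set" where
  "L2 U = {f. f \<in> borel_measurable (lebesgue_on U) \<and> integrable (lebesgue_on U) (\<lambda>x. (f x)\<^sup>2)}"

definition L2_norm :: "'a::euclidean_space set \<Rightarrow> ('a \<Rightarrow> real) \<Rightarrow> real" where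
  "L2_norm U f = sqrt (integral\<^sup>L (lebesgue_on U) (\<lambda>x. (f x)\<^sup>2))"

definition Linf :: "'a::euclidean_space set \<Rightarrow> ('a \<Rightarrow> real) set" where
  "Linf U = {f. f \<in> borel_measurable (lebesgue_on U) \<and>
     esssup (lebesgue_on U) (\<lambda>x. ereal \<bar>f x\<bar>) < \<infinity>}"

definition Linf_norm :: "'a::euclidean_space set \<Rightarrow> ('a \<Rightarrow> real) \<Rightarrow> real" where
  "Linf_norm U f = real_of_ereal (esssup (lebesgue_on U) (\<lambda>x. ereal \<bar>f x\<bar>))"

definition locally_integrable :: "'a::euclidean_space set \<Rightarrow> ('a \<Rightarrow> real) \<Rightarrow> bool" where
  "locally_integrable U f \<longleftrightarrow> (\<forall>C. compact C \<and> C \<subseteq> U \<longrightarrow> set_integrable lebesgue C f)"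

definition has_weak_deriv ::
    "'a::euclidean_space set \<Rightarrow> 'a \<Rightarrow> ('a \<Rightarrow> real) \<Rightarrow> ('a \<Rightarrow> real) \<Rightarrow> bool" where
  "has_weak_deriv U e f g \<longleftrightarrow> locally_integrable U f \<and> locally_integrable U g \<and>
     (\<forall>\<phi>\<in>test_functions U.
        integral\<^sup>L (lebesgue_on U) (\<lambda>x. f x * frechet_derivative \<phi> (at x) e)
        = - integral\<^sup>L (lebesgue_on U) (\<lambda>x. g x * \<phi> x))"

definition weak_deriv ::
    "'a::euclidean_space set \<Rightarrow> 'a \<Rightarrow> ('a \<Rightarrow> real) \<Rightarrow> 'a \<Rightarrow> real" where
  "weak_deriv U e f = (SOME g. has_weak_deriv U e f g)"

text \<open>The spaces \<open>H\<^sup>k(U)\<close> and \<open>H\<^sub>0\<^sup>k(U)\<close>, the latter being the closure of the test functions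
  in \<open>H\<^sup>k(U)\<close>.\<close>

primrec Hk :: "nat \<Rightarrow> 'a::euclidean_space set \<Rightarrow> ('a \<Rightarrow> real) set" where
  "Hk 0 U = L2 U"
| "Hk (Suc k) U = {f \<in> L2 U. \<forall>i\<in>Basis. \<exists>g\<in>Hk k U. has_weak_deriv U i f g}"

primrec Hk_sqnorm :: "nat \<Rightarrow> 'a::euclidean_space set \<Rightarrow> ('a \<Rightarrow> real) \<Rightarrow> real" where
  "Hk_sqnorm 0 U f = (L2_norm U f)\<^sup>2"
| "Hk_sqnorm (Suc k) U f = (L2_norm U f)\<^sup>2 + (\<Sum>i\<in>Basis. Hk_sqnorm k U (weak_deriv U i f))"

definition Hk_norm :: "nat \<Rightarrow> 'a::euclidean_space set \<Rightarrow> ('a \<Rightarrow> real) \<Rightarrow> real" where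
  "Hk_norm k U f = sqrt (Hk_sqnorm k U f)"

definition Hk0 :: "nat \<Rightarrow> 'a::euclidean_space set \<Rightarrow> ('a \<Rightarrow> real) set" where
  "Hk0 k U = {f \<in> Hk k U. \<exists>\<phi>. (\<forall>n. \<phi> n \<in> test_functions U) \<and>
     (\<lambda>n. Hk_norm k U (\<lambda>x. \<phi> n x - f x)) \<longlonglongrightarrow> 0}"

text \<open>The dual \<open>H\<^sup>-\<^sup>k(U)\<close> of \<open>H\<^sub>0\<^sup>k(U)\<close>. The bound forces a functional to agree on functions that
  are equal almost everywhere.\<close>

definition Hk_dual :: "nat \<Rightarrow> 'a::euclidean_space set \<Rightarrow> (('a \<Rightarrow> real) \<Rightarrow> real) set" where
  "Hk_dual k U = {l.
     (\<forall>v\<in>Hk0 k U. \<forall>w\<in>Hk0 k U. \<forall>a c. l (\<lambda>x. a * v x + c * w x) = a * l v + c * l w) \<and>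
     (\<exists>C. \<forall>v\<in>Hk0 k U. \<bar>l v\<bar> \<le> C * Hk_norm k U v)}"

definition Hk_dual_norm ::
    "nat \<Rightarrow> 'a::euclidean_space set \<Rightarrow> (('a \<Rightarrow> real) \<Rightarrow> real) \<Rightarrow> real" where
  "Hk_dual_norm k U l = (SUP v\<in>{v \<in> Hk0 k U. Hk_norm k U v \<le> 1}. \<bar>l v\<bar>)"

section \<open>Bochner spaces over \<open>(0,T)\<close>\<close>

text \<open>\<open>X\<close> is a space of functions (or functionals) and \<open>nrm\<close> its norm; \<open>s n t - v t\<close> is the
  pointwise difference. Strong measurability is a.e. approximability by simple functions.\<close>

definition bochner_measurable ::
    "real \<Rightarrow> ('b \<Rightarrow> real) set \<Rightarrow> (('b \<Rightarrow> real) \<Rightarrow> real) \<Rightarrow> (real \<Rightarrow> 'b \<Rightarrow> real) \<Rightarrow> bool" where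
  "bochner_measurable T X nrm v \<longleftrightarrow>
     (AE t in lebesgue_on {0<..<T}. v t \<in> X) \<and>
     (\<exists>s. (\<forall>n. simple_function (lebesgue_on {0<..<T}) (s n) \<and> s n ` {0<..<T} \<subseteq> X) \<and>
          (AE t in lebesgue_on {0<..<T}. (\<lambda>n. nrm (\<lambda>x. s n t x - v t x)) \<longlonglongrightarrow> 0))"

definition bochner_Lp ::
    "nat \<Rightarrow> real \<Rightarrow> ('b \<Rightarrow> real) set \<Rightarrow> (('b \<Rightarrow> real) \<Rightarrow> real) \<Rightarrow> (real \<Rightarrow> 'b \<Rightarrow> real) set" where
  "bochner_Lp q T X nrm = {v. bochner_measurable T X nrm v \<and>
     integrable (lebesgue_on {0<..<T}) (\<lambda>t. nrm (v t) ^ q)}"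

definition bochner_Linf ::
    "real \<Rightarrow> ('b \<Rightarrow> real) set \<Rightarrow> (('b \<Rightarrow> real) \<Rightarrow> real) \<Rightarrow> (real \<Rightarrow> 'b \<Rightarrow> real) set" where
  "bochner_Linf T X nrm = {v. bochner_measurable T X nrm v \<and>
     (\<exists>C. AE t in lebesgue_on {0<..<T}. nrm (v t) \<le> C)}"

section \<open>Functions on the space-time cylinder\<close>

definition cylinder :: "(real^3) set \<Rightarrow> real \<Rightarrow> ((real^3) \<times> real) set" where
  "cylinder \<Omega> T = \<Omega> \<times> {0<..<T}"

definition slice :: "((real^3) \<times> real \<Rightarrow> real) \<Rightarrow> real \<Rightarrow> real^3 \<Rightarrow> real" where
  "slice u t = (\<lambda>x. u (x, t))"

text \<open>\<open>L\<^sup>2(0,T; H\<^sub>0\<^sup>2(\<Omega>))\<close>, its elements being represented by jointly measurable functions of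
  \<open>(x, t)\<close>.\<close>

definition L2_H20 :: "(real^3) set \<Rightarrow> real \<Rightarrow> ((real^3) \<times> real \<Rightarrow> real) set" where
  "L2_H20 \<Omega> T = {u. u \<in> borel_measurable (lebesgue_on (cylinder \<Omega> T)) \<and>
     slice u \<in> bochner_Lp 2 T (Hk0 2 \<Omega>) (Hk_norm 2 \<Omega>)}"

definition grad ::
    "(real^3) set \<Rightarrow> real \<Rightarrow> ((real^3) \<times> real \<Rightarrow> real) \<Rightarrow> (real^3) \<times> real \<Rightarrow> real^3" where
  "grad \<Omega> T u z = (\<chi> i. weak_deriv (cylinder \<Omega> T) (axis i 1, 0) u z)"

definition laplacian ::
    "(real^3) set \<Rightarrow> real \<Rightarrow> ((real^3) \<times> real \<Rightarrow> real) \<Rightarrow> (real^3) \<times> real \<Rightarrow> real" where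
  "laplacian \<Omega> T u z = (\<Sum>i\<in>UNIV. weak_deriv (cylinder \<Omega> T) (axis i 1, 0)
     (weak_deriv (cylinder \<Omega> T) (axis i 1, 0) u) z)"

definition has_weak_div ::
    "(real^3) set \<Rightarrow> real \<Rightarrow> ((real^3) \<times> real \<Rightarrow> real^3) \<Rightarrow> ((real^3) \<times> real \<Rightarrow> real) \<Rightarrow> bool" where
  "has_weak_div \<Omega> T F g \<longleftrightarrow>
     (\<forall>i. locally_integrable (cylinder \<Omega> T) (\<lambda>z. F z $ i)) \<and> locally_integrable (cylinder \<Omega> T) g \<and>
     (\<forall>\<phi>\<in>test_functions (cylinder \<Omega> T).
        integral\<^sup>L (lebesgue_on (cylinder \<Omega> T))
          (\<lambda>z. F z \<bullet> (\<chi> i. frechet_derivative \<phi> (at z) (axis i 1, 0)))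
        = - integral\<^sup>L (lebesgue_on (cylinder \<Omega> T)) (\<lambda>z. g z * \<phi> z))"

text \<open>\<open>f\<close> has a representative in \<open>C([0,T]; L\<^sup>2(\<Omega>))\<close> whose value at time \<open>t0\<close> is \<open>v\<close>. The
  representative is unique, hence so is \<open>v\<close> up to null sets.\<close>

definition has_time_value ::
    "(real^3) set \<Rightarrow> real \<Rightarrow> ((real^3) \<times> real \<Rightarrow> real) \<Rightarrow> real \<Rightarrow> (real^3 \<Rightarrow> real) \<Rightarrow> bool" where
  "has_time_value \<Omega> T f t0 v \<longleftrightarrow> (\<exists>g :: real \<Rightarrow> real^3 \<Rightarrow> real.
     (\<forall>t\<in>{0..T}. g t \<in> L2 \<Omega> \<and>
        ((\<lambda>s. L2_norm \<Omega> (\<lambda>x. g s x - g t x)) \<longlongrightarrow> 0) (at t within {0..T})) \<and>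
     (AE t in lebesgue_on {0<..<T}. AE x in lebesgue_on \<Omega>. g t x = f (x, t)) \<and>
     (AE x in lebesgue_on \<Omega>. g t0 x = v x))"

text \<open>\<open>F\<close> is the distributional time derivative of \<open>w\<close> as an \<open>H\<^sup>-\<^sup>2(\<Omega>)\<close>-valued function:
  \<open>\<integral> \<eta>(t) F(t) dt = - \<integral> \<eta>'(t) w(t) dt\<close> in \<open>H\<^sup>-\<^sup>2(\<Omega>)\<close> for all test functions \<open>\<eta>\<close> on \<open>(0,T)\<close>.\<close>

definition has_time_deriv_dual ::
    "(real^3) set \<Rightarrow> real \<Rightarrow> ((real^3) \<times> real \<Rightarrow> real) \<Rightarrow> (real \<Rightarrow> (real^3 \<Rightarrow> real) \<Rightarrow> real) \<Rightarrow> bool" where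
  "has_time_deriv_dual \<Omega> T w F \<longleftrightarrow>
     (\<forall>\<eta>\<in>test_functions {0<..<T}. \<forall>v\<in>Hk0 2 \<Omega>.
        integral\<^sup>L (lebesgue_on {0<..<T}) (\<lambda>t. F t v * \<eta> t)
        = - integral\<^sup>L (lebesgue_on (cylinder \<Omega> T)) (\<lambda>(x, t). w (x, t) * v x * deriv \<eta> t))"

section \<open>The two problems\<close>

definition e3 :: "real^3" where
  "e3 = axis 3 1"

text \<open>\<open>dtb\<close> is the derivative \<open>\<partial>\<^sub>t b(u)\<close>, and \<open>dtb t (slice \<phi> t)\<close> the duality pairing.\<close>

definition weak_solution_transformed ::
    "(real^3) set \<Rightarrow> real \<Rightarrow> real \<Rightarrow> (real \<Rightarrow> real) \<Rightarrow> (real \<Rightarrow> real) \<Rightarrow> (real^3 \<Rightarrow> real)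
      \<Rightarrow> ((real^3) \<times> real \<Rightarrow> real) \<Rightarrow> bool" where
  "weak_solution_transformed \<Omega> T \<gamma> K b u0 u \<longleftrightarrow> u \<in> L2_H20 \<Omega> T \<and>
     (\<exists>dtb. has_time_deriv_dual \<Omega> T (b \<circ> u) dtb \<and>
        dtb \<in> bochner_Lp 2 T (Hk_dual 2 \<Omega>) (Hk_dual_norm 2 \<Omega>) \<and>
        K \<circ> b \<circ> u \<in> L2 (cylinder \<Omega> T) \<and>
        (\<forall>\<phi>\<in>L2_H20 \<Omega> T.
           integral\<^sup>L (lebesgue_on {0<..<T}) (\<lambda>t. dtb t (slice \<phi> t))
           + integral\<^sup>L (lebesgue_on (cylinder \<Omega> T)) (\<lambda>z.
               - K (b (u z)) * (e3 \<bullet> grad \<Omega> T \<phi> z) + grad \<Omega> T u z \<bullet> grad \<Omega> T \<phi> z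
               + \<gamma> * (laplacian \<Omega> T u z * laplacian \<Omega> T \<phi> z)) = 0) \<and>
        slice (b \<circ> u) \<in> bochner_Linf T (L1 \<Omega>) (L1_norm \<Omega>) \<and>
        (\<forall>\<phi>\<in>L2_H20 \<Omega> T. \<forall>dt\<phi>.
           has_weak_deriv (cylinder \<Omega> T) (0, 1) \<phi> dt\<phi> \<and>
           slice dt\<phi> \<in> bochner_Lp 1 T (Linf \<Omega>) (Linf_norm \<Omega>) \<and>
           has_time_value \<Omega> T \<phi> T (\<lambda>x. 0) \<longrightarrow>
           integral\<^sup>L (lebesgue_on {0<..<T}) (\<lambda>t. dtb t (slice \<phi> t))
           = integral\<^sup>L (lebesgue_on (cylinder \<Omega> T))
               (\<lambda>(x, t). (b (u0 x) - b (u (x, t))) * dt\<phi> (x, t))))"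

text \<open>The oriented integral, which is negative for \<open>p < 0\<close>.\<close>

definition kirchhoff :: "(real \<Rightarrow> real) \<Rightarrow> (real \<Rightarrow> real) \<Rightarrow> real \<Rightarrow> real" where
  "kirchhoff K S p = (LBINT \<tau>=ereal 0..ereal p. K (S \<tau>))"

text \<open>\<open>dtS\<close> and \<open>divp\<close> are \<open>\<partial>\<^sub>t S(p)\<close> and \<open>\<nabla>\<cdot>(K(S(p)) \<nabla>p)\<close>.\<close>

definition weak_solution_fourth_order ::
    "(real^3) set \<Rightarrow> real \<Rightarrow> real \<Rightarrow> (real \<Rightarrow> real) \<Rightarrow> (real \<Rightarrow> real) \<Rightarrow> (real^3 \<Rightarrow> real)
      \<Rightarrow> ((real^3) \<times> real \<Rightarrow> real) \<Rightarrow> bool" where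
  "weak_solution_fourth_order \<Omega> T \<gamma> K S p0 p \<longleftrightarrow>
     p \<in> Hk 1 (cylinder \<Omega> T) \<and> kirchhoff K S \<circ> p \<in> L2_H20 \<Omega> T \<and>
     (\<exists>dtS\<in>L2 (cylinder \<Omega> T). \<exists>divp\<in>L2 (cylinder \<Omega> T).
        has_weak_deriv (cylinder \<Omega> T) (0, 1) (S \<circ> p) dtS \<and>
        has_weak_div \<Omega> T (\<lambda>z. K (S (p z)) *\<^sub>R grad \<Omega> T p z) divp \<and>
        (\<forall>\<phi>\<in>L2_H20 \<Omega> T.
           integral\<^sup>L (lebesgue_on (cylinder \<Omega> T)) (\<lambda>z.
             dtS z * \<phi> z - K (S (p z)) * (e3 \<bullet> grad \<Omega> T \<phi> z)
             + K (S (p z)) * (grad \<Omega> T p z \<bullet> grad \<Omega> T \<phi> z))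
           + \<gamma> * integral\<^sup>L (lebesgue_on (cylinder \<Omega> T))
               (\<lambda>z. divp z * laplacian \<Omega> T \<phi> z) = 0)) \<and>
     (\<exists>p_init. has_time_value \<Omega> T p 0 p_init \<and>
        (AE x in lebesgue_on \<Omega>. S (p_init x) = S (p0 x)))"

end

theory Submission
  imports Defs
begin

text \<open>As \<open>S\<close> takes values in \<open>(0,1]\<close> and \<open>K\<close> is increasing, \<open>\<psi>' = K \<circ> S\<close> lies between the positive
  constants \<open>K 0\<close> and \<open>K 1\<close>. Thus \<open>\<psi>\<close> is a \<open>C\<^sup>1\<close> change of the unknown, Lipschitz in both directions, which
  preserves \<open>H\<^sup>1\<close> and obeys the chain rule (\<open>has_weak_deriv_chain\<close>): the nonlinear flux \<open>K(S(p)) \<nabla>p\<close> is the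
  gradient of \<open>v = \<psi>(p)\<close>. Both notions of solution then amount to one \<open>normal_solution\<close> for \<open>v\<close>: the
  time derivative of the saturation \<open>b(v)\<close> is a square integrable function \<open>g\<close>, the saturation is \<open>S(p\<^sup>0)\<close> plus the
  primitive of \<open>g\<close> in time, and \<open>v\<close> and \<open>g\<close> satisfy an equation that is linear apart from the gravity term \<open>K(b(v))\<close>.

  Three differences between the formulations have to be bridged. The functional \<open>\<partial>\<^sub>t b(u)\<close> of the transformed
  problem is the pairing with the function \<open>b'(u) \<partial>\<^sub>t u\<close> (\<open>dual_time_derivative_pairing\<close>). A function with a
  square integrable weak time derivative is an initial value plus a primitive
  (\<open>weak_time_derivative_primitive\<close>), and both the weak form and the pointwise form of the initial condition
  determine this initial value (\<open>weak_initial_condition\<close>, \<open>initial_value_unique\<close>). Elements of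
  \<open>L\<^sup>2(0,T; H\<^sub>0\<^sup>2)\<close> are given by their time slices, and their derivatives on the cylinder have to be recognised as the
  derivatives of the slices (\<open>L2_H20D\<close>). With this, \<open>\<psi>\<^sup>-\<^sup>1(u)\<close> solves the fourth-order problem.

  For uniqueness, let \<open>v\<^sub>1\<close>, \<open>v\<^sub>2\<close> be two solutions in normal form and \<open>d = v\<^sub>1 - v\<^sub>2\<close>. Test functions that are constant
  up to a time \<open>\<tau>\<close> and zero afterwards integrate the equation in time, so that it contains
  \<open>b(v\<^sub>1) - b(v\<^sub>2)\<close> at time \<open>\<tau>\<close> together with primitives of \<open>\<nabla>d\<close>, \<open>\<Delta>d\<close> and of the gravity term. Test it with \<open>d(\<tau>)\<close>, multiply by
  \<open>exp(-C\<tau>)\<close> and integrate over \<open>\<tau>\<close>. The second- and fourth-order terms become integrals of a function against its own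
  primitive, which are sums of squares (\<open>weighted_primitive_identity\<close>). By Young's inequality these squares absorb
  the gravity term up to \<open>1/(2C)\<close> times the weighted integral of \<open>(K(b(v\<^sub>1)) - K(b(v\<^sub>2)))\<^sup>2\<close>, and for suitable \<open>C\<close> this is at
  most half of the weighted integral of \<open>(b(v\<^sub>1) - b(v\<^sub>2)) d\<close> (\<open>drift_controlled_by_monotonicity\<close>). Hence the
  latter integral is not positive. As \<open>b\<close> is strictly increasing, \<open>d = 0\<close>.\<close>

section \<open>Smooth functions and test functions\<close>

lemma Ck_on_differentiable:
  "Ck_on (Suc k) f UNIV \<Longrightarrow> (f has_derivative frechet_derivative f (at x)) (at x)"
  by (simp add: differentiable_on_def frechet_derivative_works)

lemma Ck_on_SucI:
  assumes "\<And>x. (f has_derivative f' x) (at x)" "\<And>i. i \<in> Basis \<Longrightarrow> Ck_on k (\<lambda>x. f' x i) UNIV"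
  shows "Ck_on (Suc k) f UNIV"
proof -
  have "frechet_derivative f (at x) = f' x" for x
    using frechet_derivative_at[OF assms(1)] by metis
  then show ?thesis
    using assms by (auto simp: differentiable_on_def differentiable_def)
qed

lemma Ck_on_lower: "Ck_on (Suc k) f UNIV \<Longrightarrow> Ck_on k f UNIV"
  by (induction k arbitrary: f) (auto intro: differentiable_imp_continuous_on)

lemma Ck_on_const: "Ck_on k (\<lambda>x. c) UNIV"
proof (induction k arbitrary: c)
  case (Suc k)
  show ?case by (rule Ck_on_SucI[where f' = "\<lambda>x h. 0"]) (auto intro: Suc)
qed auto

lemma Ck_on_add: "Ck_on k f UNIV \<Longrightarrow> Ck_on k g UNIV \<Longrightarrow> Ck_on k (\<lambda>x. f x + g x) UNIV"
proof (induction k arbitrary: f g)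
  case (Suc k)
  show ?case
    by (rule Ck_on_SucI[OF has_derivative_add[OF Ck_on_differentiable Ck_on_differentiable]])
       (use Suc in auto)
qed (auto intro: continuous_on_add)

lemma Ck_on_mult: "Ck_on k f UNIV \<Longrightarrow> Ck_on k g UNIV \<Longrightarrow> Ck_on k (\<lambda>x. f x * g x) UNIV"
proof (induction k arbitrary: f g)
  case (Suc k)
  show ?case
  proof (rule Ck_on_SucI[OF has_derivative_mult[OF Ck_on_differentiable Ck_on_differentiable]])
    fix i :: 'a assume "i \<in> Basis"
    then show "Ck_on k (\<lambda>x. f x * frechet_derivative g (at x) i + frechet_derivative f (at x) i * g x) UNIV"
      using Suc Ck_on_lower by (intro Ck_on_add Suc.IH) auto
  qed (use Suc in auto)
qed (auto intro: continuous_on_mult)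

lemma Ck_on_diff: "Ck_on k f UNIV \<Longrightarrow> Ck_on k g UNIV \<Longrightarrow> Ck_on k (\<lambda>x. f x - g x) UNIV"
  using Ck_on_add[of k f "\<lambda>x. (-1) * g x"] Ck_on_mult[OF Ck_on_const, of k g "-1"] by simp

lemma Ck_on_sum:
  "(\<And>i. i \<in> A \<Longrightarrow> Ck_on k (f i) UNIV) \<Longrightarrow> Ck_on k (\<lambda>x. \<Sum>i\<in>A. f i x) UNIV"
  by (induction A rule: infinite_finite_induct) (auto simp: Ck_on_const intro: Ck_on_add)

lemma Ck_on_prod:
  "(\<And>i. i \<in> A \<Longrightarrow> Ck_on k (f i) UNIV) \<Longrightarrow> Ck_on k (\<lambda>x. \<Prod>i\<in>A. f i x) UNIV"
  by (induction A rule: infinite_finite_induct) (auto simp: Ck_on_const intro: Ck_on_mult)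

lemma linear_eq_sum_Basis:
  fixes D :: "'a::euclidean_space \<Rightarrow> real"
  assumes "linear D" shows "D v = (\<Sum>j\<in>Basis. (v \<bullet> j) * D j)"
proof -
  have "D v = D (\<Sum>j\<in>Basis. (v \<bullet> j) *\<^sub>R j)" by (simp add: euclidean_representation)
  also have "\<dots> = (\<Sum>j\<in>Basis. (v \<bullet> j) * D j)"
    using assms by (simp add: linear_sum linear_scale)
  finally show ?thesis .
qed

text \<open>The derivative of \<open>f(A x + c)\<close> in a direction \<open>i\<close> is a linear combination of the partial
  derivatives of \<open>f\<close> at \<open>A x + c\<close>. The induction therefore closes for compositions with affine maps, which
  cover translations, slices and products.\<close>

lemma Ck_on_affine:
  fixes A :: "'a::euclidean_space \<Rightarrow> 'b::euclidean_space"
  assumes A: "linear A"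
  shows "Ck_on k f UNIV \<Longrightarrow> Ck_on k (\<lambda>x. f (A x + c)) UNIV"
proof (induction k arbitrary: f)
  case 0
  have "continuous_on UNIV A"
    using A linear_continuous_on linear_conv_bounded_linear by blast
  then have "continuous_on UNIV (f \<circ> (\<lambda>x. A x + c))"
    using 0 by (intro continuous_on_compose) (auto intro!: continuous_intros intro: continuous_on_subset)
  then show ?case by (simp add: o_def)
next
  case (Suc k)
  have bl: "bounded_linear A" using A by (simp add: linear_conv_bounded_linear)
  have "((\<lambda>x. A x + c) has_derivative A) (at x)" for x
    using bounded_linear_imp_has_derivative[OF bl] by (auto intro!: derivative_eq_intros)
  from diff_chain_at[OF this Ck_on_differentiable[OF Suc.prems]]
  have d: "((\<lambda>x. f (A x + c)) has_derivative (\<lambda>h. frechet_derivative f (at (A x + c)) (A h))) (at x)" for x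
    by (simp add: o_def)
  show ?case
  proof (rule Ck_on_SucI[OF d])
    fix i :: 'a assume i: "i \<in> Basis"
    have "linear (frechet_derivative f (at y))" for y
      using Ck_on_differentiable[OF Suc.prems] has_derivative_linear by blast
    from linear_eq_sum_Basis[OF this]
    have "(\<lambda>x. frechet_derivative f (at (A x + c)) (A i)) =
       (\<lambda>x. \<Sum>j\<in>Basis. (A i \<bullet> j) * frechet_derivative f (at (A x + c)) j)" by blast
    moreover have "Ck_on k (\<lambda>x. frechet_derivative f (at (A x + c)) j) UNIV" if "j \<in> Basis" for j
      using Suc.IH[of "\<lambda>x. frechet_derivative f (at x) j"] Suc.prems that by simp
    ultimately show "Ck_on k (\<lambda>x. frechet_derivative f (at (A x + c)) (A i)) UNIV"
      by (auto intro!: Ck_on_sum Ck_on_mult Ck_on_const)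
  qed
qed

lemma Ck_on_exp: "Ck_on k f UNIV \<Longrightarrow> Ck_on k (\<lambda>x. exp (f x)) UNIV"
proof (induction k arbitrary: f)
  case (Suc k)
  show ?case
  proof (rule Ck_on_SucI[OF has_derivative_exp[OF Ck_on_differentiable]])
    fix i :: 'a assume "i \<in> Basis"
    then show "Ck_on k (\<lambda>x. frechet_derivative f (at x) i * exp (f x)) UNIV"
      using Suc Ck_on_lower by (intro Ck_on_mult Suc.IH) auto
  qed (use Suc in auto)
qed (auto intro: continuous_on_exp)

text \<open>The classical smooth function that is flat at the origin. Its derivatives are again of the
  form \<open>P(1/t) exp(-1/t)\<close> with a polynomial \<open>P\<close>, which is why \<open>P\<close> is a parameter.\<close>

definition flat_exp :: "real poly \<Rightarrow> real \<Rightarrow> real" where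
  "flat_exp P t = (if t > 0 then poly P (1/t) * exp (- (1/t)) else 0)"

lemma poly_times_exp_tendsto_0:
  fixes P :: "real poly" shows "((\<lambda>s. poly P s * exp (- s)) \<longlongrightarrow> 0) at_top"
proof -
  have "((\<lambda>s. \<Sum>i\<le>degree P. coeff P i * (s ^ i / exp s)) \<longlongrightarrow> (\<Sum>i\<le>degree P. coeff P i * 0)) at_top"
    by (intro tendsto_intros tendsto_power_div_exp_0)
  then show ?thesis
    by (simp add: poly_altdef sum_distrib_right sum_divide_distrib exp_minus divide_inverse mult.assoc)
qed

lemma flat_exp_has_derivative:
  "(flat_exp P has_field_derivative flat_exp ([:0,0,1:] * (P - pderiv P)) t) (at t)"
proof -
  consider "t > 0" | "t < 0" | "t = 0" by linarith
  then show ?thesis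
  proof cases
    case 1
    have "((\<lambda>t. poly P (1/t) * exp (- (1/t))) has_field_derivative
        flat_exp ([:0,0,1:] * (P - pderiv P)) t) (at t)"
      using 1 by (auto intro!: derivative_eq_intros poly_DERIV[THEN DERIV_chain2]
          simp: flat_exp_def field_simps power2_eq_square)
    then show ?thesis
      by (rule DERIV_cong_ev[THEN iffD1, rotated -1, OF _ refl _ refl])
         (use 1 in \<open>auto simp: flat_exp_def eventually_nhds intro!: exI[of _ "{0<..}"]\<close>)
  next
    case 2
    have "((\<lambda>t. 0) has_field_derivative flat_exp ([:0,0,1:] * (P - pderiv P)) t) (at t)"
      using 2 by (simp add: flat_exp_def)
    then show ?thesis
      by (rule DERIV_cong_ev[THEN iffD1, rotated -1, OF _ refl _ refl])
         (use 2 in \<open>auto simp: flat_exp_def eventually_nhds intro!: exI[of _ "{..<0}"]\<close>)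
  next
    case 3
    have r: "((\<lambda>h. flat_exp P h / h) \<longlongrightarrow> 0) (at_right 0)"
    proof -
      have "((\<lambda>s. poly ([:0,1:] * P) s * exp (- s)) \<longlongrightarrow> 0) at_top"
        by (rule poly_times_exp_tendsto_0)
      moreover have "eventually (\<lambda>s. poly ([:0,1:] * P) s * exp (- s)
          = flat_exp P (inverse s) / inverse s) at_top"
        using eventually_gt_at_top[of 0] by eventually_elim (auto simp: flat_exp_def field_simps)
      ultimately have "((\<lambda>s. flat_exp P (inverse s) / inverse s) \<longlongrightarrow> 0) at_top"
        by (rule Lim_transform_eventually)
      then show ?thesis
        by (simp add: filterlim_at_right_to_top)
    qed
    have l: "((\<lambda>h. flat_exp P h / h) \<longlongrightarrow> 0) (at_left 0)"
      by (rule tendsto_eventually) (auto simp: flat_exp_def eventually_at_filter)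
    from filterlim_split_at[OF l r] show ?thesis
      using 3 by (simp add: has_field_derivative_iff flat_exp_def)
  qed
qed

lemma Ck_on_flat_exp: "Ck_on k (flat_exp P) UNIV"
proof (induction k arbitrary: P)
  case 0
  have "isCont (flat_exp P) x" for x using flat_exp_has_derivative DERIV_isCont by blast
  then show ?case by (simp add: continuous_at_imp_continuous_on)
next
  case (Suc k)
  show ?case
    by (rule Ck_on_SucI[OF flat_exp_has_derivative[THEN has_field_derivative_imp_has_derivative]])
       (use Suc in simp)
qed

definition box_bump :: "'a::euclidean_space \<Rightarrow> 'a \<Rightarrow> 'a \<Rightarrow> real" where
  "box_bump a b x = (\<Prod>i\<in>Basis. flat_exp 1 (x \<bullet> i - a \<bullet> i) * flat_exp 1 (b \<bullet> i - x \<bullet> i))"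

lemma Ck_on_box_bump: "Ck_on k (box_bump a b) UNIV"
proof -
  have "Ck_on k (\<lambda>x::'a. flat_exp 1 (x \<bullet> i - a \<bullet> i)) UNIV" for i
    using Ck_on_affine[OF _ Ck_on_flat_exp, of "\<lambda>x::'a. x \<bullet> i" k 1 "- (a \<bullet> i)"]
    by (simp add: bounded_linear.linear bounded_linear_inner_left)
  moreover have "linear (\<lambda>x::'a. - (x \<bullet> i))" for i
    by (simp add: bounded_linear.linear bounded_linear_inner_left bounded_linear_minus)
  then have "Ck_on k (\<lambda>x::'a. flat_exp 1 (b \<bullet> i - x \<bullet> i)) UNIV" for i
    using Ck_on_affine[OF _ Ck_on_flat_exp, of "\<lambda>x::'a. - (x \<bullet> i)" k 1 "b \<bullet> i"] by simp
  ultimately have "Ck_on k (\<lambda>x. \<Prod>i\<in>Basis. flat_exp 1 (x \<bullet> i - a \<bullet> i) * flat_exp 1 (b \<bullet> i - x \<bullet> i)) UNIV"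
    by (intro Ck_on_prod Ck_on_mult)
  then show ?thesis by (simp add: box_bump_def[abs_def])
qed

lemma flat_exp_1: "flat_exp 1 t \<ge> 0" "flat_exp 1 t > 0 \<longleftrightarrow> t > 0" "flat_exp 1 t = 0 \<longleftrightarrow> t \<le> 0"
  by (auto simp: flat_exp_def)

lemma box_bump_nonneg: "box_bump a b x \<ge> 0"
  by (auto simp: box_bump_def flat_exp_1 intro!: prod_nonneg)

lemma box_bump_eq_0_iff: "box_bump a b x = 0 \<longleftrightarrow> x \<notin> box a b"
  by (auto simp: box_bump_def flat_exp_1 mem_box not_less)

lemma test_functionsI:
  assumes "\<And>k. Ck_on k \<phi> UNIV" "compact C" "C \<subseteq> U" "\<And>x. x \<notin> C \<Longrightarrow> \<phi> x = 0"
  shows "\<phi> \<in> test_functions U"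
proof -
  have "closure {x. \<phi> x \<noteq> 0} \<subseteq> C"
    using assms by (intro closure_minimal) (auto intro: compact_imp_closed)
  moreover from this have "compact (closure {x. \<phi> x \<noteq> 0})"
    using assms(2) by (metis closed_closure compact_Int_closed inf.absorb_iff2)
  ultimately show ?thesis using assms by (auto simp: test_functions_def)
qed

lemma test_functions_support:
  assumes "\<phi> \<in> test_functions U"
  obtains C where "compact C" "C \<subseteq> U" "\<And>x. x \<notin> C \<Longrightarrow> \<phi> x = 0"
proof (rule that)
  show "\<phi> x = 0" if "x \<notin> closure {x. \<phi> x \<noteq> 0}" for x
    using that closure_subset[of "{x. \<phi> x \<noteq> 0}"] by auto
qed (use assms in \<open>auto simp: test_functions_def\<close>)

lemma test_functions_mono: "\<phi> \<in> test_functions U \<Longrightarrow> U \<subseteq> V \<Longrightarrow> \<phi> \<in> test_functions V"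
  by (auto simp: test_functions_def)

lemma test_functions_Ck: "\<phi> \<in> test_functions U \<Longrightarrow> Ck_on k \<phi> UNIV"
  by (simp add: test_functions_def)

lemma test_functions_has_derivative:
  "\<phi> \<in> test_functions U \<Longrightarrow> (\<phi> has_derivative frechet_derivative \<phi> (at x)) (at x)"
  using Ck_on_differentiable test_functions_Ck by blast

lemma test_functions_continuous: "\<phi> \<in> test_functions U \<Longrightarrow> continuous_on A \<phi>"
  using test_functions_Ck[of \<phi> U 0] by (auto intro: continuous_on_subset)

lemma test_functions_cmult:
  assumes "\<phi> \<in> test_functions U" shows "(\<lambda>x. c * \<phi> x) \<in> test_functions U"
proof -
  obtain C where "compact C" "C \<subseteq> U" "\<And>x. x \<notin> C \<Longrightarrow> \<phi> x = 0"
    using test_functions_support[OF assms] by blast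
  then show ?thesis
    by (intro test_functionsI[of _ C] Ck_on_mult Ck_on_const test_functions_Ck[OF assms]) auto
qed

lemma test_functions_mult:
  assumes "\<phi> \<in> test_functions U" "\<theta> \<in> test_functions U"
  shows "(\<lambda>x. \<phi> x * \<theta> x) \<in> test_functions U"
proof -
  obtain C where "compact C" "C \<subseteq> U" "\<And>x. x \<notin> C \<Longrightarrow> \<phi> x = 0"
    using test_functions_support[OF assms(1)] by blast
  then show ?thesis
    by (intro test_functionsI[of _ C] Ck_on_mult assms[THEN test_functions_Ck]) auto
qed

lemma test_functions_diff:
  assumes "\<phi> \<in> test_functions U" "\<theta> \<in> test_functions U"
  shows "(\<lambda>x. \<phi> x - \<theta> x) \<in> test_functions U"
proof -
  obtain C where C: "compact C" "C \<subseteq> U" "\<And>x. x \<notin> C \<Longrightarrow> \<phi> x = 0"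
    using test_functions_support[OF assms(1)] by blast
  obtain C' where "compact C'" "C' \<subseteq> U" "\<And>x. x \<notin> C' \<Longrightarrow> \<theta> x = 0"
    using test_functions_support[OF assms(2)] by blast
  with C show ?thesis
    by (intro test_functionsI[of _ "C \<union> C'"] Ck_on_diff assms[THEN test_functions_Ck]) auto
qed

lemma test_functions_translate:
  assumes "\<phi> \<in> test_functions U" "compact C" "C \<subseteq> V" "\<And>x. \<phi> (x + c) \<noteq> 0 \<Longrightarrow> x \<in> C"
  shows "(\<lambda>x. \<phi> (x + c)) \<in> test_functions V"
  using Ck_on_affine[OF linear_id test_functions_Ck[OF assms(1)], of _ c] assms
  by (intro test_functionsI[of _ C]) auto

lemma Ck_on_dir:
  assumes "Ck_on (Suc k) \<phi> UNIV" shows "Ck_on k (\<lambda>x. frechet_derivative \<phi> (at x) e) UNIV"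
proof -
  have "linear (frechet_derivative \<phi> (at x))" for x
    using Ck_on_differentiable[OF assms] has_derivative_linear by blast
  from linear_eq_sum_Basis[OF this, where v = e]
  have "(\<lambda>x. frechet_derivative \<phi> (at x) e) = (\<lambda>x. \<Sum>j\<in>Basis. (e \<bullet> j) * frechet_derivative \<phi> (at x) j)"
    by blast
  then show ?thesis using assms by (auto intro!: Ck_on_sum Ck_on_mult Ck_on_const)
qed

lemma test_functions_derivative_outside:
  assumes "\<phi> \<in> test_functions U" "closed C" "\<And>x. x \<notin> C \<Longrightarrow> \<phi> x = 0" "x \<notin> C"
  shows "frechet_derivative \<phi> (at x) e = 0"
proof -
  have "(\<phi> has_derivative (\<lambda>h. 0)) (at x)"
  proof (rule has_derivative_transform_within_open[OF has_derivative_const[of 0]])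
    show "open (- C)" "x \<in> - C" using assms by auto
  qed (use assms in auto)
  then show ?thesis using frechet_derivative_at by metis
qed

lemma test_functions_derivative:
  assumes "\<phi> \<in> test_functions U"
  shows "(\<lambda>x. frechet_derivative \<phi> (at x) e) \<in> test_functions U"
proof -
  obtain C where C: "compact C" "C \<subseteq> U" "\<And>x. x \<notin> C \<Longrightarrow> \<phi> x = 0"
    using test_functions_support[OF assms] by blast
  show ?thesis
  proof (rule test_functionsI[OF _ C(1,2)])
    show "Ck_on k (\<lambda>x. frechet_derivative \<phi> (at x) e) UNIV" for k
      using Ck_on_dir test_functions_Ck[OF assms] by blast
    show "frechet_derivative \<phi> (at x) e = 0" if "x \<notin> C" for x
      using test_functions_derivative_outside[OF assms compact_imp_closed[OF C(1)] C(3) that] .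
  qed
qed

lemma test_functions_bounded:
  assumes "\<phi> \<in> test_functions U"
  obtains B where "B \<ge> 0" "\<And>x. \<bar>\<phi> x\<bar> \<le> B"
proof -
  obtain C where C: "compact C" "C \<subseteq> U" "\<And>x. x \<notin> C \<Longrightarrow> \<phi> x = 0"
    using test_functions_support[OF assms] by blast
  have "bounded (\<phi> ` C)"
    using C(1) test_functions_continuous[OF assms] compact_continuous_image compact_imp_bounded by blast
  then obtain B where "\<And>x. x \<in> C \<Longrightarrow> \<bar>\<phi> x\<bar> \<le> B"
    unfolding bounded_iff by auto
  then have "\<bar>\<phi> x\<bar> \<le> max B 0" for x using C(3) by (cases "x \<in> C") (force simp: max_def)+
  then show ?thesis using that[of "max B 0"] by auto
qed

lemma test_functions_product:
  assumes "\<zeta> \<in> test_functions U" "\<eta> \<in> test_functions V"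
  shows "(\<lambda>z. \<zeta> (fst z) * \<eta> (snd z)) \<in> test_functions (U \<times> V)"
proof -
  obtain C where C: "compact C" "C \<subseteq> U" "\<And>x. x \<notin> C \<Longrightarrow> \<zeta> x = 0"
    using test_functions_support[OF assms(1)] by blast
  obtain C' where C': "compact C'" "C' \<subseteq> V" "\<And>x. x \<notin> C' \<Longrightarrow> \<eta> x = 0"
    using test_functions_support[OF assms(2)] by blast
  show ?thesis
  proof (rule test_functionsI[of _ "C \<times> C'"])
    show "Ck_on k (\<lambda>z. \<zeta> (fst z) * \<eta> (snd z)) UNIV" for k
      using Ck_on_affine[OF _ test_functions_Ck[OF assms(1)], of fst k 0]
        Ck_on_affine[OF _ test_functions_Ck[OF assms(2)], of snd k 0]
      by (intro Ck_on_mult) (auto simp: bounded_linear.linear bounded_linear_fst bounded_linear_snd)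
    show "compact (C \<times> C')" "C \<times> C' \<subseteq> U \<times> V"
      using C C' by (auto intro: compact_Times)
    show "\<zeta> (fst z) * \<eta> (snd z) = 0" if "z \<notin> C \<times> C'" for z
      using that C(3)[of "fst z"] C'(3)[of "snd z"] by (cases z) auto
  qed
qed

text \<open>Slices of a test function on a product vary over test functions on the factor; this is what
  transfers weak derivatives between the slices and the product.\<close>

lemma test_functions_slice:
  assumes "\<phi> \<in> test_functions (U \<times> V)"
  shows "(\<lambda>x. \<phi> (x, t)) \<in> test_functions U"
proof -
  obtain C where C: "compact C" "C \<subseteq> U \<times> V" "\<And>x. x \<notin> C \<Longrightarrow> \<phi> x = 0"
    using test_functions_support[OF assms] by blast
  have "linear (\<lambda>x. (x, 0::'b))"
    by (simp add: linear_iff)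
  from Ck_on_affine[OF this test_functions_Ck[OF assms], of _ "(0,t)"]
  have "Ck_on k (\<lambda>x. \<phi> (x, t)) UNIV" for k by simp
  then show ?thesis
    using C by (intro test_functionsI[of _ "fst ` C"])
       (auto intro!: compact_continuous_image continuous_intros simp: image_iff, metis fst_conv)
qed

lemma frechet_derivative_slice:
  assumes "\<phi> \<in> test_functions W"
  shows "frechet_derivative (\<lambda>x. \<phi> (x, t)) (at x) e = frechet_derivative \<phi> (at (x, t)) (e, 0)"
proof -
  have "((\<lambda>x. (x, t)) has_derivative (\<lambda>h. (h, 0))) (at x)"
    by (auto intro!: derivative_eq_intros)
  from diff_chain_at[OF this test_functions_has_derivative[OF assms]]
  have "((\<lambda>x. \<phi> (x, t)) has_derivative (\<lambda>h. frechet_derivative \<phi> (at (x, t)) (h, 0))) (at x)"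
    by (simp add: o_def)
  then show ?thesis using frechet_derivative_at by metis
qed

text \<open>The indicator of a box is a bounded pointwise limit of test functions: compose the bump
  \<open>\<beta>\<close> of the box with \<open>1 - exp(- n \<beta>)\<close>.\<close>

lemma indicator_box_limit_test_functions:
  fixes a b :: "'a::euclidean_space"
  assumes "cbox a b \<subseteq> U"
  obtains \<beta> where "\<And>n. \<beta> n \<in> test_functions U" "\<And>n x. \<beta> n x \<in> {0..1}"
    "\<And>n x. x \<notin> box a b \<Longrightarrow> \<beta> n x = 0"
    "\<And>x. (\<lambda>n. \<beta> n x) \<longlonglongrightarrow> indicator (box a b) x"
proof
  define \<beta> where "\<beta> n x = 1 - exp ((- real n) * box_bump a b x)" for n x
  show z: "\<beta> n x = 0" if "x \<notin> box a b" for n x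
    using that by (simp add: \<beta>_def box_bump_eq_0_iff)
  show "\<beta> n \<in> test_functions U" for n
  proof (rule test_functionsI[OF _ _ assms])
    show "Ck_on k (\<beta> n) UNIV" for k
      unfolding \<beta>_def[abs_def]
      by (intro Ck_on_diff Ck_on_const Ck_on_exp Ck_on_mult Ck_on_box_bump)
    show "\<beta> n x = 0" if "x \<notin> cbox a b" for x
      using that z box_subset_cbox[of a b] by blast
  qed auto
  show "\<beta> n x \<in> {0..1}" for n x
    using box_bump_nonneg[of a b x] by (auto simp: \<beta>_def)
  show "(\<lambda>n. \<beta> n x) \<longlonglongrightarrow> indicator (box a b) x" for x
  proof (cases "x \<in> box a b")
    case True
    then have p: "box_bump a b x > 0"
      using box_bump_nonneg[of a b x] box_bump_eq_0_iff[of a b x] by linarith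
    have "(\<lambda>n. exp (- box_bump a b x) ^ n) \<longlonglongrightarrow> 0"
      using p by (intro LIMSEQ_realpow_zero) auto
    then have "(\<lambda>n. 1 - exp (- box_bump a b x) ^ n) \<longlonglongrightarrow> 1 - 0"
      by (rule tendsto_diff[OF tendsto_const])
    moreover have "\<beta> n x = 1 - exp (- box_bump a b x) ^ n" for n
      using exp_of_nat_mult[of n "- box_bump a b x"] by (simp add: \<beta>_def)
    ultimately show ?thesis
      using True by simp
  qed (simp add: z)
qed

section \<open>Lebesgue spaces on measurable sets\<close>

lemma AE_lebesgue_on_iff:
  "U \<in> sets lebesgue \<Longrightarrow> (AE x in lebesgue_on U. P x) \<longleftrightarrow> (AE x in lborel. x \<in> U \<longrightarrow> P x)"
  by (simp add: AE_restrict_space_iff AE_completion_iff)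

lemma open_sets_lebesgue [simp]: "open U \<Longrightarrow> U \<in> sets lebesgue"
  by auto

lemma borel_measurable_lebesgue_on_cong_AE:
  fixes f :: "'a::euclidean_space \<Rightarrow> real"
  assumes "f \<in> borel_measurable (lebesgue_on U)" "AE x in lebesgue_on U. f x = g x" "U \<in> sets lebesgue"
  shows "g \<in> borel_measurable (lebesgue_on U)"
proof -
  have "AE x in lebesgue. (if x \<in> U then f x else 0) = (if x \<in> U then g x else 0)"
    using assms(2) unfolding AE_lebesgue_on_iff[OF assms(3)] AE_completion_iff
    by (elim eventually_mono) auto
  from borel_measurable_AE[OF borel_measurable_if_I[OF assms(1,3)] this]
  show ?thesis by (rule borel_measurable_if_D)
qed

text \<open>Integrals over \<open>U\<close> of a Borel function that vanishes outside \<open>U\<close> are integrals with respect to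
  \<^term>\<open>lborel\<close>, for which translation invariance and product measures are available.\<close>

lemma borel_representative:
  fixes f :: "'a::euclidean_space \<Rightarrow> real"
  assumes "U \<in> sets borel" "f \<in> borel_measurable (lebesgue_on U)"
  obtains g where "g \<in> borel_measurable borel" "\<And>x. x \<notin> U \<Longrightarrow> g x = 0"
    "AE x in lebesgue_on U. f x = g x"
proof -
  have U: "U \<in> sets lebesgue" using assms by auto
  from completion_ex_borel_measurable_real[OF borel_measurable_if_I[OF assms(2) U]]
  obtain g where g: "g \<in> borel_measurable lborel" "AE x in lborel. (if x \<in> U then f x else 0) = g x"
    by blast
  have "AE x in lebesgue_on U. f x = (if x \<in> U then g x else 0)"
    using g(2) unfolding AE_lebesgue_on_iff[OF U] by (elim eventually_mono) auto
  moreover have "(\<lambda>x. if x \<in> U then g x else 0) \<in> borel_measurable borel"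
    using g(1) assms(1) by (simp add: measurable_If_set)
  ultimately show ?thesis using that[of "\<lambda>x. if x \<in> U then g x else 0"] by auto
qed

lemma borel_zero_outside:
  fixes g :: "'a::euclidean_space \<Rightarrow> real"
  assumes "U \<in> sets borel" "g \<in> borel_measurable borel" "\<And>x. x \<notin> U \<Longrightarrow> g x = 0"
  shows "integrable (lebesgue_on U) g \<longleftrightarrow> integrable lborel g"
    and "integral\<^sup>L (lebesgue_on U) g = integral\<^sup>L lborel g"
proof -
  have U: "U \<in> sets lebesgue" using assms by auto
  have eq: "(\<lambda>x. if x \<in> U then g x else 0) = g" using assms(3) by auto
  show "integrable (lebesgue_on U) g \<longleftrightarrow> integrable lborel g"
    using Lebesgue_Measure.integrable_restrict_UNIV[OF U, of g] integrable_completion[of g lborel] assms(2) by (simp add: eq)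
  show "integral\<^sup>L (lebesgue_on U) g = integral\<^sup>L lborel g"
    using Lebesgue_Measure.integral_restrict_UNIV[OF U, of g] integral_completion[of g lborel] assms(2) by (simp add: eq)
qed

lemma integrable_borel_representative:
  fixes f :: "'a::euclidean_space \<Rightarrow> real"
  assumes "U \<in> sets borel" "integrable (lebesgue_on U) f"
  obtains g where "g \<in> borel_measurable borel" "\<And>x. x \<notin> U \<Longrightarrow> g x = 0"
    "AE x in lebesgue_on U. f x = g x" "integrable lborel g"
    "integral\<^sup>L lborel g = integral\<^sup>L (lebesgue_on U) f"
proof -
  obtain g where g: "g \<in> borel_measurable borel" "\<And>x. x \<notin> U \<Longrightarrow> g x = 0"
    "AE x in lebesgue_on U. f x = g x"
    using borel_representative[OF assms(1) borel_measurable_integrable[OF assms(2)]] by blast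
  have gU: "g \<in> borel_measurable (lebesgue_on U)"
    using g(1) by (simp add: measurable_completion measurable_restrict_space1)
  have "integrable (lebesgue_on U) g"
    using assms(2) integrable_cong_AE[OF borel_measurable_integrable[OF assms(2)] gU g(3)] by simp
  moreover have "integral\<^sup>L (lebesgue_on U) f = integral\<^sup>L (lebesgue_on U) g"
    by (rule integral_cong_AE[OF borel_measurable_integrable[OF assms(2)] gU g(3)])
  ultimately show ?thesis using that g borel_zero_outside[OF assms(1) g(1,2)] by metis
qed

lemma borel_measurable_lebesgue_onI:
  "g \<in> borel_measurable borel \<Longrightarrow> g \<in> borel_measurable (lebesgue_on U)"
  by (simp add: measurable_completion measurable_restrict_space1)

lemma integrable_lebesgue_on_cong_AE:
  fixes f g :: "'a::euclidean_space \<Rightarrow> real"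
  assumes "integrable (lebesgue_on U) f" "AE x in lebesgue_on U. f x = g x" "U \<in> sets lebesgue"
  shows "integrable (lebesgue_on U) g" "integral\<^sup>L (lebesgue_on U) g = integral\<^sup>L (lebesgue_on U) f"
proof -
  have m: "f \<in> borel_measurable (lebesgue_on U)" using assms by auto
  have n: "g \<in> borel_measurable (lebesgue_on U)"
    by (rule borel_measurable_lebesgue_on_cong_AE[OF m assms(2,3)])
  show "integrable (lebesgue_on U) g"
    using assms(1) integrable_cong_AE[OF m n assms(2)] by simp
  show "integral\<^sup>L (lebesgue_on U) g = integral\<^sup>L (lebesgue_on U) f"
    using integral_cong_AE[OF m n assms(2)] by simp
qed

lemma integral_lebesgue_on_cong_AE:
  fixes f g :: "'a::euclidean_space \<Rightarrow> real"
  assumes "AE x in lebesgue_on U. f x = g x" "U \<in> sets lebesgue"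
  shows "integral\<^sup>L (lebesgue_on U) g = integral\<^sup>L (lebesgue_on U) f"
proof (cases "integrable (lebesgue_on U) f")
  case True
  then show ?thesis using integrable_lebesgue_on_cong_AE[OF _ assms] by blast
next
  case False
  then have "\<not> integrable (lebesgue_on U) g"
    using integrable_lebesgue_on_cong_AE[of U g f] assms by (auto simp: eq_commute)
  then show ?thesis using False by (simp add: not_integrable_integral_eq)
qed

subsection \<open>Square integrable functions\<close>

lemma L2_cong_AE:
  assumes "f \<in> L2 U" "AE x in lebesgue_on U. f x = g x" "U \<in> sets lebesgue"
  shows "g \<in> L2 U"
proof -
  have "AE x in lebesgue_on U. (f x)\<^sup>2 = (g x)\<^sup>2" using assms(2) by (elim eventually_mono) auto
  from integrable_lebesgue_on_cong_AE(1)[OF _ this assms(3)]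
    borel_measurable_lebesgue_on_cong_AE[OF _ assms(2,3)]
  show ?thesis using assms(1) by (simp add: L2_def)
qed

lemma L2_norm_cong_AE:
  assumes "AE x in lebesgue_on U. f x = g x" "U \<in> sets lebesgue"
  shows "L2_norm U g = L2_norm U f"
proof -
  have "AE x in lebesgue_on U. (f x)\<^sup>2 = (g x)\<^sup>2" using assms(1) by (elim eventually_mono) auto
  from integral_lebesgue_on_cong_AE[OF this assms(2)] show ?thesis by (simp add: L2_norm_def)
qed

lemma L2_measurable: "f \<in> L2 U \<Longrightarrow> f \<in> borel_measurable (lebesgue_on U)"
  and L2_square: "f \<in> L2 U \<Longrightarrow> integrable (lebesgue_on U) (\<lambda>x. (f x)\<^sup>2)"
  by (auto simp: L2_def)

lemma L2_norm_power2: "(L2_norm U f)\<^sup>2 = integral\<^sup>L (lebesgue_on U) (\<lambda>x. (f x)\<^sup>2)"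
  by (simp add: L2_norm_def)

lemma L2_norm_nonneg: "L2_norm U f \<ge> 0"
  by (simp add: L2_norm_def)

lemma L2_mult_integrable:
  assumes "f \<in> L2 U" "g \<in> L2 U"
  shows "integrable (lebesgue_on U) (\<lambda>x. f x * g x)"
proof (rule Bochner_Integration.integrable_bound)
  show "integrable (lebesgue_on U) (\<lambda>x. (f x)\<^sup>2 + (g x)\<^sup>2)"
    using assms by (auto simp: L2_def)
  have "\<bar>a * b\<bar> \<le> a\<^sup>2 + b\<^sup>2" for a b :: real
  proof -
    have "2 * (\<bar>a\<bar> * \<bar>b\<bar>) \<le> a\<^sup>2 + b\<^sup>2"
      using sum_squares_bound[of "\<bar>a\<bar>" "\<bar>b\<bar>"] by simp
    moreover have "0 \<le> \<bar>a\<bar> * \<bar>b\<bar>" by simp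
    ultimately show ?thesis unfolding abs_mult by linarith
  qed
  then show "AE x in lebesgue_on U. norm (f x * g x) \<le> norm ((f x)\<^sup>2 + (g x)\<^sup>2)"
    by simp
  show "(\<lambda>x. f x * g x) \<in> borel_measurable (lebesgue_on U)"
    using assms[THEN L2_measurable] by measurable
qed

lemma L2_cmult: "f \<in> L2 U \<Longrightarrow> (\<lambda>x. c * f x) \<in> L2 U"
  by (auto simp: L2_def power_mult_distrib)

lemma L2_add:
  assumes "f \<in> L2 U" "g \<in> L2 U"
  shows "(\<lambda>x. f x + g x) \<in> L2 U"
proof -
  have "integrable (lebesgue_on U) (\<lambda>x. (f x)\<^sup>2 + (g x)\<^sup>2 + 2 * (f x * g x))"
    using assms[THEN L2_square] L2_mult_integrable[OF assms] by auto
  also have "(\<lambda>x. (f x)\<^sup>2 + (g x)\<^sup>2 + 2 * (f x * g x)) = (\<lambda>x. (f x + g x)\<^sup>2)"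
    by (auto simp: power2_eq_square algebra_simps)
  finally show ?thesis using assms[THEN L2_measurable] by (simp add: L2_def)
qed

lemma L2_diff: "f \<in> L2 U \<Longrightarrow> g \<in> L2 U \<Longrightarrow> (\<lambda>x. f x - g x) \<in> L2 U"
  using L2_add[of f U "\<lambda>x. (-1) * g x"] L2_cmult[of g U "-1"] by simp

lemma L2_zero: "(\<lambda>x. 0) \<in> L2 U"
  by (simp add: L2_def)

lemma L2_sum: "(\<And>i. i \<in> A \<Longrightarrow> f i \<in> L2 U) \<Longrightarrow> (\<lambda>x. \<Sum>i\<in>A. f i x) \<in> L2 U"
  by (induction A rule: infinite_finite_induct) (auto intro: L2_add L2_zero)

lemma L2_bounded_mult:
  assumes "f \<in> L2 U" "h \<in> borel_measurable (lebesgue_on U)" "\<And>x. x \<in> U \<Longrightarrow> \<bar>h x\<bar> \<le> B"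
  shows "(\<lambda>x. h x * f x) \<in> L2 U"
proof -
  have "integrable (lebesgue_on U) (\<lambda>x. (h x * f x)\<^sup>2)"
  proof (rule Bochner_Integration.integrable_bound)
    show "integrable (lebesgue_on U) (\<lambda>x. B\<^sup>2 * (f x)\<^sup>2)" using L2_square[OF assms(1)] by simp
    have "(h x * f x)\<^sup>2 \<le> B\<^sup>2 * (f x)\<^sup>2" if "x \<in> U" for x
      using power_mono[OF assms(3)[OF that] abs_ge_zero, of 2]
      by (auto simp: power_mult_distrib intro: mult_right_mono)
    then show "AE x in lebesgue_on U. norm ((h x * f x)\<^sup>2) \<le> norm (B\<^sup>2 * (f x)\<^sup>2)"
      by (auto intro!: AE_I2)
  qed (use L2_measurable[OF assms(1)] assms(2) in measurable)
  then show ?thesis using L2_measurable[OF assms(1)] assms(2) by (simp add: L2_def)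
qed

lemma bounded_L2:
  assumes "U \<in> lmeasurable" "h \<in> borel_measurable (lebesgue_on U)" "\<And>x. x \<in> U \<Longrightarrow> \<bar>h x\<bar> \<le> B"
  shows "h \<in> L2 U"
proof -
  interpret finite_measure "lebesgue_on U" by (rule finite_measure_lebesgue_on[OF assms(1)])
  have "(\<lambda>x. 1) \<in> L2 U" by (simp add: L2_def)
  from L2_bounded_mult[OF this assms(2,3)] show ?thesis by simp
qed

lemma L2_integrable:
  assumes "U \<in> lmeasurable" "f \<in> L2 U"
  shows "integrable (lebesgue_on U) f"
  using L2_mult_integrable[OF assms(2) bounded_L2[OF assms(1), of "\<lambda>x. 1" 1]] by simp

lemma L2_Cauchy_Schwarz:
  assumes "f \<in> L2 U" "g \<in> L2 U"
  shows "\<bar>integral\<^sup>L (lebesgue_on U) (\<lambda>x. f x * g x)\<bar> \<le> L2_norm U f * L2_norm U g"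
proof -
  define a where "a = integral\<^sup>L (lebesgue_on U) (\<lambda>x. (f x)\<^sup>2)"
  define b where "b = integral\<^sup>L (lebesgue_on U) (\<lambda>x. f x * g x)"
  define c where "c = integral\<^sup>L (lebesgue_on U) (\<lambda>x. (g x)\<^sup>2)"
  have i: "integrable (lebesgue_on U) (\<lambda>x. (f x)\<^sup>2)" "integrable (lebesgue_on U) (\<lambda>x. (g x)\<^sup>2)"
    "integrable (lebesgue_on U) (\<lambda>x. f x * g x)"
    using assms L2_mult_integrable[OF assms] by (auto simp: L2_def)
  have pos: "a * s\<^sup>2 + 2 * b * s * t + c * t\<^sup>2 \<ge> 0" for s t
  proof -
    have "0 \<le> integral\<^sup>L (lebesgue_on U) (\<lambda>x. (s * f x + t * g x)\<^sup>2)" by simp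
    also have "(\<lambda>x. (s * f x + t * g x)\<^sup>2) = (\<lambda>x. s\<^sup>2 * (f x)\<^sup>2 + 2 * s * t * (f x * g x) + t\<^sup>2 * (g x)\<^sup>2)"
      by (auto simp: power2_eq_square algebra_simps)
    also have "integral\<^sup>L (lebesgue_on U) \<dots> = s\<^sup>2 * a + 2 * s * t * b + t\<^sup>2 * c"
      using i by (simp add: a_def b_def c_def)
    finally show ?thesis by (simp add: algebra_simps)
  qed
  have ac: "a \<ge> 0" "c \<ge> 0" by (auto simp: a_def c_def)
  have "b\<^sup>2 \<le> a * c"
  proof (cases "c = 0")
    case False
    then have "c > 0" using ac by simp
    have "0 \<le> a * c\<^sup>2 + 2 * b * c * (- b) + c * (- b)\<^sup>2" using pos[of c "-b"] by simp
    also have "\<dots> = c * (a * c - b\<^sup>2)" by (simp add: power2_eq_square algebra_simps)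
    finally show ?thesis using \<open>c > 0\<close> by (simp add: zero_le_mult_iff)
  next
    case True
    have "a + 2 * b * t \<ge> 0" for t using pos[of 1 t] True by simp
    from this[of "- (a + 1) / (2 * b)"] have "b = 0" by (cases "b = 0") auto
    then show ?thesis using True by simp
  qed
  then have "sqrt (b\<^sup>2) \<le> sqrt (a * c)" by (rule real_sqrt_le_mono)
  then show ?thesis by (simp add: a_def b_def c_def L2_norm_def real_sqrt_mult)
qed

lemma L2_norm_add_power2:
  assumes "f \<in> L2 U" "g \<in> L2 U"
  shows "(L2_norm U (\<lambda>x. a * f x + b * g x))\<^sup>2 \<le> 2 * a\<^sup>2 * (L2_norm U f)\<^sup>2 + 2 * b\<^sup>2 * (L2_norm U g)\<^sup>2"
proof -
  have i: "integrable (lebesgue_on U) (\<lambda>x. (f x)\<^sup>2)" "integrable (lebesgue_on U) (\<lambda>x. (g x)\<^sup>2)"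
    using assms by (auto simp: L2_def)
  have "integral\<^sup>L (lebesgue_on U) (\<lambda>x. (a * f x + b * g x)\<^sup>2)
      \<le> integral\<^sup>L (lebesgue_on U) (\<lambda>x. 2 * a\<^sup>2 * (f x)\<^sup>2 + 2 * b\<^sup>2 * (g x)\<^sup>2)"
  proof (rule integral_mono)
    show "integrable (lebesgue_on U) (\<lambda>x. (a * f x + b * g x)\<^sup>2)"
      by (rule L2_square[OF L2_add[OF L2_cmult L2_cmult]]) (use assms in auto)
    show "(a * f x + b * g x)\<^sup>2 \<le> 2 * a\<^sup>2 * (f x)\<^sup>2 + 2 * b\<^sup>2 * (g x)\<^sup>2" for x
      using sum_squares_bound[of "a * f x" "b * g x"] by (simp add: power2_sum power_mult_distrib)
  qed (use i in auto)
  also have "\<dots> = 2 * a\<^sup>2 * (L2_norm U f)\<^sup>2 + 2 * b\<^sup>2 * (L2_norm U g)\<^sup>2"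
    using i by (simp add: L2_norm_power2)
  finally show ?thesis by (simp add: L2_norm_power2)
qed

lemma L2_norm_cmult: "L2_norm U (\<lambda>x. c * f x) = \<bar>c\<bar> * L2_norm U f"
  by (simp add: L2_norm_def power_mult_distrib real_sqrt_mult)

lemma L2_inner_tendsto:
  assumes "\<And>n. f n \<in> L2 U" "h \<in> L2 U" "g \<in> L2 U" "(\<lambda>n. L2_norm U (\<lambda>x. f n x - h x)) \<longlonglongrightarrow> 0"
  shows "(\<lambda>n. integral\<^sup>L (lebesgue_on U) (\<lambda>x. f n x * g x)) \<longlonglongrightarrow> integral\<^sup>L (lebesgue_on U) (\<lambda>x. h x * g x)"
proof -
  have "(\<lambda>n. integral\<^sup>L (lebesgue_on U) (\<lambda>x. (f n x - h x) * g x)) \<longlonglongrightarrow> 0"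
  proof (rule tendsto_0_le)
    show "(\<lambda>n. L2_norm U (\<lambda>x. f n x - h x)) \<longlonglongrightarrow> 0" by fact
    show "\<forall>\<^sub>F n in sequentially. norm (integral\<^sup>L (lebesgue_on U) (\<lambda>x. (f n x - h x) * g x))
        \<le> norm (L2_norm U (\<lambda>x. f n x - h x)) * L2_norm U g"
      using L2_Cauchy_Schwarz[OF L2_diff[OF assms(1,2)] assms(3)]
      by (simp add: abs_of_nonneg[OF L2_norm_nonneg])
  qed
  moreover have "integral\<^sup>L (lebesgue_on U) (\<lambda>x. (f n x - h x) * g x) =
      integral\<^sup>L (lebesgue_on U) (\<lambda>x. f n x * g x) - integral\<^sup>L (lebesgue_on U) (\<lambda>x. h x * g x)" for n
    using L2_mult_integrable[OF assms(1,3)] L2_mult_integrable[OF assms(2,3)] by (simp add: left_diff_distrib)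
  ultimately show ?thesis using LIM_zero_cancel by fastforce
qed

subsection \<open>Local integrability\<close>

lemma set_integrable_lebesgue_iff:
  fixes f :: "'a::euclidean_space \<Rightarrow> real"
  assumes "C \<in> sets lebesgue"
  shows "set_integrable lebesgue C f \<longleftrightarrow> integrable (lebesgue_on C) f"
  using assms by (simp add: set_integrable_def integrable_restrict_space)

lemma integrable_subset_lebesgue_on:
  fixes f :: "'a::euclidean_space \<Rightarrow> real"
  assumes "integrable (lebesgue_on U) f" "V \<subseteq> U" "U \<in> sets lebesgue" "V \<in> sets lebesgue"
  shows "integrable (lebesgue_on V) f"
  using assms set_integrable_subset[of lebesgue U f V] by (simp add: set_integrable_lebesgue_iff)

lemma integrable_imp_locally_integrable:
  assumes "integrable (lebesgue_on U) f" "U \<in> sets lebesgue"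
  shows "locally_integrable U f"
  unfolding locally_integrable_def
  using assms integrable_subset_lebesgue_on[OF assms(1)]
  by (auto simp: set_integrable_lebesgue_iff compact_imp_closed)

lemma locally_integrable_mult:
  fixes f h :: "'a::euclidean_space \<Rightarrow> real"
  assumes "locally_integrable U f" "U \<in> sets lebesgue" "h \<in> borel_measurable borel" "\<And>x. \<bar>h x\<bar> \<le> B"
    "compact C" "C \<subseteq> U" "\<And>x. x \<notin> C \<Longrightarrow> h x = 0"
  shows "integrable (lebesgue_on U) (\<lambda>x. f x * h x)" "integrable lebesgue (\<lambda>x. f x * h x)"
    "integral\<^sup>L (lebesgue_on U) (\<lambda>x. f x * h x) = integral\<^sup>L lebesgue (\<lambda>x. f x * h x)"
proof -
  have C: "C \<in> sets lebesgue" using assms(5) by (simp add: compact_imp_closed)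
  have f: "integrable lebesgue (\<lambda>x. indicator C x * f x)"
    using assms(1,5,6) by (auto simp: locally_integrable_def set_integrable_def)
  have "h \<in> borel_measurable lebesgue" using assms(3) by (simp add: measurable_completion)
  have B: "B \<ge> 0" using assms(4)[of 0] by linarith
  have "integrable lebesgue (\<lambda>x. h x * (indicator C x * f x))"
  proof (rule Bochner_Integration.integrable_bound)
    show "integrable lebesgue (\<lambda>x. B * (indicator C x * f x))" using f by simp
    show "AE x in lebesgue. norm (h x * (indicator C x * f x)) \<le> norm (B * (indicator C x * f x))"
      using assms(4) B by (intro AE_I2) (auto simp: abs_mult intro!: mult_right_mono)
  qed (use f \<open>h \<in> borel_measurable lebesgue\<close> in \<open>auto intro!: borel_measurable_times\<close>)
  moreover have eq: "(\<lambda>x. h x * (indicator C x * f x)) = (\<lambda>x. f x * h x)"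
  proof
    show "h x * (indicator C x * f x) = f x * h x" for x
      using assms(7)[of x] by (cases "x \<in> C") auto
  qed
  ultimately show i: "integrable lebesgue (\<lambda>x. f x * h x)" by simp
  have eq2: "(\<lambda>x. if x \<in> U then f x * h x else 0) = (\<lambda>x. f x * h x)"
  proof
    show "(if x \<in> U then f x * h x else 0) = f x * h x" for x
      using assms(6) assms(7)[of x] by auto
  qed
  show "integrable (lebesgue_on U) (\<lambda>x. f x * h x)"
    using Lebesgue_Measure.integrable_restrict_UNIV[OF assms(2), of "\<lambda>x. f x * h x"] i by (simp add: eq2)
  show "integral\<^sup>L (lebesgue_on U) (\<lambda>x. f x * h x) = integral\<^sup>L lebesgue (\<lambda>x. f x * h x)"
    using Lebesgue_Measure.integral_restrict_UNIV[OF assms(2), of "\<lambda>x. f x * h x"] by (simp add: eq2)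
qed

lemma locally_integrable_mult_test:
  assumes "locally_integrable U f" "U \<in> sets lebesgue" "\<phi> \<in> test_functions U"
  shows "integrable (lebesgue_on U) (\<lambda>x. f x * \<phi> x)"
proof -
  obtain C where "compact C" "C \<subseteq> U" "\<And>x. x \<notin> C \<Longrightarrow> \<phi> x = 0"
    using test_functions_support[OF assms(3)] by blast
  moreover obtain B where "\<And>x. \<bar>\<phi> x\<bar> \<le> B" using test_functions_bounded[OF assms(3)] by blast
  ultimately show ?thesis
    using assms(1,2) test_functions_continuous[OF assms(3)]
    by (intro locally_integrable_mult(1)) (auto intro: borel_measurable_continuous_onI)
qed

lemma locally_integrable_cong_AE:
  assumes "locally_integrable U f" "AE x in lebesgue_on U. f x = g x" "U \<in> sets lebesgue"
  shows "locally_integrable U g"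
  unfolding locally_integrable_def
proof safe
  fix C assume C: "compact C" "C \<subseteq> U"
  then have Cl: "C \<in> sets lebesgue" by (simp add: compact_imp_closed)
  have "AE x in lebesgue_on C. f x = g x"
    using assms(2) C(2) unfolding AE_lebesgue_on_iff[OF Cl] AE_lebesgue_on_iff[OF assms(3)]
    by (elim eventually_mono) auto
  then show "set_integrable lebesgue C g"
    using assms(1) C Cl integrable_lebesgue_on_cong_AE(1)[OF _ _ Cl, of f g]
    by (auto simp: set_integrable_lebesgue_iff locally_integrable_def)
qed

lemma locally_integrable_lincomb:
  assumes "locally_integrable U f" "locally_integrable U g"
  shows "locally_integrable U (\<lambda>x. a * f x + b * g x)"
  unfolding locally_integrable_def
proof safe
  fix C assume "compact C" "C \<subseteq> U"
  then have "set_integrable lebesgue C f" "set_integrable lebesgue C g"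
    using assms by (auto simp: locally_integrable_def)
  then show "set_integrable lebesgue C (\<lambda>x. a * f x + b * g x)"
    by (intro set_integral_add set_integrable_mult_right) auto
qed

lemma L2_locally_integrable:
  assumes "f \<in> L2 U" "U \<in> lmeasurable"
  shows "locally_integrable U f"
  using L2_integrable[OF assms(2,1)] assms(2) by (auto intro: integrable_imp_locally_integrable)

section \<open>The fundamental lemma of the calculus of variations\<close>

text \<open>Boxes form a generator of the Borel sets that is stable under intersection, so the integral of
  \<open>g\<close> vanishes over every Borel set.\<close>

lemma AE_zero_if_box_integrals_zero:
  fixes g :: "'a::euclidean_space \<Rightarrow> real"
  assumes g: "integrable lborel g"
    and z: "\<And>c d. (\<integral>x. indicator (box c d) x * g x \<partial>lborel) = 0"
  shows "AE x in lborel. g x = 0"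
proof (rule sigma_finite_measure.density_zero[OF sigma_finite_lborel g])
  fix A assume A: "A \<in> sets (lborel :: 'a measure)"
  have A': "A \<in> sigma_sets UNIV (range (\<lambda>(a, b). box a b :: 'a set))"
    using A by (simp add: borel_eq_box)
  have Int: "Int_stable (range (\<lambda>(a, b). box a b :: 'a set))"
    by (auto simp: Int_stable_def box_Int_box)
  have ind: "integrable lborel (\<lambda>x. indicator B x * g x)" if "B \<in> sets borel" for B
    using integrable_mult_indicator[OF _ g, of B] that by simp
  have P: "range (\<lambda>(a, b). box a b :: 'a set) \<subseteq> Pow UNIV" by simp
  from Int P A' have "(\<integral>x. indicator A x * g x \<partial>lborel) = 0"
  proof (induction rule: sigma_sets_induct_disjoint)
    case (basic A)
    then show ?case using z by auto
  next
    case empty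
    then show ?case by simp
  next
    case (compl A)
    have U: "(\<integral>x. g x \<partial>lborel) = 0"
    proof (rule LIMSEQ_unique)
      have "(\<lambda>n. \<integral>x. indicator (box (- real n *\<^sub>R One) (real n *\<^sub>R One)) x * g x \<partial>lborel) \<longlonglongrightarrow> (\<integral>x. g x \<partial>lborel)"
      proof (rule integral_dominated_convergence[where w = "\<lambda>x. \<bar>g x\<bar>"])
        show "AE x in lborel. (\<lambda>n. indicator (box (- real n *\<^sub>R One) (real n *\<^sub>R One)) x * g x) \<longlonglongrightarrow> g x"
        proof (rule AE_I2, rule tendsto_eventually)
          fix x :: 'a
          obtain N where N: "norm x < real N" using reals_Archimedean2 by blast
          show "\<forall>\<^sub>F n in sequentially. indicator (box (- real n *\<^sub>R One) (real n *\<^sub>R One)) x * g x = g x"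
          proof (rule eventually_sequentiallyI[of N])
            fix n assume "N \<le> n"
            then have "norm x < real n" using N by linarith
            then have "x \<in> box (- real n *\<^sub>R One) (real n *\<^sub>R One)"
              using Basis_le_norm[of _ x] by (force simp: mem_box abs_less_iff)
            then show "indicator (box (- real n *\<^sub>R One) (real n *\<^sub>R One)) x * g x = g x" by simp
          qed
        qed
      qed (use g in \<open>auto simp: indicator_def\<close>)
      then show "(\<lambda>n. 0) \<longlonglongrightarrow> (\<integral>x. g x \<partial>lborel)" using z by simp
    qed simp
    have "A \<in> sets borel" using compl by (simp add: borel_eq_box)
    then have "(\<integral>x. g x - indicator A x * g x \<partial>lborel) = 0"
      using compl U g ind[of A] by simp
    moreover have "(\<lambda>x. indicator (UNIV - A) x * g x) = (\<lambda>x. g x - indicator A x * g x)"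
      by (auto simp: indicator_def)
    ultimately show ?case by simp
  next
    case (union A)
    have A: "\<And>i. A i \<in> sets borel" using union by (auto simp: borel_eq_box)
    have "set_integrable lborel (\<Union>i. A i) g" using ind[of "\<Union>i. A i"] A
      by (auto simp: set_integrable_def)
    from lebesgue_integral_countable_add[OF _ _ this] A union show ?case
      by (simp add: set_lebesgue_integral_def disjoint_family_on_def)
  qed
  then show "set_lebesgue_integral lborel A g = 0" by (simp add: set_lebesgue_integral_def)
qed

text \<open>An open set is a countable union of closed boxes, whose boundaries are null sets.\<close>

lemma AE_zero_if_locally_AE_zero:
  fixes f :: "'a::euclidean_space \<Rightarrow> real"
  assumes "open U" "\<And>a b. cbox a b \<subseteq> U \<Longrightarrow> AE x in lborel. x \<in> box a b \<longrightarrow> f x = 0"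
  shows "AE x in lebesgue_on U. f x = 0"
proof -
  obtain D where D: "countable D" "D \<subseteq> Pow U" "\<And>X. X \<in> D \<Longrightarrow> \<exists>a b. X = cbox a b" "\<Union> D = U"
    using open_countable_Union_open_cbox[OF assms(1)] by metis
  have "AE x in lborel. x \<in> X \<longrightarrow> f x = 0" if X: "X \<in> D" for X
  proof -
    obtain a b where ab: "X = cbox a b" using D(3) X by blast
    have "AE x in lborel. x \<in> box a b \<longrightarrow> f x = 0" using assms(2)[of a b] D(2) X ab by auto
    moreover have "cbox a b - box a b \<in> null_sets lborel"
      using negligible_frontier_interval[of a b]
      by (simp add: negligible_iff_null_sets null_sets_completion_iff)
    then have "AE x in lborel. x \<notin> cbox a b - box a b" by (rule AE_not_in)
    ultimately show ?thesis by eventually_elim (use ab in auto)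
  qed
  then have "AE x in lborel. \<forall>X\<in>D. x \<in> X \<longrightarrow> f x = 0"
    by (subst AE_ball_countable[OF D(1)]) blast
  then show ?thesis
    unfolding AE_lebesgue_on_iff[OF open_sets_lebesgue[OF assms(1)]] using D(4)
    by (elim eventually_mono) auto
qed

text \<open>It suffices to test with functions that approximate the indicators of boxes. The flexible
  class \<open>\<Phi>\<close> is there for product domains, where tensor products suffice.\<close>

lemma fundamental_lemma_class:
  fixes f :: "'a::euclidean_space \<Rightarrow> real"
  assumes U: "open U" and f: "locally_integrable U f"
    and \<Phi>: "\<Phi> \<subseteq> test_functions U"
    and z: "\<And>\<phi>. \<phi> \<in> \<Phi> \<Longrightarrow> integral\<^sup>L (lebesgue_on U) (\<lambda>x. f x * \<phi> x) = 0"
    and box: "\<And>a b. cbox a b \<subseteq> U \<Longrightarrow> \<exists>\<beta>. (\<forall>n. \<beta> n \<in> \<Phi>) \<and> (\<forall>n x. \<beta> n x \<in> {0..1}) \<and>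
      (\<forall>n x. x \<notin> box a b \<longrightarrow> \<beta> n x = 0) \<and> (\<forall>x. (\<lambda>n. \<beta> n x) \<longlonglongrightarrow> indicator (box a b) x)"
  shows "AE x in lebesgue_on U. f x = 0"
proof (rule AE_zero_if_locally_AE_zero[OF U])
  fix a b :: 'a assume ab: "cbox a b \<subseteq> U"
  have "integrable (lebesgue_on (cbox a b)) f"
    using f ab by (simp add: locally_integrable_def set_integrable_lebesgue_iff[symmetric])
  from integrable_borel_representative[OF _ this]
  obtain g where g: "g \<in> borel_measurable borel" "\<And>x. x \<notin> cbox a b \<Longrightarrow> g x = 0"
    "AE x in lebesgue_on (cbox a b). f x = g x" "integrable lborel g" by auto
  have fg: "AE x in lborel. x \<in> cbox a b \<longrightarrow> f x = g x"
    using g(3) by (simp add: AE_lebesgue_on_iff)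
  have small: "(\<integral>x. indicator (box c d) x * g x \<partial>lborel) = 0" if cd: "cbox c d \<subseteq> cbox a b" for c d
  proof -
    obtain \<beta> where \<beta>: "\<And>n. \<beta> n \<in> \<Phi>" "\<And>n x. \<beta> n x \<in> {0..1}"
      "\<And>n x. x \<notin> box c d \<Longrightarrow> \<beta> n x = 0" "\<And>x. (\<lambda>n. \<beta> n x) \<longlonglongrightarrow> indicator (box c d) x"
      using box[of c d] cd ab by (metis subset_trans)
    have bm: "\<beta> n \<in> borel_measurable borel" for n
      using test_functions_continuous[of "\<beta> n" U UNIV] \<beta>(1)[of n] \<Phi> by (auto intro: borel_measurable_continuous_onI)
    have "(\<integral>x. \<beta> n x * g x \<partial>lborel) = 0" for n
    proof -
      have U': "U \<in> sets borel" using U by simp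
      have out: "\<beta> n x * g x = 0" if "x \<notin> U" for x using that ab g(2)[of x] by auto
      have "AE x in lebesgue_on U. \<beta> n x * g x = f x * \<beta> n x"
        using fg unfolding AE_lebesgue_on_iff[OF open_sets_lebesgue[OF U]]
        using \<beta>(3)[of _ n] cd box_subset_cbox[of c d] by (elim eventually_mono) (metis mult.commute mult_zero_left subsetD)
      from integral_lebesgue_on_cong_AE[OF this] z[OF \<beta>(1)[of n]] U
      have "integral\<^sup>L (lebesgue_on U) (\<lambda>x. \<beta> n x * g x) = 0" by simp
      then show ?thesis
        using borel_zero_outside(2)[OF U' _ out] g(1) bm by simp
    qed
    moreover have "(\<lambda>n. \<integral>x. \<beta> n x * g x \<partial>lborel) \<longlonglongrightarrow> (\<integral>x. indicator (box c d) x * g x \<partial>lborel)"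
    proof (rule integral_dominated_convergence[where w = "\<lambda>x. \<bar>g x\<bar>"])
      show "AE x in lborel. (\<lambda>n. \<beta> n x * g x) \<longlonglongrightarrow> indicator (box c d) x * g x"
        by (intro AE_I2 tendsto_mult \<beta>(4) tendsto_const)
      show "AE x in lborel. norm (\<beta> n x * g x) \<le> \<bar>g x\<bar>" for n
        using \<beta>(2)[of n] by (intro AE_I2) (auto simp: abs_mult intro: mult_left_le_one_le)
    qed (use g bm in auto)
    ultimately show ?thesis by (simp add: LIMSEQ_const_iff)
  qed
  have "AE x in lborel. indicator (box a b) x * g x = 0"
  proof (rule AE_zero_if_box_integrals_zero)
    show "integrable lborel (\<lambda>x. indicator (box a b) x * g x)"
      using integrable_mult_indicator[OF _ g(4), of "box a b"] by simp
    fix c d :: 'a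
    obtain c' d' where cd: "box a b \<inter> box c d = box c' d'" unfolding box_Int_box by blast
    show "(\<integral>x. indicator (box c d) x * (indicator (box a b) x * g x) \<partial>lborel) = 0"
    proof (cases "box c' d' = {}")
      case True
      then have "(\<lambda>x. indicator (box c d) x * (indicator (box a b) x * g x)) = (\<lambda>x. 0)"
        using cd by (auto simp: indicator_def fun_eq_iff)
      then show ?thesis by simp
    next
      case False
      have "cbox c' d' = closure (box c' d')" using False by simp
      also have "\<dots> \<subseteq> cbox a b"
        using cd box_subset_cbox[of a b] by (intro closure_minimal) auto
      finally have "(\<integral>x. indicator (box c' d') x * g x \<partial>lborel) = 0" by (rule small)
      moreover have "(\<lambda>x. indicator (box c d) x * (indicator (box a b) x * g x)) = (\<lambda>x. indicator (box c' d') x * g x)"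
        unfolding cd[symmetric] by (auto simp: indicator_def)
      ultimately show ?thesis by simp
    qed
  qed
  with fg show "AE x in lborel. x \<in> box a b \<longrightarrow> f x = 0"
    by eventually_elim (use box_subset_cbox[of a b] in \<open>auto simp: indicator_def\<close>)
qed

lemma fundamental_lemma:
  fixes f :: "'a::euclidean_space \<Rightarrow> real"
  assumes "open U" "locally_integrable U f"
    and "\<And>\<phi>. \<phi> \<in> test_functions U \<Longrightarrow> integral\<^sup>L (lebesgue_on U) (\<lambda>x. f x * \<phi> x) = 0"
  shows "AE x in lebesgue_on U. f x = 0"
proof (rule fundamental_lemma_class[OF assms(1,2) order_refl assms(3)])
  fix a b :: 'a assume "cbox a b \<subseteq> U"
  from indicator_box_limit_test_functions[OF this]
  show "\<exists>\<beta>. (\<forall>n. \<beta> n \<in> test_functions U) \<and> (\<forall>n x. \<beta> n x \<in> {0..1}) \<and>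
      (\<forall>n x. x \<notin> box a b \<longrightarrow> \<beta> n x = 0) \<and> (\<forall>x. (\<lambda>n. \<beta> n x) \<longlonglongrightarrow> indicator (box a b) x)"
    by metis
qed auto

text \<open>A box in the product is a product of boxes, and the products of approximations of the two
  indicators approximate the indicator of the product.\<close>

lemma fundamental_lemma_product:
  fixes f :: "'a::euclidean_space \<times> 'b::euclidean_space \<Rightarrow> real"
  assumes "open U" "open V" "locally_integrable (U \<times> V) f"
    and "\<And>\<zeta> \<eta>. \<zeta> \<in> test_functions U \<Longrightarrow> \<eta> \<in> test_functions V \<Longrightarrow>
      integral\<^sup>L (lebesgue_on (U \<times> V)) (\<lambda>z. f z * (\<zeta> (fst z) * \<eta> (snd z))) = 0"
  shows "AE x in lebesgue_on (U \<times> V). f x = 0"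
proof (rule fundamental_lemma_class[OF open_Times[OF assms(1,2)] assms(3),
    of "{\<lambda>z. \<zeta> (fst z) * \<eta> (snd z) | \<zeta> \<eta>. \<zeta> \<in> test_functions U \<and> \<eta> \<in> test_functions V}"])
  fix p q :: "'a \<times> 'b" assume pq: "cbox p q \<subseteq> U \<times> V"
  obtain a s b t where p: "p = (a, s)" "q = (b, t)" by (cases p, cases q) auto
  have box: "box p q = box a b \<times> box s t"
    by (auto simp: p box_def Basis_prod_def inner_Pair ball_Un)
  let ?\<Phi> = "{\<lambda>z. \<zeta> (fst z) * \<eta> (snd z) | \<zeta> \<eta>. \<zeta> \<in> test_functions U \<and> \<eta> \<in> test_functions V}"
  show "\<exists>\<beta>. (\<forall>n. \<beta> n \<in> ?\<Phi>) \<and> (\<forall>n x. \<beta> n x \<in> {0..1}) \<and>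
      (\<forall>n x. x \<notin> box p q \<longrightarrow> \<beta> n x = 0) \<and> (\<forall>x. (\<lambda>n. \<beta> n x) \<longlonglongrightarrow> indicator (box p q) x)"
  proof (cases "cbox a b = {} \<or> cbox s t = {}")
    case True
    then have e: "box p q = {}" using box box_subset_cbox[of a b] box_subset_cbox[of s t] by auto
    have "(\<lambda>x. 0) \<in> test_functions U" "(\<lambda>x. 0) \<in> test_functions V"
      by (auto intro!: test_functionsI[of _ "{}"] Ck_on_const)
    then have "(\<lambda>z. 0) \<in> ?\<Phi>" by (intro CollectI exI[of _ "\<lambda>x. 0"]) auto
    then show ?thesis using e by (intro exI[of _ "\<lambda>n z. 0"]) auto
  next
    case False
    have "cbox a b \<times> cbox s t \<subseteq> U \<times> V" using pq by (simp add: p cbox_Pair_eq)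
    then have "cbox a b \<subseteq> U" "cbox s t \<subseteq> V" using False by auto
    obtain \<beta> where \<beta>: "\<And>n. \<beta> n \<in> test_functions U" "\<And>n x. \<beta> n x \<in> {0..1}"
      "\<And>n x. x \<notin> box a b \<Longrightarrow> \<beta> n x = 0" "\<And>x. (\<lambda>n. \<beta> n x) \<longlonglongrightarrow> indicator (box a b) x"
      using indicator_box_limit_test_functions[OF \<open>cbox a b \<subseteq> U\<close>] by metis
    obtain \<alpha> where \<alpha>: "\<And>n. \<alpha> n \<in> test_functions V" "\<And>n x. \<alpha> n x \<in> {0..1}"
      "\<And>n x. x \<notin> box s t \<Longrightarrow> \<alpha> n x = 0" "\<And>x. (\<lambda>n. \<alpha> n x) \<longlonglongrightarrow> indicator (box s t) x"
      using indicator_box_limit_test_functions[OF \<open>cbox s t \<subseteq> V\<close>] by metis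
    show ?thesis
    proof (intro exI[of _ "\<lambda>n z. \<beta> n (fst z) * \<alpha> n (snd z)"] conjI allI impI)
      show "(\<lambda>z. \<beta> n (fst z) * \<alpha> n (snd z)) \<in> ?\<Phi>" for n using \<beta>(1) \<alpha>(1) by blast
      show "\<beta> n (fst x) * \<alpha> n (snd x) \<in> {0..1}" for n x
        using \<beta>(2)[of n "fst x"] \<alpha>(2)[of n "snd x"] by (auto intro: mult_le_one)
      show "\<beta> n (fst x) * \<alpha> n (snd x) = 0" if "x \<notin> box p q" for n x
        using that \<beta>(3)[of "fst x" n] \<alpha>(3)[of "snd x" n] by (cases x) (auto simp: box)
      have "indicator (box p q) x = (indicator (box a b) (fst x) * indicator (box s t) (snd x) :: real)" for x
        by (cases x) (auto simp: box indicator_def)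
      then show "(\<lambda>n. \<beta> n (fst x) * \<alpha> n (snd x)) \<longlonglongrightarrow> indicator (box p q) x" for x
        by (auto intro!: tendsto_mult \<beta>(4) \<alpha>(4))
    qed
  qed
qed (use assms(4) test_functions_product in auto)

section \<open>Weak derivatives\<close>

lemma has_weak_deriv_locally_integrable:
  "has_weak_deriv U e f g \<Longrightarrow> locally_integrable U f" "has_weak_deriv U e f g \<Longrightarrow> locally_integrable U g"
  by (auto simp: has_weak_deriv_def)

lemma has_weak_deriv_cong_AE:
  assumes "has_weak_deriv U e f g" "AE x in lebesgue_on U. f x = f' x" "AE x in lebesgue_on U. g x = g' x" "open U"
  shows "has_weak_deriv U e f' g'"
proof -
  have 1: "integral\<^sup>L (lebesgue_on U) (\<lambda>x. f' x * h x) = integral\<^sup>L (lebesgue_on U) (\<lambda>x. f x * h x)" for h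
    using assms(2) assms(4) by (intro integral_lebesgue_on_cong_AE) (auto elim: eventually_mono)
  have 2: "integral\<^sup>L (lebesgue_on U) (\<lambda>x. g' x * h x) = integral\<^sup>L (lebesgue_on U) (\<lambda>x. g x * h x)" for h
    using assms(3) assms(4) by (intro integral_lebesgue_on_cong_AE) (auto elim: eventually_mono)
  show ?thesis
    using assms(1) locally_integrable_cong_AE[OF _ assms(2)] locally_integrable_cong_AE[OF _ assms(3)] assms(4)
    by (auto simp: has_weak_deriv_def 1 2)
qed

lemma has_weak_deriv_lincomb:
  assumes "has_weak_deriv U e f g" "has_weak_deriv U e f' g'" "open U"
  shows "has_weak_deriv U e (\<lambda>x. a * f x + b * f' x) (\<lambda>x. a * g x + b * g' x)"
  unfolding has_weak_deriv_def
proof (intro conjI ballI)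
  note l = has_weak_deriv_locally_integrable[OF assms(1)] has_weak_deriv_locally_integrable[OF assms(2)]
  show "locally_integrable U (\<lambda>x. a * f x + b * f' x)" "locally_integrable U (\<lambda>x. a * g x + b * g' x)"
    using l by (auto intro: locally_integrable_lincomb)
  fix \<phi> assume \<phi>: "\<phi> \<in> test_functions U"
  have i: "integrable (lebesgue_on U) (\<lambda>x. F x * \<phi> x)"
      "integrable (lebesgue_on U) (\<lambda>x. F x * frechet_derivative \<phi> (at x) e)" if "locally_integrable U F" for F
    using locally_integrable_mult_test[OF that _ \<phi>] assms(3)
      locally_integrable_mult_test[OF that _ test_functions_derivative[OF \<phi>, of e]] by auto
  have "integral\<^sup>L (lebesgue_on U) (\<lambda>x. (a * f x + b * f' x) * frechet_derivative \<phi> (at x) e) =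
     a * integral\<^sup>L (lebesgue_on U) (\<lambda>x. f x * frechet_derivative \<phi> (at x) e) +
     b * integral\<^sup>L (lebesgue_on U) (\<lambda>x. f' x * frechet_derivative \<phi> (at x) e)"
    using i l by (simp add: distrib_right mult.assoc)
  also have "\<dots> = - (a * integral\<^sup>L (lebesgue_on U) (\<lambda>x. g x * \<phi> x) + b * integral\<^sup>L (lebesgue_on U) (\<lambda>x. g' x * \<phi> x))"
    using assms(1,2) \<phi> by (simp add: has_weak_deriv_def)
  also have "a * integral\<^sup>L (lebesgue_on U) (\<lambda>x. g x * \<phi> x) + b * integral\<^sup>L (lebesgue_on U) (\<lambda>x. g' x * \<phi> x)
     = integral\<^sup>L (lebesgue_on U) (\<lambda>x. (a * g x + b * g' x) * \<phi> x)"
    using i l by (simp add: distrib_right mult.assoc)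
  finally show "integral\<^sup>L (lebesgue_on U) (\<lambda>x. (a * f x + b * f' x) * frechet_derivative \<phi> (at x) e) =
     - integral\<^sup>L (lebesgue_on U) (\<lambda>x. (a * g x + b * g' x) * \<phi> x)" .
qed

lemma has_weak_deriv_unique:
  assumes "has_weak_deriv U e f g" "has_weak_deriv U e f h" "open U"
  shows "AE x in lebesgue_on U. g x = h x"
proof -
  have "AE x in lebesgue_on U. 1 * g x + (- 1) * h x = 0"
  proof (rule fundamental_lemma[OF assms(3)])
    show "locally_integrable U (\<lambda>x. 1 * g x + (- 1) * h x)"
      using has_weak_deriv_locally_integrable assms by (intro locally_integrable_lincomb)
    fix \<phi> assume \<phi>: "\<phi> \<in> test_functions U"
    have "integrable (lebesgue_on U) (\<lambda>x. g x * \<phi> x)" "integrable (lebesgue_on U) (\<lambda>x. h x * \<phi> x)"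
      using has_weak_deriv_locally_integrable assms \<phi> by (auto intro!: locally_integrable_mult_test)
    moreover have "integral\<^sup>L (lebesgue_on U) (\<lambda>x. g x * \<phi> x) = integral\<^sup>L (lebesgue_on U) (\<lambda>x. h x * \<phi> x)"
      using assms(1,2) \<phi> by (auto simp: has_weak_deriv_def)
    ultimately show "integral\<^sup>L (lebesgue_on U) (\<lambda>x. (1 * g x + (- 1) * h x) * \<phi> x) = 0"
      by (simp add: left_diff_distrib)
  qed
  then show ?thesis by (elim eventually_mono) auto
qed

lemma weak_deriv_works: "has_weak_deriv U e f g \<Longrightarrow> has_weak_deriv U e f (weak_deriv U e f)"
  unfolding weak_deriv_def by (rule someI[of "has_weak_deriv U e f"])

lemma weak_deriv_AE_eq:
  "has_weak_deriv U e f g \<Longrightarrow> open U \<Longrightarrow> AE x in lebesgue_on U. weak_deriv U e f x = g x"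
  using has_weak_deriv_unique weak_deriv_works by blast

section \<open>Continuity of translations in the mean\<close>

lemma lborel_translate:
  fixes F :: "'a::euclidean_space \<Rightarrow> real"
  assumes "F \<in> borel_measurable borel"
  shows "integrable lborel (\<lambda>x. F (x + c)) \<longleftrightarrow> integrable lborel F"
    and "(\<integral>x. F (x + c) \<partial>lborel) = (\<integral>x. F x \<partial>lborel)"
proof -
  have e: "(\<lambda>x. F (x + c)) = (\<lambda>x. F (c + x))" by (simp add: add.commute)
  show "integrable lborel (\<lambda>x. F (x + c)) \<longleftrightarrow> integrable lborel F"
    using integrable_distr_eq[of "(+) c" lborel borel F] assms by (simp add: lborel_distr_plus e)
  show "(\<integral>x. F (x + c) \<partial>lborel) = (\<integral>x. F x \<partial>lborel)"
    using integral_distr[of "(+) c" lborel borel F] assms by (simp add: lborel_distr_plus e)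
qed

text \<open>Truncate \<open>F\<close> first in its values and its domain. The truncation is an almost everywhere limit of
  continuous functions that are truncated in the same way, so dominated convergence applies.\<close>

lemma L1_dense_continuous:
  fixes F :: "'a::euclidean_space \<Rightarrow> real"
  assumes F: "integrable lborel F" and e: "\<epsilon> > 0"
  obtains G M B where "continuous_on UNIV G" "\<And>x. norm x > M \<Longrightarrow> G x = 0" "\<And>x. \<bar>G x\<bar> \<le> B"
    "integrable lborel G" "(\<integral>x. \<bar>F x - G x\<bar> \<partial>lborel) < \<epsilon>"
proof -
  have Fm: "F \<in> borel_measurable borel" using F by auto
  have "F measurable_on UNIV"
    using Fm by (simp add: measurable_on_iff_borel_measurable borel_measurable_lebesgue_onI)
  then obtain N g where N: "negligible N" "\<And>n. continuous_on UNIV (g n)"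
    "\<And>x. x \<notin> N \<Longrightarrow> (\<lambda>n. g n x) \<longlonglongrightarrow> F x"
    by (auto simp: measurable_on_def)
  define cut where "cut m x = max 0 (min 1 (real m + 1 - norm x))" for m and x :: 'a
  define clip where "clip m y = max (- real m) (min (real m) y)" for m and y :: real
  define Fc where "Fc m x = clip m (F x) * cut m x" for m x
  have cut01: "cut m x \<in> {0..1}" for m x by (auto simp: cut_def)
  have clip_abs: "\<bar>clip m y\<bar> \<le> \<bar>y\<bar>" "\<bar>clip m y\<bar> \<le> real m" "\<bar>y - clip m y * c\<bar> \<le> \<bar>y\<bar>" if "c \<in> {0..1}" for m y c
  proof -
    show 1: "\<bar>clip m y\<bar> \<le> \<bar>y\<bar>" "\<bar>clip m y\<bar> \<le> real m" by (auto simp: clip_def)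
    have "\<bar>clip m y\<bar> * c \<le> \<bar>y\<bar>" using that 1 by (meson mult_left_le abs_ge_zero atLeastAtMost_iff order_trans)
    then have "\<bar>clip m y * c\<bar> \<le> \<bar>y\<bar>" using that by (simp add: abs_mult)
    moreover have "y \<ge> 0 \<Longrightarrow> clip m y * c \<ge> 0" "y \<le> 0 \<Longrightarrow> clip m y * c \<le> 0"
      using that by (auto simp: clip_def mult_le_0_iff)
    ultimately show "\<bar>y - clip m y * c\<bar> \<le> \<bar>y\<bar>" by (cases "y \<ge> 0") auto
  qed
  have cutm: "cut m \<in> borel_measurable borel" "continuous_on UNIV (cut m)" for m
    unfolding cut_def[abs_def] by (auto intro!: continuous_intros)
  have clipc: "continuous_on UNIV (clip m)" for m
    unfolding clip_def[abs_def] by (auto intro!: continuous_intros)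
  then have clipm: "clip m \<in> borel_measurable borel" for m by (rule borel_measurable_continuous_onI)
  have Fcm: "Fc m \<in> borel_measurable borel" for m
    unfolding Fc_def[abs_def] using cutm measurable_compose[OF Fm clipm] by (intro borel_measurable_times)
  have "(\<lambda>m. \<integral>x. \<bar>F x - Fc m x\<bar> \<partial>lborel) \<longlonglongrightarrow> (\<integral>x. 0 \<partial>(lborel::'a measure))"
  proof (rule integral_dominated_convergence[where w = "\<lambda>x. \<bar>F x\<bar>"])
    show "AE x in lborel. (\<lambda>m. \<bar>F x - Fc m x\<bar>) \<longlonglongrightarrow> 0"
    proof (rule AE_I2, rule tendsto_eventually)
      fix x :: 'a
      obtain n where n: "norm x + \<bar>F x\<bar> < real n" using reals_Archimedean2 by blast
      show "\<forall>\<^sub>F m in sequentially. \<bar>F x - Fc m x\<bar> = 0"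
      proof (rule eventually_sequentiallyI[of n])
        fix m assume "n \<le> m"
        then have "norm x + \<bar>F x\<bar> < real m" using n by linarith
        then have "norm x \<le> real m" "\<bar>F x\<bar> \<le> real m"
          using norm_ge_zero[of x] abs_ge_zero[of "F x"] by linarith+
        then have "cut m x = 1" "clip m (F x) = F x" by (auto simp: cut_def clip_def)
        then show "\<bar>F x - Fc m x\<bar> = 0" by (simp add: Fc_def)
      qed
    qed
    show "AE x in lborel. norm \<bar>F x - Fc m x\<bar> \<le> \<bar>F x\<bar>" for m
      using clip_abs(3)[OF cut01] by (simp add: Fc_def)
  qed (use F Fcm in auto)
  then have "eventually (\<lambda>m. (\<integral>x. \<bar>F x - Fc m x\<bar> \<partial>lborel) < \<epsilon>/2) sequentially"
    using e by (intro order_tendstoD) auto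
  then obtain m where m: "(\<integral>x. \<bar>F x - Fc m x\<bar> \<partial>lborel) < \<epsilon>/2"
    using eventually_happens'[OF sequentially_bot] by blast
  define G where "G n x = clip m (g n x) * cut m x" for n x
  define w where "w x = real m * indicator (cball 0 (real m + 1)) x" for x :: 'a
  have cut0: "cut m x = 0" if "norm x > real m + 1" for x using that by (auto simp: cut_def)
  have cutm_le: "\<bar>clip m y * cut m x\<bar> \<le> real m" for x y
  proof -
    have "\<bar>clip m y\<bar> * \<bar>cut m x\<bar> \<le> real m * 1"
      using clip_abs(2)[OF cut01, of m y] cut01[of m x] by (intro mult_mono) auto
    then show ?thesis by (simp add: abs_mult)
  qed
  have bd: "\<bar>clip m y * cut m x\<bar> \<le> w x" for x y
  proof (cases "norm x > real m + 1")
    case False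
    have "\<bar>clip m y * cut m x\<bar> \<le> real m"
      using cutm_le[of y x] .
    then show ?thesis using False by (auto simp: w_def)
  qed (simp add: cut0 w_def)
  have wi: "integrable lborel w" unfolding w_def
    by (auto intro!: integrable_real_indicator simp: emeasure_lborel_cball_finite[unfolded infinity_ennreal_def])
  have Gc: "continuous_on UNIV (G n)" for n
    unfolding G_def[abs_def]
    using cutm(2) continuous_on_compose[OF N(2)[of n], of "clip m"] clipc
    by (intro continuous_on_mult) (auto simp: o_def intro: continuous_on_subset)
  then have Gm: "G n \<in> borel_measurable borel" for n by (rule borel_measurable_continuous_onI)
  have Gi: "integrable lborel (G n)" for n
    using wi by (rule Bochner_Integration.integrable_bound) (use Gm bd in \<open>auto simp: G_def intro!: AE_I2 order_trans[OF bd]\<close>)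
  have "(\<lambda>n. \<integral>x. \<bar>Fc m x - G n x\<bar> \<partial>lborel) \<longlonglongrightarrow> (\<integral>x. 0 \<partial>(lborel::'a measure))"
  proof (rule integral_dominated_convergence[where w = "\<lambda>x. 2 * w x"])
    have "AE x in lborel. x \<notin> N"
      using N(1) AE_not_in[of N lebesgue] by (simp add: negligible_iff_null_sets AE_completion_iff)
    then show "AE x in lborel. (\<lambda>n. \<bar>Fc m x - G n x\<bar>) \<longlonglongrightarrow> 0"
    proof eventually_elim
      case (elim x)
      have "(\<lambda>n. clip m (g n x)) \<longlonglongrightarrow> clip m (F x)"
        by (rule continuous_on_tendsto_compose[OF clipc N(3)[OF elim]]) auto
      then have "(\<lambda>n. \<bar>Fc m x - G n x\<bar>) \<longlonglongrightarrow> \<bar>Fc m x - clip m (F x) * cut m x\<bar>"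
        unfolding G_def by (intro tendsto_intros)
      then show ?case by (simp add: Fc_def)
    qed
    show "AE x in lborel. norm \<bar>Fc m x - G n x\<bar> \<le> 2 * w x" for n
    proof (rule AE_I2)
      fix x
      show "norm \<bar>Fc m x - G n x\<bar> \<le> 2 * w x"
        using bd[of "F x" x] bd[of "g n x" x] unfolding Fc_def G_def real_norm_def by linarith
    qed
  qed (use wi Fcm Gm in auto)
  then have "eventually (\<lambda>n. (\<integral>x. \<bar>Fc m x - G n x\<bar> \<partial>lborel) < \<epsilon>/2) sequentially"
    using e by (intro order_tendstoD) auto
  then obtain n where n: "(\<integral>x. \<bar>Fc m x - G n x\<bar> \<partial>lborel) < \<epsilon>/2"
    using eventually_happens'[OF sequentially_bot] by blast
  have Fci: "integrable lborel (Fc m)"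
    using wi by (rule Bochner_Integration.integrable_bound) (use Fcm bd in \<open>auto simp: Fc_def intro!: AE_I2 order_trans[OF bd]\<close>)
  have "(\<integral>x. \<bar>F x - G n x\<bar> \<partial>lborel) \<le> (\<integral>x. \<bar>F x - Fc m x\<bar> + \<bar>Fc m x - G n x\<bar> \<partial>lborel)"
    using F Fci Gi by (intro integral_mono) auto
  also have "\<dots> < \<epsilon>" using F Fci Gi m n by simp
  finally have "(\<integral>x. \<bar>F x - G n x\<bar> \<partial>lborel) < \<epsilon>" .
  moreover have "\<bar>G n x\<bar> \<le> real m" for x
    using cutm_le by (simp add: G_def)
  ultimately show ?thesis
    using that[OF Gc, of "real m + 1" n "real m"] Gi cut0 by (auto simp: G_def)
qed

text \<open>For continuous functions of bounded support this is dominated convergence; the general case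
  follows by density, because translations preserve the \<open>L\<^sup>1\<close> norm.\<close>

lemma L1_translation_continuous:
  fixes F :: "'a::euclidean_space \<Rightarrow> real"
  assumes F: "integrable lborel F" and y: "y \<longlonglongrightarrow> 0"
  shows "(\<lambda>n. \<integral>x. \<bar>F (x + y n) - F x\<bar> \<partial>lborel) \<longlonglongrightarrow> 0"
proof (rule LIMSEQ_I)
  fix \<epsilon> :: real assume e: "0 < \<epsilon>"
  obtain G M B where G: "continuous_on UNIV G" "\<And>x. norm x > M \<Longrightarrow> G x = 0" "\<And>x. \<bar>G x\<bar> \<le> B"
    "integrable lborel G" "(\<integral>x. \<bar>F x - G x\<bar> \<partial>lborel) < \<epsilon>/3"
    by (rule L1_dense_continuous[OF F, of "\<epsilon>/3"]) (use e in auto)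
  have m: "F \<in> borel_measurable borel" "G \<in> borel_measurable borel" using F G(4) by auto
  obtain Y where Y: "\<And>n. norm (y n) \<le> Y"
    using y convergent_imp_Bseq[of y] by (auto simp: convergent_def Bseq_def)
  have "(\<lambda>n. \<integral>x. \<bar>G (x + y n) - G x\<bar> \<partial>lborel) \<longlonglongrightarrow> (\<integral>x. 0 \<partial>(lborel::'a measure))"
  proof (rule integral_dominated_convergence[where w = "\<lambda>x. 2 * B * indicator (cball 0 (M + Y)) x"])
    show "AE x in lborel. (\<lambda>n. \<bar>G (x + y n) - G x\<bar>) \<longlonglongrightarrow> 0"
    proof (rule AE_I2)
      fix x
      have "(\<lambda>n. x + y n) \<longlonglongrightarrow> x + 0" using y by (intro tendsto_intros)
      then have "(\<lambda>n. G (x + y n)) \<longlonglongrightarrow> G x"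
        using G(1) by (intro continuous_on_tendsto_compose[of UNIV G]) auto
      then have "(\<lambda>n. \<bar>G (x + y n) - G x\<bar>) \<longlonglongrightarrow> \<bar>G x - G x\<bar>" by (intro tendsto_intros)
      then show "(\<lambda>n. \<bar>G (x + y n) - G x\<bar>) \<longlonglongrightarrow> 0" by simp
    qed
    show "AE x in lborel. norm \<bar>G (x + y n) - G x\<bar> \<le> 2 * B * indicator (cball 0 (M + Y)) x" for n
    proof (rule AE_I2)
      fix x
      show "norm \<bar>G (x + y n) - G x\<bar> \<le> 2 * B * indicator (cball 0 (M + Y)) x"
      proof (cases "norm x \<le> M + Y")
        case True
        then show ?thesis using G(3)[of x] G(3)[of "x + y n"] by simp
      next
        case False
        have "norm (x + y n) \<ge> norm x - norm (y n)" by (rule norm_diff_ineq)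
        then have "norm (x + y n) > M" "norm x > M"
          using False Y[of n] norm_ge_zero[of "y n"] by linarith+
        then show ?thesis using G(2) False by simp
      qed
    qed
  qed (use m in \<open>auto intro!: integrable_real_indicator simp: emeasure_lborel_cball_finite[unfolded infinity_ennreal_def]\<close>)
  then have "(\<lambda>n. \<integral>x. \<bar>G (x + y n) - G x\<bar> \<partial>lborel) \<longlonglongrightarrow> 0" by simp
  then have "eventually (\<lambda>n. (\<integral>x. \<bar>G (x + y n) - G x\<bar> \<partial>lborel) < \<epsilon>/3) sequentially"
    using e by (intro order_tendstoD) auto
  then obtain N where N: "\<And>n. n \<ge> N \<Longrightarrow> (\<integral>x. \<bar>G (x + y n) - G x\<bar> \<partial>lborel) < \<epsilon>/3"
    by (auto simp: eventually_sequentially)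
  have "(\<integral>x. \<bar>F (x + y n) - F x\<bar> \<partial>lborel) < \<epsilon>" if "n \<ge> N" for n
  proof -
    have Fi: "integrable lborel (\<lambda>x. F (x + y n))" and Gi: "integrable lborel (\<lambda>x. G (x + y n))"
      using lborel_translate(1)[OF m(1)] lborel_translate(1)[OF m(2)] F G(4) by auto
    have "(\<integral>x. \<bar>F (x + y n) - F x\<bar> \<partial>lborel) \<le>
       (\<integral>x. \<bar>F (x + y n) - G (x + y n)\<bar> + \<bar>G (x + y n) - G x\<bar> + \<bar>F x - G x\<bar> \<partial>lborel)"
      using F G(4) Fi Gi by (intro integral_mono) auto
    also have "\<dots> = (\<integral>x. \<bar>F (x + y n) - G (x + y n)\<bar> \<partial>lborel) + (\<integral>x. \<bar>G (x + y n) - G x\<bar> \<partial>lborel)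
        + (\<integral>x. \<bar>F x - G x\<bar> \<partial>lborel)"
      using F G(4) Fi Gi by simp
    also have "(\<integral>x. \<bar>F (x + y n) - G (x + y n)\<bar> \<partial>lborel) = (\<integral>x. \<bar>F x - G x\<bar> \<partial>lborel)"
      using lborel_translate(2)[of "\<lambda>x. \<bar>F x - G x\<bar>" "y n"] m by auto
    finally show ?thesis using G(5) N[OF that] by linarith
  qed
  then show "\<exists>N. \<forall>n\<ge>N. norm ((\<integral>x. \<bar>F (x + y n) - F x\<bar> \<partial>lborel) - 0) < \<epsilon>"
    by (intro exI[of _ N]) (auto simp: abs_of_nonneg)
qed

section \<open>Increments of weakly differentiable functions\<close>

lemma test_line_derivative:
  assumes "\<theta> \<in> test_functions U"
  shows "((\<lambda>s. \<theta> (x - s *\<^sub>R e)) has_real_derivative - frechet_derivative \<theta> (at (x - s *\<^sub>R e)) e) (at s)"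
proof -
  let ?D = "frechet_derivative \<theta> (at (x - s *\<^sub>R e))"
  have "((\<lambda>s. x - s *\<^sub>R e) has_derivative (\<lambda>h. - (h *\<^sub>R e))) (at s)"
    by (auto intro!: derivative_eq_intros)
  from diff_chain_at[OF this test_functions_has_derivative[OF assms]]
  have "((\<lambda>s. \<theta> (x - s *\<^sub>R e)) has_derivative (\<lambda>h. ?D (- (h *\<^sub>R e)))) (at s)" by (simp add: o_def)
  moreover have "linear ?D" using test_functions_has_derivative[OF assms] has_derivative_linear by blast
  then have "?D (- (h *\<^sub>R e)) = h * (- ?D e)" for h
    by (metis linear_neg linear_scale real_scaleR_def mult_minus_right)
  then have "(\<lambda>h. ?D (- (h *\<^sub>R e))) = (*) (- ?D e)" by (simp add: fun_eq_iff)
  ultimately show ?thesis by (simp add: has_field_derivative_def)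
qed

lemma test_functions_borel: "\<phi> \<in> test_functions U \<Longrightarrow> \<phi> \<in> borel_measurable borel"
  using test_functions_continuous[of \<phi> U UNIV] by (auto intro: borel_measurable_continuous_onI)

lemma integrable_mult_test_translate:
  fixes F :: "'a::euclidean_space \<Rightarrow> real"
  assumes "integrable lborel F" "\<theta> \<in> test_functions U"
  shows "integrable lborel (\<lambda>x. F x * \<theta> (x - c))"
proof -
  obtain B where B: "\<And>x. \<bar>\<theta> x\<bar> \<le> B" using test_functions_bounded[OF assms(2)] by blast
  have "B \<ge> 0" using B[of 0] by linarith
  have [measurable]: "\<theta> \<in> borel_measurable borel" "F \<in> borel_measurable borel"
    using test_functions_borel assms by auto
  show ?thesis
  proof (rule Bochner_Integration.integrable_bound)
    show "integrable lborel (\<lambda>x. F x * B)" using assms(1) by simp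
    show "AE x in lborel. norm (F x * \<theta> (x - c)) \<le> norm (F x * B)"
      using B \<open>B \<ge> 0\<close> by (intro AE_I2) (simp add: abs_mult mult_left_mono)
  qed measurable
qed

text \<open>The mean value theorem bounds the difference quotients of \<open>\<theta>\<close>, so the derivative passes under the
  integral. Translations act on the smooth factor, so \<open>F\<close> need only be integrable.\<close>

lemma translated_test_integral_DERIV:
  fixes F :: "'a::euclidean_space \<Rightarrow> real"
  assumes F: "integrable lborel F" and t: "\<theta> \<in> test_functions U"
  shows "((\<lambda>h. \<integral>x. F x * \<theta> (x - h *\<^sub>R e) \<partial>lborel) has_real_derivative
     - (\<integral>x. F x * frechet_derivative \<theta> (at (x - h *\<^sub>R e)) e \<partial>lborel)) (at h)"
  unfolding DERIV_def tendsto_at_iff_sequentially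
proof safe
  fix X :: "nat \<Rightarrow> real" assume X0: "\<forall>i. X i \<in> UNIV - {0}" and X: "X \<longlonglongrightarrow> 0"
  let ?q = "\<lambda>n x. (\<theta> (x - (h + X n) *\<^sub>R e) - \<theta> (x - h *\<^sub>R e)) / X n"
  obtain B where B: "\<And>x. \<bar>frechet_derivative \<theta> (at x) e\<bar> \<le> B"
    using test_functions_bounded[OF test_functions_derivative[OF t, of e]] by blast
  have [measurable]: "\<theta> \<in> borel_measurable borel" "F \<in> borel_measurable borel"
    "(\<lambda>x. frechet_derivative \<theta> (at x) e) \<in> borel_measurable borel"
    using test_functions_borel[OF t] F test_functions_borel[OF test_functions_derivative[OF t, of e]] by auto
  have "(\<lambda>n. \<integral>x. F x * ?q n x \<partial>lborel) \<longlonglongrightarrow> (\<integral>x. F x * (- frechet_derivative \<theta> (at (x - h *\<^sub>R e)) e) \<partial>lborel)"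
  proof (rule integral_dominated_convergence[where w = "\<lambda>x. \<bar>F x\<bar> * B"])
    have "(\<lambda>n. ?q n x) \<longlonglongrightarrow> - frechet_derivative \<theta> (at (x - h *\<^sub>R e)) e" for x
      using test_line_derivative[OF t, of x e h] X X0
      unfolding DERIV_def tendsto_at_iff_sequentially by (auto simp: o_def)
    then show "AE x in lborel. (\<lambda>n. F x * ?q n x) \<longlonglongrightarrow> F x * (- frechet_derivative \<theta> (at (x - h *\<^sub>R e)) e)"
      by (intro AE_I2 tendsto_mult tendsto_const)
    have "\<bar>?q n x\<bar> \<le> B" for n x
    proof -
      have "norm (\<theta> (x - (h + X n) *\<^sub>R e) - \<theta> (x - h *\<^sub>R e)) \<le> B * norm ((h + X n) - h)"
        by (rule field_differentiable_bound[of UNIV _ "\<lambda>s. - frechet_derivative \<theta> (at (x - s *\<^sub>R e)) e"])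
           (use test_line_derivative[OF t] B in auto)
      then show ?thesis using X0 by (simp add: abs_divide divide_le_eq)
    qed
    then show "AE x in lborel. norm (F x * ?q n x) \<le> \<bar>F x\<bar> * B" for n
      by (intro AE_I2) (simp only: real_norm_def abs_mult, intro mult_left_mono, auto)
  qed (use F in \<open>auto\<close>)
  moreover have "(\<integral>x. F x * ?q n x \<partial>lborel) =
    ((\<integral>x. F x * \<theta> (x - (h + X n) *\<^sub>R e) \<partial>lborel) - (\<integral>x. F x * \<theta> (x - h *\<^sub>R e) \<partial>lborel)) / X n" for n
  proof -
    have "(\<integral>x. F x * ?q n x \<partial>lborel) = (\<integral>x. (F x * \<theta> (x - (h + X n) *\<^sub>R e) - F x * \<theta> (x - h *\<^sub>R e)) / X n \<partial>lborel)"
      by (simp add: right_diff_distrib)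
    also have "\<dots> = ((\<integral>x. F x * \<theta> (x - (h + X n) *\<^sub>R e) \<partial>lborel) - (\<integral>x. F x * \<theta> (x - h *\<^sub>R e) \<partial>lborel)) / X n"
      using integrable_mult_test_translate[OF F t] by simp
    finally show ?thesis .
  qed
  moreover have "(\<integral>x. F x * (- frechet_derivative \<theta> (at (x - h *\<^sub>R e)) e) \<partial>lborel)
      = - (\<integral>x. F x * frechet_derivative \<theta> (at (x - h *\<^sub>R e)) e \<partial>lborel)"
    by simp
  ultimately show "((\<lambda>k. ((\<integral>x. F x * \<theta> (x - (h + k) *\<^sub>R e) \<partial>lborel) - (\<integral>x. F x * \<theta> (x - h *\<^sub>R e) \<partial>lborel)) / k) \<circ> X)
    \<longlonglongrightarrow> - (\<integral>x. F x * frechet_derivative \<theta> (at (x - h *\<^sub>R e)) e \<partial>lborel)"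
    unfolding o_def by (simp only:)
qed

text \<open>The integral of \<open>\<phi>\<close> is invariant under translation, so its derivative along the translation
  vanishes.\<close>

lemma integral_test_derivative_zero:
  fixes \<phi> :: "'a::euclidean_space \<Rightarrow> real"
  assumes t: "\<phi> \<in> test_functions U"
  shows "(\<integral>x. frechet_derivative \<phi> (at x) e \<partial>lborel) = 0"
proof -
  obtain C where C: "compact C" "\<And>x. x \<notin> C \<Longrightarrow> \<phi> x = 0" using test_functions_support[OF t] by metis
  obtain M where M: "\<And>x. x \<in> C \<Longrightarrow> norm x \<le> M" using C(1) compact_imp_bounded bounded_iff by metis
  \<comment> \<open>The constant 1 is not integrable; the indicator of a ball that contains the supports of all the translates used replaces it.\<close>
  let ?I = "indicator (cball 0 (M + norm e)) :: 'a \<Rightarrow> real"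
  have I: "integrable lborel ?I"
    by (intro integrable_real_indicator) (auto simp: emeasure_lborel_cball_finite[unfolded infinity_ennreal_def])
  have c: "(\<integral>x. ?I x * \<phi> (x - h *\<^sub>R e) \<partial>lborel) = (\<integral>x. \<phi> x \<partial>lborel)" if h: "h \<in> {-1<..<1}" for h
  proof -
    have "?I x * \<phi> (x - h *\<^sub>R e) = \<phi> (x + - (h *\<^sub>R e))" for x
    proof (cases "x - h *\<^sub>R e \<in> C")
      case True
      have "norm x \<le> norm (x - h *\<^sub>R e) + norm (h *\<^sub>R e)" using norm_triangle_ineq[of "x - h *\<^sub>R e" "h *\<^sub>R e"] by simp
      also have "\<bar>h\<bar> * norm e \<le> 1 * norm e" using h by (intro mult_right_mono) auto
      then have "norm (x - h *\<^sub>R e) + norm (h *\<^sub>R e) \<le> M + 1 * norm e" using M[OF True] by simp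
      finally show ?thesis by simp
    qed (simp add: C(2))
    then have "(\<integral>x. ?I x * \<phi> (x - h *\<^sub>R e) \<partial>lborel) = (\<integral>x. \<phi> (x + - (h *\<^sub>R e)) \<partial>lborel)"
      by (simp only:)
    then show ?thesis using lborel_translate(2)[OF test_functions_borel[OF t], of "- (h *\<^sub>R e)"] by simp
  qed
  have "((\<lambda>h. \<integral>x. \<phi> x \<partial>lborel) has_real_derivative
     - (\<integral>x. ?I x * frechet_derivative \<phi> (at (x - 0 *\<^sub>R e)) e \<partial>lborel)) (at 0)"
    by (rule has_field_derivative_transform_within_open[OF translated_test_integral_DERIV[OF I t], where S = "{-1<..<1}"])
       (use c in auto)
  moreover have "((\<lambda>h. \<integral>x. \<phi> x \<partial>lborel) has_real_derivative 0) (at 0)" by simp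
  ultimately have "- (\<integral>x. ?I x * frechet_derivative \<phi> (at (x - 0 *\<^sub>R e)) e \<partial>lborel) = 0"
    by (rule DERIV_unique)
  then have "(\<integral>x. ?I x * frechet_derivative \<phi> (at (x - 0 *\<^sub>R e)) e \<partial>lborel) = 0"
    by linarith
  moreover have "?I x * frechet_derivative \<phi> (at (x - 0 *\<^sub>R e)) e = frechet_derivative \<phi> (at x) e" for x
  proof (cases "x \<in> C")
    case True
    then have "norm x \<le> M + norm e" using M[OF True] norm_ge_zero[of e] by linarith
    then show ?thesis by simp
  next
    case False
    then show ?thesis using test_functions_derivative_outside[OF t compact_imp_closed[OF C(1)] C(2)] by simp
  qed
  ultimately show ?thesis by (simp only:)
qed

text \<open>The product with a test function is again a test function, and the integral of its derivative
  vanishes; the product rule turns this into integration by parts.\<close>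

lemma has_weak_deriv_test:
  fixes \<phi> :: "'a::euclidean_space \<Rightarrow> real"
  assumes U: "open U" and t: "\<phi> \<in> test_functions V"
  shows "has_weak_deriv U e \<phi> (\<lambda>x. frechet_derivative \<phi> (at x) e)"
  unfolding has_weak_deriv_def
proof (intro conjI ballI)
  have li: "locally_integrable U \<theta>" if "\<theta> \<in> test_functions V" for \<theta>
    unfolding locally_integrable_def
  proof safe
    fix C assume "compact C" "C \<subseteq> U"
    then show "set_integrable lebesgue C \<theta>"
      using borel_integrable_compact[of C \<theta>] test_functions_continuous[OF that] test_functions_borel[OF that]
      by (simp add: set_integrable_def integrable_completion borel_compact)
  qed
  show "locally_integrable U \<phi>" "locally_integrable U (\<lambda>x. frechet_derivative \<phi> (at x) e)"
    using li t test_functions_derivative by auto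
  fix \<theta> assume th: "\<theta> \<in> test_functions U"
  define p where "p x = \<phi> x * frechet_derivative \<theta> (at x) e" for x
  define q where "q x = frechet_derivative \<phi> (at x) e * \<theta> x" for x
  obtain C where C: "compact C" "C \<subseteq> U" "\<And>x. x \<notin> C \<Longrightarrow> \<theta> x = 0"
    using test_functions_support[OF th] by blast
  have d: "frechet_derivative (\<lambda>x. \<phi> x * \<theta> x) (at x) e = p x + q x" for x
    using frechet_derivative_at[OF has_derivative_mult[OF test_functions_has_derivative[OF t] test_functions_has_derivative[OF th]], of x]
    by (simp add: p_def q_def fun_eq_iff)
  have pb: "p \<in> borel_measurable borel" "q \<in> borel_measurable borel"
    unfolding p_def[abs_def] q_def[abs_def]
    using test_functions_borel[OF t] test_functions_borel[OF th]
      test_functions_borel[OF test_functions_derivative[OF t, of e]]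
      test_functions_borel[OF test_functions_derivative[OF th, of e]]
    by (auto intro!: borel_measurable_times)
  have out: "x \<notin> U \<Longrightarrow> p x = 0" "x \<notin> U \<Longrightarrow> q x = 0" for x
    using C test_functions_derivative_outside[OF th compact_imp_closed[OF C(1)] C(3), of x e]
    by (auto simp: p_def q_def)
  have Ub: "U \<in> sets borel" using U by simp
  have "integrable (lebesgue_on U) p" "integrable (lebesgue_on U) q"
    unfolding p_def[abs_def] q_def[abs_def]
    using locally_integrable_mult_test[OF li[OF t] _ test_functions_derivative[OF th]]
      locally_integrable_mult_test[OF li[OF test_functions_derivative[OF t]] _ th] U by auto
  then have i: "integrable lborel p" "integrable lborel q"
    using borel_zero_outside(1)[OF Ub pb(1) out(1)] borel_zero_outside(1)[OF Ub pb(2) out(2)] by auto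
  have "(\<integral>x. p x + q x \<partial>lborel) = 0"
    using integral_test_derivative_zero[OF test_functions_mult[OF test_functions_mono[OF t subset_UNIV] test_functions_mono[OF th subset_UNIV]], of e]
    by (simp add: d)
  then have "integral\<^sup>L lborel p = - integral\<^sup>L lborel q" using i by simp
  then have "integral\<^sup>L (lebesgue_on U) p = - integral\<^sup>L (lebesgue_on U) q"
    using borel_zero_outside(2)[OF Ub pb(1) out(1)] borel_zero_outside(2)[OF Ub pb(2) out(2)] by simp
  then show "(LINT x|lebesgue_on U. \<phi> x * frechet_derivative \<theta> (at x) e) = - (LINT x|lebesgue_on U. frechet_derivative \<phi> (at x) e * \<theta> x)"
    by (simp add: p_def[abs_def] q_def[abs_def])
qed

lemma line_averages_integrable:
  fixes H :: "'a::euclidean_space \<Rightarrow> real"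
  assumes H: "integrable lborel H"
  shows "integrable (lborel \<Otimes>\<^sub>M lborel) (\<lambda>(t, x). indicator {0..1::real} t * H (x + t *\<^sub>R v))"
    and "integrable lborel (\<lambda>x. \<integral>t. indicator {0..1::real} t * H (x + t *\<^sub>R v) \<partial>lborel)"
proof -
  have [measurable]: "H \<in> borel_measurable borel" using H by auto
  show 1: "integrable (lborel \<Otimes>\<^sub>M lborel) (\<lambda>(t, x). indicator {0..1::real} t * H (x + t *\<^sub>R v))"
  proof (rule lborel_pair.Fubini_integrable)
    have "(\<integral>x. norm (case (t, x) of (t, x) \<Rightarrow> indicator {0..1::real} t * H (x + t *\<^sub>R v)) \<partial>lborel)
        = indicator {0..1} t * (\<integral>x. \<bar>H x\<bar> \<partial>lborel)" for t
      using lborel_translate(2)[of "\<lambda>x. \<bar>H x\<bar>" "t *\<^sub>R v"] by (simp add: abs_mult)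
    then show "integrable lborel (\<lambda>t. \<integral>x. norm (case (t, x) of (t, x) \<Rightarrow> indicator {0..1::real} t * H (x + t *\<^sub>R v)) \<partial>lborel)"
      by simp
    show "AE t in lborel. integrable lborel (\<lambda>x. case (t, x) of (t, x) \<Rightarrow> indicator {0..1::real} t * H (x + t *\<^sub>R v))"
      using lborel_translate(1)[of H] H by (intro AE_I2) simp
  qed measurable
  from lborel_pair.integrable_snd[OF 1]
  show "integrable lborel (\<lambda>x. \<integral>t. indicator {0..1::real} t * H (x + t *\<^sub>R v) \<partial>lborel)" by simp
qed

text \<open>The fundamental theorem of calculus for weak derivatives: test against \<open>\<theta>\<close>, move the translations to
  \<open>\<theta>\<close>, and differentiate there. The segments from \<open>V\<close> in direction \<open>v\<close> stay in a compact set \<open>K\<close>, so the integrable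
  extensions \<open>F\<close> and \<open>H\<close> of \<open>f\<close> and \<open>g\<close> from \<open>K\<close> to the whole space may replace them.\<close>

lemma weak_deriv_increment:
  fixes f g F H :: "'a::euclidean_space \<Rightarrow> real"
  assumes U: "open U" and wd: "has_weak_deriv U v f g" and V: "open V" and K: "compact K" "K \<subseteq> U"
    and VK: "\<And>x s. x \<in> V \<Longrightarrow> s \<in> {0..1} \<Longrightarrow> x + s *\<^sub>R v \<in> K"
    and F: "integrable lborel F" "AE x in lborel. x \<in> K \<longrightarrow> f x = F x"
    and H: "integrable lborel H" "AE x in lborel. x \<in> K \<longrightarrow> g x = H x"
  shows "AE x in lebesgue_on V. F (x + v) - F x = (\<integral>t. indicator {0..1} t * H (x + t *\<^sub>R v) \<partial>lborel)"
proof -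
  define A where "A x = (\<integral>t. indicator {0..1} t * H (x + t *\<^sub>R v) \<partial>lborel)" for x
  define Z where "Z x = F (x + v) - F x - A x" for x
  have [measurable]: "F \<in> borel_measurable borel" "H \<in> borel_measurable borel" using F H by auto
  have Ai: "integrable lborel A" unfolding A_def[abs_def] by (rule line_averages_integrable[OF H(1)])
  have Fi: "integrable lborel (\<lambda>x. F (x + v))" using lborel_translate(1)[of F] F by simp
  have Zi: "integrable lborel Z" unfolding Z_def[abs_def] using F Fi Ai by auto
  have Zm [measurable]: "Z \<in> borel_measurable borel" "A \<in> borel_measurable borel" using Zi Ai by auto
  have Vb: "V \<in> sets borel" and Ub: "U \<in> sets borel" using U V by auto
  have "AE x in lebesgue_on V. Z x = 0"
  proof (rule fundamental_lemma[OF V])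
    have "integrable lebesgue Z" using Zi integrable_completion[of Z lborel] Zm by simp
    then have "integrable (lebesgue_on V) Z"
      using V integrable_subset_lebesgue_on[of UNIV Z V] by (simp add: lebesgue_on_UNIV_eq)
    then show "locally_integrable V Z" using V by (auto intro: integrable_imp_locally_integrable)
    fix \<theta> assume th: "\<theta> \<in> test_functions V"
    have [measurable]: "\<theta> \<in> borel_measurable borel" by (rule test_functions_borel[OF th])
    obtain C where C: "compact C" "C \<subseteq> V" "\<And>x. x \<notin> C \<Longrightarrow> \<theta> x = 0"
      using test_functions_support[OF th] by blast
    define J where "J h = (\<integral>x. F x * \<theta> (x - h *\<^sub>R v) \<partial>lborel)" for h
    define I where "I h = (\<integral>x. H x * \<theta> (x - h *\<^sub>R v) \<partial>lborel)" for h
    \<comment> \<open>The translate of \<open>\<theta>\<close> by \<open>s v\<close> is supported in \<open>K\<close>, hence admissible in the weak derivative of \<open>f\<close>.\<close>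
    have Jd: "(J has_real_derivative I s) (at s)" if s: "s \<in> {0..1}" for s
    proof -
      define ths where "ths x = \<theta> (x - s *\<^sub>R v)" for x
      have supp: "ths x = 0" if "x \<notin> K" for x
        using VK[of "x - s *\<^sub>R v" s] s that C by (auto simp: ths_def)
      have t: "ths \<in> test_functions U"
        using test_functions_translate[OF th K, of "- (s *\<^sub>R v)"] supp by (auto simp: ths_def[abs_def])
      have fd: "frechet_derivative ths (at x) v = frechet_derivative \<theta> (at (x - s *\<^sub>R v)) v" for x
      proof -
        have "((\<lambda>x. x - s *\<^sub>R v) has_derivative (\<lambda>h. h)) (at x)" by (auto intro!: derivative_eq_intros)
        from diff_chain_at[OF this test_functions_has_derivative[OF th]]
        have "(ths has_derivative (\<lambda>h. frechet_derivative \<theta> (at (x - s *\<^sub>R v)) h)) (at x)"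
          by (simp add: o_def ths_def[abs_def])
        from frechet_derivative_at[OF this] show ?thesis by metis
      qed
      have suppd: "frechet_derivative ths (at x) v = 0" if "x \<notin> K" for x
        using test_functions_derivative_outside[OF t compact_imp_closed[OF K(1)] supp that] .
      have conv: "integral\<^sup>L (lebesgue_on U) (\<lambda>x. p x * q x) = (\<integral>x. P x * q x \<partial>lborel)"
        if q: "q \<in> test_functions U" "\<And>x. x \<notin> K \<Longrightarrow> q x = 0" and P: "P \<in> borel_measurable borel"
          "AE x in lborel. x \<in> K \<longrightarrow> p x = P x" for p P q
      proof -
        have "AE x in lebesgue_on U. P x * q x = p x * q x"
          unfolding AE_lebesgue_on_iff[OF open_sets_lebesgue[OF U]] using P(2)
          by (elim eventually_mono) (metis q(2) mult_zero_right)
        from integral_lebesgue_on_cong_AE[OF this open_sets_lebesgue[OF U]]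
        have "integral\<^sup>L (lebesgue_on U) (\<lambda>x. p x * q x) = integral\<^sup>L (lebesgue_on U) (\<lambda>x. P x * q x)" .
        also have "\<dots> = (\<integral>x. P x * q x \<partial>lborel)"
          using q K(2) P(1) test_functions_borel[OF q(1)] by (intro borel_zero_outside(2)[OF Ub]) auto
        finally show ?thesis .
      qed
      have "(\<integral>x. F x * frechet_derivative ths (at x) v \<partial>lborel) = integral\<^sup>L (lebesgue_on U) (\<lambda>x. f x * frechet_derivative ths (at x) v)"
        using conv[OF test_functions_derivative[OF t, of v] suppd _ F(2)] by simp
      also have "\<dots> = - integral\<^sup>L (lebesgue_on U) (\<lambda>x. g x * ths x)"
        using wd t by (simp add: has_weak_deriv_def)
      also have "integral\<^sup>L (lebesgue_on U) (\<lambda>x. g x * ths x) = I s"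
        using conv[OF t supp _ H(2)] by (simp add: I_def ths_def)
      finally have "- (\<integral>x. F x * frechet_derivative \<theta> (at (x - s *\<^sub>R v)) v \<partial>lborel) = I s" by (simp add: fd)
      then show ?thesis
        using translated_test_integral_DERIV[OF F(1) th, of v s] by (simp add: J_def[abs_def])
    qed
    have Ic: "isCont I s" for s
      unfolding I_def[abs_def] using translated_test_integral_DERIV[OF H(1) th, of v s] DERIV_isCont by blast
    have "(\<integral>t. I t * indicator {0..1} t \<partial>lborel) = J 1 - J 0"
      by (rule integral_FTC_Icc_real) (use Jd Ic in auto)
    moreover have "(\<integral>t. I t * indicator {0..1} t \<partial>lborel) = (\<integral>x. A x * \<theta> x \<partial>lborel)"
    proof -
      obtain B where B: "B \<ge> 0" "\<And>x. \<bar>\<theta> x\<bar> \<le> B" using test_functions_bounded[OF th] by blast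
      have i: "integrable (lborel \<Otimes>\<^sub>M lborel) (\<lambda>(t, x). indicator {0..1::real} t * H (x + t *\<^sub>R v) * \<theta> x)"
      proof (rule Bochner_Integration.integrable_bound)
        show "integrable (lborel \<Otimes>\<^sub>M lborel) (\<lambda>z. B * (case z of (t, x) \<Rightarrow> indicator {0..1::real} t * H (x + t *\<^sub>R v)))"
          using line_averages_integrable(1)[OF H(1)] by (rule integrable_mult_right)
        show "AE z in lborel \<Otimes>\<^sub>M lborel. norm (case z of (t, x) \<Rightarrow> indicator {0..1::real} t * H (x + t *\<^sub>R v) * \<theta> x)
           \<le> norm (B * (case z of (t, x) \<Rightarrow> indicator {0..1::real} t * H (x + t *\<^sub>R v)))"
        proof (rule AE_I2, safe)
          fix t x
          have "\<bar>\<theta> x\<bar> * \<bar>indicator {0..1} t * H (x + t *\<^sub>R v)\<bar> \<le> B * \<bar>indicator {0..1} t * H (x + t *\<^sub>R v)\<bar>"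
            using B(2) by (intro mult_right_mono) auto
          then show "norm (indicator {0..1} t * H (x + t *\<^sub>R v) * \<theta> x) \<le> norm (B * (indicator {0..1} t * H (x + t *\<^sub>R v)))"
            using B(1) by (simp add: abs_mult mult_ac)
        qed
      qed measurable
      have "I t * indicator {0..1} t = (\<integral>x. indicator {0..1} t * H (x + t *\<^sub>R v) * \<theta> x \<partial>lborel)" for t
        using lborel_translate(2)[of "\<lambda>x. H x * \<theta> (x - t *\<^sub>R v)" "t *\<^sub>R v"] by (simp add: I_def mult.assoc)
      then have "(\<integral>t. I t * indicator {0..1} t \<partial>lborel) = (\<integral>t. \<integral>x. indicator {0..1} t * H (x + t *\<^sub>R v) * \<theta> x \<partial>lborel \<partial>lborel)"
        by simp
      also have "\<dots> = (\<integral>x. \<integral>t. indicator {0..1} t * H (x + t *\<^sub>R v) * \<theta> x \<partial>lborel \<partial>lborel)"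
        using lborel_pair.Fubini_integral[OF i] by simp
      also have "\<dots> = (\<integral>x. A x * \<theta> x \<partial>lborel)" by (simp add: A_def)
      finally show ?thesis .
    qed
    moreover have "J 1 = (\<integral>x. F (x + v) * \<theta> x \<partial>lborel)"
      using lborel_translate(2)[of "\<lambda>x. F x * \<theta> (x - v)" v] by (simp add: J_def)
    moreover have "J 0 = (\<integral>x. F x * \<theta> x \<partial>lborel)" by (simp add: J_def)
    moreover have "(\<integral>x. Z x * \<theta> x \<partial>lborel) = (\<integral>x. F (x + v) * \<theta> x \<partial>lborel) - (\<integral>x. F x * \<theta> x \<partial>lborel) - (\<integral>x. A x * \<theta> x \<partial>lborel)"
      using integrable_mult_test_translate[OF F(1) th, of 0] integrable_mult_test_translate[OF Fi th, of 0]
        integrable_mult_test_translate[OF Ai th, of 0] by (simp add: Z_def left_diff_distrib)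
    ultimately have "(\<integral>x. Z x * \<theta> x \<partial>lborel) = 0" by simp
    then show "integral\<^sup>L (lebesgue_on V) (\<lambda>x. Z x * \<theta> x) = 0"
      using C by (subst borel_zero_outside(2)[OF Vb]) auto
  qed
  then show ?thesis by (simp add: Z_def A_def)
qed

text \<open>An average over translations is close to \<open>H\<close> in the mean because each of the translations is.\<close>

lemma line_averages_tendsto_L1:
  fixes H :: "'a::euclidean_space \<Rightarrow> real"
  assumes H: "integrable lborel H" and h: "h \<longlonglongrightarrow> 0"
  shows "(\<lambda>n. \<integral>x. \<bar>(\<integral>t. indicator {0..1} t * H (x + t *\<^sub>R (h n *\<^sub>R e)) \<partial>lborel) - H x\<bar> \<partial>lborel) \<longlonglongrightarrow> 0"
proof -
  have [measurable]: "H \<in> borel_measurable borel" using H by auto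
  define \<omega> where "\<omega> n t = (\<integral>x. \<bar>H (x + t *\<^sub>R (h n *\<^sub>R e)) - H x\<bar> \<partial>lborel)" for n t
  have om: "\<omega> n \<in> borel_measurable borel" for n unfolding \<omega>_def[abs_def] by measurable
  have tr: "integrable lborel (\<lambda>x. H (x + c))" "(\<integral>x. \<bar>H (x + c)\<bar> \<partial>lborel) = (\<integral>x. \<bar>H x\<bar> \<partial>lborel)" for c
    using lborel_translate(1)[of H c] H lborel_translate(2)[of "\<lambda>x. \<bar>H x\<bar>" c] by auto
  have ob: "\<omega> n t \<le> 2 * (\<integral>x. \<bar>H x\<bar> \<partial>lborel)" "\<omega> n t \<ge> 0" for n t
  proof -
    have "\<omega> n t \<le> (\<integral>x. \<bar>H (x + t *\<^sub>R (h n *\<^sub>R e))\<bar> + \<bar>H x\<bar> \<partial>lborel)"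
      unfolding \<omega>_def using H tr(1) by (intro integral_mono) auto
    also have "\<dots> = 2 * (\<integral>x. \<bar>H x\<bar> \<partial>lborel)" using H tr by simp
    finally show "\<omega> n t \<le> 2 * (\<integral>x. \<bar>H x\<bar> \<partial>lborel)" .
  qed (simp add: \<omega>_def)
  have lim: "(\<lambda>n. \<integral>t. indicator {0..1} t * \<omega> n t \<partial>lborel) \<longlonglongrightarrow> (\<integral>t. 0 \<partial>(lborel::real measure))"
  proof (rule integral_dominated_convergence[where w = "\<lambda>t. indicator {0..1} t * (2 * (\<integral>x. \<bar>H x\<bar> \<partial>lborel))"])
    have "(\<lambda>n. t *\<^sub>R (h n *\<^sub>R e)) \<longlonglongrightarrow> t *\<^sub>R (0 *\<^sub>R e)" for t using h by (intro tendsto_intros)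
    then have "(\<lambda>n. \<omega> n t) \<longlonglongrightarrow> 0" for t
      unfolding \<omega>_def using L1_translation_continuous[OF H, of "\<lambda>n. t *\<^sub>R (h n *\<^sub>R e)"] by simp
    then have "(\<lambda>n. indicator {0..1} t * \<omega> n t) \<longlonglongrightarrow> indicator {0..1} t * 0" for t :: real by (intro tendsto_intros)
    then show "AE t in lborel. (\<lambda>n. indicator {0..1::real} t * \<omega> n t) \<longlonglongrightarrow> 0" by simp
    show "AE t in lborel. norm (indicator {0..1} t * \<omega> n t) \<le> indicator {0..1::real} t * (2 * (\<integral>x. \<bar>H x\<bar> \<partial>lborel))" for n
      using ob[of n] by (intro AE_I2) (auto simp: indicator_def)
  qed (use om in auto)
  show ?thesis
  proof (rule tendsto_sandwich[OF _ _ tendsto_const])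
    show "(\<lambda>n. \<integral>t. indicator {0..1} t * \<omega> n t \<partial>lborel) \<longlonglongrightarrow> 0" using lim by simp
    show "\<forall>\<^sub>F n in sequentially. (\<integral>x. \<bar>(\<integral>t. indicator {0..1} t * H (x + t *\<^sub>R (h n *\<^sub>R e)) \<partial>lborel) - H x\<bar> \<partial>lborel)
        \<le> (\<integral>t. indicator {0..1} t * \<omega> n t \<partial>lborel)"
    proof (rule always_eventually, rule allI)
      fix n
      let ?k = "\<lambda>t x. indicator {0..1::real} t * (H (x + t *\<^sub>R (h n *\<^sub>R e)) - H x)"
      have i1: "integrable (lborel \<Otimes>\<^sub>M lborel) (\<lambda>(t, x). indicator {0..1::real} t * H (x + t *\<^sub>R (h n *\<^sub>R e)))"
        by (rule line_averages_integrable(1)[OF H])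
      have i2: "integrable (lborel \<Otimes>\<^sub>M lborel) (\<lambda>(t, x). indicator {0..1::real} t * H x)"
        using line_averages_integrable(1)[OF H, of 0] by simp
      have i: "integrable (lborel \<Otimes>\<^sub>M lborel) (\<lambda>(t, x). ?k t x)"
        using Bochner_Integration.integrable_diff[OF i1 i2] by (simp add: case_prod_unfold right_diff_distrib)
      have ia: "integrable (lborel \<Otimes>\<^sub>M lborel) (\<lambda>(t, x). \<bar>?k t x\<bar>)"
        using integrable_abs[OF i] by (simp add: case_prod_unfold)
      have "AE x in lborel. \<bar>(\<integral>t. indicator {0..1} t * H (x + t *\<^sub>R (h n *\<^sub>R e)) \<partial>lborel) - H x\<bar> \<le> (\<integral>t. \<bar>?k t x\<bar> \<partial>lborel)"
        using lborel_pair.AE_integrable_snd[OF i] lborel_pair.AE_integrable_snd[OF i1]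
      proof eventually_elim
        case (elim x)
        have "H x = (\<integral>t. indicator {0..1::real} t * H x \<partial>lborel)" by simp
        then have "(\<integral>t. indicator {0..1} t * H (x + t *\<^sub>R (h n *\<^sub>R e)) \<partial>lborel) - H x
            = (\<integral>t. indicator {0..1} t * H (x + t *\<^sub>R (h n *\<^sub>R e)) \<partial>lborel) - (\<integral>t. indicator {0..1::real} t * H x \<partial>lborel)"
          by simp
        also have "\<dots> = (\<integral>t. ?k t x \<partial>lborel)" using elim by (simp add: right_diff_distrib)
        finally show ?case by simp
      qed
      then have "(\<integral>x. \<bar>(\<integral>t. indicator {0..1} t * H (x + t *\<^sub>R (h n *\<^sub>R e)) \<partial>lborel) - H x\<bar> \<partial>lborel)
          \<le> (\<integral>x. \<integral>t. \<bar>?k t x\<bar> \<partial>lborel \<partial>lborel)"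
        using lborel_pair.integrable_snd[OF ia]
          Bochner_Integration.integrable_diff[OF line_averages_integrable(2)[OF H, of "h n *\<^sub>R e"] H]
        by (intro integral_mono_AE) (auto intro: integrable_abs)
      also have "\<dots> = (\<integral>t. \<integral>x. \<bar>?k t x\<bar> \<partial>lborel \<partial>lborel)"
        using lborel_pair.Fubini_integral[OF ia] by simp
      also have "\<dots> = (\<integral>t. indicator {0..1} t * \<omega> n t \<partial>lborel)"
        by (simp add: \<omega>_def abs_mult)
      finally show "(\<integral>x. \<bar>(\<integral>t. indicator {0..1} t * H (x + t *\<^sub>R (h n *\<^sub>R e)) \<partial>lborel) - H x\<bar> \<partial>lborel)
        \<le> (\<integral>t. indicator {0..1} t * \<omega> n t \<partial>lborel)" .
    qed
  qed simp
qed

section \<open>The chain rule for weak derivatives\<close>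

lemma has_weak_deriv_scale_direction:
  assumes "has_weak_deriv U e f g"
  shows "has_weak_deriv U (c *\<^sub>R e) f (\<lambda>x. c * g x)"
  unfolding has_weak_deriv_def
proof (intro conjI ballI)
  show "locally_integrable U f" "locally_integrable U (\<lambda>x. c * g x)"
    using has_weak_deriv_locally_integrable[OF assms] locally_integrable_lincomb[of U g f c 0] by auto
  fix \<phi> assume t: "\<phi> \<in> test_functions U"
  have "frechet_derivative \<phi> (at x) (c *\<^sub>R e) = c * frechet_derivative \<phi> (at x) e" for x
    using has_derivative_linear[OF test_functions_has_derivative[OF t]] linear_scale by fastforce
  then show "(LINT x|lebesgue_on U. f x * frechet_derivative \<phi> (at x) (c *\<^sub>R e)) = - (LINT x|lebesgue_on U. c * g x * \<phi> x)"
    using assms t by (simp add: has_weak_deriv_def mult.left_commute mult.assoc)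
qed

lemma Lipschitz_if_bounded_derivative:
  fixes G :: "real \<Rightarrow> real"
  assumes "\<And>y. (G has_real_derivative G' y) (at y)" "\<And>y. \<bar>G' y\<bar> \<le> L"
  shows "\<bar>G a - G b\<bar> \<le> L * \<bar>a - b\<bar>"
  using field_differentiable_bound[of UNIV G G' L a b] assms by simp

text \<open>The continuation to the diagonal makes \<open>G b - G a\<close> the slope times \<open>b - a\<close> without exception and
  keeps the slope continuous in \<open>b\<close> at \<open>a\<close>.\<close>

definition slope :: "(real \<Rightarrow> real) \<Rightarrow> (real \<Rightarrow> real) \<Rightarrow> real \<Rightarrow> real \<Rightarrow> real" where
  "slope G G' a b = (if b = a then G' a else (G b - G a) / (b - a))"

lemma slope_bound:
  assumes "\<And>y. (G has_real_derivative G' y) (at y)" "\<And>y. \<bar>G' y\<bar> \<le> L"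
  shows "\<bar>slope G G' a b\<bar> \<le> L"
  using Lipschitz_if_bounded_derivative[OF assms, of b a] assms(2)[of a]
  by (auto simp: slope_def abs_divide divide_le_eq)

lemma slope_tendsto:
  assumes "(G has_real_derivative G' a) (at a)" "b \<longlonglongrightarrow> a"
  shows "(\<lambda>n. slope G G' a (b n)) \<longlonglongrightarrow> G' a"
proof -
  have "((\<lambda>y. (G y - G a) / (y - a)) \<longlongrightarrow> G' a) (at a)"
    using assms(1) by (simp add: has_field_derivative_iff)
  then have "(slope G G' a \<longlongrightarrow> G' a) (at a)"
    by (rule Lim_transform_eventually) (auto simp: slope_def eventually_at_filter)
  then have "isCont (slope G G' a) a" by (simp add: isCont_def slope_def)
  from isCont_tendsto_compose[OF this assms(2)] show ?thesis by (simp add: slope_def)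
qed

text \<open>The difference quotient of \<open>G \<circ> f\<close> is a slope of \<open>G\<close> times an average of the
  derivative of \<open>f\<close> along a short segment. The slopes are bounded and converge almost everywhere,
  the averages converge in the mean.\<close>

lemma has_weak_deriv_chain:
  fixes f g :: "'a::euclidean_space \<Rightarrow> real"
  assumes U: "open U" and wd: "has_weak_deriv U e f g"
    and G: "\<And>y. (G has_real_derivative G' y) (at y)" and G'c: "continuous_on UNIV G'"
    and L: "\<And>y. \<bar>G' y\<bar> \<le> L"
  shows "has_weak_deriv U e (\<lambda>x. G (f x)) (\<lambda>x. G' (f x) * g x)"
proof -
  have L0: "L \<ge> 0" using L[of 0] by linarith
  have Gc: "continuous_on UNIV G" using G DERIV_isCont by (auto simp: continuous_on_eq_continuous_at)
  note Gm [measurable] = borel_measurable_continuous_onI[OF Gc]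
  note G'm [measurable] = borel_measurable_continuous_onI[OF G'c]
  have Glip: "\<bar>G y - G 0\<bar> \<le> L * \<bar>y\<bar>" for y
    using Lipschitz_if_bounded_derivative[of G G' L y 0] G L by simp
  note li = has_weak_deriv_locally_integrable[OF wd]
  have li1: "locally_integrable U (\<lambda>x. G (f x))" "locally_integrable U (\<lambda>x. G' (f x) * g x)"
    unfolding locally_integrable_def
  proof safe
    fix C assume C: "compact C" "C \<subseteq> U"
    have Cl: "C \<in> sets lebesgue" using C(1) by (simp add: compact_imp_closed)
    interpret finite_measure "lebesgue_on C"
      using C(1) by (intro finite_measure_lebesgue_on lmeasurable_compact)
    have fi: "integrable (lebesgue_on C) f" "integrable (lebesgue_on C) g"
      using li C by (auto simp: locally_integrable_def set_integrable_lebesgue_iff[OF Cl])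
    then have [measurable]: "f \<in> borel_measurable (lebesgue_on C)" "g \<in> borel_measurable (lebesgue_on C)" by auto
    have "integrable (lebesgue_on C) (\<lambda>x. G (f x))"
    proof (rule Bochner_Integration.integrable_bound)
      show "integrable (lebesgue_on C) (\<lambda>x. \<bar>G 0\<bar> + L * \<bar>f x\<bar>)" using fi by auto
      have "\<bar>G y\<bar> \<le> \<bar>G 0\<bar> + L * \<bar>y\<bar>" for y using Glip[of y] by linarith
      then show "AE x in lebesgue_on C. norm (G (f x)) \<le> norm (\<bar>G 0\<bar> + L * \<bar>f x\<bar>)"
        by (intro AE_I2) (smt (verit) real_norm_def)
    qed measurable
    moreover have "integrable (lebesgue_on C) (\<lambda>x. G' (f x) * g x)"
    proof (rule Bochner_Integration.integrable_bound)
      show "integrable (lebesgue_on C) (\<lambda>x. L * g x)" using fi by auto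
      show "AE x in lebesgue_on C. norm (G' (f x) * g x) \<le> norm (L * g x)"
        using L L0 by (intro AE_I2) (auto simp: abs_mult intro: mult_right_mono)
    qed measurable
    ultimately show "set_integrable lebesgue C (\<lambda>x. G (f x))" "set_integrable lebesgue C (\<lambda>x. G' (f x) * g x)"
      by (auto simp: set_integrable_lebesgue_iff[OF Cl])
  qed
  show ?thesis
    unfolding has_weak_deriv_def
  proof (intro conjI ballI)
    fix \<phi> assume t: "\<phi> \<in> test_functions U"
    obtain C where C: "compact C" "C \<subseteq> U" "\<And>x. x \<notin> C \<Longrightarrow> \<phi> x = 0"
      using test_functions_support[OF t] by blast
    obtain r where r: "r > 0" "(\<Union>x\<in>C. ball x (3 * r)) \<subseteq> U"
    proof -
      obtain \<epsilon> where "\<epsilon> > 0" "(\<Union>x\<in>C. ball x \<epsilon>) \<subseteq> U"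
        using compact_subset_open_imp_ball_epsilon_subset[OF C(1) U C(2)] by blast
      then show ?thesis using that[of "\<epsilon>/3"] by simp
    qed
    define V where "V = (\<Union>x\<in>C. ball x r)"
    define K where "K = {x + y | x y. x \<in> C \<and> y \<in> cball 0 (2 * r)}"
    have V: "open V" "C \<subseteq> V" using r by (auto simp: V_def)
    have K: "compact K" unfolding K_def using C(1) by (intro compact_sums) auto
    have KU: "K \<subseteq> U"
    proof
      fix z assume "z \<in> K"
      then obtain x y where "z = x + y" "x \<in> C" "norm y \<le> 2 * r" by (auto simp: K_def)
      then have "z \<in> ball x (3 * r)" using r(1) by (simp add: dist_norm)
      then show "z \<in> U" using r(2) \<open>x \<in> C\<close> by blast
    qed
    have VK: "x + w \<in> K" if xV: "x \<in> V" and wr: "norm w \<le> r" for x w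
    proof -
      obtain c where c: "c \<in> C" "dist c x < r" using xV by (auto simp: V_def)
      have "norm ((x - c) + w) \<le> norm (x - c) + norm w" by (rule norm_triangle_ineq)
      also have "\<dots> \<le> 2 * r" using c(2) wr by (simp add: dist_norm norm_minus_commute)
      finally have "(x - c) + w \<in> cball 0 (2 * r)" by simp
      moreover have "x + w = c + ((x - c) + w)" by simp
      ultimately show ?thesis using c(1) unfolding K_def by blast
    qed
    have Kl: "K \<in> sets lebesgue" and Kb: "K \<in> sets borel" using K by (auto simp: compact_imp_closed)
    have "integrable (lebesgue_on K) f" "integrable (lebesgue_on K) g"
      using li K KU by (auto simp: locally_integrable_def set_integrable_lebesgue_iff[OF Kl])
    then obtain F H where F: "F \<in> borel_measurable borel" "AE x in lebesgue_on K. f x = F x" "integrable lborel F"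
      and H: "H \<in> borel_measurable borel" "AE x in lebesgue_on K. g x = H x" "integrable lborel H"
      by (metis integrable_borel_representative[OF Kb])
    note [measurable] = F(1) H(1)
    have fF: "AE x in lborel. x \<in> K \<longrightarrow> f x = F x" and gH: "AE x in lborel. x \<in> K \<longrightarrow> g x = H x"
      using F(2) H(2) by (auto simp: AE_lebesgue_on_iff[OF Kl])
    \<comment> \<open>The steps are so short that the segments from \<open>V\<close> stay in \<open>K\<close>.\<close>
    define h0 where "h0 = r / (1 + norm e)"
    have h0: "h0 > 0" "h0 * norm e \<le> r"
      using r(1) norm_ge_zero[of e] by (auto simp: h0_def field_simps add_pos_nonneg)
    define h where "h n = h0 / real (Suc n)" for n
    have h_pos: "h n > 0" and h_le: "h n \<le> h0" for n
      using h0(1) by (auto simp: h_def divide_le_eq)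
    have h_lim: "h \<longlonglongrightarrow> 0" unfolding h_def by (rule lim_const_over_n[THEN LIMSEQ_Suc])
    define A where "A n x = (\<integral>t. indicator {0..1} t * H (x + t *\<^sub>R (h n *\<^sub>R e)) \<partial>lborel)" for n x
    have Ai: "integrable lborel (A n)" for n
      unfolding A_def[abs_def] by (rule line_averages_integrable(2)[OF H(3)])
    have [measurable]: "A n \<in> borel_measurable borel" for n using Ai[of n] by auto
    have inc: "AE x in lborel. x \<in> V \<longrightarrow> F (x + h n *\<^sub>R e) - F x = h n * A n x" for n
    proof -
      have "AE x in lebesgue_on V. F (x + h n *\<^sub>R e) - F x
          = (\<integral>t. indicator {0..1} t * (h n * H (x + t *\<^sub>R (h n *\<^sub>R e))) \<partial>lborel)"
      proof (rule weak_deriv_increment[OF U has_weak_deriv_scale_direction[OF wd] V(1) K KU _ F(3) fF])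
        show "x + s *\<^sub>R h n *\<^sub>R e \<in> K" if "x \<in> V" "s \<in> {0..1}" for x s
        proof (rule VK[OF that(1)])
          have "norm (s *\<^sub>R h n *\<^sub>R e) = s * (h n * norm e)" using that(2) h_pos[of n] by simp
          also have "\<dots> \<le> 1 * (h0 * norm e)"
            using that(2) h_pos[of n] h_le[of n] by (intro mult_mono) auto
          finally show "norm (s *\<^sub>R h n *\<^sub>R e) \<le> r" using h0(2) by simp
        qed
        show "integrable lborel (\<lambda>x. h n * H x)" using H(3) by simp
        show "AE x in lborel. x \<in> K \<longrightarrow> h n * g x = h n * H x" using gH by (elim eventually_mono) auto
      qed
      then have "AE x in lebesgue_on V. F (x + h n *\<^sub>R e) - F x = h n * A n x"
        by (simp add: A_def mult.left_commute[of _ "h n"])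
      then show ?thesis using V(1) by (simp add: AE_lebesgue_on_iff)
    qed
    \<comment> \<open>Without the constant \<open>G 0\<close> the composition is integrable over the whole space; constants do not contribute to the derivative.\<close>
    define P where "P x = G (F x) - G 0" for x
    have [measurable]: "P \<in> borel_measurable borel" unfolding P_def[abs_def] by measurable
    have Pi: "integrable lborel P"
    proof (rule Bochner_Integration.integrable_bound)
      show "integrable lborel (\<lambda>x. L * F x)" using F(3) by simp
      show "AE x in lborel. norm (P x) \<le> norm (L * F x)"
        using Glip L0 by (intro AE_I2) (simp add: P_def abs_mult)
    qed measurable
    have [measurable]: "\<phi> \<in> borel_measurable borel" by (rule test_functions_borel[OF t])
    obtain B where B: "B \<ge> 0" "\<And>x. \<bar>\<phi> x\<bar> \<le> B" using test_functions_bounded[OF t] by blast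
    define m where "m n x = slope G G' (F x) (F (x + h n *\<^sub>R e))" for n x
    have m_le: "\<bar>m n x\<bar> \<le> L" for n x unfolding m_def by (rule slope_bound[OF G L])
    have [measurable]: "m n \<in> borel_measurable borel" for n
      unfolding m_def[abs_def] slope_def by measurable
    define Q where "Q n = (\<integral>x. \<phi> x * (m n x * A n x) \<partial>lborel)" for n
    have Q_lim: "Q \<longlonglongrightarrow> - (\<integral>x. P x * frechet_derivative \<phi> (at x) e \<partial>lborel)"
    proof -
      let ?J = "\<lambda>k. \<integral>x. P x * \<phi> (x - k *\<^sub>R e) \<partial>lborel"
      have "(\<lambda>n. (?J (0 + h n) - ?J 0) / h n) \<longlonglongrightarrow> - (\<integral>x. P x * frechet_derivative \<phi> (at (x - 0 *\<^sub>R e)) e \<partial>lborel)"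
        using translated_test_integral_DERIV[OF Pi t, of e 0] h_lim h_pos
        unfolding DERIV_def tendsto_at_iff_sequentially o_def
        by (metis (no_types, lifting) DiffI UNIV_I less_irrefl singletonD)
      moreover have "(?J (0 + h n) - ?J 0) / h n = Q n" for n
      proof -
        have Pt: "integrable lborel (\<lambda>x. P (x + h n *\<^sub>R e))" using lborel_translate(1)[of P] Pi by simp
        have "?J (0 + h n) = (\<integral>x. P (x + h n *\<^sub>R e) * \<phi> x \<partial>lborel)"
          using lborel_translate(2)[of "\<lambda>x. P x * \<phi> (x - h n *\<^sub>R e)" "h n *\<^sub>R e"] by simp
        then have "(?J (0 + h n) - ?J 0) / h n = (\<integral>x. (P (x + h n *\<^sub>R e) * \<phi> x - P x * \<phi> x) / h n \<partial>lborel)"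
          using integrable_mult_test_translate[OF Pt t, of 0] integrable_mult_test_translate[OF Pi t, of 0] by simp
        also have "\<dots> = Q n"
          unfolding Q_def
        proof (rule integral_cong_AE)
          show "AE x in lborel. (P (x + h n *\<^sub>R e) * \<phi> x - P x * \<phi> x) / h n = \<phi> x * (m n x * A n x)"
            using inc[of n]
          proof eventually_elim
            case (elim x)
            show ?case
            proof (cases "x \<in> V")
              case True
              then have i: "F (x + h n *\<^sub>R e) - F x = h n * A n x" using elim by simp
              have "P (x + h n *\<^sub>R e) - P x = m n x * (F (x + h n *\<^sub>R e) - F x)"
                by (auto simp: P_def m_def slope_def)
              then show ?thesis using h_pos[of n] unfolding i
                by (simp add: field_simps)
            next
              case False
              then have "\<phi> x = 0" using V(2) C(3) by blast
              then show ?thesis by simp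
            qed
          qed
        qed measurable
        finally show ?thesis .
      qed
      ultimately show ?thesis by simp
    qed
    have Ftr: "(\<lambda>n. \<integral>x. norm (F (x + h n *\<^sub>R e) - F x) \<partial>lborel) \<longlonglongrightarrow> 0"
    proof -
      have "(\<lambda>n. h n *\<^sub>R e) \<longlonglongrightarrow> 0 *\<^sub>R e" using h_lim by (intro tendsto_intros)
      then show ?thesis using L1_translation_continuous[OF F(3), of "\<lambda>n. h n *\<^sub>R e"] by simp
    qed
    have Fd: "integrable lborel (\<lambda>x. F (x + h n *\<^sub>R e) - F x)" for n
      using lborel_translate(1)[OF F(1), of "h n *\<^sub>R e"] F(3) by auto
    obtain k where k: "strict_mono k" "AE x in lborel. (\<lambda>n. F (x + h (k n) *\<^sub>R e) - F x) \<longlonglongrightarrow> 0"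
      using tendsto_L1_AE_subseq[OF Fd Ftr] by blast
    have A_lim: "(\<lambda>n. \<integral>x. \<bar>A (k n) x - H x\<bar> \<partial>lborel) \<longlonglongrightarrow> 0"
      using LIMSEQ_subseq_LIMSEQ[OF line_averages_tendsto_L1[OF H(3) h_lim, of e] k(1)]
      by (simp add: A_def o_def)
    have bdi: "integrable lborel (\<lambda>x. \<phi> x * (q x * R x))"
      if "integrable lborel R" "q \<in> borel_measurable borel" "\<And>x. \<bar>q x\<bar> \<le> c" for q R c
    proof (rule Bochner_Integration.integrable_bound)
      have c: "c \<ge> 0" using that(3)[of 0] by linarith
      show "integrable lborel (\<lambda>x. B * (c * R x))" using that(1) by simp
      show "AE x in lborel. norm (\<phi> x * (q x * R x)) \<le> norm (B * (c * R x))"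
        using B that(3) c by (intro AE_I2) (auto simp: abs_mult intro!: mult_mono)
    qed (use that in measurable)
    have mH: "(\<lambda>n. \<integral>x. \<phi> x * (m (k n) x * H x) \<partial>lborel) \<longlonglongrightarrow> (\<integral>x. \<phi> x * (G' (F x) * H x) \<partial>lborel)"
    proof (rule integral_dominated_convergence[where w = "\<lambda>x. \<bar>B * (L * H x)\<bar>"])
      show "AE x in lborel. (\<lambda>n. \<phi> x * (m (k n) x * H x)) \<longlonglongrightarrow> \<phi> x * (G' (F x) * H x)"
        using k(2)
      proof eventually_elim
        case (elim x)
        then have "(\<lambda>n. F (x + h (k n) *\<^sub>R e)) \<longlonglongrightarrow> F x" using LIM_zero_cancel by fastforce
        then have "(\<lambda>n. m (k n) x) \<longlonglongrightarrow> G' (F x)" unfolding m_def by (rule slope_tendsto[OF G])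
        then show ?case by (intro tendsto_intros)
      qed
      show "AE x in lborel. norm (\<phi> x * (m (k n) x * H x)) \<le> \<bar>B * (L * H x)\<bar>" for n
        using B m_le L0 by (intro AE_I2) (auto simp: abs_mult intro!: mult_mono)
      show "integrable lborel (\<lambda>x. \<bar>B * (L * H x)\<bar>)" using H(3) by auto
    qed measurable
    have "(\<lambda>n. Q (k n) - (\<integral>x. \<phi> x * (m (k n) x * H x) \<partial>lborel)) \<longlonglongrightarrow> 0"
    proof (rule tendsto_0_le[OF A_lim, where K = "B * L"], rule always_eventually, rule allI)
      fix n
      have AH: "integrable lborel (\<lambda>x. A (k n) x - H x)" using Ai H(3) by auto
      have "Q (k n) - (\<integral>x. \<phi> x * (m (k n) x * H x) \<partial>lborel) = (\<integral>x. \<phi> x * (m (k n) x * (A (k n) x - H x)) \<partial>lborel)"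
        unfolding Q_def using bdi[OF Ai[of "k n"] _ m_le[of "k n"]] bdi[OF H(3) _ m_le[of "k n"]]
        by (simp add: right_diff_distrib)
      also have "\<bar>\<dots>\<bar> \<le> (\<integral>x. \<bar>\<phi> x * (m (k n) x * (A (k n) x - H x))\<bar> \<partial>lborel)" by (rule integral_abs_bound)
      also have "\<dots> \<le> (\<integral>x. B * L * \<bar>A (k n) x - H x\<bar> \<partial>lborel)"
      proof (rule integral_mono)
        show "integrable lborel (\<lambda>x. \<bar>\<phi> x * (m (k n) x * (A (k n) x - H x))\<bar>)"
          using bdi[OF AH _ m_le[of "k n"]] by auto
        show "\<bar>\<phi> x * (m (k n) x * (A (k n) x - H x))\<bar> \<le> B * L * \<bar>A (k n) x - H x\<bar>" for x
          unfolding abs_mult mult.assoc using B m_le L0 by (intro mult_mono) auto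
      qed (use AH in auto)
      finally show "norm (Q (k n) - (\<integral>x. \<phi> x * (m (k n) x * H x) \<partial>lborel)) \<le> norm (\<integral>x. \<bar>A (k n) x - H x\<bar> \<partial>lborel) * (B * L)"
        by (simp add: mult.commute)
    qed
    from tendsto_add[OF this mH] have "(\<lambda>n. Q (k n)) \<longlonglongrightarrow> (\<integral>x. \<phi> x * (G' (F x) * H x) \<partial>lborel)" by simp
    moreover have "(\<lambda>n. Q (k n)) \<longlonglongrightarrow> - (\<integral>x. P x * frechet_derivative \<phi> (at x) e \<partial>lborel)"
      using LIMSEQ_subseq_LIMSEQ[OF Q_lim k(1)] by (simp add: o_def)
    ultimately have main: "(\<integral>x. P x * frechet_derivative \<phi> (at x) e \<partial>lborel) = - (\<integral>x. \<phi> x * (G' (F x) * H x) \<partial>lborel)"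
      using LIMSEQ_unique by fastforce
    have CK: "x \<in> K" if "x \<in> C" for x using VK[of x 0] V(2) that r(1) by auto
    note Ub = open_sets_lebesgue[OF U]
    have UB: "U \<in> sets borel" using U by simp
    define D where "D x = frechet_derivative \<phi> (at x) e" for x
    have D: "D \<in> test_functions U" unfolding D_def[abs_def] by (rule test_functions_derivative[OF t])
    have [measurable]: "D \<in> borel_measurable borel" by (rule test_functions_borel[OF D])
    have D0: "D x = 0" if "x \<notin> C" for x
      unfolding D_def using test_functions_derivative_outside[OF t compact_imp_closed[OF C(1)] C(3) that] .
    have "integral\<^sup>L (lebesgue_on U) (\<lambda>x. G (f x) * D x) = integral\<^sup>L (lebesgue_on U) (\<lambda>x. G (F x) * D x)"
    proof (rule integral_lebesgue_on_cong_AE[OF _ Ub])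
      show "AE x in lebesgue_on U. G (F x) * D x = G (f x) * D x"
        unfolding AE_lebesgue_on_iff[OF Ub] using fF by (elim eventually_mono) (metis D0 CK mult_zero_right)
    qed
    also have "\<dots> = (\<integral>x. G (F x) * D x \<partial>lborel)"
      using D0 C(2) by (intro borel_zero_outside(2)[OF UB]) auto
    also have "\<dots> = (\<integral>x. P x * D x + G 0 * D x \<partial>lborel)" by (simp add: P_def algebra_simps)
    also have "\<dots> = (\<integral>x. P x * D x \<partial>lborel) + G 0 * (\<integral>x. D x \<partial>lborel)"
    proof -
      have "locally_integrable U D"
        using has_weak_deriv_locally_integrable(2)[OF has_weak_deriv_test[OF U t, of e]] by (simp add: D_def[abs_def])
      then have "integrable lborel D"
      proof -
        have "integrable (lebesgue_on C) D" using \<open>locally_integrable U D\<close> C(1,2)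
          by (simp add: locally_integrable_def set_integrable_lebesgue_iff compact_imp_closed)
        then show ?thesis using borel_zero_outside(1)[of C D] C(1) D0 by (simp add: compact_imp_closed)
      qed
      then show ?thesis using integrable_mult_test_translate[OF Pi D, of 0] by simp
    qed
    also have "(\<integral>x. D x \<partial>lborel) = 0" unfolding D_def by (rule integral_test_derivative_zero[OF t])
    also have "(\<integral>x. P x * D x \<partial>lborel) = - (\<integral>x. \<phi> x * (G' (F x) * H x) \<partial>lborel)" using main by (simp add: D_def)
    also have "(\<integral>x. \<phi> x * (G' (F x) * H x) \<partial>lborel) = integral\<^sup>L (lebesgue_on U) (\<lambda>x. \<phi> x * (G' (F x) * H x))"
      using C by (intro borel_zero_outside(2)[OF UB, symmetric]) auto
    also have "\<dots> = integral\<^sup>L (lebesgue_on U) (\<lambda>x. G' (f x) * g x * \<phi> x)"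
    proof (rule integral_lebesgue_on_cong_AE[OF _ Ub])
      show "AE x in lebesgue_on U. G' (f x) * g x * \<phi> x = \<phi> x * (G' (F x) * H x)"
        unfolding AE_lebesgue_on_iff[OF Ub] using fF gH
        by eventually_elim (metis C(3) CK mult.commute mult_zero_right)
    qed
    finally show "(LINT x|lebesgue_on U. G (f x) * frechet_derivative \<phi> (at x) e) = - (LINT x|lebesgue_on U. G' (f x) * g x * \<phi> x)"
      by (simp add: D_def)
  qed (use li1 in auto)
qed

section \<open>Fubini's theorem for Lebesgue measure on product sets\<close>

lemma AE_lborel_prod_slices:
  fixes Q :: "'a::euclidean_space \<times> 'b::euclidean_space \<Rightarrow> bool"
  assumes "AE z in lborel. Q z"
  shows "AE x in lborel. AE t in lborel. Q (x, t)" "AE t in lborel. AE x in lborel. Q (x, t)"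
proof -
  obtain N where N: "N \<in> null_sets lborel" "{z. \<not> Q z} \<subseteq> N"
    using assms by (auto simp: eventually_ae_filter)
  have "AE z in lborel. z \<notin> N" using N(1) by (rule AE_not_in)
  then have "AE z in (lborel :: 'a measure) \<Otimes>\<^sub>M (lborel :: 'b measure). z \<notin> N" by (simp only: lborel_prod)
  from lborel_pair.AE_pair[OF this] have 1: "AE x in lborel. AE t in lborel. (x, t) \<notin> N" by simp
  have "N \<in> sets borel" using null_setsD2[OF N(1)] by simp
  from borel_comp[OF this] have Nc: "{z. z \<notin> N} \<in> sets borel" by (simp add: Compl_eq)
  have "{z \<in> space ((lborel :: 'a measure) \<Otimes>\<^sub>M (lborel :: 'b measure)). (fst z, snd z) \<notin> N} \<in> sets (lborel \<Otimes>\<^sub>M lborel)"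
    using Nc unfolding lborel_prod by simp
  from lborel_pair.AE_commute[OF this] 1
  have 2: "AE t in lborel. AE x in lborel. (x, t) \<notin> N" by simp
  show "AE x in lborel. AE t in lborel. Q (x, t)"
    using 1 by (elim eventually_mono) (use N(2) in blast)
  show "AE t in lborel. AE x in lborel. Q (x, t)"
    using 2 by (elim eventually_mono) (use N(2) in blast)
qed

lemma AE_lborel_prodI:
  fixes Q :: "'a::euclidean_space \<times> 'b::euclidean_space \<Rightarrow> bool"
  assumes "{z. Q z} \<in> sets borel" "AE t in lborel. AE x in lborel. Q (x, t)"
  shows "AE z in lborel. Q z"
proof -
  have m: "{z \<in> space ((lborel :: 'a measure) \<Otimes>\<^sub>M (lborel :: 'b measure)). Q (fst z, snd z)} \<in> sets (lborel \<Otimes>\<^sub>M lborel)"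
    using assms(1) unfolding lborel_prod by simp
  have "AE x in lborel. AE t in lborel. Q (x, t)"
    using lborel_pair.AE_commute[OF m] assms(2) by simp
  moreover have "{z \<in> space ((lborel :: 'a measure) \<Otimes>\<^sub>M (lborel :: 'b measure)). Q z} \<in> sets (lborel \<Otimes>\<^sub>M lborel)"
    using assms(1) unfolding lborel_prod by simp
  ultimately have "AE z in (lborel :: 'a measure) \<Otimes>\<^sub>M (lborel :: 'b measure). Q z"
    by (intro lborel_pair.AE_pair_measure)
  then show ?thesis by (simp only: lborel_prod)
qed

lemma AE_lborel_fst:
  fixes Q :: "'a::euclidean_space \<Rightarrow> bool"
  assumes "AE x in lborel. Q x"
  shows "AE z in (lborel :: ('a \<times> 'b::euclidean_space) measure). Q (fst z)"
proof -
  obtain N where N: "N \<in> null_sets lborel" "{z. \<not> Q z} \<subseteq> N"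
    using assms by (auto simp: eventually_ae_filter)
  have "AE x in lborel. x \<notin> N" using N(1) by (rule AE_not_in)
  moreover have "(fst :: 'a \<times> 'b \<Rightarrow> 'a) \<in> borel_measurable borel"
    by (intro borel_measurable_continuous_onI continuous_on_fst continuous_on_id)
  from measurable_sets[OF this, of "- N"] have "fst -` (- N) \<in> sets (borel :: ('a \<times> 'b) measure)"
    using N(1) by (auto simp: borel_comp)
  then have "{z :: 'a \<times> 'b. fst z \<notin> N} \<in> sets borel" by (simp add: vimage_def)
  ultimately have "AE z in (lborel :: ('a \<times> 'b) measure). fst z \<notin> N"
    by (intro AE_lborel_prodI) auto
  then show ?thesis by (elim eventually_mono) (use N(2) in auto)
qed

text \<open>Lebesgue measure on a product is the completion of a product measure and not itself a product
  measure. The statements below therefore hold for Borel representatives first.\<close>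

context
  fixes A :: "'a::euclidean_space set" and B :: "'b::euclidean_space set"
  assumes A: "A \<in> sets borel" and B: "B \<in> sets borel"
begin

lemma prod_sets_borel: "A \<times> B \<in> sets borel"
  using A B by (metis borel_prod pair_measureI)

lemma AE_lebesgue_slices:
  assumes "AE z in lebesgue_on (A \<times> B). P z"
  shows "AE x in lebesgue_on A. AE t in lebesgue_on B. P (x, t)"
    "AE t in lebesgue_on B. AE x in lebesgue_on A. P (x, t)"
proof -
  have A': "A \<in> sets lebesgue" and B': "B \<in> sets lebesgue" and C': "A \<times> B \<in> sets lebesgue"
    using A B prod_sets_borel by auto
  have *: "AE z in lborel. z \<in> A \<times> B \<longrightarrow> P z" using assms by (simp add: AE_lebesgue_on_iff[OF C'])
  show "AE x in lebesgue_on A. AE t in lebesgue_on B. P (x, t)"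
    using AE_lborel_prod_slices(1)[OF *] unfolding AE_lebesgue_on_iff[OF A'] AE_lebesgue_on_iff[OF B']
    by (elim eventually_mono) auto
  show "AE t in lebesgue_on B. AE x in lebesgue_on A. P (x, t)"
    using AE_lborel_prod_slices(2)[OF *] unfolding AE_lebesgue_on_iff[OF A'] AE_lebesgue_on_iff[OF B']
    by (elim eventually_mono) auto
qed

lemma borel_slice:
  fixes g :: "'a \<times> 'b \<Rightarrow> real"
  assumes "g \<in> borel_measurable borel"
  shows "(\<lambda>x. g (x, t)) \<in> borel_measurable borel" "(\<lambda>t. g (x, t)) \<in> borel_measurable borel"
proof -
  have "(\<lambda>x::'a. (x, t)) \<in> borel_measurable borel" "(\<lambda>t. (x, t)) \<in> borel_measurable borel"
    by (auto intro!: borel_measurable_continuous_onI continuous_intros)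
  from measurable_compose[OF this(1) assms] measurable_compose[OF this(2) assms]
  show "(\<lambda>x. g (x, t)) \<in> borel_measurable borel" "(\<lambda>t. g (x, t)) \<in> borel_measurable borel" by auto
qed

lemma measurable_slices:
  fixes f :: "'a \<times> 'b \<Rightarrow> real"
  assumes "f \<in> borel_measurable (lebesgue_on (A \<times> B))"
  shows "AE t in lebesgue_on B. (\<lambda>x. f (x, t)) \<in> borel_measurable (lebesgue_on A)"
proof -
  obtain g where g: "g \<in> borel_measurable borel" "AE z in lebesgue_on (A \<times> B). f z = g z"
    by (rule borel_representative[OF prod_sets_borel assms]) auto
  show ?thesis using AE_lebesgue_slices(2)[OF g(2)]
  proof (elim eventually_mono)
    fix t assume "AE x in lebesgue_on A. f (x, t) = g (x, t)"
    then show "(\<lambda>x. f (x, t)) \<in> borel_measurable (lebesgue_on A)"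
      using A by (intro borel_measurable_lebesgue_on_cong_AE[OF borel_measurable_lebesgue_onI[OF borel_slice(1)[OF g(1)]]])
        (auto simp: eq_commute)
  qed
qed

lemma integrable_slices:
  fixes f :: "'a \<times> 'b \<Rightarrow> real"
  assumes "integrable (lebesgue_on (A \<times> B)) f"
  shows "AE t in lebesgue_on B. integrable (lebesgue_on A) (\<lambda>x. f (x, t))"
    "integrable (lebesgue_on B) (\<lambda>t. \<integral>x. f (x, t) \<partial>lebesgue_on A)"
    "(\<integral>t. \<integral>x. f (x, t) \<partial>lebesgue_on A \<partial>lebesgue_on B) = integral\<^sup>L (lebesgue_on (A \<times> B)) f"
    "AE x in lebesgue_on A. integrable (lebesgue_on B) (\<lambda>t. f (x, t))"
    "integrable (lebesgue_on A) (\<lambda>x. \<integral>t. f (x, t) \<partial>lebesgue_on B)"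
    "(\<integral>x. \<integral>t. f (x, t) \<partial>lebesgue_on B \<partial>lebesgue_on A) = integral\<^sup>L (lebesgue_on (A \<times> B)) f"
proof -
  have A': "A \<in> sets lebesgue" and B': "B \<in> sets lebesgue" using A B by auto
  obtain g where g: "g \<in> borel_measurable borel" "\<And>z. z \<notin> A \<times> B \<Longrightarrow> g z = 0"
    "AE z in lebesgue_on (A \<times> B). f z = g z" "integrable lborel g"
    "integral\<^sup>L lborel g = integral\<^sup>L (lebesgue_on (A \<times> B)) f"
    by (rule integrable_borel_representative[OF prod_sets_borel assms]) auto
  have gi: "integrable ((lborel :: 'a measure) \<Otimes>\<^sub>M (lborel :: 'b measure)) g" using g(4) by (simp add: lborel_prod)
  note sl = borel_slice[OF g(1)]
  have zx: "(\<integral>x. g (x, t) \<partial>lebesgue_on A) = (\<integral>x. g (x, t) \<partial>lborel)"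
    "integrable (lebesgue_on A) (\<lambda>x. g (x, t)) \<longleftrightarrow> integrable lborel (\<lambda>x. g (x, t))" for t
    using borel_zero_outside[OF A sl(1)] g(2) by auto
  have zt: "(\<integral>t. g (x, t) \<partial>lebesgue_on B) = (\<integral>t. g (x, t) \<partial>lborel)"
    "integrable (lebesgue_on B) (\<lambda>t. g (x, t)) \<longleftrightarrow> integrable lborel (\<lambda>t. g (x, t))" for x
    using borel_zero_outside[OF B sl(2)] g(2) by auto
  have gi': "integrable ((lborel :: 'a measure) \<Otimes>\<^sub>M (lborel :: 'b measure)) (\<lambda>(x, y). g (x, y))"
    using gi by (simp add: case_prod_unfold)
  have L2: "AE t in lborel. integrable lborel (\<lambda>x. g (x, t))" "integrable lborel (\<lambda>t. \<integral>x. g (x, t) \<partial>lborel)"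
    "(\<integral>t. \<integral>x. g (x, t) \<partial>lborel \<partial>lborel) = integral\<^sup>L lborel g"
    using lborel_pair.AE_integrable_snd[OF gi'] lborel_pair.integrable_snd[OF gi'] lborel_pair.integral_snd[OF gi']
    by (auto simp: lborel_prod)
  have L1: "AE x in lborel. integrable lborel (\<lambda>t. g (x, t))" "integrable lborel (\<lambda>x. \<integral>t. g (x, t) \<partial>lborel)"
    "(\<integral>x. \<integral>t. g (x, t) \<partial>lborel \<partial>lborel) = integral\<^sup>L lborel g"
    using lborel_pair.AE_integrable_fst[OF gi'] lborel_pair.integrable_fst[OF gi'] lborel_pair.integral_fst[OF gi']
    by (auto simp: lborel_prod)
  have fx: "AE t in lebesgue_on B. AE x in lebesgue_on A. g (x, t) = f (x, t)"
    using AE_lebesgue_slices(2)[OF g(3)] by (simp add: eq_commute)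
  have ft: "AE x in lebesgue_on A. AE t in lebesgue_on B. g (x, t) = f (x, t)"
    using AE_lebesgue_slices(1)[OF g(3)] by (simp add: eq_commute)
  have "AE t in lebesgue_on B. integrable lborel (\<lambda>x. g (x, t))"
    using L2(1) unfolding AE_lebesgue_on_iff[OF B'] by (elim eventually_mono) auto
  with fx show "AE t in lebesgue_on B. integrable (lebesgue_on A) (\<lambda>x. f (x, t))"
    by eventually_elim (rule integrable_lebesgue_on_cong_AE(1)[OF _ _ A'], simp_all add: zx(2))
  have "AE x in lebesgue_on A. integrable lborel (\<lambda>t. g (x, t))"
    using L1(1) unfolding AE_lebesgue_on_iff[OF A'] by (elim eventually_mono) auto
  with ft show "AE x in lebesgue_on A. integrable (lebesgue_on B) (\<lambda>t. f (x, t))"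
    by eventually_elim (rule integrable_lebesgue_on_cong_AE(1)[OF _ _ B'], simp_all add: zt(2))
  have ex: "AE t in lebesgue_on B. (\<integral>x. g (x, t) \<partial>lborel) = (\<integral>x. f (x, t) \<partial>lebesgue_on A)"
    using fx by eventually_elim (subst zx(1)[symmetric], rule integral_lebesgue_on_cong_AE[OF _ A', symmetric], assumption)
  have et: "AE x in lebesgue_on A. (\<integral>t. g (x, t) \<partial>lborel) = (\<integral>t. f (x, t) \<partial>lebesgue_on B)"
    using ft by eventually_elim (subst zt(1)[symmetric], rule integral_lebesgue_on_cong_AE[OF _ B', symmetric], assumption)
  have ox: "(\<integral>x. g (x, t) \<partial>lborel) = 0" if "t \<notin> B" for t using g(2) that by simp
  have ot: "(\<integral>t. g (x, t) \<partial>lborel) = 0" if "x \<notin> A" for x using g(2) that by simp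
  have bx: "integrable (lebesgue_on B) (\<lambda>t. \<integral>x. g (x, t) \<partial>lborel)"
    "(\<integral>t. \<integral>x. g (x, t) \<partial>lborel \<partial>lebesgue_on B) = integral\<^sup>L lborel g"
    using borel_zero_outside[OF B _ ox] L2(2,3) by auto
  have bt: "integrable (lebesgue_on A) (\<lambda>x. \<integral>t. g (x, t) \<partial>lborel)"
    "(\<integral>x. \<integral>t. g (x, t) \<partial>lborel \<partial>lebesgue_on A) = integral\<^sup>L lborel g"
    using borel_zero_outside[OF A _ ot] L1(2,3) by auto
  show "integrable (lebesgue_on B) (\<lambda>t. \<integral>x. f (x, t) \<partial>lebesgue_on A)"
    "(\<integral>t. \<integral>x. f (x, t) \<partial>lebesgue_on A \<partial>lebesgue_on B) = integral\<^sup>L (lebesgue_on (A \<times> B)) f"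
    using integrable_lebesgue_on_cong_AE[OF bx(1) ex B'] bx(2) g(5) by auto
  show "integrable (lebesgue_on A) (\<lambda>x. \<integral>t. f (x, t) \<partial>lebesgue_on B)"
    "(\<integral>x. \<integral>t. f (x, t) \<partial>lebesgue_on B \<partial>lebesgue_on A) = integral\<^sup>L (lebesgue_on (A \<times> B)) f"
    using integrable_lebesgue_on_cong_AE[OF bt(1) et A'] bt(2) g(5) by auto
qed

text \<open>Tonelli's theorem: joint measurability is an assumption, the bound \<open>w\<close> on the \<open>L\<^sup>1\<close> norms of the
  slices gives integrability.\<close>

lemma integrable_product_by_slices:
  fixes f :: "'a \<times> 'b \<Rightarrow> real"
  assumes f: "f \<in> borel_measurable (lebesgue_on (A \<times> B))"
    and i: "AE t in lebesgue_on B. integrable (lebesgue_on A) (\<lambda>x. f (x, t))"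
    and w: "integrable (lebesgue_on B) w" "AE t in lebesgue_on B. (\<integral>x. \<bar>f (x, t)\<bar> \<partial>lebesgue_on A) \<le> w t"
  shows "integrable (lebesgue_on (A \<times> B)) f"
proof -
  have A': "A \<in> sets lebesgue" and B': "B \<in> sets lebesgue" and C': "A \<times> B \<in> sets lebesgue"
    using A B prod_sets_borel by auto
  obtain g where g: "g \<in> borel_measurable borel" "\<And>z. z \<notin> A \<times> B \<Longrightarrow> g z = 0"
    "AE z in lebesgue_on (A \<times> B). f z = g z"
    by (rule borel_representative[OF prod_sets_borel f]) auto
  obtain W where W: "W \<in> borel_measurable borel" "AE t in lebesgue_on B. w t = W t" "integrable lborel W"
    by (rule integrable_borel_representative[OF B w(1)]) auto
  note sl = borel_slice[OF g(1)]
  have zx: "integrable (lebesgue_on A) (\<lambda>x. g (x, t)) \<longleftrightarrow> integrable lborel (\<lambda>x. g (x, t))" for t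
    using borel_zero_outside[OF A sl(1)] g(2) by auto
  have absm: "(\<lambda>z. \<bar>g z\<bar>) \<in> borel_measurable borel" using g(1) by simp
  have za: "(\<integral>x. \<bar>g (x, t)\<bar> \<partial>lebesgue_on A) = (\<integral>x. \<bar>g (x, t)\<bar> \<partial>lborel)" for t
    using borel_zero_outside(2)[OF A borel_slice(1)[OF absm]] g(2) by auto
  have key: "AE t in lborel. integrable lborel (\<lambda>x. g (x, t)) \<and> (\<integral>x. \<bar>g (x, t)\<bar> \<partial>lborel) \<le> \<bar>W t\<bar>"
    using i w(2) W(2) AE_lebesgue_slices(2)[OF g(3)] unfolding AE_lebesgue_on_iff[OF B']
  proof eventually_elim
    case (elim t)
    show ?case
    proof (cases "t \<in> B")
      case True
      then have ae: "AE x in lebesgue_on A. f (x, t) = g (x, t)" using elim by simp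
      then have ae2: "AE x in lebesgue_on A. \<bar>g (x, t)\<bar> = \<bar>f (x, t)\<bar>" by (elim eventually_mono) auto
      have "integrable lborel (\<lambda>x. g (x, t))"
        using integrable_lebesgue_on_cong_AE(1)[OF _ ae A'] elim True zx by simp
      moreover have "(\<integral>x. \<bar>g (x, t)\<bar> \<partial>lborel) \<le> w t"
        using integral_lebesgue_on_cong_AE[OF ae2 A'] za elim True by simp
      ultimately show ?thesis using elim True by simp
    next
      case False
      then show ?thesis using g(2) by simp
    qed
  qed
  have gp: "(\<lambda>(t, x). g (x, t)) \<in> borel_measurable ((lborel :: 'b measure) \<Otimes>\<^sub>M (lborel :: 'a measure))"
  proof -
    have "(\<lambda>z. g (snd z, fst z)) \<in> borel_measurable (borel :: ('b \<times> 'a) measure)"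
      by (rule measurable_compose[OF _ g(1)]) (auto intro!: borel_measurable_continuous_onI continuous_intros)
    then show ?thesis by (simp add: lborel_prod case_prod_unfold)
  qed
  have "integrable ((lborel :: 'b measure) \<Otimes>\<^sub>M (lborel :: 'a measure)) (\<lambda>(t, x). g (x, t))"
  proof (rule lborel_pair.Fubini_integrable[OF gp])
    show "integrable lborel (\<lambda>t. \<integral>x. norm (case (t, x) of (t, x) \<Rightarrow> g (x, t)) \<partial>lborel)"
    proof (rule Bochner_Integration.integrable_bound)
      show "integrable lborel (\<lambda>t. \<bar>W t\<bar>)" using W(3) by auto
      have "(\<lambda>z. norm (case z of (t, x) \<Rightarrow> g (x, t))) \<in> borel_measurable ((lborel :: 'b measure) \<Otimes>\<^sub>M (lborel :: 'a measure))"
        using gp by measurable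
      then have "case_prod (\<lambda>t x. norm (case (t, x) of (t, x) \<Rightarrow> g (x, t))) \<in> borel_measurable ((lborel :: 'b measure) \<Otimes>\<^sub>M (lborel :: 'a measure))"
        by (simp add: case_prod_unfold)
      then show "(\<lambda>t. \<integral>x. norm (case (t, x) of (t, x) \<Rightarrow> g (x, t)) \<partial>lborel) \<in> borel_measurable lborel"
        by (rule lborel.borel_measurable_lebesgue_integral)
      show "AE t in lborel. norm (\<integral>x. norm (case (t, x) of (t, x) \<Rightarrow> g (x, t)) \<partial>lborel) \<le> norm \<bar>W t\<bar>"
        using key by (elim eventually_mono) auto
    qed
    show "AE t in lborel. integrable lborel (\<lambda>x. case (t, x) of (t, x) \<Rightarrow> g (x, t))"
      using key by (elim eventually_mono) auto
  qed
  from lborel_pair.integrable_product_swap[OF this]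
  have "integrable ((lborel :: 'a measure) \<Otimes>\<^sub>M (lborel :: 'b measure)) g" by (simp add: case_prod_unfold)
  then have "integrable lborel g" by (simp add: lborel_prod)
  then have "integrable (lebesgue_on (A \<times> B)) g" using borel_zero_outside(1)[OF prod_sets_borel g(1,2)] by simp
  then show ?thesis using integrable_lebesgue_on_cong_AE(1)[OF _ _ C', of g f] g(3) by (simp add: eq_commute)
qed

text \<open>The joint measurability of both functions makes the exceptional set measurable, and it is a null set
  because almost all its slices are.\<close>

lemma AE_product_eqI:
  fixes f g :: "'a \<times> 'b \<Rightarrow> real"
  assumes f: "f \<in> borel_measurable (lebesgue_on (A \<times> B))" and g: "g \<in> borel_measurable (lebesgue_on (A \<times> B))"
    and e: "AE t in lebesgue_on B. AE x in lebesgue_on A. f (x, t) = g (x, t)"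
  shows "AE z in lebesgue_on (A \<times> B). f z = g z"
proof -
  have A': "A \<in> sets lebesgue" and B': "B \<in> sets lebesgue" and C': "A \<times> B \<in> sets lebesgue"
    using A B prod_sets_borel by auto
  obtain F where F: "F \<in> borel_measurable borel" "\<And>z. z \<notin> A \<times> B \<Longrightarrow> F z = 0" "AE z in lebesgue_on (A \<times> B). f z = F z"
    by (rule borel_representative[OF prod_sets_borel f]) auto
  obtain G where G: "G \<in> borel_measurable borel" "\<And>z. z \<notin> A \<times> B \<Longrightarrow> G z = 0" "AE z in lebesgue_on (A \<times> B). g z = G z"
    by (rule borel_representative[OF prod_sets_borel g]) auto
  have "AE z in lborel. F z = G z"
  proof (rule AE_lborel_prodI)
    show "{z. F z = G z} \<in> sets borel"
      using borel_measurable_eq[of F borel G] F(1) G(1) by simp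
    show "AE t in lborel. AE x in lborel. F (x, t) = G (x, t)"
      using e AE_lebesgue_slices(2)[OF F(3)] AE_lebesgue_slices(2)[OF G(3)]
      unfolding AE_lebesgue_on_iff[OF B'] AE_lebesgue_on_iff[OF A']
    proof eventually_elim
      case (elim t)
      show ?case
      proof (cases "t \<in> B")
        case True
        from elim(1)[rule_format, OF True] elim(2)[rule_format, OF True] elim(3)[rule_format, OF True]
        show ?thesis
        proof eventually_elim
          case (elim x)
          then show ?case using F(2)[of "(x, t)"] G(2)[of "(x, t)"] by (cases "x \<in> A") auto
        qed
      qed (use F(2) G(2) in auto)
    qed
  qed
  then have "AE z in lebesgue_on (A \<times> B). F z = G z"
    unfolding AE_lebesgue_on_iff[OF C'] by (elim eventually_mono) auto
  with F(3) G(3) show ?thesis by eventually_elim auto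
qed

lemma AE_lebesgue_fst:
  assumes "AE x in lebesgue_on A. Q x"
  shows "AE z in lebesgue_on (A \<times> B). Q (fst z)"
proof -
  have A': "A \<in> sets lebesgue" and C': "A \<times> B \<in> sets lebesgue" using A prod_sets_borel by auto
  have "AE x in lborel. x \<in> A \<longrightarrow> Q x" using assms by (simp add: AE_lebesgue_on_iff[OF A'])
  from AE_lborel_fst[OF this] have "AE z in (lborel :: ('a \<times> 'b) measure). fst z \<in> A \<longrightarrow> Q (fst z)" .
  then show ?thesis
    unfolding AE_lebesgue_on_iff[OF C'] by (elim eventually_mono) auto
qed

lemma measurable_lebesgue_fst:
  fixes f :: "'a \<Rightarrow> real"
  assumes "f \<in> borel_measurable (lebesgue_on A)"
  shows "(\<lambda>z. f (fst z)) \<in> borel_measurable (lebesgue_on (A \<times> B))"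
proof -
  obtain g where g: "g \<in> borel_measurable borel" "AE x in lebesgue_on A. f x = g x"
    by (rule borel_representative[OF A assms]) auto
  have "(\<lambda>z. g (fst z)) \<in> borel_measurable (borel :: ('a \<times> 'b) measure)"
    by (rule measurable_compose[OF _ g(1)]) (auto intro!: borel_measurable_continuous_onI continuous_intros)
  from borel_measurable_lebesgue_onI[OF this]
  have "(\<lambda>z. g (fst z)) \<in> borel_measurable (lebesgue_on (A \<times> B))" .
  then show ?thesis
    by (rule borel_measurable_lebesgue_on_cong_AE)
       (use AE_lebesgue_fst[OF g(2)] prod_sets_borel in \<open>auto simp: eq_commute\<close>)
qed

lemma integrable_lebesgue_fst:
  fixes f :: "'a \<Rightarrow> real"
  assumes "integrable (lebesgue_on A) f" "B \<in> lmeasurable"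
  shows "integrable (lebesgue_on (A \<times> B)) (\<lambda>z. f (fst z))"
proof (rule integrable_product_by_slices[where w = "\<lambda>t. \<integral>x. \<bar>f x\<bar> \<partial>lebesgue_on A"])
  interpret finite_measure "lebesgue_on B" by (rule finite_measure_lebesgue_on[OF assms(2)])
  show "integrable (lebesgue_on B) (\<lambda>t. \<integral>x. \<bar>f x\<bar> \<partial>lebesgue_on A)" by simp
qed (use assms measurable_lebesgue_fst in auto)

end

text \<open>The indicator in place of variable limits of integration makes the primitive an integral over the fixed
  set \<open>I\<close> with a jointly measurable integrand, to which Fubini's theorem applies.\<close>

definition time_primitive :: "real set \<Rightarrow> ('a \<times> real \<Rightarrow> real) \<Rightarrow> 'a \<times> real \<Rightarrow> real" where
  "time_primitive I f z = (\<integral>s. indicator {..<snd z} s * f (fst z, s) \<partial>lebesgue_on I)"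

lemma time_primitive_measurable:
  fixes f :: "'a::euclidean_space \<times> real \<Rightarrow> real"
  assumes A: "A \<in> sets borel" and I: "I \<in> sets borel"
    and f: "f \<in> borel_measurable (lebesgue_on (A \<times> I))"
  shows "time_primitive I f \<in> borel_measurable (lebesgue_on (A \<times> I))"
proof -
  have I': "I \<in> sets lebesgue" using I by simp
  note C = prod_sets_borel[OF A I]
  obtain g where g: "g \<in> borel_measurable borel" "\<And>z. z \<notin> A \<times> I \<Longrightarrow> g z = 0" "AE z in lebesgue_on (A \<times> I). f z = g z"
    by (rule borel_representative[OF C f]) auto
  have m: "(\<lambda>y. indicator {..<snd (fst y)} (snd y) * g (fst (fst y), snd y)) \<in> borel_measurable (borel :: (('a \<times> real) \<times> real) measure)"
  proof (rule borel_measurable_times)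
    have "{y :: ('a \<times> real) \<times> real. snd y < snd (fst y)} \<in> sets borel"
      by (intro borel_measurable_less[where M = borel, simplified]) (auto intro!: borel_measurable_continuous_onI continuous_intros)
    then have "(\<lambda>y :: ('a \<times> real) \<times> real. indicator {y. snd y < snd (fst y)} y :: real) \<in> borel_measurable borel"
      by (intro borel_measurable_indicator) auto
    moreover have "(\<lambda>y :: ('a \<times> real) \<times> real. indicator {y. snd y < snd (fst y)} y :: real) = (\<lambda>y. indicator {..<snd (fst y)} (snd y))"
      by (auto simp: indicator_def)
    ultimately show "(\<lambda>y :: ('a \<times> real) \<times> real. indicator {..<snd (fst y)} (snd y) :: real) \<in> borel_measurable borel" by simp
    show "(\<lambda>y. g (fst (fst y), snd y)) \<in> borel_measurable (borel :: (('a \<times> real) \<times> real) measure)"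
      by (rule measurable_compose[OF _ g(1)]) (auto intro!: borel_measurable_continuous_onI continuous_intros)
  qed
  then have "case_prod (\<lambda>z s. indicator {..<snd z} s * g (fst z, s)) \<in> borel_measurable ((lborel :: ('a \<times> real) measure) \<Otimes>\<^sub>M (lborel :: real measure))"
    by (simp add: lborel_prod case_prod_unfold)
  then have "(\<lambda>z. \<integral>s. indicator {..<snd z} s * g (fst z, s) \<partial>lborel) \<in> borel_measurable (lborel :: ('a \<times> real) measure)"
    by (rule lborel.borel_measurable_lebesgue_integral)
  then have "(\<lambda>z. \<integral>s. indicator {..<snd z} s * g (fst z, s) \<partial>lborel) \<in> borel_measurable (lebesgue_on (A \<times> I))"
    by (intro borel_measurable_lebesgue_onI) simp
  moreover have "AE z in lebesgue_on (A \<times> I). \<forall>t. (\<integral>s. indicator {..<t} s * g (fst z, s) \<partial>lborel) = time_primitive I f (fst z, t)"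
  proof (rule AE_lebesgue_fst[OF A I])
    show "AE x in lebesgue_on A. \<forall>t. (\<integral>s. indicator {..<t} s * g (x, s) \<partial>lborel) = time_primitive I f (x, t)"
      using AE_lebesgue_slices(1)[OF A I g(3)]
    proof (elim eventually_mono, intro allI)
      fix x t assume ae: "AE s in lebesgue_on I. f (x, s) = g (x, s)"
      have "time_primitive I f (x, t) = (\<integral>s. indicator {..<t} s * g (x, s) \<partial>lebesgue_on I)"
        unfolding time_primitive_def
        by (rule integral_lebesgue_on_cong_AE[OF _ I'], simp, use ae in \<open>elim eventually_mono\<close>) auto
      also have "\<dots> = (\<integral>s. indicator {..<t} s * g (x, s) \<partial>lborel)"
        using borel_slice(2)[OF A I g(1)] g(2)
        by (intro borel_zero_outside(2)[OF I]) (auto intro!: borel_measurable_times)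
      finally show "(\<integral>s. indicator {..<t} s * g (x, s) \<partial>lborel) = time_primitive I f (x, t)" by simp
    qed
  qed
  then have "AE z in lebesgue_on (A \<times> I). (\<integral>s. indicator {..<snd z} s * g (fst z, s) \<partial>lborel) = time_primitive I f z"
    by (elim eventually_mono) auto
  ultimately show ?thesis
    by (rule borel_measurable_lebesgue_on_cong_AE) (use C in auto)
qed

section \<open>Sobolev spaces\<close>

lemma Hk_L2: "f \<in> Hk k U \<Longrightarrow> f \<in> L2 U"
  by (cases k) auto

lemma Hk_cong_AE:
  assumes "f \<in> Hk k U" "AE x in lebesgue_on U. f x = g x" "open U"
  shows "g \<in> Hk k U"
proof (cases k)
  case 0
  then show ?thesis using assms L2_cong_AE[OF _ assms(2)] by simp
next
  case (Suc k')
  have "\<exists>h\<in>Hk k' U. has_weak_deriv U i g h" if i: "i \<in> Basis" for i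
  proof -
    obtain h where "h \<in> Hk k' U" "has_weak_deriv U i f h" using assms(1) i Suc by auto
    then show ?thesis using has_weak_deriv_cong_AE[of U i f h g h] assms(2,3) by auto
  qed
  then show ?thesis using assms L2_cong_AE[OF _ assms(2)] Suc by simp
qed

lemma Hk_weak_deriv:
  assumes "f \<in> Hk (Suc k) U" "i \<in> Basis" "open U"
  shows "has_weak_deriv U i f (weak_deriv U i f)" "weak_deriv U i f \<in> Hk k U"
proof -
  obtain h where h: "h \<in> Hk k U" "has_weak_deriv U i f h" using assms(1,2) by auto
  show "has_weak_deriv U i f (weak_deriv U i f)" by (rule weak_deriv_works[OF h(2)])
  show "weak_deriv U i f \<in> Hk k U"
    using Hk_cong_AE[OF h(1) _ assms(3)] weak_deriv_AE_eq[OF h(2) assms(3)] by (simp add: eq_commute)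
qed

lemma Hk_lincomb:
  "f \<in> Hk k U \<Longrightarrow> g \<in> Hk k U \<Longrightarrow> open U \<Longrightarrow> (\<lambda>x. a * f x + b * g x) \<in> Hk k U"
proof (induction k arbitrary: f g)
  case 0
  then show ?case by (simp add: L2_add L2_cmult)
next
  case (Suc k)
  have "\<exists>h\<in>Hk k U. has_weak_deriv U i (\<lambda>x. a * f x + b * g x) h" if i: "i \<in> Basis" for i
    using Suc.IH[OF Hk_weak_deriv(2)[OF Suc.prems(1) i] Hk_weak_deriv(2)[OF Suc.prems(2) i] Suc.prems(3)]
      has_weak_deriv_lincomb[OF Hk_weak_deriv(1)[OF Suc.prems(1) i] Hk_weak_deriv(1)[OF Suc.prems(2) i] Suc.prems(3)]
      Suc.prems(3) by blast
  then show ?case using Suc.prems by (simp add: L2_add L2_cmult)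
qed

lemma weak_deriv_lincomb_AE:
  assumes "f \<in> Hk (Suc k) U" "g \<in> Hk (Suc k) U" "open U" "i \<in> Basis"
  shows "AE x in lebesgue_on U. weak_deriv U i (\<lambda>x. a * f x + b * g x) x = a * weak_deriv U i f x + b * weak_deriv U i g x"
  using weak_deriv_AE_eq[OF has_weak_deriv_lincomb[OF Hk_weak_deriv(1) Hk_weak_deriv(1)]] assms by blast

lemma Hk_sqnorm_nonneg: "Hk_sqnorm k U f \<ge> 0"
  by (induction k arbitrary: f) (auto intro!: add_nonneg_nonneg sum_nonneg)

lemma Hk_sqnorm_cong_AE:
  "f \<in> Hk k U \<Longrightarrow> AE x in lebesgue_on U. f x = g x \<Longrightarrow> open U \<Longrightarrow> Hk_sqnorm k U g = Hk_sqnorm k U f"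
proof (induction k arbitrary: f g)
  case 0
  then show ?case using L2_norm_cong_AE[OF 0(2)] by simp
next
  case (Suc k)
  have "Hk_sqnorm k U (weak_deriv U i g) = Hk_sqnorm k U (weak_deriv U i f)" if i: "i \<in> Basis" for i
  proof (rule Suc.IH[OF Hk_weak_deriv(2)[OF Suc.prems(1) i Suc.prems(3)] _ Suc.prems(3)])
    have "has_weak_deriv U i g (weak_deriv U i f)"
      using has_weak_deriv_cong_AE[OF Hk_weak_deriv(1)[OF Suc.prems(1) i Suc.prems(3)] Suc.prems(2)] Suc.prems(3) by simp
    from weak_deriv_AE_eq[OF this Suc.prems(3)]
    show "AE x in lebesgue_on U. weak_deriv U i f x = weak_deriv U i g x" by (simp add: eq_commute)
  qed
  then show ?case using L2_norm_cong_AE[OF Suc.prems(2)] Suc.prems(3) by simp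
qed

text \<open>The factor \<open>2\<close> comes from \<open>(x + y)\<^sup>2 \<le> 2 x\<^sup>2 + 2 y\<^sup>2\<close>. This bound suffices for
  passing to limits.\<close>

lemma Hk_sqnorm_lincomb:
  "f \<in> Hk k U \<Longrightarrow> g \<in> Hk k U \<Longrightarrow> open U \<Longrightarrow>
    Hk_sqnorm k U (\<lambda>x. a * f x + b * g x) \<le> 2 * a\<^sup>2 * Hk_sqnorm k U f + 2 * b\<^sup>2 * Hk_sqnorm k U g"
proof (induction k arbitrary: f g)
  case 0
  then show ?case using L2_norm_add_power2[of f U g a b] by simp
next
  case (Suc k)
  note d = Hk_weak_deriv(2)[OF Suc.prems(1) _ Suc.prems(3)] Hk_weak_deriv(2)[OF Suc.prems(2) _ Suc.prems(3)]
  have "Hk_sqnorm k U (weak_deriv U i (\<lambda>x. a * f x + b * g x))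
      \<le> 2 * a\<^sup>2 * Hk_sqnorm k U (weak_deriv U i f) + 2 * b\<^sup>2 * Hk_sqnorm k U (weak_deriv U i g)" if i: "i \<in> Basis" for i
  proof -
    have "Hk_sqnorm k U (weak_deriv U i (\<lambda>x. a * f x + b * g x)) = Hk_sqnorm k U (\<lambda>x. a * weak_deriv U i f x + b * weak_deriv U i g x)"
      using Hk_sqnorm_cong_AE[OF Hk_lincomb[OF d(1)[OF i] d(2)[OF i] Suc.prems(3)], where g = "weak_deriv U i (\<lambda>x. a * f x + b * g x)"]
        weak_deriv_lincomb_AE[OF Suc.prems i, of a b] Suc.prems(3) by (simp add: eq_commute)
    then show ?thesis using Suc.IH[OF d(1)[OF i] d(2)[OF i] Suc.prems(3)] by simp
  qed
  then have "(\<Sum>i\<in>Basis. Hk_sqnorm k U (weak_deriv U i (\<lambda>x. a * f x + b * g x)))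
      \<le> (\<Sum>i\<in>Basis. 2 * a\<^sup>2 * Hk_sqnorm k U (weak_deriv U i f) + 2 * b\<^sup>2 * Hk_sqnorm k U (weak_deriv U i g))"
    by (rule sum_mono)
  then show ?case
    using L2_norm_add_power2[OF Hk_L2[OF Suc.prems(1)] Hk_L2[OF Suc.prems(2)], of a b]
    by (simp add: sum.distrib sum_distrib_left distrib_left algebra_simps)
qed

lemma Hk_sqnorm_cmult:
  "f \<in> Hk k U \<Longrightarrow> open U \<Longrightarrow> Hk_sqnorm k U (\<lambda>x. c * f x) = c\<^sup>2 * Hk_sqnorm k U f"
proof (induction k arbitrary: f)
  case 0
  then show ?case by (simp add: L2_norm_cmult power_mult_distrib)
next
  case (Suc k)
  note d = Hk_weak_deriv(2)[OF Suc.prems(1) _ Suc.prems(2)]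
  have "Hk_sqnorm k U (weak_deriv U i (\<lambda>x. c * f x)) = c\<^sup>2 * Hk_sqnorm k U (weak_deriv U i f)" if i: "i \<in> Basis" for i
  proof -
    have 1: "(\<lambda>x. c * weak_deriv U i f x) \<in> Hk k U" using Hk_lincomb[OF d[OF i] d[OF i] Suc.prems(2), of c 0] by simp
    have 2: "AE x in lebesgue_on U. c * weak_deriv U i f x = weak_deriv U i (\<lambda>x. c * f x) x"
      using weak_deriv_lincomb_AE[OF Suc.prems(1,1,2) i, of c 0] by (simp add: eq_commute)
    show ?thesis using Hk_sqnorm_cong_AE[OF 1 2 Suc.prems(2)] Suc.IH[OF d[OF i] Suc.prems(2)] by simp
  qed
  then show ?case by (simp add: L2_norm_cmult power_mult_distrib distrib_left sum_distrib_left)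
qed

lemma Hk_norm_power2: "(Hk_norm k U f)\<^sup>2 = Hk_sqnorm k U f"
  by (simp add: Hk_norm_def Hk_sqnorm_nonneg)

lemma Hk_norm_nonneg: "Hk_norm k U f \<ge> 0"
  by (simp add: Hk_norm_def Hk_sqnorm_nonneg)

lemma Hk_norm_cmult:
  "f \<in> Hk k U \<Longrightarrow> open U \<Longrightarrow> Hk_norm k U (\<lambda>x. c * f x) = \<bar>c\<bar> * Hk_norm k U f"
  by (simp add: Hk_norm_def Hk_sqnorm_cmult real_sqrt_mult)

lemma L2_norm_le_Hk_norm: "L2_norm U f \<le> Hk_norm k U f"
proof -
  have "(L2_norm U f)\<^sup>2 \<le> Hk_sqnorm k U f"
    by (cases k) (auto intro!: sum_nonneg Hk_sqnorm_nonneg)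
  then show ?thesis unfolding Hk_norm_def by (intro real_le_rsqrt)
qed

lemma Hk_norm_weak_deriv_le: "i \<in> Basis \<Longrightarrow> Hk_norm k U (weak_deriv U i f) \<le> Hk_norm (Suc k) U f"
  unfolding Hk_norm_def
proof (rule real_sqrt_le_mono)
  assume i: "i \<in> Basis"
  have "Hk_sqnorm k U (weak_deriv U i f) \<le> (\<Sum>i\<in>Basis. Hk_sqnorm k U (weak_deriv U i f))"
    using i by (intro member_le_sum) (auto simp: Hk_sqnorm_nonneg)
  then show "Hk_sqnorm k U (weak_deriv U i f) \<le> Hk_sqnorm (Suc k) U f" by (simp add: add_increasing)
qed

lemma test_functions_L2:
  assumes "\<phi> \<in> test_functions V" "U \<in> lmeasurable"
  shows "\<phi> \<in> L2 U"
proof -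
  obtain B where "\<And>x. \<bar>\<phi> x\<bar> \<le> B" using test_functions_bounded[OF assms(1)] by blast
  then show ?thesis
    using bounded_L2[OF assms(2) borel_measurable_lebesgue_onI[OF test_functions_borel[OF assms(1)]]] by blast
qed

lemma test_functions_Hk:
  "\<phi> \<in> test_functions V \<Longrightarrow> U \<in> lmeasurable \<Longrightarrow> open U \<Longrightarrow> \<phi> \<in> Hk k U"
proof (induction k arbitrary: \<phi>)
  case 0
  then show ?case by (simp add: test_functions_L2)
next
  case (Suc k)
  show ?case
    using Suc.IH[OF test_functions_derivative[OF Suc.prems(1)] Suc.prems(2,3)]
      has_weak_deriv_test[OF Suc.prems(3,1)] test_functions_L2[OF Suc.prems(1,2)] by auto
qed

lemma Hk_zero_norm: "f \<in> Hk k U \<Longrightarrow> open U \<Longrightarrow> Hk_norm k U (\<lambda>x. 0) = 0"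
  using Hk_norm_cmult[of f k U 0] by simp

lemma test_functions_Hk0:
  assumes "\<phi> \<in> test_functions U" "U \<in> lmeasurable" "open U"
  shows "\<phi> \<in> Hk0 k U"
  using test_functions_Hk[OF assms] Hk_zero_norm[OF test_functions_Hk[OF assms] assms(3)] assms
  by (auto simp: Hk0_def intro!: exI[of _ "\<lambda>n. \<phi>"])

lemma Hk0_Hk: "f \<in> Hk0 k U \<Longrightarrow> f \<in> Hk k U"
  by (simp add: Hk0_def)

lemma Hk0_lincomb:
  assumes "f \<in> Hk0 k U" "g \<in> Hk0 k U" "open U" "U \<in> lmeasurable"
  shows "(\<lambda>x. a * f x + b * g x) \<in> Hk0 k U"
proof -
  obtain \<phi> where \<phi>: "\<And>n. \<phi> n \<in> test_functions U" "(\<lambda>n. Hk_norm k U (\<lambda>x. \<phi> n x - f x)) \<longlonglongrightarrow> 0"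
    using assms(1) by (auto simp: Hk0_def)
  obtain \<theta> where \<theta>: "\<And>n. \<theta> n \<in> test_functions U" "(\<lambda>n. Hk_norm k U (\<lambda>x. \<theta> n x - g x)) \<longlonglongrightarrow> 0"
    using assms(2) by (auto simp: Hk0_def)
  have t: "(\<lambda>x. a * \<phi> n x + b * \<theta> n x) \<in> test_functions U" for n
    using test_functions_diff[OF test_functions_cmult[OF \<phi>(1)[of n], of a] test_functions_cmult[OF \<theta>(1)[of n], of "-b"]] by simp
  have d: "(\<lambda>x. F x - G x) \<in> Hk k U" if "F \<in> Hk k U" "G \<in> Hk k U" for F G
    using Hk_lincomb[OF that assms(3), of 1 "-1"] by simp
  note d1 = d[OF test_functions_Hk[OF \<phi>(1) assms(4,3)] Hk0_Hk[OF assms(1)]]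
  note d2 = d[OF test_functions_Hk[OF \<theta>(1) assms(4,3)] Hk0_Hk[OF assms(2)]]
  have "(\<lambda>n. 2 * a\<^sup>2 * (Hk_norm k U (\<lambda>x. \<phi> n x - f x))\<^sup>2 + 2 * b\<^sup>2 * (Hk_norm k U (\<lambda>x. \<theta> n x - g x))\<^sup>2) \<longlonglongrightarrow> 2 * a\<^sup>2 * 0\<^sup>2 + 2 * b\<^sup>2 * 0\<^sup>2"
    by (intro tendsto_intros \<phi>(2) \<theta>(2))
  then have l: "(\<lambda>n. 2 * a\<^sup>2 * Hk_sqnorm k U (\<lambda>x. \<phi> n x - f x) + 2 * b\<^sup>2 * Hk_sqnorm k U (\<lambda>x. \<theta> n x - g x)) \<longlonglongrightarrow> 0"
    by (simp add: Hk_norm_power2)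
  have "(\<lambda>n. Hk_sqnorm k U (\<lambda>x. (a * \<phi> n x + b * \<theta> n x) - (a * f x + b * g x))) \<longlonglongrightarrow> 0"
  proof (rule tendsto_sandwich[OF _ _ tendsto_const l])
    have "(\<lambda>x. (a * \<phi> n x + b * \<theta> n x) - (a * f x + b * g x)) = (\<lambda>x. a * (\<phi> n x - f x) + b * (\<theta> n x - g x))" for n
      by (simp add: algebra_simps)
    then show "\<forall>\<^sub>F n in sequentially. Hk_sqnorm k U (\<lambda>x. (a * \<phi> n x + b * \<theta> n x) - (a * f x + b * g x))
        \<le> 2 * a\<^sup>2 * Hk_sqnorm k U (\<lambda>x. \<phi> n x - f x) + 2 * b\<^sup>2 * Hk_sqnorm k U (\<lambda>x. \<theta> n x - g x)"
      using Hk_sqnorm_lincomb[OF d1 d2 assms(3)] by simp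
  qed (simp add: Hk_sqnorm_nonneg)
  from tendsto_real_sqrt[OF this]
  have "(\<lambda>n. Hk_norm k U (\<lambda>x. (a * \<phi> n x + b * \<theta> n x) - (a * f x + b * g x))) \<longlonglongrightarrow> 0"
    by (simp add: Hk_norm_def)
  then show ?thesis
    using t Hk_lincomb[OF Hk0_Hk[OF assms(1)] Hk0_Hk[OF assms(2)] assms(3)] unfolding Hk0_def
    by (intro CollectI conjI exI[of _ "\<lambda>n x. a * \<phi> n x + b * \<theta> n x"]) auto
qed

lemma Hk0_diff:
  "f \<in> Hk0 k U \<Longrightarrow> g \<in> Hk0 k U \<Longrightarrow> open U \<Longrightarrow> U \<in> lmeasurable \<Longrightarrow> (\<lambda>x. f x - g x) \<in> Hk0 k U"
  using Hk0_lincomb[of f k U g 1 "-1"] by simp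

lemma Hk0_cmult:
  "f \<in> Hk0 k U \<Longrightarrow> open U \<Longrightarrow> U \<in> lmeasurable \<Longrightarrow> (\<lambda>x. c * f x) \<in> Hk0 k U"
  using Hk0_lincomb[of f k U f c 0] by simp

lemma L2_norm_weak_deriv_diff_le:
  assumes "f \<in> Hk 2 U" "g \<in> Hk 2 U" "open U" "i \<in> Basis"
  shows "L2_norm U (\<lambda>x. weak_deriv U i f x - weak_deriv U i g x) \<le> Hk_norm 2 U (\<lambda>x. f x - g x)"
    and "j \<in> Basis \<Longrightarrow> L2_norm U (\<lambda>x. weak_deriv U j (weak_deriv U i f) x - weak_deriv U j (weak_deriv U i g) x)
      \<le> Hk_norm 2 U (\<lambda>x. f x - g x)"
proof -
  have H2: "f \<in> Hk (Suc (Suc 0)) U" "g \<in> Hk (Suc (Suc 0)) U" using assms(1,2) by (simp_all add: numeral_2_eq_2 del: Hk.simps)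
  note d = Hk_weak_deriv(2)[OF H2(1) assms(4,3)] Hk_weak_deriv(2)[OF H2(2) assms(4,3)]
  have e: "AE x in lebesgue_on U. weak_deriv U i (\<lambda>x. f x - g x) x = weak_deriv U i f x - weak_deriv U i g x"
    using weak_deriv_lincomb_AE[OF H2 assms(3,4), of 1 "-1"] by simp
  have H1: "(\<lambda>x. weak_deriv U i f x - weak_deriv U i g x) \<in> Hk (Suc 0) U"
    using Hk_lincomb[OF d assms(3), of 1 "-1"] by simp
  have n: "Hk_norm (Suc 0) U (\<lambda>x. weak_deriv U i f x - weak_deriv U i g x) \<le> Hk_norm 2 U (\<lambda>x. f x - g x)"
  proof -
    have "Hk_norm (Suc 0) U (weak_deriv U i (\<lambda>x. f x - g x)) = Hk_norm (Suc 0) U (\<lambda>x. weak_deriv U i f x - weak_deriv U i g x)"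
      unfolding Hk_norm_def using Hk_sqnorm_cong_AE[OF H1 _ assms(3)] e by (simp only: eq_commute)
    then show ?thesis using Hk_norm_weak_deriv_le[OF assms(4), of "Suc 0" U "\<lambda>x. f x - g x"] by (simp add: numeral_2_eq_2)
  qed
  then show "L2_norm U (\<lambda>x. weak_deriv U i f x - weak_deriv U i g x) \<le> Hk_norm 2 U (\<lambda>x. f x - g x)"
    using L2_norm_le_Hk_norm order_trans by blast
  assume j: "j \<in> Basis"
  have "AE x in lebesgue_on U. weak_deriv U j (\<lambda>x. weak_deriv U i f x - weak_deriv U i g x) x
      = weak_deriv U j (weak_deriv U i f) x - weak_deriv U j (weak_deriv U i g) x"
    using weak_deriv_lincomb_AE[OF d assms(3) j, of 1 "-1"] by simp
  from L2_norm_cong_AE[OF this] assms(3)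
  have "L2_norm U (\<lambda>x. weak_deriv U j (weak_deriv U i f) x - weak_deriv U j (weak_deriv U i g) x)
      = Hk_norm 0 U (weak_deriv U j (\<lambda>x. weak_deriv U i f x - weak_deriv U i g x))"
    by (simp add: Hk_norm_def L2_norm_nonneg)
  then show "L2_norm U (\<lambda>x. weak_deriv U j (weak_deriv U i f) x - weak_deriv U j (weak_deriv U i g) x) \<le> Hk_norm 2 U (\<lambda>x. f x - g x)"
    using Hk_norm_weak_deriv_le[OF j, of 0 U] n order_trans by metis
qed

lemma L2_norm_weak_deriv_le:
  "i \<in> Basis \<Longrightarrow> L2_norm U (weak_deriv U i f) \<le> Hk_norm 2 U f"
  "i \<in> Basis \<Longrightarrow> j \<in> Basis \<Longrightarrow> L2_norm U (weak_deriv U j (weak_deriv U i f)) \<le> Hk_norm 2 U f"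
  using order_trans[OF L2_norm_le_Hk_norm Hk_norm_weak_deriv_le[of i "Suc 0" U f]]
    order_trans[OF order_trans[OF L2_norm_le_Hk_norm Hk_norm_weak_deriv_le[of j 0 U "weak_deriv U i f"]]
      Hk_norm_weak_deriv_le[of i "Suc 0" U f]]
  by (auto simp: numeral_2_eq_2)

lemma Hk_dual_norm_bound:
  assumes l: "l \<in> Hk_dual k U" and v: "v \<in> Hk0 k U" and U: "open U" "U \<in> lmeasurable"
  shows "\<bar>l v\<bar> \<le> Hk_dual_norm k U l * Hk_norm k U v"
proof -
  obtain C where C: "\<And>v. v \<in> Hk0 k U \<Longrightarrow> \<bar>l v\<bar> \<le> C * Hk_norm k U v"
    using l unfolding Hk_dual_def by blast
  show ?thesis
  proof (cases "Hk_norm k U v = 0")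
    case True
    then show ?thesis using C[OF v] by simp
  next
    case False
    define N where "N = Hk_norm k U v"
    have N: "N > 0" using False Hk_norm_nonneg[of k U v] by (simp add: N_def)
    let ?w = "\<lambda>x. (1 / N) * v x"
    have w: "?w \<in> Hk0 k U" by (rule Hk0_cmult[OF v U])
    have nw: "Hk_norm k U ?w = 1" using Hk_norm_cmult[OF Hk0_Hk[OF v] U(1), of "1 / N"] N by (simp add: N_def)
    have bdd: "bdd_above ((\<lambda>v. \<bar>l v\<bar>) ` {v \<in> Hk0 k U. Hk_norm k U v \<le> 1})"
    proof (rule bdd_aboveI2)
      fix v assume v: "v \<in> {v \<in> Hk0 k U. Hk_norm k U v \<le> 1}"
      then have "\<bar>l v\<bar> \<le> C * Hk_norm k U v" using C by blast
      also have "\<dots> \<le> \<bar>C\<bar> * 1" using v Hk_norm_nonneg[of k U v] by (intro mult_mono) auto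
      finally show "\<bar>l v\<bar> \<le> \<bar>C\<bar>" by simp
    qed
    have "\<bar>l ?w\<bar> \<le> Hk_dual_norm k U l"
      unfolding Hk_dual_norm_def using w nw by (intro cSUP_upper[OF _ bdd]) simp
    moreover have "l ?w = (1 / N) * l v"
    proof -
      have "l (\<lambda>x. (1 / N) * v x + 0 * v x) = (1 / N) * l v + 0 * l v"
        using l v unfolding Hk_dual_def by blast
      then show ?thesis by simp
    qed
    ultimately have "\<bar>l v\<bar> / N \<le> Hk_dual_norm k U l" using N by (simp add: abs_mult)
    then show ?thesis using N by (simp add: N_def divide_le_eq)
  qed
qed

lemma Hk_dual_diff:
  assumes "l \<in> Hk_dual k U" "m \<in> Hk_dual k U"
  shows "(\<lambda>v. l v - m v) \<in> Hk_dual k U"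
proof -
  obtain C where C: "\<And>v. v \<in> Hk0 k U \<Longrightarrow> \<bar>l v\<bar> \<le> C * Hk_norm k U v"
    using assms(1) unfolding Hk_dual_def by blast
  obtain D where D: "\<And>v. v \<in> Hk0 k U \<Longrightarrow> \<bar>m v\<bar> \<le> D * Hk_norm k U v"
    using assms(2) unfolding Hk_dual_def by blast
  have "\<bar>l v - m v\<bar> \<le> (C + D) * Hk_norm k U v" if "v \<in> Hk0 k U" for v
    using C[OF that] D[OF that] by (simp add: distrib_right)
  moreover have "l (\<lambda>x. a * v x + c * w x) - m (\<lambda>x. a * v x + c * w x) = a * (l v - m v) + c * (l w - m w)"
    if "v \<in> Hk0 k U" "w \<in> Hk0 k U" for a c v w
  proof -
    have "l (\<lambda>x. a * v x + c * w x) = a * l v + c * l w" "m (\<lambda>x. a * v x + c * w x) = a * m v + c * m w"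
      using assms that unfolding Hk_dual_def by blast+
    then show ?thesis by (simp add: algebra_simps)
  qed
  ultimately show ?thesis unfolding Hk_dual_def by blast
qed

section \<open>Functions on the cylinder with values in a Sobolev space\<close>

lemma measurable_lebesgue_snd:
  fixes f :: "'b::euclidean_space \<Rightarrow> real" and A :: "'a::euclidean_space set"
  assumes A: "A \<in> sets borel" and B: "B \<in> sets borel" and f: "f \<in> borel_measurable (lebesgue_on B)"
  shows "(\<lambda>z. f (snd z)) \<in> borel_measurable (lebesgue_on (A \<times> B))"
proof -
  note C = prod_sets_borel[OF A B]
  have B': "B \<in> sets lebesgue" and C': "A \<times> B \<in> sets lebesgue" using B C by auto
  obtain g where g: "g \<in> borel_measurable borel" "AE x in lebesgue_on B. f x = g x"
    by (rule borel_representative[OF B f]) auto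
  obtain N where N: "N \<in> null_sets lborel" "{t. \<not> (t \<in> B \<longrightarrow> f t = g t)} \<subseteq> N"
    using g(2) unfolding AE_lebesgue_on_iff[OF B'] by (auto simp: eventually_ae_filter)
  have sb: "(snd :: 'a \<times> 'b \<Rightarrow> 'b) \<in> borel_measurable borel"
    by (intro borel_measurable_continuous_onI continuous_on_snd continuous_on_id)
  have "AE z in (lborel :: ('a \<times> 'b) measure). snd z \<notin> N"
  proof (rule AE_lborel_prodI)
    show "{z :: 'a \<times> 'b. snd z \<notin> N} \<in> sets borel"
      using measurable_sets[OF sb, of "- N"] null_setsD2[OF N(1)] by (simp add: borel_comp vimage_def)
    show "AE t in lborel. AE x in lborel. snd (x :: 'a, t) \<notin> N"
      using AE_not_in[OF N(1)] by (elim eventually_mono) simp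
  qed
  then have ae: "AE z in lebesgue_on (A \<times> B). g (snd z) = f (snd z)"
    unfolding AE_lebesgue_on_iff[OF C'] by (elim eventually_mono) (use N(2) in auto)
  have "(\<lambda>z. g (snd z)) \<in> borel_measurable (lebesgue_on (A \<times> B))"
    by (rule borel_measurable_lebesgue_onI[OF measurable_compose[OF sb g(1)]])
  from borel_measurable_lebesgue_on_cong_AE[OF this ae C'] show ?thesis .
qed

locale bounded_cylinder =
  fixes \<Omega> :: "(real^3) set" and T :: real
  assumes open_\<Omega>: "open \<Omega>" and bounded_\<Omega>: "bounded \<Omega>"
begin

abbreviation "I \<equiv> {0<..<T}"
abbreviation "Q \<equiv> cylinder \<Omega> T"

lemma sets_borel: "\<Omega> \<in> sets borel" "I \<in> sets borel" "Q \<in> sets borel"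
  and sets_lebesgue: "\<Omega> \<in> sets lebesgue" "I \<in> sets lebesgue" "Q \<in> sets lebesgue"
  and open_Q: "open Q"
  and lmeasurable: "\<Omega> \<in> lmeasurable" "I \<in> lmeasurable" "Q \<in> lmeasurable"
proof -
  show o: "open Q" unfolding cylinder_def using open_\<Omega> by (intro open_Times) auto
  have b: "bounded Q" unfolding cylinder_def using bounded_\<Omega> by (intro bounded_Times) auto
  show "\<Omega> \<in> sets borel" "I \<in> sets borel" "Q \<in> sets borel" using open_\<Omega> o by auto
  then show "\<Omega> \<in> sets lebesgue" "I \<in> sets lebesgue" "Q \<in> sets lebesgue" by auto
  show "\<Omega> \<in> lmeasurable" "I \<in> lmeasurable" "Q \<in> lmeasurable"
    using lmeasurable_open open_\<Omega> bounded_\<Omega> o b by auto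
qed

lemma finite_measures: "finite_measure (lebesgue_on \<Omega>)" "finite_measure (lebesgue_on I)" "finite_measure (lebesgue_on Q)"
  using lmeasurable finite_measure_lebesgue_on by auto

lemmas AE_slices = AE_lebesgue_slices[OF sets_borel(1,2), folded cylinder_def]
lemmas int_slices = integrable_slices[OF sets_borel(1,2), folded cylinder_def]
lemmas int_by_slices = integrable_product_by_slices[OF sets_borel(1,2), folded cylinder_def]
lemmas AE_Q_eqI = AE_product_eqI[OF sets_borel(1,2), folded cylinder_def]
lemmas AE_fst = AE_lebesgue_fst[OF sets_borel(1,2), folded cylinder_def]
lemmas meas_fst = measurable_lebesgue_fst[OF sets_borel(1,2), folded cylinder_def]
lemmas meas_snd = measurable_lebesgue_snd[OF sets_borel(1,2), folded cylinder_def]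
lemmas int_fst = integrable_lebesgue_fst[OF sets_borel(1,2) _ lmeasurable(2), folded cylinder_def]
lemmas meas_prim = time_primitive_measurable[OF sets_borel(1,2), folded cylinder_def]

lemma simple_joint_measurable:
  fixes s :: "real \<Rightarrow> real^3 \<Rightarrow> real"
  assumes s: "simple_function (lebesgue_on I) s" and m: "\<And>t. t \<in> I \<Longrightarrow> s t \<in> borel_measurable (lebesgue_on \<Omega>)"
  shows "(\<lambda>z. s (snd z) (fst z)) \<in> borel_measurable (lebesgue_on Q)"
proof -
  have fin: "finite (s ` I)" using simple_functionD(1)[OF s] by simp
  have ind: "(\<lambda>t. indicator (s -` {c} \<inter> I) t :: real) \<in> borel_measurable (lebesgue_on I)" for c
    using simple_functionD(2)[OF s, of "{c}"] by simp
  have "(\<lambda>z. \<Sum>c\<in>s ` I. indicator (s -` {c} \<inter> I) (snd z) * c (fst z)) \<in> borel_measurable (lebesgue_on Q)"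
    using m by (intro borel_measurable_sum borel_measurable_times meas_snd[OF ind] meas_fst) auto
  moreover have "(\<Sum>c\<in>s ` I. indicator (s -` {c} \<inter> I) (snd z) * c (fst z)) = s (snd z) (fst z)" if "z \<in> Q" for z
  proof -
    have z: "snd z \<in> I" using that by (auto simp: cylinder_def)
    have "(\<Sum>c\<in>s ` I. indicator (s -` {c} \<inter> I) (snd z) * c (fst z)) = (\<Sum>c\<in>s ` I. if c = s (snd z) then c (fst z) else 0)"
      using z by (intro sum.cong) (auto simp: indicator_def)
    also have "\<dots> = s (snd z) (fst z)" using z fin by (simp add: sum.delta)
    finally show ?thesis .
  qed
  ultimately show ?thesis by (subst measurable_lebesgue_cong) (auto simp: eq_commute)
qed

lemma abs_arctan_diff_le: "\<bar>arctan a - arctan b\<bar> \<le> \<bar>a - b\<bar>"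
  using Lipschitz_if_bounded_derivative[of arctan "\<lambda>x. inverse (1 + x\<^sup>2)" 1 a b] DERIV_arctan
  by (simp add: inverse_le_1_iff abs_of_nonneg)

lemma abs_arctan_le: "\<bar>arctan a\<bar> \<le> pi / 2"
  using arctan_bounded[of a] by linarith

lemma L2_norm_L1:
  assumes "f \<in> L2 \<Omega>"
  shows "(\<integral>x. \<bar>f x\<bar> \<partial>lebesgue_on \<Omega>) \<le> L2_norm \<Omega> f * L2_norm \<Omega> (\<lambda>x. 1)"
proof -
  have a: "(\<lambda>x. \<bar>f x\<bar>) \<in> L2 \<Omega>" using assms by (auto simp: L2_def)
  have o: "(\<lambda>x. 1) \<in> L2 \<Omega>" by (rule bounded_L2[OF lmeasurable(1)]) auto
  show ?thesis using L2_Cauchy_Schwarz[OF a o] by (simp add: L2_norm_def)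
qed

text \<open>The limits at the individual times are only equivalence classes and need not fit together to a
  measurable function on the cylinder. Composed with the bounded function \<^term>\<open>arctan\<close>, however, the sequence is
  Cauchy in \<open>L\<^sup>1\<close> of the cylinder without any bound that is uniform in time, hence a subsequence converges almost
  everywhere, and the tangent of its limit is a jointly measurable representative.\<close>

lemma joint_L2_limit:
  fixes s :: "nat \<Rightarrow> real \<Rightarrow> real^3 \<Rightarrow> real"
  assumes s: "\<And>n. simple_function (lebesgue_on I) (s n)" "\<And>n t. t \<in> I \<Longrightarrow> s n t \<in> L2 \<Omega>"
    and v: "AE t in lebesgue_on I. v t \<in> L2 \<Omega> \<and> (\<lambda>n. L2_norm \<Omega> (\<lambda>x. s n t x - v t x)) \<longlonglongrightarrow> 0"
  obtains F where "F \<in> borel_measurable (lebesgue_on Q)"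
    "AE t in lebesgue_on I. AE x in lebesgue_on \<Omega>. F (x, t) = v t x"
proof -
  interpret f\<Omega>: finite_measure "lebesgue_on \<Omega>" by (rule finite_measures)
  interpret fI: finite_measure "lebesgue_on I" by (rule finite_measures)
  have arc: "arctan \<in> borel_measurable borel"
    by (intro borel_measurable_continuous_onI continuous_on_arctan continuous_on_id)
  define f where "f n z = arctan (s n (snd z) (fst z))" for n z
  have fm: "f n \<in> borel_measurable (lebesgue_on Q)" for n
    unfolding f_def[abs_def]
    by (rule measurable_compose[OF simple_joint_measurable[OF s(1) L2_measurable[OF s(2)]] arc])
  have fi: "integrable (lebesgue_on Q) (f n)" for n
    by (rule L2_integrable[OF lmeasurable(3) bounded_L2[OF lmeasurable(3) fm, of _ "pi/2"]])
       (simp only: f_def abs_arctan_le)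
  have ti: "integrable (lebesgue_on \<Omega>) (\<lambda>x. arctan (g x))" if "g \<in> L2 \<Omega>" for g
    by (rule L2_integrable[OF lmeasurable(1) bounded_L2[OF lmeasurable(1) measurable_compose[OF L2_measurable[OF that] arc], of "pi/2"]])
       (simp only: abs_arctan_le)
  define q where "q i j t = (\<integral>x. \<bar>f i (x, t) - f j (x, t)\<bar> \<partial>lebesgue_on \<Omega>)" for i j t
  define r where "r i t = (\<integral>x. \<bar>f i (x, t) - arctan (v t x)\<bar> \<partial>lebesgue_on \<Omega>)" for i t
  have fij: "integrable (lebesgue_on Q) (\<lambda>z. \<bar>f i z - f j z\<bar>)" for i j using fi[of i] fi[of j] by auto
  have qi: "integrable (lebesgue_on I) (q i j)" for i j
    unfolding q_def[abs_def] using int_slices(2)[OF fij] .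
  have qint: "(\<integral>z. \<bar>f i z - f j z\<bar> \<partial>lebesgue_on Q) = (\<integral>t. q i j t \<partial>lebesgue_on I)" for i j
    unfolding q_def using int_slices(3)[OF fij, of i j] by simp
  have good: "AE t in lebesgue_on I. (\<forall>i. (\<lambda>j. q i j t) \<longlonglongrightarrow> r i t) \<and> (\<lambda>i. r i t) \<longlonglongrightarrow> 0 \<and>
      (\<forall>i j. q i j t \<le> r i t + r j t) \<and> (\<forall>i. r i t \<in> {0..pi * measure (lebesgue_on \<Omega>) \<Omega>})"
    using v AE_space
  proof eventually_elim
    case (elim t)
    then have t: "t \<in> I" and vt: "v t \<in> L2 \<Omega>" and lim: "(\<lambda>n. L2_norm \<Omega> (\<lambda>x. s n t x - v t x)) \<longlonglongrightarrow> 0" by auto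
    have i: "integrable (lebesgue_on \<Omega>) (\<lambda>x. f n (x, t))" for n
      unfolding f_def using ti[OF s(2)[OF t]] by simp
    have iv: "integrable (lebesgue_on \<Omega>) (\<lambda>x. arctan (v t x))" by (rule ti[OF vt])
    have r1: "r n t \<le> L2_norm \<Omega> (\<lambda>x. s n t x - v t x) * L2_norm \<Omega> (\<lambda>x. 1)" for n
    proof -
      have d: "(\<lambda>x. s n t x - v t x) \<in> L2 \<Omega>" using L2_diff[OF s(2)[OF t] vt] .
      have "r n t \<le> (\<integral>x. \<bar>s n t x - v t x\<bar> \<partial>lebesgue_on \<Omega>)"
        unfolding r_def using i iv L2_integrable[OF lmeasurable(1) d]
        by (intro integral_mono) (auto simp: f_def abs_arctan_diff_le)
      then show ?thesis using L2_norm_L1[OF d] by linarith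
    qed
    have r0: "r n t \<ge> 0" for n by (simp add: r_def)
    have rl: "(\<lambda>i. r i t) \<longlonglongrightarrow> 0"
    proof (rule tendsto_sandwich[OF _ _ tendsto_const])
      show "(\<lambda>n. L2_norm \<Omega> (\<lambda>x. s n t x - v t x) * L2_norm \<Omega> (\<lambda>x. 1)) \<longlonglongrightarrow> 0"
        using tendsto_mult_right[OF lim, of "L2_norm \<Omega> (\<lambda>x. 1)"] by simp
    qed (use r0 r1 in auto)
    have qr: "q a b t \<le> r a t + r b t" for a b
    proof -
      have "q a b t \<le> (\<integral>x. \<bar>f a (x, t) - arctan (v t x)\<bar> + \<bar>f b (x, t) - arctan (v t x)\<bar> \<partial>lebesgue_on \<Omega>)"
        unfolding q_def using i iv by (intro integral_mono) auto
      also have "\<dots> = r a t + r b t" unfolding r_def using i iv by (intro Bochner_Integration.integral_add) auto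
      finally show ?thesis .
    qed
    have rq: "r a t \<le> q a b t + r b t" for a b
    proof -
      have "r a t \<le> (\<integral>x. \<bar>f a (x, t) - f b (x, t)\<bar> + \<bar>f b (x, t) - arctan (v t x)\<bar> \<partial>lebesgue_on \<Omega>)"
        unfolding r_def using i iv by (intro integral_mono) auto
      also have "\<dots> = q a b t + r b t" unfolding r_def q_def using i iv by (intro Bochner_Integration.integral_add) auto
      finally show ?thesis .
    qed
    have "(\<lambda>j. q a j t) \<longlonglongrightarrow> r a t" for a
    proof (rule LIM_zero_cancel, rule tendsto_0_le[OF rl, of _ 1])
      show "\<forall>\<^sub>F j in sequentially. norm (q a j t - r a t) \<le> norm (r j t) * 1"
        using qr[of a] rq[of a] r0 by (auto simp: abs_le_iff algebra_simps)
    qed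
    moreover have "r a t \<in> {0..pi * measure (lebesgue_on \<Omega>) \<Omega>}" for a
    proof -
      have b: "\<bar>arctan c - arctan d\<bar> \<le> pi" for c d
        using abs_arctan_le[of c] abs_arctan_le[of d] by linarith
      have "r a t \<le> (\<integral>x. pi \<partial>lebesgue_on \<Omega>)"
        unfolding r_def using i iv b by (intro integral_mono) (auto simp: f_def)
      then show ?thesis using r0 by (simp add: mult.commute)
    qed
    ultimately show ?case using rl qr by blast
  qed
  have rm: "r i \<in> borel_measurable (lebesgue_on I)" for i
  proof (rule borel_measurable_lebesgue_on_cong_AE[OF _ _ sets_lebesgue(2)])
    show "(\<lambda>t. lim (\<lambda>j. q i j t)) \<in> borel_measurable (lebesgue_on I)"
      using qi[of i] by (intro borel_measurable_lim_metric) auto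
    show "AE t in lebesgue_on I. lim (\<lambda>j. q i j t) = r i t"
      using good by (elim eventually_mono) (auto intro: limI)
  qed
  have ri: "integrable (lebesgue_on I) (r i)" for i
    by (rule fI.integrable_const_bound[of _ "pi * measure (lebesgue_on \<Omega>) \<Omega>"])
       (use good rm in \<open>auto elim: eventually_mono\<close>)
  have "(\<lambda>i. \<integral>t. r i t \<partial>lebesgue_on I) \<longlonglongrightarrow> (\<integral>t. 0 \<partial>lebesgue_on I)"
  proof (rule integral_dominated_convergence[where w = "\<lambda>t. pi * measure (lebesgue_on \<Omega>) \<Omega>"])
    show "AE t in lebesgue_on I. (\<lambda>i. r i t) \<longlonglongrightarrow> 0" using good by (elim eventually_mono) auto
    show "AE t in lebesgue_on I. norm (r i t) \<le> pi * measure (lebesgue_on \<Omega>) \<Omega>" for i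
      using good by (elim eventually_mono) auto
  qed (use rm in auto)
  then have rlim: "(\<lambda>i. \<integral>t. r i t \<partial>lebesgue_on I) \<longlonglongrightarrow> 0" by simp
  have "\<exists>N. \<forall>i\<ge>N. \<forall>j\<ge>N. (LINT z|lebesgue_on Q. norm (f i z - f j z)) < e" if e: "e > 0" for e
  proof -
    have "eventually (\<lambda>i. (\<integral>t. r i t \<partial>lebesgue_on I) < e/2) sequentially"
      using rlim e by (intro order_tendstoD) auto
    then obtain N where N: "\<And>i. i \<ge> N \<Longrightarrow> (\<integral>t. r i t \<partial>lebesgue_on I) < e/2"
      by (auto simp: eventually_sequentially)
    have "(LINT z|lebesgue_on Q. norm (f i z - f j z)) < e" if "i \<ge> N" "j \<ge> N" for i j
    proof -
      have "(\<integral>t. q i j t \<partial>lebesgue_on I) \<le> (\<integral>t. r i t + r j t \<partial>lebesgue_on I)"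
        using qi ri good by (intro integral_mono_AE) (auto elim: eventually_mono)
      also have "\<dots> = (\<integral>t. r i t \<partial>lebesgue_on I) + (\<integral>t. r j t \<partial>lebesgue_on I)" using ri by simp
      also have "\<dots> < e" using N[OF that(1)] N[OF that(2)] by linarith
      finally show ?thesis using qint[of i j] by simp
    qed
    then show ?thesis by blast
  qed
  from cauchy_L1_AE_cauchy_subseq[OF fi this]
  obtain k where k: "strict_mono k" "AE z in lebesgue_on Q. Cauchy (\<lambda>i. f (k i) z)" by blast
  define F0 where "F0 z = lim (\<lambda>i. f (k i) z)" for z
  have F0m: "F0 \<in> borel_measurable (lebesgue_on Q)"
    unfolding F0_def[abs_def] using fm by (intro borel_measurable_lim_metric)
  have "AE z in lebesgue_on Q. (\<lambda>i. f (k i) z) \<longlonglongrightarrow> F0 z"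
    using k(2) by (elim eventually_mono) (simp add: F0_def Cauchy_convergent_iff convergent_LIMSEQ_iff)
  note conv = AE_slices(2)[OF this]
  have tanm: "tan \<in> borel_measurable (borel :: real measure)"
    unfolding tan_def[abs_def]
    by (intro borel_measurable_divide borel_measurable_continuous_onI continuous_intros)
  show ?thesis
  proof (rule that[of "\<lambda>z. tan (F0 z)"])
    show "(\<lambda>z. tan (F0 z)) \<in> borel_measurable (lebesgue_on Q)" by (rule measurable_compose[OF F0m tanm])
    show "AE t in lebesgue_on I. AE x in lebesgue_on \<Omega>. tan (F0 (x, t)) = v t x"
      using conv good v AE_space
    proof eventually_elim
      case (elim t)
      then have t: "t \<in> I" and vt: "v t \<in> L2 \<Omega>" by auto
      have "integrable (lebesgue_on \<Omega>) (\<lambda>x. f (k n) (x, t) - arctan (v t x))" for n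
        unfolding f_def using ti[OF s(2)[OF t]] ti[OF vt] by simp
      moreover have "(\<lambda>n. \<integral>x. norm (f (k n) (x, t) - arctan (v t x)) \<partial>lebesgue_on \<Omega>) \<longlonglongrightarrow> 0"
        using LIMSEQ_subseq_LIMSEQ[OF _ k(1), of "\<lambda>i. r i t" 0] elim by (simp add: r_def o_def)
      ultimately obtain m where m: "strict_mono m" "AE x in lebesgue_on \<Omega>. (\<lambda>n. f (k (m n)) (x, t) - arctan (v t x)) \<longlonglongrightarrow> 0"
        using tendsto_L1_AE_subseq[of "lebesgue_on \<Omega>" "\<lambda>n x. f (k n) (x, t) - arctan (v t x)"] by blast
      show ?case using elim(1) m(2)
      proof eventually_elim
        case (elim x)
        have "(\<lambda>n. f (k (m n)) (x, t)) \<longlonglongrightarrow> F0 (x, t)"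
          using LIMSEQ_subseq_LIMSEQ[OF elim(1) m(1)] by (simp add: o_def)
        moreover have "(\<lambda>n. f (k (m n)) (x, t)) \<longlonglongrightarrow> arctan (v t x)" using elim(2) by (rule LIM_zero_cancel)
        ultimately have "F0 (x, t) = arctan (v t x)" by (rule LIMSEQ_unique)
        then show ?case by (simp add: tan_arctan)
      qed
    qed
  qed
qed

lemma L2_Q_if_slices_bounded:
  assumes F: "F \<in> borel_measurable (lebesgue_on Q)"
    and w: "integrable (lebesgue_on I) (\<lambda>t. (w t)\<^sup>2)"
    and v: "AE t in lebesgue_on I. AE x in lebesgue_on \<Omega>. F (x, t) = v t x"
    and b: "AE t in lebesgue_on I. v t \<in> L2 \<Omega> \<and> L2_norm \<Omega> (v t) \<le> w t"
  shows "F \<in> L2 Q"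
proof -
  have "integrable (lebesgue_on Q) (\<lambda>z. (F z)\<^sup>2)"
  proof (rule int_by_slices[OF _ _ w])
    show "(\<lambda>z. (F z)\<^sup>2) \<in> borel_measurable (lebesgue_on Q)" using F by measurable
    show "AE t in lebesgue_on I. integrable (lebesgue_on \<Omega>) (\<lambda>x. (F (x, t))\<^sup>2)"
      using v b
    proof eventually_elim
      case (elim t)
      have "AE x in lebesgue_on \<Omega>. v t x = F (x, t)" using elim(1) by (simp add: eq_commute)
      from L2_cong_AE[OF _ this sets_lebesgue(1)] elim(2) show ?case by (simp add: L2_def)
    qed
    show "AE t in lebesgue_on I. (\<integral>x. \<bar>(F (x, t))\<^sup>2\<bar> \<partial>lebesgue_on \<Omega>) \<le> (w t)\<^sup>2"
      using v b
    proof eventually_elim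
      case (elim t)
      have "(\<integral>x. \<bar>(F (x, t))\<^sup>2\<bar> \<partial>lebesgue_on \<Omega>) = (L2_norm \<Omega> (\<lambda>x. F (x, t)))\<^sup>2" by (simp add: L2_norm_power2)
      also have "L2_norm \<Omega> (\<lambda>x. F (x, t)) = L2_norm \<Omega> (v t)"
        using L2_norm_cong_AE[OF elim(1) sets_lebesgue(1)] by simp
      also have "(L2_norm \<Omega> (v t))\<^sup>2 \<le> (w t)\<^sup>2" using elim(2) L2_norm_nonneg by (intro power_mono) auto
      finally show ?case .
    qed
  qed
  then show ?thesis using F by (simp add: L2_def)
qed

text \<open>A test function on the cylinder is a test function in space at every time; integrate the slicewise
  identities over time.\<close>

lemma has_weak_deriv_from_slices:
  assumes f: "f \<in> L2 Q" and F: "F \<in> L2 Q"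
    and sl: "AE t in lebesgue_on I. has_weak_deriv \<Omega> e (\<lambda>x. f (x, t)) (\<lambda>x. F (x, t))"
  shows "has_weak_deriv Q (e, 0) f F"
  unfolding has_weak_deriv_def
proof (intro conjI ballI)
  show l: "locally_integrable Q f" "locally_integrable Q F"
    using L2_locally_integrable[OF _ lmeasurable(3)] f F by auto
  fix \<phi> assume t: "\<phi> \<in> test_functions Q"
  have t': "\<phi> \<in> test_functions (\<Omega> \<times> I)" using t by (simp add: cylinder_def)
  have i1: "integrable (lebesgue_on Q) (\<lambda>z. f z * frechet_derivative \<phi> (at z) (e, 0))"
    by (rule locally_integrable_mult_test[OF l(1) sets_lebesgue(3) test_functions_derivative[OF t]])
  have i2: "integrable (lebesgue_on Q) (\<lambda>z. F z * \<phi> z)"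
    by (rule locally_integrable_mult_test[OF l(2) sets_lebesgue(3) t])
  have "(LINT z|lebesgue_on Q. f z * frechet_derivative \<phi> (at z) (e, 0))
      = (\<integral>t. \<integral>x. f (x, t) * frechet_derivative \<phi> (at (x, t)) (e, 0) \<partial>lebesgue_on \<Omega> \<partial>lebesgue_on I)"
    using int_slices(3)[OF i1] by simp
  also have "\<dots> = (\<integral>t. - (\<integral>x. F (x, t) * \<phi> (x, t) \<partial>lebesgue_on \<Omega>) \<partial>lebesgue_on I)"
  proof (rule integral_cong_AE)
    show "(\<lambda>t. \<integral>x. f (x, t) * frechet_derivative \<phi> (at (x, t)) (e, 0) \<partial>lebesgue_on \<Omega>) \<in> borel_measurable (lebesgue_on I)"
      using int_slices(2)[OF i1] by auto
    show "(\<lambda>t. - (\<integral>x. F (x, t) * \<phi> (x, t) \<partial>lebesgue_on \<Omega>)) \<in> borel_measurable (lebesgue_on I)"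
      using int_slices(2)[OF i2] by auto
    show "AE t in lebesgue_on I. (\<integral>x. f (x, t) * frechet_derivative \<phi> (at (x, t)) (e, 0) \<partial>lebesgue_on \<Omega>)
        = - (\<integral>x. F (x, t) * \<phi> (x, t) \<partial>lebesgue_on \<Omega>)"
      using sl
    proof eventually_elim
      case (elim s)
      then show ?case
        using test_functions_slice[OF t', of s] frechet_derivative_slice[OF t, of s]
        by (auto simp: has_weak_deriv_def)
    qed
  qed
  also have "\<dots> = - (LINT z|lebesgue_on Q. F z * \<phi> z)"
    using int_slices(3)[OF i2] by simp
  finally show "(LINT z|lebesgue_on Q. f z * frechet_derivative \<phi> (at z) (e, 0)) = - (LINT z|lebesgue_on Q. F z * \<phi> z)" .
qed

abbreviation "dir i \<equiv> (axis i 1 :: real^3)"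
abbreviation "DQ i \<equiv> weak_deriv Q (dir i, 0)"
abbreviation "D\<Omega> i \<equiv> weak_deriv \<Omega> (dir i)"

lemma dir_Basis: "dir i \<in> Basis"
  by (simp add: axis_in_Basis_iff)

lemma Hk2D:
  assumes "f \<in> Hk 2 \<Omega>"
  shows "has_weak_deriv \<Omega> (dir i) f (D\<Omega> i f)" "D\<Omega> i f \<in> L2 \<Omega>"
    "has_weak_deriv \<Omega> (dir j) (D\<Omega> i f) (D\<Omega> j (D\<Omega> i f))" "D\<Omega> j (D\<Omega> i f) \<in> L2 \<Omega>"
proof -
  have f: "f \<in> Hk (Suc (Suc 0)) \<Omega>" using assms by (simp add: numeral_2_eq_2 del: Hk.simps)
  note 1 = Hk_weak_deriv[OF f dir_Basis open_\<Omega>, of i]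
  show "has_weak_deriv \<Omega> (dir i) f (D\<Omega> i f)" "D\<Omega> i f \<in> L2 \<Omega>"
    using 1 Hk_L2 by auto
  show "has_weak_deriv \<Omega> (dir j) (D\<Omega> i f) (D\<Omega> j (D\<Omega> i f))" "D\<Omega> j (D\<Omega> i f) \<in> L2 \<Omega>"
    using Hk_weak_deriv[OF 1(2) dir_Basis open_\<Omega>, of j] by auto
qed

lemma L2_H20_slices:
  assumes "\<phi> \<in> L2_H20 \<Omega> T"
  obtains s where "\<And>n. simple_function (lebesgue_on I) (s n)" "\<And>n t. t \<in> I \<Longrightarrow> s n t \<in> Hk0 2 \<Omega>"
    "AE t in lebesgue_on I. (\<lambda>n. Hk_norm 2 \<Omega> (\<lambda>x. s n t x - \<phi> (x, t))) \<longlonglongrightarrow> 0"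
    "AE t in lebesgue_on I. slice \<phi> t \<in> Hk0 2 \<Omega>"
    "integrable (lebesgue_on I) (\<lambda>t. (Hk_norm 2 \<Omega> (slice \<phi> t))\<^sup>2)"
proof -
  have b: "bochner_measurable T (Hk0 2 \<Omega>) (Hk_norm 2 \<Omega>) (slice \<phi>)"
    "integrable (lebesgue_on I) (\<lambda>t. (Hk_norm 2 \<Omega> (slice \<phi> t))\<^sup>2)"
    using assms by (auto simp: L2_H20_def bochner_Lp_def)
  then obtain s where "\<And>n. simple_function (lebesgue_on I) (s n) \<and> s n ` I \<subseteq> Hk0 2 \<Omega>"
    "AE t in lebesgue_on I. (\<lambda>n. Hk_norm 2 \<Omega> (\<lambda>x. s n t x - slice \<phi> t x)) \<longlonglongrightarrow> 0"
    "AE t in lebesgue_on I. slice \<phi> t \<in> Hk0 2 \<Omega>"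
    unfolding bochner_measurable_def by blast
  then show ?thesis using that[of s] b(2) by (simp add: slice_def image_subset_iff)
qed

text \<open>The operator \<open>P\<close> stands for a spatial derivative of order one or two.\<close>

lemma L2_H20_joint_derivatives:
  assumes \<phi>: "\<phi> \<in> L2_H20 \<Omega> T"
    and P: "\<And>f. f \<in> Hk 2 \<Omega> \<Longrightarrow> P f \<in> L2 \<Omega>"
    and Pb: "\<And>f. f \<in> Hk 2 \<Omega> \<Longrightarrow> L2_norm \<Omega> (P f) \<le> Hk_norm 2 \<Omega> f"
    and Pd: "\<And>f g. f \<in> Hk 2 \<Omega> \<Longrightarrow> g \<in> Hk 2 \<Omega> \<Longrightarrow> L2_norm \<Omega> (\<lambda>x. P f x - P g x) \<le> Hk_norm 2 \<Omega> (\<lambda>x. f x - g x)"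
  obtains F where "F \<in> L2 Q" "AE t in lebesgue_on I. AE x in lebesgue_on \<Omega>. F (x, t) = P (slice \<phi> t) x"
proof -
  obtain s where s: "\<And>n. simple_function (lebesgue_on I) (s n)" "\<And>n t. t \<in> I \<Longrightarrow> s n t \<in> Hk0 2 \<Omega>"
    "AE t in lebesgue_on I. (\<lambda>n. Hk_norm 2 \<Omega> (\<lambda>x. s n t x - \<phi> (x, t))) \<longlonglongrightarrow> 0"
    "AE t in lebesgue_on I. slice \<phi> t \<in> Hk0 2 \<Omega>"
    "integrable (lebesgue_on I) (\<lambda>t. (Hk_norm 2 \<Omega> (slice \<phi> t))\<^sup>2)"
    using L2_H20_slices[OF \<phi>] by blast
  have L: "AE t in lebesgue_on I. P (slice \<phi> t) \<in> L2 \<Omega> \<and> L2_norm \<Omega> (P (slice \<phi> t)) \<le> Hk_norm 2 \<Omega> (slice \<phi> t)"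
    using s(4) by (elim eventually_mono) (use P Pb Hk0_Hk in blast)
  have "AE t in lebesgue_on I. P (slice \<phi> t) \<in> L2 \<Omega> \<and> (\<lambda>n. L2_norm \<Omega> (\<lambda>x. P (s n t) x - P (slice \<phi> t) x)) \<longlonglongrightarrow> 0"
    using L s(3,4) AE_space
  proof eventually_elim
    case (elim t)
    have "(\<lambda>n. L2_norm \<Omega> (\<lambda>x. P (s n t) x - P (slice \<phi> t) x)) \<longlonglongrightarrow> 0"
    proof (rule tendsto_sandwich[OF _ _ tendsto_const])
      show "(\<lambda>n. Hk_norm 2 \<Omega> (\<lambda>x. s n t x - \<phi> (x, t))) \<longlonglongrightarrow> 0" by fact
      have "L2_norm \<Omega> (\<lambda>x. P (s n t) x - P (slice \<phi> t) x) \<le> Hk_norm 2 \<Omega> (\<lambda>x. s n t x - \<phi> (x, t))" for n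
        using Pd[OF Hk0_Hk[OF s(2)] Hk0_Hk, of t "slice \<phi> t" n] elim by (simp add: slice_def)
      then show "\<forall>\<^sub>F n in sequentially. L2_norm \<Omega> (\<lambda>x. P (s n t) x - P (slice \<phi> t) x) \<le> Hk_norm 2 \<Omega> (\<lambda>x. s n t x - \<phi> (x, t))"
        by simp
    qed (simp add: L2_norm_nonneg)
    then show ?case using elim by simp
  qed
  from joint_L2_limit[OF simple_function_compose1[OF s(1), of P] P[OF Hk0_Hk[OF s(2)]] this]
  obtain F where F: "F \<in> borel_measurable (lebesgue_on Q)" "AE t in lebesgue_on I. AE x in lebesgue_on \<Omega>. F (x, t) = P (slice \<phi> t) x"
    by blast
  show ?thesis using that[OF L2_Q_if_slices_bounded[OF F(1) s(5) F(2) L] F(2)] .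
qed

text \<open>The slicewise derivatives have jointly measurable representatives, and these are weak derivatives on
  the cylinder.\<close>

theorem L2_H20D:
  assumes \<phi>: "\<phi> \<in> L2_H20 \<Omega> T"
  shows "\<phi> \<in> L2 Q"
    and "has_weak_deriv Q (dir i, 0) \<phi> (DQ i \<phi>)" and "DQ i \<phi> \<in> L2 Q"
    and "AE t in lebesgue_on I. AE x in lebesgue_on \<Omega>. DQ i \<phi> (x, t) = D\<Omega> i (slice \<phi> t) x"
    and "has_weak_deriv Q (dir j, 0) (DQ i \<phi>) (DQ j (DQ i \<phi>))" and "DQ j (DQ i \<phi>) \<in> L2 Q"
    and "AE t in lebesgue_on I. AE x in lebesgue_on \<Omega>. DQ j (DQ i \<phi>) (x, t) = D\<Omega> j (D\<Omega> i (slice \<phi> t)) x"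
proof -
  obtain s where s: "AE t in lebesgue_on I. slice \<phi> t \<in> Hk0 2 \<Omega>"
    "integrable (lebesgue_on I) (\<lambda>t. (Hk_norm 2 \<Omega> (slice \<phi> t))\<^sup>2)"
    using L2_H20_slices[OF \<phi>] by metis
  have \<phi>m: "\<phi> \<in> borel_measurable (lebesgue_on Q)" using \<phi> by (simp add: L2_H20_def)
  show \<phi>2: "\<phi> \<in> L2 Q"
  proof (rule L2_Q_if_slices_bounded[OF \<phi>m s(2)])
    show "AE t in lebesgue_on I. AE x in lebesgue_on \<Omega>. \<phi> (x, t) = slice \<phi> t x" by (simp add: slice_def)
    show "AE t in lebesgue_on I. slice \<phi> t \<in> L2 \<Omega> \<and> L2_norm \<Omega> (slice \<phi> t) \<le> Hk_norm 2 \<Omega> (slice \<phi> t)"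
      using s(1) by (elim eventually_mono) (use L2_norm_le_Hk_norm Hk_L2 Hk0_Hk in blast)
  qed
  obtain F where F: "F \<in> L2 Q" "AE t in lebesgue_on I. AE x in lebesgue_on \<Omega>. F (x, t) = D\<Omega> i (slice \<phi> t) x"
    using L2_H20_joint_derivatives[OF \<phi>, of "D\<Omega> i"] Hk2D(2) L2_norm_weak_deriv_le(1)[OF dir_Basis]
      L2_norm_weak_deriv_diff_le(1)[OF _ _ open_\<Omega> dir_Basis] by blast
  obtain G where G: "G \<in> L2 Q" "AE t in lebesgue_on I. AE x in lebesgue_on \<Omega>. G (x, t) = D\<Omega> j (D\<Omega> i (slice \<phi> t)) x"
    using L2_H20_joint_derivatives[OF \<phi>, of "\<lambda>f. D\<Omega> j (D\<Omega> i f)"] Hk2D(4) L2_norm_weak_deriv_le(2)[OF dir_Basis dir_Basis]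
      L2_norm_weak_deriv_diff_le(2)[OF _ _ open_\<Omega> dir_Basis dir_Basis] by blast
  have 1: "has_weak_deriv Q (dir i, 0) \<phi> F"
  proof (rule has_weak_deriv_from_slices[OF \<phi>2 F(1)])
    show "AE t in lebesgue_on I. has_weak_deriv \<Omega> (dir i) (\<lambda>x. \<phi> (x, t)) (\<lambda>x. F (x, t))"
      using s(1) F(2)
    proof eventually_elim
      case (elim t)
      from has_weak_deriv_cong_AE[OF Hk2D(1)[OF Hk0_Hk[OF elim(1)], of i] _ _ open_\<Omega>, of "\<lambda>x. \<phi> (x, t)" "\<lambda>x. F (x, t)"] elim(2)
      show ?case by (simp add: slice_def eq_commute)
    qed
  qed
  have 2: "has_weak_deriv Q (dir j, 0) F G"
  proof (rule has_weak_deriv_from_slices[OF F(1) G(1)])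
    show "AE t in lebesgue_on I. has_weak_deriv \<Omega> (dir j) (\<lambda>x. F (x, t)) (\<lambda>x. G (x, t))"
      using s(1) F(2) G(2)
    proof eventually_elim
      case (elim t)
      from has_weak_deriv_cong_AE[OF Hk2D(3)[OF Hk0_Hk[OF elim(1)], of j i] _ _ open_\<Omega>, of "\<lambda>x. F (x, t)" "\<lambda>x. G (x, t)"] elim(2,3)
      show ?case by (simp add: eq_commute)
    qed
  qed
  have FD: "AE z in lebesgue_on Q. DQ i \<phi> z = F z" by (rule weak_deriv_AE_eq[OF 1 open_Q])
  then have FD': "AE z in lebesgue_on Q. F z = DQ i \<phi> z" by (simp add: eq_commute)
  have 3: "has_weak_deriv Q (dir j, 0) (DQ i \<phi>) G"
    by (rule has_weak_deriv_cong_AE[OF 2 FD' _ open_Q]) simp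
  have GD: "AE z in lebesgue_on Q. DQ j (DQ i \<phi>) z = G z" by (rule weak_deriv_AE_eq[OF 3 open_Q])
  then have GD': "AE z in lebesgue_on Q. G z = DQ j (DQ i \<phi>) z" by (simp add: eq_commute)
  show "has_weak_deriv Q (dir i, 0) \<phi> (DQ i \<phi>)" by (rule weak_deriv_works[OF 1])
  show "DQ i \<phi> \<in> L2 Q" by (rule L2_cong_AE[OF F(1) FD' sets_lebesgue(3)])
  show "AE t in lebesgue_on I. AE x in lebesgue_on \<Omega>. DQ i \<phi> (x, t) = D\<Omega> i (slice \<phi> t) x"
    using AE_slices(2)[OF FD] F(2)
  proof eventually_elim
    case (elim t)
    then show ?case by eventually_elim simp
  qed
  show "has_weak_deriv Q (dir j, 0) (DQ i \<phi>) (DQ j (DQ i \<phi>))" by (rule weak_deriv_works[OF 3])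
  show "DQ j (DQ i \<phi>) \<in> L2 Q" by (rule L2_cong_AE[OF G(1) GD' sets_lebesgue(3)])
  show "AE t in lebesgue_on I. AE x in lebesgue_on \<Omega>. DQ j (DQ i \<phi>) (x, t) = D\<Omega> j (D\<Omega> i (slice \<phi> t)) x"
    using AE_slices(2)[OF GD] G(2)
  proof eventually_elim
    case (elim t)
    then show ?case by eventually_elim simp
  qed
qed

end

section \<open>Weak time derivatives and primitives in time\<close>

text \<open>The mean value zero is what makes the antiderivative vanish again to the right of the support. It is
  then supported in the convex hull of the support of \<open>\<theta>\<close>.\<close>

lemma test_antiderivative:
  fixes \<theta> :: "real \<Rightarrow> real"
  assumes t: "\<theta> \<in> test_functions {0<..<T}" and z: "(\<integral>s. \<theta> s \<partial>lborel) = 0"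
  obtains \<kappa> where "\<kappa> \<in> test_functions {0<..<T}" "\<And>t. (\<kappa> has_real_derivative \<theta> t) (at t)"
    "\<And>t. t \<in> {0<..<T} \<Longrightarrow> \<kappa> t = (\<integral>s. indicator {..<t} s * \<theta> s \<partial>lborel)"
proof -
  obtain C where C: "compact C" "C \<subseteq> {0<..<T}" "\<And>x. x \<notin> C \<Longrightarrow> \<theta> x = 0"
    using test_functions_support[OF t] by blast
  define \<kappa> where "\<kappa> t = (LBINT s=ereal 0..ereal t. \<theta> s)" for t
  have c: "continuous_on A \<theta>" for A by (rule test_functions_continuous[OF t])
  have d: "(\<kappa> has_real_derivative \<theta> t) (at t)" for t
  proof -
    define M where "M = \<bar>t\<bar> + 1"
    have "((\<lambda>u. LBINT y=ereal 0..ereal u. \<theta> y) has_vector_derivative \<theta> t) (at t within {-M..M})"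
      by (rule interval_integral_FTC2[OF _ _ c]) (auto simp: M_def)
    then have "(\<kappa> has_real_derivative \<theta> t) (at t within {-M..M})"
      by (simp add: \<kappa>_def[abs_def] has_real_derivative_iff_has_vector_derivative)
    moreover have "t \<in> interior {-M..M}" by (auto simp: M_def)
    ultimately show ?thesis using at_within_interior[of t "{-M..M}"] by simp
  qed
  have pos: "\<kappa> t = (\<integral>s. indicator {..<t} s * \<theta> s \<partial>lborel)" if "t > 0" for t
  proof -
    have "\<kappa> t = (\<integral>s. indicator {0<..<t} s * \<theta> s \<partial>lborel)"
      using that by (simp add: \<kappa>_def interval_integral_Ioo set_lebesgue_integral_def)
    also have "(\<lambda>s. indicator {0<..<t} s * \<theta> s) = (\<lambda>s. indicator {..<t} s * \<theta> s)"
    proof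
      fix s
      show "indicator {0<..<t} s * \<theta> s = indicator {..<t} s * \<theta> s"
        using C(2) C(3)[of s] by (cases "s \<in> C") (auto simp: indicator_def)
    qed
    finally show ?thesis .
  qed
  have out: "\<kappa> t = 0" if th: "t \<notin> convex hull C" for t
  proof -
    have "(\<forall>c\<in>C. t < c) \<or> (\<forall>c\<in>C. c < t)"
    proof (rule ccontr)
      assume "\<not> ?thesis"
      then obtain c d where cd: "c \<in> C" "c \<le> t" "d \<in> C" "t \<le> d" by (auto simp: not_less)
      then have "t \<in> closed_segment c d" by (simp add: closed_segment_eq_real_ivl)
      also have "closed_segment c d \<subseteq> convex hull C"
        using cd hull_subset[of C convex] by (intro closed_segment_subset) auto
      finally show False using th by simp
    qed
    then show ?thesis
    proof
      assume l: "\<forall>c\<in>C. t < c"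
      have "\<kappa> t = (LBINT s=ereal 0..ereal t. 0)"
        unfolding \<kappa>_def
      proof (rule interval_integral_cong)
        fix s assume "s \<in> einterval (min (ereal 0) (ereal t)) (max (ereal 0) (ereal t))"
        then have "s < 0 \<or> s < t \<or> s \<le> max 0 t" by (auto simp: einterval_def max_def min_def split: if_splits)
        then have "s \<le> max 0 t" by auto
        then have "s \<notin> C" using l C(2) by fastforce
        then show "\<theta> s = 0" by (rule C(3))
      qed
      then show ?thesis by simp
    next
      assume l: "\<forall>c\<in>C. c < t"
      show ?thesis
      proof (cases "C = {}")
        case True
        then have "\<theta> = (\<lambda>x. 0)" using C(3) by auto
        then show ?thesis by (simp add: \<kappa>_def)
      next
        case False
        then have "t > 0" using l C(2) by fastforce
        then have "\<kappa> t = (\<integral>s. indicator {..<t} s * \<theta> s \<partial>lborel)" by (rule pos)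
        also have "(\<lambda>s. indicator {..<t} s * \<theta> s) = \<theta>"
        proof
          show "indicator {..<t} s * \<theta> s = \<theta> s" for s using l C(3)[of s] by (cases "s \<in> C") auto
        qed
        finally show ?thesis using z by simp
      qed
    qed
  qed
  have Ck: "Ck_on k \<kappa> UNIV" for k
  proof (cases k)
    case 0
    then show ?thesis using d DERIV_isCont by (auto simp: continuous_on_eq_continuous_at)
  next
    case (Suc k')
    then show ?thesis
      using Ck_on_SucI[OF d[THEN has_field_derivative_imp_has_derivative], of k'] test_functions_Ck[OF t] by simp
  qed
  have "\<kappa> \<in> test_functions {0<..<T}"
    using Ck out C(1,2) by (intro test_functionsI[of _ "convex hull C"] compact_convex_hull hull_minimal) auto
  then show ?thesis using that d pos by auto
qed

lemma normalized_test_function: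
  fixes T :: real assumes T: "0 < T"
  obtains \<eta> where "\<eta> \<in> test_functions {0<..<T}" "(\<integral>s. \<eta> s \<partial>lborel) = 1"
proof -
  have "cbox (T/4) (3*T/4) \<subseteq> {0<..<T}" using T by auto
  from indicator_box_limit_test_functions[OF this]
  obtain \<beta> where \<beta>: "\<And>n. \<beta> n \<in> test_functions {0<..<T}" "\<And>n x. \<beta> n x \<in> {0..1}"
    "\<And>n x. x \<notin> box (T/4) (3*T/4) \<Longrightarrow> \<beta> n x = 0" "\<And>x. (\<lambda>n. \<beta> n x) \<longlonglongrightarrow> indicator (box (T/4) (3*T/4)) x" by metis
  have "(\<lambda>n. \<integral>s. \<beta> n s \<partial>lborel) \<longlonglongrightarrow> (\<integral>s. indicator (box (T/4) (3*T/4)) s \<partial>lborel)"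
  proof (rule integral_dominated_convergence[where w = "indicator (box (T/4) (3*T/4))"])
    show "AE x in lborel. norm (\<beta> n x) \<le> indicator (box (T/4) (3*T/4)) x" for n
    proof (rule AE_I2)
      fix x
      show "norm (\<beta> n x) \<le> indicator (box (T/4) (3*T/4)) x"
        using \<beta>(2)[of n x] \<beta>(3)[of x n] by (cases "x \<in> box (T/4) (3*T/4)") (auto simp del: box_real)
    qed
  qed (use T \<beta>(4) test_functions_borel[OF \<beta>(1)] in \<open>auto intro!: integrable_real_indicator\<close>)
  moreover have "(\<integral>s. indicator (box (T/4) (3*T/4)) s \<partial>lborel) = T/2" using T by simp
  ultimately have "(\<lambda>n. \<integral>s. \<beta> n s \<partial>lborel) \<longlonglongrightarrow> T/2" by (simp only:)
  from order_tendstoD(1)[OF this, of 0] have "eventually (\<lambda>n. (\<integral>s. \<beta> n s \<partial>lborel) > 0) sequentially"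
    using T by simp
  then obtain n where n: "(\<integral>s. \<beta> n s \<partial>lborel) > 0" using eventually_happens'[OF sequentially_bot] by blast
  show ?thesis
    using that[OF test_functions_cmult[OF \<beta>(1)[of n], of "1 / (\<integral>s. \<beta> n s \<partial>lborel)"]] n by simp
qed

lemma frechet_derivative_product_time:
  assumes z: "\<zeta> \<in> test_functions U" and k: "\<kappa> \<in> test_functions V" "(\<kappa> has_real_derivative d) (at (snd p))"
  shows "frechet_derivative (\<lambda>z. \<zeta> (fst z) * \<kappa> (snd z)) (at p) (0, 1) = \<zeta> (fst p) * d"
proof -
  note d1 = diff_chain_at[OF has_derivative_fst[OF has_derivative_ident] test_functions_has_derivative[OF z], of p]
  have d2: "((\<lambda>z. \<kappa> (snd z)) has_derivative (\<lambda>h. d * snd h)) (at p)"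
    using diff_chain_at[OF has_derivative_snd[OF has_derivative_ident] k(2)[unfolded has_field_derivative_def]]
    by (simp add: o_def)
  have "((\<lambda>z. \<zeta> (fst z) * \<kappa> (snd z)) has_derivative
     (\<lambda>h. \<zeta> (fst p) * (d * snd h) + frechet_derivative \<zeta> (at (fst p)) (fst h) * \<kappa> (snd p))) (at p)"
    using has_derivative_mult[OF d1[unfolded o_def] d2] by simp
  from fun_cong[OF frechet_derivative_at[OF this], of "(0, 1)"]
  have "frechet_derivative (\<lambda>z. \<zeta> (fst z) * \<kappa> (snd z)) (at p) (0, 1)
      = \<zeta> (fst p) * d + frechet_derivative \<zeta> (at (fst p)) 0 * \<kappa> (snd p)"
    by simp
  moreover have "frechet_derivative \<zeta> (at (fst p)) 0 = 0"
    using linear_0[OF has_derivative_linear[OF test_functions_has_derivative[OF z]]] .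
  ultimately show ?thesis by simp
qed

text \<open>Both sides integrate \<open>h s * f t\<close> over the triangle \<open>s < t\<close>.\<close>

lemma swap_primitives:
  fixes f h :: "real \<Rightarrow> real"
  assumes Ib: "I \<in> sets borel" and f: "integrable (lebesgue_on I) f" and h: "integrable (lebesgue_on I) h"
  shows "(\<integral>t. f t * (\<integral>s. indicator {..<t} s * h s \<partial>lebesgue_on I) \<partial>lebesgue_on I)
       = (\<integral>s. h s * (\<integral>t. indicator {s<..} t * f t \<partial>lebesgue_on I) \<partial>lebesgue_on I)" (is ?eq)
    and "integrable (lebesgue_on I) (\<lambda>t. f t * (\<integral>s. indicator {..<t} s * h s \<partial>lebesgue_on I))"
    and "integrable (lebesgue_on I) (\<lambda>s. h s * (\<integral>t. indicator {s<..} t * f t \<partial>lebesgue_on I))"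
proof -
  define k where "k z = h (fst z) * f (snd z) * (if fst z < snd z then 1 else 0)" for z :: "real \<times> real"
  have Il: "I \<in> sets lebesgue" using Ib by simp
  have [measurable]: "(\<lambda>z. h (fst z)) \<in> borel_measurable (lebesgue_on (I \<times> I))"
    "(\<lambda>z. f (snd z)) \<in> borel_measurable (lebesgue_on (I \<times> I))"
    using measurable_lebesgue_fst[OF Ib Ib] measurable_lebesgue_snd[OF Ib Ib] f h by auto
  have "{z :: real \<times> real. fst z < snd z} \<in> sets borel"
    by (intro borel_measurable_less[where M = borel, simplified]) (auto intro!: borel_measurable_continuous_onI continuous_intros)
  then have "(\<lambda>z :: real \<times> real. indicator {z. fst z < snd z} z :: real) \<in> borel_measurable borel"
    by (intro borel_measurable_indicator) auto
  moreover have "(\<lambda>z :: real \<times> real. indicator {z. fst z < snd z} z :: real) = (\<lambda>z. if fst z < snd z then 1 else 0)"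
    by (auto simp: indicator_def)
  ultimately have [measurable]: "(\<lambda>z. if fst z < snd z then 1 else 0 :: real) \<in> borel_measurable (lebesgue_on (I \<times> I))"
    using borel_measurable_lebesgue_onI by metis
  have ki: "integrable (lebesgue_on (I \<times> I)) k"
  proof (rule integrable_product_by_slices[OF Ib Ib])
    show "k \<in> borel_measurable (lebesgue_on (I \<times> I))" unfolding k_def[abs_def] by measurable
    have ks: "k (s, t) = f t * (indicator {..<t} s * h s)" for s t by (auto simp: k_def)
    have tm: "(\<lambda>s. indicator {..<t} s * h s) \<in> borel_measurable (lebesgue_on I)" for t :: real
      by (rule borel_measurable_times[OF borel_measurable_lebesgue_onI borel_measurable_integrable[OF h]]) simp
    have ti: "integrable (lebesgue_on I) (\<lambda>s. indicator {..<t} s * h s)" for t :: real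
      by (rule Bochner_Integration.integrable_bound[OF h tm]) (auto simp: indicator_def)
    then show "AE t in lebesgue_on I. integrable (lebesgue_on I) (\<lambda>s. k (s, t))" by (simp add: ks)
    show "integrable (lebesgue_on I) (\<lambda>t. \<bar>f t\<bar> * (\<integral>s. \<bar>h s\<bar> \<partial>lebesgue_on I))" using f by auto
    show "AE t in lebesgue_on I. (\<integral>s. \<bar>k (s, t)\<bar> \<partial>lebesgue_on I) \<le> \<bar>f t\<bar> * (\<integral>s. \<bar>h s\<bar> \<partial>lebesgue_on I)"
    proof (rule AE_I2)
      fix t
      have "(\<integral>s. \<bar>indicator {..<t} s * h s\<bar> \<partial>lebesgue_on I) \<le> (\<integral>s. \<bar>h s\<bar> \<partial>lebesgue_on I)"
        using ti[of t] h by (intro integral_mono) (auto simp: indicator_def)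
      then show "(\<integral>s. \<bar>k (s, t)\<bar> \<partial>lebesgue_on I) \<le> \<bar>f t\<bar> * (\<integral>s. \<bar>h s\<bar> \<partial>lebesgue_on I)"
        by (simp add: ks abs_mult mult_left_mono)
    qed
  qed
  note sl = integrable_slices[OF Ib Ib ki]
  have 1: "(\<integral>s. k (s, t) \<partial>lebesgue_on I) = f t * (\<integral>s. indicator {..<t} s * h s \<partial>lebesgue_on I)" for t
  proof -
    have "(\<lambda>s. k (s, t)) = (\<lambda>s. f t * (indicator {..<t} s * h s))" by (auto simp: k_def)
    then show ?thesis by simp
  qed
  have 2: "(\<integral>t. k (s, t) \<partial>lebesgue_on I) = h s * (\<integral>t. indicator {s<..} t * f t \<partial>lebesgue_on I)" for s
  proof -
    have "(\<lambda>t. k (s, t)) = (\<lambda>t. h s * (indicator {s<..} t * f t))" by (auto simp: k_def)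
    then show ?thesis by simp
  qed
  show ?eq using sl(3,6) by (simp add: 1 2)
  show "integrable (lebesgue_on I) (\<lambda>t. f t * (\<integral>s. indicator {..<t} s * h s \<partial>lebesgue_on I))"
    using sl(2) by (simp add: 1)
  show "integrable (lebesgue_on I) (\<lambda>s. h s * (\<integral>t. indicator {s<..} t * f t \<partial>lebesgue_on I))"
    using sl(5) by (simp add: 2)
qed

lemma AE_time_near_0:
  assumes "AE t in lebesgue_on {0<..<T}. P t" "0 < T" "0 < \<delta>"
  shows "\<exists>t\<in>{0<..<T}. t < \<delta> \<and> P (t :: real)"
proof (rule ccontr)
  assume no: "\<not> ?thesis"
  have "AE t in lborel. t \<in> {0<..<T} \<longrightarrow> P t"
    using assms(1) by (simp add: AE_lebesgue_on_iff)
  then have "AE t in lborel. t \<notin> {0<..<min T \<delta>}"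
    by (elim eventually_mono) (use no in auto)
  then have "{0<..<min T \<delta>} \<in> null_sets lborel"
    using AE_iff_null_sets[of "{0<..<min T \<delta>}" lborel] by simp
  then have "emeasure lborel {0<..<min T \<delta>} = 0" by (rule null_setsD1)
  then show False using assms(2,3) by (simp add: min_def split: if_splits)
qed

context bounded_cylinder
begin

lemma L2_slices_time:
  assumes "f \<in> L2 Q"
  shows "AE x in lebesgue_on \<Omega>. (\<lambda>t. f (x, t)) \<in> L2 I"
    and "AE t in lebesgue_on I. (\<lambda>x. f (x, t)) \<in> L2 \<Omega>"
proof -
  have f: "integrable (lebesgue_on Q) f" "integrable (lebesgue_on Q) (\<lambda>z. (f z)\<^sup>2)"
    using L2_integrable[OF lmeasurable(3) assms] L2_square[OF assms] by auto
  show "AE x in lebesgue_on \<Omega>. (\<lambda>t. f (x, t)) \<in> L2 I"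
    using int_slices(4)[OF f(1)] int_slices(4)[OF f(2)] by eventually_elim (auto simp: L2_def)
  show "AE t in lebesgue_on I. (\<lambda>x. f (x, t)) \<in> L2 \<Omega>"
    using int_slices(1)[OF f(1)] int_slices(1)[OF f(2)] by eventually_elim (auto simp: L2_def)
qed

lemma weighted_time_integral_L2:
  assumes m: "m \<in> L2 Q" and h: "h \<in> borel_measurable borel" "\<And>t. \<bar>h t\<bar> \<le> c"
  shows "(\<lambda>x. \<integral>s. h s * m (x, s) \<partial>lebesgue_on I) \<in> L2 \<Omega>"
    and "(L2_norm \<Omega> (\<lambda>x. \<integral>s. h s * m (x, s) \<partial>lebesgue_on I))\<^sup>2 \<le> (L2_norm I h)\<^sup>2 * (L2_norm Q m)\<^sup>2"
proof -
  let ?g = "\<lambda>x. \<integral>s. h s * m (x, s) \<partial>lebesgue_on I"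
  have hI: "h \<in> borel_measurable (lebesgue_on I)" by (rule borel_measurable_lebesgue_onI[OF h(1)])
  have hL: "h \<in> L2 I" using bounded_L2[OF lmeasurable(2) hI h(2)] .
  have "(\<lambda>z. h (snd z) * m z) \<in> L2 Q" by (rule L2_bounded_mult[OF m meas_snd[OF hI] h(2)])
  from L2_integrable[OF lmeasurable(3) this] int_slices(5)[of "\<lambda>z. h (snd z) * m z"]
  have gm: "?g \<in> borel_measurable (lebesgue_on \<Omega>)" by auto
  have m2: "integrable (lebesgue_on Q) (\<lambda>z. (m z)\<^sup>2)" by (rule L2_square[OF m])
  have b: "AE x in lebesgue_on \<Omega>. (?g x)\<^sup>2 \<le> (L2_norm I h)\<^sup>2 * (\<integral>s. (m (x, s))\<^sup>2 \<partial>lebesgue_on I)"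
    using L2_slices_time(1)[OF m]
  proof eventually_elim
    case (elim x)
    have "(?g x)\<^sup>2 = \<bar>?g x\<bar>\<^sup>2" by simp
    also have "\<dots> \<le> (L2_norm I h * L2_norm I (\<lambda>s. m (x, s)))\<^sup>2"
      using L2_Cauchy_Schwarz[OF hL elim] by (intro power_mono) auto
    finally show ?case by (simp add: power_mult_distrib L2_norm_power2)
  qed
  have i2: "integrable (lebesgue_on \<Omega>) (\<lambda>x. (L2_norm I h)\<^sup>2 * (\<integral>s. (m (x, s))\<^sup>2 \<partial>lebesgue_on I))"
    using int_slices(5)[OF m2] by simp
  have i1: "integrable (lebesgue_on \<Omega>) (\<lambda>x. (?g x)\<^sup>2)"
    by (rule Bochner_Integration.integrable_bound[OF i2]) (use gm b in \<open>auto elim: eventually_mono\<close>)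
  then show "?g \<in> L2 \<Omega>" using gm by (simp add: L2_def)
  have "(L2_norm \<Omega> ?g)\<^sup>2 = (\<integral>x. (?g x)\<^sup>2 \<partial>lebesgue_on \<Omega>)" by (simp add: L2_norm_power2)
  also have "\<dots> \<le> (\<integral>x. (L2_norm I h)\<^sup>2 * (\<integral>s. (m (x, s))\<^sup>2 \<partial>lebesgue_on I) \<partial>lebesgue_on \<Omega>)"
    by (rule integral_mono_AE[OF i1 i2 b])
  also have "\<dots> = (L2_norm I h)\<^sup>2 * (L2_norm Q m)\<^sup>2"
    using int_slices(6)[OF m2] by (simp add: L2_norm_power2)
  finally show "(L2_norm \<Omega> ?g)\<^sup>2 \<le> (L2_norm I h)\<^sup>2 * (L2_norm Q m)\<^sup>2" .
qed

lemma time_primitive_L2: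
  assumes "m \<in> L2 Q" shows "time_primitive I m \<in> L2 Q"
proof (rule L2_Q_if_slices_bounded[where w = "\<lambda>t. L2_norm I (\<lambda>s. 1) * L2_norm Q m" and v = "\<lambda>t x. time_primitive I m (x, t)"])
  interpret finite_measure "lebesgue_on I" by (rule finite_measures)
  show "time_primitive I m \<in> borel_measurable (lebesgue_on Q)" by (rule meas_prim[OF L2_measurable[OF assms]])
  show "integrable (lebesgue_on I) (\<lambda>t. (L2_norm I (\<lambda>s. 1) * L2_norm Q m)\<^sup>2)" by simp
  show "AE t in lebesgue_on I. (\<lambda>x. time_primitive I m (x, t)) \<in> L2 \<Omega> \<and>
      L2_norm \<Omega> (\<lambda>x. time_primitive I m (x, t)) \<le> L2_norm I (\<lambda>s. 1) * L2_norm Q m"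
  proof (rule AE_I2)
    fix t :: real
    have h: "(\<lambda>s. indicator {..<t} s :: real) \<in> borel_measurable borel" "\<And>s. \<bar>indicator {..<t} s :: real\<bar> \<le> 1"
      by (simp_all add: borel_measurable_indicator)
    note w = weighted_time_integral_L2[OF assms h]
    have "(L2_norm I (indicator {..<t}))\<^sup>2 \<le> (L2_norm I (\<lambda>s. 1))\<^sup>2"
    proof -
      have "(\<integral>s. (indicator {..<t} s :: real)\<^sup>2 \<partial>lebesgue_on I) \<le> (\<integral>s. 1\<^sup>2 \<partial>lebesgue_on I)"
        using L2_square[OF bounded_L2[OF lmeasurable(2) borel_measurable_lebesgue_onI[OF h(1)] h(2)]]
        by (rule integral_mono) (auto simp: indicator_def)
      then show ?thesis by (simp add: L2_norm_power2)
    qed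
    then have "(L2_norm \<Omega> (\<lambda>x. time_primitive I m (x, t)))\<^sup>2 \<le> (L2_norm I (\<lambda>s. 1))\<^sup>2 * (L2_norm Q m)\<^sup>2"
      using w(2) mult_right_mono[of "(L2_norm I (indicator {..<t}))\<^sup>2" "(L2_norm I (\<lambda>s. 1))\<^sup>2" "(L2_norm Q m)\<^sup>2"]
      by (simp add: time_primitive_def)
    then have "(L2_norm \<Omega> (\<lambda>x. time_primitive I m (x, t)))\<^sup>2 \<le> (L2_norm I (\<lambda>s. 1) * L2_norm Q m)\<^sup>2"
      by (simp add: power_mult_distrib)
    then have "L2_norm \<Omega> (\<lambda>x. time_primitive I m (x, t)) \<le> L2_norm I (\<lambda>s. 1) * L2_norm Q m"
      by (rule power2_le_imp_le) (simp add: L2_norm_nonneg)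
    then show "(\<lambda>x. time_primitive I m (x, t)) \<in> L2 \<Omega> \<and>
      L2_norm \<Omega> (\<lambda>x. time_primitive I m (x, t)) \<le> L2_norm I (\<lambda>s. 1) * L2_norm Q m"
      using w(1) by (simp add: time_primitive_def)
  qed
qed simp

text \<open>Products \<open>\<zeta>(x) \<eta>(t)\<close> suffice as test functions. With a fixed \<open>\<eta>\<^sub>1\<close> of integral one, \<open>\<eta>\<close> is a multiple of \<open>\<eta>\<^sub>1\<close> plus
  the derivative of a test function: on the first part \<open>B\<close> is adjusted, on the second part the weak derivative
  applies.\<close>

lemma weak_time_derivative_primitive:
  assumes T: "0 < T" and f: "f \<in> L2 Q" and g: "g \<in> L2 Q" and wd: "has_weak_deriv Q (0, 1) f g"
  obtains B where "B \<in> L2 \<Omega>" "AE z in lebesgue_on Q. f z = B (fst z) + time_primitive I g z"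
proof -
  obtain \<eta>1 where \<eta>1: "\<eta>1 \<in> test_functions I" "(\<integral>s. \<eta>1 s \<partial>lborel) = 1" by (rule normalized_test_function[OF T])
  have onI: "\<And>\<eta>. \<eta> \<in> test_functions I \<Longrightarrow> (\<integral>s. \<eta> s \<partial>lebesgue_on I) = (\<integral>s. \<eta> s \<partial>lborel)"
  proof -
    fix \<eta> assume t: "\<eta> \<in> test_functions I"
    obtain C where "C \<subseteq> I" "\<And>x. x \<notin> C \<Longrightarrow> \<eta> x = 0" using test_functions_support[OF t] by metis
    then show "(\<integral>s. \<eta> s \<partial>lebesgue_on I) = (\<integral>s. \<eta> s \<partial>lborel)"
      by (intro borel_zero_outside(2)[OF sets_borel(2) test_functions_borel[OF t]]) blast
  qed
  define K1 where "K1 s = (\<integral>t. indicator {..<s} t * \<eta>1 t \<partial>lborel)" for s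
  have \<eta>1i: "integrable lborel \<eta>1" using \<eta>1(2) not_integrable_integral_eq by fastforce
  have K1m: "K1 \<in> borel_measurable borel"
  proof -
    have "case_prod (\<lambda>s t. (if t < s then 1 else 0) * \<eta>1 t) \<in> borel_measurable (lborel \<Otimes>\<^sub>M lborel)"
      using test_functions_borel[OF \<eta>1(1)] by measurable
    then have "(\<lambda>s. \<integral>t. (if t < s then 1 else 0) * \<eta>1 t \<partial>lborel) \<in> borel_measurable lborel"
      by (rule lborel.borel_measurable_lebesgue_integral)
    moreover have "(\<lambda>s. \<integral>t. (if t < s then 1 else 0) * \<eta>1 t \<partial>lborel) = K1"
      unfolding K1_def by (intro ext Bochner_Integration.integral_cong) (auto simp: indicator_def)
    ultimately show ?thesis by simp
  qed
  have indi: "integrable lborel (\<lambda>t. indicator {..<s} t * \<eta> t)" if "integrable lborel \<eta>" for s and \<eta> :: "real \<Rightarrow> real"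
    using integrable_mult_indicator[OF _ that, of "{..<s}"] by simp
  have K1b: "\<bar>K1 s\<bar> \<le> (\<integral>t. \<bar>\<eta>1 t\<bar> \<partial>lborel)" for s
  proof -
    have "\<bar>K1 s\<bar> \<le> (\<integral>t. \<bar>indicator {..<s} t * \<eta>1 t\<bar> \<partial>lborel)" unfolding K1_def by (rule integral_abs_bound)
    also have "\<dots> \<le> (\<integral>t. \<bar>\<eta>1 t\<bar> \<partial>lborel)"
      using indi[OF \<eta>1i, of s] \<eta>1i by (intro integral_mono) (auto simp: indicator_def)
    finally show ?thesis .
  qed
  obtain c1 where c1: "\<And>t. \<bar>\<eta>1 t\<bar> \<le> c1" using test_functions_bounded[OF \<eta>1(1)] by blast
  \<comment> \<open>The initial value is the \<open>\<eta>\<^sub>1\<close>-mean of \<open>f\<close> minus the \<open>\<eta>\<^sub>1\<close>-mean of the primitive of \<open>g\<close>; swapping the integrals turns the latter into \<open>- B2\<close>.\<close>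
  define B1 where "B1 x = (\<integral>s. \<eta>1 s * f (x, s) \<partial>lebesgue_on I)" for x
  define B2 where "B2 x = (\<integral>s. (K1 s - 1) * g (x, s) \<partial>lebesgue_on I)" for x
  define B where "B x = B1 x + B2 x" for x
  have "B1 \<in> L2 \<Omega>" unfolding B1_def by (rule weighted_time_integral_L2(1)[OF f test_functions_borel[OF \<eta>1(1)] c1])
  moreover have "\<bar>K1 s - 1\<bar> \<le> (\<integral>t. \<bar>\<eta>1 t\<bar> \<partial>lborel) + 1" for s using K1b[of s] by linarith
  then have "B2 \<in> L2 \<Omega>" unfolding B2_def using K1m by (intro weighted_time_integral_L2(1)[OF g]) auto
  ultimately have BL: "B \<in> L2 \<Omega>" unfolding B_def[abs_def] by (rule L2_add)
  have Bi: "integrable (lebesgue_on Q) (\<lambda>z. B (fst z))"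
    by (rule int_fst[OF L2_integrable[OF lmeasurable(1) BL]])
  have fi: "integrable (lebesgue_on Q) f" and gi: "integrable (lebesgue_on Q) g"
    using L2_integrable[OF lmeasurable(3)] f g by auto
  have Pi: "integrable (lebesgue_on Q) (time_primitive I g)"
    using L2_integrable[OF lmeasurable(3) time_primitive_L2[OF g]] .
  define w where "w z = f z - (B (fst z) + time_primitive I g z)" for z
  have wi: "integrable (lebesgue_on Q) w" unfolding w_def[abs_def] using fi Bi Pi by auto
  have "AE z in lebesgue_on (\<Omega> \<times> I). w z = 0"
  proof (rule fundamental_lemma_product)
    show "locally_integrable (\<Omega> \<times> I) w"
      using integrable_imp_locally_integrable[OF wi sets_lebesgue(3)] by (simp add: cylinder_def)
    fix \<zeta> \<eta> assume \<zeta>: "\<zeta> \<in> test_functions \<Omega>" and \<eta>: "\<eta> \<in> test_functions I"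
    define c where "c = (\<integral>s. \<eta> s \<partial>lborel)"
    have testi: "integrable lborel \<theta>" if t: "\<theta> \<in> test_functions I" for \<theta>
    proof -
      obtain C where C: "C \<subseteq> I" "\<And>x. x \<notin> C \<Longrightarrow> \<theta> x = 0" using test_functions_support[OF t] by metis
      then have "\<And>x. x \<notin> I \<Longrightarrow> \<theta> x = 0" by blast
      from borel_zero_outside(1)[OF sets_borel(2) test_functions_borel[OF t] this]
      show ?thesis using L2_integrable[OF lmeasurable(2) test_functions_L2[OF t lmeasurable(2)]] by simp
    qed
    define \<theta> where "\<theta> t = \<eta> t - c * \<eta>1 t" for t
    have \<theta>t: "\<theta> \<in> test_functions I"
      unfolding \<theta>_def[abs_def] by (intro test_functions_diff[OF \<eta> test_functions_cmult[OF \<eta>1(1)]])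
    have \<theta>0: "(\<integral>s. \<theta> s \<partial>lborel) = 0" using testi[OF \<eta>] \<eta>1i \<eta>1(2) by (simp add: \<theta>_def c_def)
    obtain \<kappa> where \<kappa>: "\<kappa> \<in> test_functions I" "\<And>t. (\<kappa> has_real_derivative \<theta> t) (at t)"
      "\<And>t. t \<in> I \<Longrightarrow> \<kappa> t = (\<integral>s. indicator {..<t} s * \<theta> s \<partial>lborel)"
      using test_antiderivative[OF \<theta>t \<theta>0] by blast
    have test: "(\<lambda>z. \<zeta> (fst z) * \<alpha> (snd z)) \<in> test_functions Q" if "\<alpha> \<in> test_functions I" for \<alpha>
      using test_functions_product[OF \<zeta> that] by (simp add: cylinder_def)
    have ti: "integrable (lebesgue_on Q) (\<lambda>z. F z * (\<zeta> (fst z) * \<alpha> (snd z)))"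
      if "integrable (lebesgue_on Q) F" "\<alpha> \<in> test_functions I" for F \<alpha>
      by (rule locally_integrable_mult_test[OF integrable_imp_locally_integrable[OF that(1) sets_lebesgue(3)] sets_lebesgue(3) test[OF that(2)]])
    have weak: "(\<integral>z. f z * (\<zeta> (fst z) * \<theta> (snd z)) \<partial>lebesgue_on Q) = - (\<integral>z. g z * (\<zeta> (fst z) * \<kappa> (snd z)) \<partial>lebesgue_on Q)"
    proof -
      have "(\<integral>z. f z * frechet_derivative (\<lambda>z. \<zeta> (fst z) * \<kappa> (snd z)) (at z) (0, 1) \<partial>lebesgue_on Q)
          = - (\<integral>z. g z * (\<zeta> (fst z) * \<kappa> (snd z)) \<partial>lebesgue_on Q)"
        using wd test[OF \<kappa>(1)] unfolding has_weak_deriv_def by blast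
      then show ?thesis by (simp only: frechet_derivative_product_time[OF \<zeta> \<kappa>(1) \<kappa>(2)])
    qed
    obtain ce where ce: "\<And>t. \<bar>\<eta> t\<bar> \<le> ce" using test_functions_bounded[OF \<eta>] by blast
    have "(\<integral>z. (B (fst z) + time_primitive I g z) * (\<zeta> (fst z) * \<eta> (snd z)) \<partial>lebesgue_on Q)
        = (\<integral>x. \<integral>t. (B x + time_primitive I g (x, t)) * (\<zeta> x * \<eta> t) \<partial>lebesgue_on I \<partial>lebesgue_on \<Omega>)"
      using int_slices(6)[OF ti[OF Bochner_Integration.integrable_add[OF Bi Pi] \<eta>]] by simp
    also have "\<dots> = (\<integral>x. \<integral>t. c * (f (x, t) * (\<zeta> x * \<eta>1 t)) - g (x, t) * (\<zeta> x * \<kappa> t) \<partial>lebesgue_on I \<partial>lebesgue_on \<Omega>)"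
    proof (rule integral_cong_AE)
      show "(\<lambda>x. \<integral>t. (B x + time_primitive I g (x, t)) * (\<zeta> x * \<eta> t) \<partial>lebesgue_on I) \<in> borel_measurable (lebesgue_on \<Omega>)"
        using int_slices(5)[OF ti[OF Bochner_Integration.integrable_add[OF Bi Pi] \<eta>]] by auto
      have "integrable (lebesgue_on Q) (\<lambda>z. c * (f z * (\<zeta> (fst z) * \<eta>1 (snd z))) - g z * (\<zeta> (fst z) * \<kappa> (snd z)))"
        using ti[OF fi \<eta>1(1)] ti[OF gi \<kappa>(1)] by auto
      from int_slices(5)[OF this]
      show "(\<lambda>x. \<integral>t. c * (f (x, t) * (\<zeta> x * \<eta>1 t)) - g (x, t) * (\<zeta> x * \<kappa> t) \<partial>lebesgue_on I) \<in> borel_measurable (lebesgue_on \<Omega>)"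
        by auto
      show "AE x in lebesgue_on \<Omega>. (\<integral>t. (B x + time_primitive I g (x, t)) * (\<zeta> x * \<eta> t) \<partial>lebesgue_on I)
        = (\<integral>t. c * (f (x, t) * (\<zeta> x * \<eta>1 t)) - g (x, t) * (\<zeta> x * \<kappa> t) \<partial>lebesgue_on I)"
        using int_slices(4)[OF fi] int_slices(4)[OF gi]
      proof eventually_elim
        case (elim x)
        let ?f = "\<lambda>t. f (x, t)" and ?g = "\<lambda>t. g (x, t)"
        have bi: "integrable (lebesgue_on I) (\<lambda>t. h t * F t)"
          if "integrable (lebesgue_on I) F" "h \<in> borel_measurable borel" "\<And>t. \<bar>h t\<bar> \<le> b"
          for h F :: "real \<Rightarrow> real" and b
        proof (rule Bochner_Integration.integrable_bound)
          show "integrable (lebesgue_on I) (\<lambda>t. b * F t)" using that(1) by simp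
          show "AE t in lebesgue_on I. norm (h t * F t) \<le> norm (b * F t)"
            using that(3) by (intro AE_I2) (auto simp: abs_mult intro!: mult_right_mono order_trans[OF that(3)])
        qed (use that borel_measurable_lebesgue_onI[OF that(2)] in \<open>auto intro!: borel_measurable_times\<close>)
        have \<eta>I: "integrable (lebesgue_on I) \<eta>"
          using L2_integrable[OF lmeasurable(2) test_functions_L2[OF \<eta> lmeasurable(2)]] .
        have "(\<integral>t. \<eta> t * (\<integral>s. indicator {..<t} s * ?g s \<partial>lebesgue_on I) \<partial>lebesgue_on I)
           = (\<integral>s. ?g s * (\<integral>t. indicator {s<..} t * \<eta> t \<partial>lebesgue_on I) \<partial>lebesgue_on I)"
          and pint: "integrable (lebesgue_on I) (\<lambda>t. \<eta> t * (\<integral>s. indicator {..<t} s * ?g s \<partial>lebesgue_on I))"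
          using swap_primitives(1,2)[OF sets_borel(2) \<eta>I elim(2)] by auto
        note this(1)
        also have "(\<integral>s. ?g s * (\<integral>t. indicator {s<..} t * \<eta> t \<partial>lebesgue_on I) \<partial>lebesgue_on I)
            = (\<integral>s. (c - c * K1 s) * ?g s - \<kappa> s * ?g s \<partial>lebesgue_on I)"
        proof (rule Bochner_Integration.integral_cong[OF refl])
          fix s assume "s \<in> space (lebesgue_on I)"
          then have s: "s \<in> I" by simp
          obtain C where C: "C \<subseteq> I" "\<And>x. x \<notin> C \<Longrightarrow> \<eta> x = 0" using test_functions_support[OF \<eta>] by metis
          then have out: "\<And>t. t \<notin> I \<Longrightarrow> \<eta> t = 0" by blast
          have "(\<integral>t. indicator {s<..} t * \<eta> t \<partial>lebesgue_on I) = (\<integral>t. indicator {s<..} t * \<eta> t \<partial>lborel)"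
            using out test_functions_borel[OF \<eta>] by (intro borel_zero_outside(2)[OF sets_borel(2)]) auto
          also have "\<dots> = (\<integral>t. \<eta> t - indicator {..<s} t * \<eta> t \<partial>lborel)"
          proof (rule integral_cong_AE)
            show "AE t in lborel. indicator {s<..} t * \<eta> t = \<eta> t - indicator {..<s} t * \<eta> t"
              using AE_lborel_singleton[of s] by (elim eventually_mono) (auto simp: indicator_def)
          qed (use test_functions_borel[OF \<eta>] in auto)
          also have "\<dots> = c - (\<integral>t. indicator {..<s} t * \<eta> t \<partial>lborel)"
            using testi[OF \<eta>] indi[OF testi[OF \<eta>]] by (simp add: c_def)
          also have "(\<integral>t. indicator {..<s} t * \<eta> t \<partial>lborel) = \<kappa> s + c * K1 s"
          proof -
            have "(\<integral>t. indicator {..<s} t * \<eta> t \<partial>lborel)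
                = (\<integral>t. indicator {..<s} t * \<theta> t + c * (indicator {..<s} t * \<eta>1 t) \<partial>lborel)"
              by (simp add: \<theta>_def algebra_simps)
            also have "\<dots> = \<kappa> s + c * K1 s"
              using indi[OF testi[OF \<theta>t], of s] indi[OF \<eta>1i, of s] \<kappa>(3)[OF s] by (simp add: K1_def)
            finally show ?thesis .
          qed
          finally have E: "(\<integral>t. indicator {s<..} t * \<eta> t \<partial>lebesgue_on I) = c - (\<kappa> s + c * K1 s)" .
          show "?g s * (\<integral>t. indicator {s<..} t * \<eta> t \<partial>lebesgue_on I) = (c - c * K1 s) * ?g s - \<kappa> s * ?g s"
            unfolding E by (simp add: algebra_simps)
        qed
        also have "\<dots> = - c * B2 x - (\<integral>s. \<kappa> s * ?g s \<partial>lebesgue_on I)"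
        proof -
          obtain ck where ck: "\<And>t. \<bar>\<kappa> t\<bar> \<le> ck" using test_functions_bounded[OF \<kappa>(1)] by blast
          have i1: "integrable (lebesgue_on I) (\<lambda>s. \<kappa> s * ?g s)"
            by (rule bi[OF elim(2) test_functions_borel[OF \<kappa>(1)] ck])
          have "\<bar>K1 s - 1\<bar> \<le> (\<integral>t. \<bar>\<eta>1 t\<bar> \<partial>lborel) + 1" for s using K1b[of s] by linarith
          then have i2: "integrable (lebesgue_on I) (\<lambda>s. (K1 s - 1) * ?g s)"
            using K1m by (intro bi[OF elim(2)]) auto
          have "(\<lambda>s. (c - c * K1 s) * ?g s - \<kappa> s * ?g s) = (\<lambda>s. (- c) * ((K1 s - 1) * ?g s) - \<kappa> s * ?g s)"
            by (auto simp: algebra_simps)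
          then show ?thesis using i1 i2 by (simp add: B2_def)
        qed
        finally have P: "(\<integral>t. \<eta> t * time_primitive I g (x, t) \<partial>lebesgue_on I) = - c * B2 x - (\<integral>s. \<kappa> s * ?g s \<partial>lebesgue_on I)"
          by (simp add: time_primitive_def)
        have "(\<integral>t. (B x + time_primitive I g (x, t)) * (\<zeta> x * \<eta> t) \<partial>lebesgue_on I)
            = (\<integral>t. \<zeta> x * B x * \<eta> t + \<zeta> x * (\<eta> t * time_primitive I g (x, t)) \<partial>lebesgue_on I)"
          by (simp add: algebra_simps)
        also have "\<dots> = \<zeta> x * B x * c + \<zeta> x * (- c * B2 x - (\<integral>s. \<kappa> s * ?g s \<partial>lebesgue_on I))"
          using \<eta>I pint P onI[OF \<eta>] by (simp add: time_primitive_def c_def)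
        also have "\<dots> = \<zeta> x * (c * B1 x - (\<integral>s. \<kappa> s * ?g s \<partial>lebesgue_on I))"
          by (simp add: B_def algebra_simps)
        also have "\<dots> = (\<integral>t. c * (f (x, t) * (\<zeta> x * \<eta>1 t)) - g (x, t) * (\<zeta> x * \<kappa> t) \<partial>lebesgue_on I)"
        proof -
          obtain ck where ck: "\<And>t. \<bar>\<kappa> t\<bar> \<le> ck" using test_functions_bounded[OF \<kappa>(1)] by blast
          have i1: "integrable (lebesgue_on I) (\<lambda>s. \<kappa> s * ?g s)"
            by (rule bi[OF elim(2) test_functions_borel[OF \<kappa>(1)] ck])
          have i2: "integrable (lebesgue_on I) (\<lambda>s. \<eta>1 s * ?f s)"
            by (rule bi[OF elim(1) test_functions_borel[OF \<eta>1(1)] c1])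
          have "(\<lambda>t. c * (f (x, t) * (\<zeta> x * \<eta>1 t)) - g (x, t) * (\<zeta> x * \<kappa> t)) = (\<lambda>t. \<zeta> x * c * (\<eta>1 t * ?f t) - \<zeta> x * (\<kappa> t * ?g t))"
            by (auto simp: algebra_simps)
          then show ?thesis using i1 i2 by (simp add: B1_def right_diff_distrib)
        qed
        finally show ?case .
      qed
    qed
    also have "\<dots> = (\<integral>z. c * (f z * (\<zeta> (fst z) * \<eta>1 (snd z))) - g z * (\<zeta> (fst z) * \<kappa> (snd z)) \<partial>lebesgue_on Q)"
      using int_slices(6)[of "\<lambda>z. c * (f z * (\<zeta> (fst z) * \<eta>1 (snd z))) - g z * (\<zeta> (fst z) * \<kappa> (snd z))"]
        ti[OF fi \<eta>1(1)] ti[OF gi \<kappa>(1)] by simp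
    also have "\<dots> = c * (\<integral>z. f z * (\<zeta> (fst z) * \<eta>1 (snd z)) \<partial>lebesgue_on Q) + (\<integral>z. f z * (\<zeta> (fst z) * \<theta> (snd z)) \<partial>lebesgue_on Q)"
      using ti[OF fi \<eta>1(1)] ti[OF gi \<kappa>(1)] weak by simp
    also have "\<dots> = (\<integral>z. c * (f z * (\<zeta> (fst z) * \<eta>1 (snd z))) + f z * (\<zeta> (fst z) * \<theta> (snd z)) \<partial>lebesgue_on Q)"
      using ti[OF fi \<eta>1(1)] ti[OF fi \<theta>t] by simp
    also have "\<dots> = (\<integral>z. f z * (\<zeta> (fst z) * \<eta> (snd z)) \<partial>lebesgue_on Q)"
      by (simp add: \<theta>_def algebra_simps)
    finally have "(\<integral>z. w z * (\<zeta> (fst z) * \<eta> (snd z)) \<partial>lebesgue_on Q) = 0"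
      unfolding w_def using ti[OF fi \<eta>] ti[OF Bochner_Integration.integrable_add[OF Bi Pi] \<eta>]
      by (simp add: left_diff_distrib[of "f _"])
    then show "(\<integral>z. w z * (\<zeta> (fst z) * \<eta> (snd z)) \<partial>lebesgue_on (\<Omega> \<times> I)) = 0"
      by (simp add: cylinder_def)
  qed (use open_\<Omega> in auto)
  then have "AE z in lebesgue_on Q. f z = B (fst z) + time_primitive I g z"
    unfolding cylinder_def by (elim eventually_mono) (simp add: w_def)
  with BL show ?thesis by (rule that)
qed

end

context bounded_cylinder
begin

section \<open>Initial values\<close>

lemma time_primitive_at:
  assumes "g \<in> L2 Q"
  shows "(\<lambda>x. time_primitive I g (x, t)) \<in> L2 \<Omega>"
  unfolding time_primitive_def fst_conv snd_conv
  by (rule weighted_time_integral_L2(1)[OF assms, where c = 1]) (auto simp: indicator_def borel_measurable_indicator)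

text \<open>Cauchy--Schwarz in time: the primitive is Hoelder continuous with exponent \<open>1/2\<close>.\<close>

lemma time_primitive_increment:
  assumes g: "g \<in> L2 Q"
  shows "L2_norm \<Omega> (\<lambda>x. time_primitive I g (x, s) - time_primitive I g (x, t)) \<le> sqrt \<bar>s - t\<bar> * L2_norm Q g"
proof -
  define h where "h u = (indicator {..<s} u - indicator {..<t} u :: real)" for u
  have hm: "h \<in> borel_measurable borel" unfolding h_def[abs_def] by (intro borel_measurable_diff borel_measurable_indicator) auto
  have hb: "\<bar>h u\<bar> \<le> 1" for u by (auto simp: h_def indicator_def)
  note w = weighted_time_integral_L2[OF g hm hb]
  have ae: "AE x in lebesgue_on \<Omega>. time_primitive I g (x, s) - time_primitive I g (x, t) = (\<integral>u. h u * g (x, u) \<partial>lebesgue_on I)"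
    using int_slices(4)[OF L2_integrable[OF lmeasurable(3) g]]
  proof eventually_elim
    case (elim x)
    have i: "integrable (lebesgue_on I) (\<lambda>u. indicator {..<r} u * g (x, u))" for r :: real
    proof (rule Bochner_Integration.integrable_bound[OF elim])
      have "(\<lambda>u. indicator {..<r} u :: real) \<in> borel_measurable (lebesgue_on I)"
        by (intro borel_measurable_lebesgue_onI borel_measurable_indicator) auto
      then show "(\<lambda>u. indicator {..<r} u * g (x, u)) \<in> borel_measurable (lebesgue_on I)"
        using borel_measurable_integrable[OF elim] by (rule borel_measurable_times)
    qed (auto simp: indicator_def)
    show ?case using i by (simp add: time_primitive_def h_def left_diff_distrib)
  qed
  have "(L2_norm I h)\<^sup>2 \<le> \<bar>s - t\<bar>"
  proof -
    let ?A = "{min s t..<max s t}"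
    let ?k = "\<lambda>u. indicator (I \<inter> ?A) u :: real"
    have "(L2_norm I h)\<^sup>2 = (\<integral>u. (h u)\<^sup>2 \<partial>lebesgue_on I)" by (rule L2_norm_power2)
    also have "\<dots> = (\<integral>u. ?k u \<partial>lebesgue_on I)"
      by (rule Bochner_Integration.integral_cong) (auto simp: h_def indicator_def min_def max_def split: if_splits)
    also have "\<dots> = (\<integral>u. ?k u \<partial>lborel)"
      by (rule borel_zero_outside(2)[OF sets_borel(2)]) auto
    also have "\<dots> \<le> (\<integral>u. indicator ?A u \<partial>lborel)"
    proof (rule integral_mono)
      show i1: "integrable lborel (indicator ?A :: real \<Rightarrow> real)" by (rule integrable_real_indicator) auto
      show "integrable lborel ?k"
        by (rule Bochner_Integration.integrable_bound[OF i1]) (auto simp: indicator_def)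
    qed (auto simp: indicator_def)
    also have "\<dots> = \<bar>s - t\<bar>" by (auto simp: min_def max_def)
    finally show ?thesis .
  qed
  then have "(L2_norm \<Omega> (\<lambda>x. \<integral>u. h u * g (x, u) \<partial>lebesgue_on I))\<^sup>2 \<le> \<bar>s - t\<bar> * (L2_norm Q g)\<^sup>2"
    using w(2) by (meson mult_right_mono order_trans zero_le_power2)
  also have "\<dots> = (sqrt \<bar>s - t\<bar> * L2_norm Q g)\<^sup>2" by (simp add: power_mult_distrib)
  finally have "L2_norm \<Omega> (\<lambda>x. \<integral>u. h u * g (x, u) \<partial>lebesgue_on I) \<le> sqrt \<bar>s - t\<bar> * L2_norm Q g"
    by (rule power2_le_imp_le) (simp add: L2_norm_nonneg)
  then show ?thesis using L2_norm_cong_AE[OF ae sets_lebesgue(1)] by simp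
qed

lemma sqrt_increment_tendsto_0: "((\<lambda>s. sqrt \<bar>s - t\<bar> * c) \<longlongrightarrow> 0) (at t within A)"
proof -
  have "((\<lambda>s. sqrt \<bar>s - t\<bar> * c) \<longlongrightarrow> sqrt \<bar>t - t\<bar> * c) (at t within A)"
    by (intro tendsto_intros)
  then show ?thesis by simp
qed

lemma primitive_has_time_value:
  assumes B: "B \<in> L2 \<Omega>" and g: "g \<in> L2 Q" and ae: "AE z in lebesgue_on Q. f z = B (fst z) + time_primitive I g z"
  shows "has_time_value \<Omega> T f t0 (\<lambda>x. B x + time_primitive I g (x, t0))"
  unfolding has_time_value_def
proof (intro exI[of _ "\<lambda>t x. B x + time_primitive I g (x, t)"] conjI ballI)
  show "(\<lambda>x. B x + time_primitive I g (x, t)) \<in> L2 \<Omega>" for t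
    by (rule L2_add[OF B time_primitive_at[OF g]])
  show "((\<lambda>s. L2_norm \<Omega> (\<lambda>x. (B x + time_primitive I g (x, s)) - (B x + time_primitive I g (x, t)))) \<longlongrightarrow> 0) (at t within {0..T})" for t
    by (rule tendsto_sandwich[OF _ _ tendsto_const sqrt_increment_tendsto_0[of t "L2_norm Q g"]])
       (simp_all add: L2_norm_nonneg time_primitive_increment[OF g])
  show "AE t in lebesgue_on I. AE x in lebesgue_on \<Omega>. B x + time_primitive I g (x, t) = f (x, t)"
    using AE_slices(2)[OF ae]
  proof eventually_elim
    case (elim t)
    then show ?case by eventually_elim simp
  qed
qed simp

lemma time_primitive_0: "time_primitive I g (x, 0) = 0"
proof -
  have "(\<integral>s. indicator {..<0} s * g (x, s) \<partial>lebesgue_on I) = (\<integral>s. 0 \<partial>lebesgue_on I)"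
    by (rule Bochner_Integration.integral_cong) (auto simp: indicator_def)
  then show ?thesis by (simp add: time_primitive_def)
qed

text \<open>Both descriptions of \<open>S(q)\<close> are continuous in time with values in \<open>L\<^sup>2\<close>, the first because \<open>S\<close> is
  Lipschitz continuous, and they agree at almost every time.\<close>

lemma initial_value_unique:
  assumes T: "0 < T" and q: "has_time_value \<Omega> T q 0 q0"
    and S: "continuous_on UNIV S" "\<And>a b. \<bar>S a - S b\<bar> \<le> L * \<bar>a - b\<bar>" "\<And>a. \<bar>S a\<bar> \<le> c"
    and B: "B \<in> L2 \<Omega>" and g: "g \<in> L2 Q"
    and ae: "AE z in lebesgue_on Q. S (q z) = B (fst z) + time_primitive I g z"
  shows "AE x in lebesgue_on \<Omega>. S (q0 x) = B x"
proof -
  obtain G where G: "\<And>t. t \<in> {0..T} \<Longrightarrow> G t \<in> L2 \<Omega>"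
    "\<And>t. t \<in> {0..T} \<Longrightarrow> ((\<lambda>s. L2_norm \<Omega> (\<lambda>x. G s x - G t x)) \<longlongrightarrow> 0) (at t within {0..T})"
    "AE t in lebesgue_on I. AE x in lebesgue_on \<Omega>. G t x = q (x, t)" "AE x in lebesgue_on \<Omega>. G 0 x = q0 x"
    using q unfolding has_time_value_def by blast
  have SG: "(\<lambda>x. S (G t x)) \<in> L2 \<Omega>" if "t \<in> {0..T}" for t
    using measurable_compose[OF L2_measurable[OF G(1)[OF that]] borel_measurable_continuous_onI[OF S(1)]] S(3)
    by (intro bounded_L2[OF lmeasurable(1)]) auto
  have T0: "0 \<in> {0..T}" using T by simp
  have dL: "(L2_norm \<Omega> (\<lambda>x. S (G 0 x) - S (G t x)))\<^sup>2 \<le> L\<^sup>2 * (L2_norm \<Omega> (\<lambda>x. G t x - G 0 x))\<^sup>2" if t: "t \<in> {0..T}" for t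
  proof -
    note d = L2_diff[OF G(1)[OF t] G(1)[OF T0]]
    have "(\<integral>x. (S (G 0 x) - S (G t x))\<^sup>2 \<partial>lebesgue_on \<Omega>) \<le> (\<integral>x. L\<^sup>2 * (G t x - G 0 x)\<^sup>2 \<partial>lebesgue_on \<Omega>)"
    proof (rule integral_mono)
      show "integrable (lebesgue_on \<Omega>) (\<lambda>x. (S (G 0 x) - S (G t x))\<^sup>2)" by (rule L2_square[OF L2_diff[OF SG[OF T0] SG[OF t]]])
      show "integrable (lebesgue_on \<Omega>) (\<lambda>x. L\<^sup>2 * (G t x - G 0 x)\<^sup>2)" using L2_square[OF d] by simp
      show "(S (G 0 x) - S (G t x))\<^sup>2 \<le> L\<^sup>2 * (G t x - G 0 x)\<^sup>2" for x
        using power_mono[OF S(2)[of "G 0 x" "G t x"] abs_ge_zero, of 2]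
        by (simp add: power_mult_distrib power2_commute[of "G 0 x"])
    qed
    then show ?thesis using L2_square[OF d] by (simp add: L2_norm_power2)
  qed
  have good: "AE t in lebesgue_on I. AE x in lebesgue_on \<Omega>. S (G t x) = B x + time_primitive I g (x, t)"
    using G(3) AE_slices(2)[OF ae]
  proof eventually_elim
    case (elim t)
    then show ?case by eventually_elim simp
  qed
  \<comment> \<open>Times that tend to \<open>0\<close> and at which the two descriptions agree.\<close>
  define t where "t n = (SOME t. t \<in> I \<and> t < 1 / real (Suc n) \<and> (AE x in lebesgue_on \<Omega>. S (G t x) = B x + time_primitive I g (x, t)))" for n
  have t: "t n \<in> I" "t n < 1 / real (Suc n)" "AE x in lebesgue_on \<Omega>. S (G (t n) x) = B x + time_primitive I g (x, t n)" for n
  proof -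
    have "\<exists>t. t \<in> I \<and> t < 1 / real (Suc n) \<and> (AE x in lebesgue_on \<Omega>. S (G t x) = B x + time_primitive I g (x, t))"
      using AE_time_near_0[OF good T, of "1 / real (Suc n)"] by auto
    from someI_ex[OF this] show "t n \<in> I" "t n < 1 / real (Suc n)"
      "AE x in lebesgue_on \<Omega>. S (G (t n) x) = B x + time_primitive I g (x, t n)" unfolding t_def by auto
  qed
  have tl: "t \<longlonglongrightarrow> 0"
    by (rule tendsto_sandwich[OF _ _ tendsto_const LIMSEQ_inverse_real_of_nat])
       (use t(1,2) in \<open>auto simp: less_imp_le inverse_eq_divide\<close>)
  have tI: "t n \<in> {0..T}" "t n \<noteq> 0" for n using t(1)[of n] by auto
  have Gt: "(\<lambda>n. L2_norm \<Omega> (\<lambda>x. G (t n) x - G 0 x)) \<longlonglongrightarrow> 0"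
    using G(2)[OF T0] tl tI unfolding tendsto_at_iff_sequentially by (auto simp: o_def)
  have Pt: "(\<lambda>n. L2_norm \<Omega> (\<lambda>x. time_primitive I g (x, t n))) \<longlonglongrightarrow> 0"
  proof (rule tendsto_sandwich[OF _ _ tendsto_const])
    have "(\<lambda>n. sqrt \<bar>t n - 0\<bar> * L2_norm Q g) \<longlonglongrightarrow> sqrt \<bar>0 - 0\<bar> * L2_norm Q g" by (intro tendsto_intros tl)
    then show "(\<lambda>n. sqrt \<bar>t n - 0\<bar> * L2_norm Q g) \<longlonglongrightarrow> 0" by simp
    show "\<forall>\<^sub>F n in sequentially. L2_norm \<Omega> (\<lambda>x. time_primitive I g (x, t n)) \<le> sqrt \<bar>t n - 0\<bar> * L2_norm Q g"
      using time_primitive_increment[OF g, of "t _" 0] by (simp add: time_primitive_0)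
  qed (simp add: L2_norm_nonneg)
  have le: "(L2_norm \<Omega> (\<lambda>x. S (G 0 x) - B x))\<^sup>2 \<le> 2 * (L\<^sup>2 * (L2_norm \<Omega> (\<lambda>x. G (t n) x - G 0 x))\<^sup>2)
      + 2 * (L2_norm \<Omega> (\<lambda>x. time_primitive I g (x, t n)))\<^sup>2" for n
  proof -
    have "AE x in lebesgue_on \<Omega>. 1 * (S (G 0 x) - S (G (t n) x)) + 1 * time_primitive I g (x, t n) = S (G 0 x) - B x"
      using t(3)[of n] by (elim eventually_mono) simp
    from L2_norm_cong_AE[OF this sets_lebesgue(1)]
      L2_norm_add_power2[OF L2_diff[OF SG[OF T0] SG[OF tI(1)]] time_primitive_at[OF g], of 1 n 1 "t n"]
    have "(L2_norm \<Omega> (\<lambda>x. S (G 0 x) - B x))\<^sup>2 \<le> 2 * (L2_norm \<Omega> (\<lambda>x. S (G 0 x) - S (G (t n) x)))\<^sup>2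
      + 2 * (L2_norm \<Omega> (\<lambda>x. time_primitive I g (x, t n)))\<^sup>2" by simp
    then show ?thesis using dL[OF tI(1), of n] by linarith
  qed
  have "(\<lambda>n. 2 * (L\<^sup>2 * (L2_norm \<Omega> (\<lambda>x. G (t n) x - G 0 x))\<^sup>2) + 2 * (L2_norm \<Omega> (\<lambda>x. time_primitive I g (x, t n)))\<^sup>2)
     \<longlonglongrightarrow> 2 * (L\<^sup>2 * 0\<^sup>2) + 2 * 0\<^sup>2" by (intro tendsto_intros Gt Pt)
  from LIMSEQ_le_const[OF this, of "(L2_norm \<Omega> (\<lambda>x. S (G 0 x) - B x))\<^sup>2"] le
  have "(L2_norm \<Omega> (\<lambda>x. S (G 0 x) - B x))\<^sup>2 \<le> 2 * (L\<^sup>2 * 0\<^sup>2) + 2 * 0\<^sup>2" by blast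
  then have "(L2_norm \<Omega> (\<lambda>x. S (G 0 x) - B x))\<^sup>2 \<le> 0" by simp
  then have z: "(\<integral>x. (S (G 0 x) - B x)\<^sup>2 \<partial>lebesgue_on \<Omega>) = 0"
    by (simp add: L2_norm_power2[symmetric])
  have "AE x in lebesgue_on \<Omega>. (S (G 0 x) - B x)\<^sup>2 = 0"
    using integral_nonneg_eq_0_iff_AE[OF L2_square[OF L2_diff[OF SG[OF T0] B]]] z by simp
  with G(4) show ?thesis by eventually_elim simp
qed

section \<open>Products of a function of space and a function of time\<close>

lemma L2_fst: "v \<in> L2 \<Omega> \<Longrightarrow> (\<lambda>z. v (fst z)) \<in> L2 Q"
  using meas_fst[of v] int_fst[of "\<lambda>x. (v x)\<^sup>2"] by (simp add: L2_def)

text \<open>Simple functions that approximate \<open>c\<close> give simple functions with values in the line spanned by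
  \<open>v\<close>.\<close>

lemma product_L2_H20:
  assumes v: "v \<in> Hk0 2 \<Omega>" and c: "c \<in> borel_measurable borel" "\<And>t. \<bar>c t\<bar> \<le> C"
  shows "(\<lambda>z. v (fst z) * c (snd z)) \<in> L2_H20 \<Omega> T"
proof -
  interpret fI: finite_measure "lebesgue_on I" by (rule finite_measures)
  have cI: "c \<in> borel_measurable (lebesgue_on I)" by (rule borel_measurable_lebesgue_onI[OF c(1)])
  note H = Hk0_cmult[OF v open_\<Omega> lmeasurable(1)]
  note N = Hk_norm_cmult[OF Hk0_Hk[OF v] open_\<Omega>]
  have sl: "slice (\<lambda>z. v (fst z) * c (snd z)) = (\<lambda>t x. c t * v x)" by (simp add: slice_def fun_eq_iff mult.commute)
  obtain F where F: "\<And>i. simple_function (lebesgue_on I) (F i)" "\<And>x. x \<in> I \<Longrightarrow> (\<lambda>i. F i x) \<longlonglongrightarrow> c x"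
    using borel_measurable_implies_sequence_metric[OF cI, of 0] unfolding space_lebesgue_on by blast
  have "bochner_measurable T (Hk0 2 \<Omega>) (Hk_norm 2 \<Omega>) (\<lambda>t x. c t * v x)"
    unfolding bochner_measurable_def
  proof (intro conjI exI[of _ "\<lambda>n t x. F n t * v x"] allI)
    show "AE t in lebesgue_on I. (\<lambda>x. c t * v x) \<in> Hk0 2 \<Omega>" using H by simp
    show "simple_function (lebesgue_on I) (\<lambda>t x. F n t * v x)" for n
      using simple_function_compose1[OF F(1)[of n], of "\<lambda>y x. y * v x"] .
    show "(\<lambda>t x. F n t * v x) ` I \<subseteq> Hk0 2 \<Omega>" for n using H by auto
    show "AE t in lebesgue_on I. (\<lambda>n. Hk_norm 2 \<Omega> (\<lambda>x. F n t * v x - c t * v x)) \<longlonglongrightarrow> 0"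
    proof (rule AE_I2)
      fix t assume "t \<in> space (lebesgue_on I)"
      then have "(\<lambda>n. \<bar>F n t - c t\<bar> * Hk_norm 2 \<Omega> v) \<longlonglongrightarrow> \<bar>c t - c t\<bar> * Hk_norm 2 \<Omega> v"
        by (intro tendsto_intros F(2)) simp
      then show "(\<lambda>n. Hk_norm 2 \<Omega> (\<lambda>x. F n t * v x - c t * v x)) \<longlonglongrightarrow> 0"
        by (simp add: N left_diff_distrib[symmetric])
    qed
  qed
  moreover have "integrable (lebesgue_on I) (\<lambda>t. (Hk_norm 2 \<Omega> (\<lambda>x. c t * v x))\<^sup>2)"
  proof -
    have "(\<lambda>t. c t * Hk_norm 2 \<Omega> v) \<in> L2 I"
      using L2_cmult[OF bounded_L2[OF lmeasurable(2) cI c(2)], of "Hk_norm 2 \<Omega> v"] by (simp add: mult.commute)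
    from L2_square[OF this] show ?thesis by (simp add: N power_mult_distrib)
  qed
  moreover have "(\<lambda>z. v (fst z) * c (snd z)) \<in> borel_measurable (lebesgue_on Q)"
    using meas_fst[OF L2_measurable[OF Hk_L2[OF Hk0_Hk[OF v]]]] meas_snd[OF cI] by (rule borel_measurable_times)
  ultimately show ?thesis by (simp add: L2_H20_def bochner_Lp_def sl)
qed

lemma Linf_norm_cmult: "Linf_norm \<Omega> (\<lambda>x. c * f x) = \<bar>c\<bar> * Linf_norm \<Omega> f"
proof (cases "c = 0")
  case True
  have "esssup (lebesgue_on \<Omega>) (\<lambda>x. ereal 0) \<in> {0, - \<infinity>}"
    by (cases "emeasure (lebesgue_on \<Omega>) (space (lebesgue_on \<Omega>)) = 0")
       (simp_all add: esssup_const esssup_zero_space zero_ereal_def)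
  then show ?thesis using True by (auto simp: Linf_norm_def)
next
  case False
  have e: "(\<lambda>x. ereal \<bar>c * f x\<bar>) = (\<lambda>x. ereal \<bar>c\<bar> * ereal \<bar>f x\<bar>)" by (simp add: abs_mult)
  have "esssup (lebesgue_on \<Omega>) (\<lambda>x. ereal \<bar>c * f x\<bar>) = ereal \<bar>c\<bar> * esssup (lebesgue_on \<Omega>) (\<lambda>x. ereal \<bar>f x\<bar>)"
    unfolding e by (rule esssup_cmult) (use False in simp)
  then show ?thesis by (simp add: Linf_norm_def)
qed

lemma product_bochner_Linf:
  assumes v: "v \<in> test_functions \<Omega>" and c: "c \<in> test_functions V"
  shows "slice (\<lambda>z. v (fst z) * c (snd z)) \<in> bochner_Lp 1 T (Linf \<Omega>) (Linf_norm \<Omega>)"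
proof -
  interpret fI: finite_measure "lebesgue_on I" by (rule finite_measures)
  note cI = borel_measurable_lebesgue_onI[OF test_functions_borel[OF c], of I]
  obtain D where D: "D \<ge> 0" "\<And>x. \<bar>v x\<bar> \<le> D" using test_functions_bounded[OF v] by blast
  obtain C where C: "\<And>x. \<bar>c x\<bar> \<le> C" using test_functions_bounded[OF c] by blast
  have H: "(\<lambda>x. k * v x) \<in> Linf \<Omega>" for k
  proof -
    have m: "(\<lambda>x. k * v x) \<in> borel_measurable (lebesgue_on \<Omega>)"
      using borel_measurable_lebesgue_onI[OF test_functions_borel[OF v]] by measurable
    have "esssup (lebesgue_on \<Omega>) (\<lambda>x. ereal \<bar>k * v x\<bar>) \<le> ereal (\<bar>k\<bar> * D)"
    proof (rule esssup_I)
      show "(\<lambda>x. ereal \<bar>k * v x\<bar>) \<in> borel_measurable (lebesgue_on \<Omega>)" using m by measurable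
      show "AE x in lebesgue_on \<Omega>. ereal \<bar>k * v x\<bar> \<le> ereal (\<bar>k\<bar> * D)"
        using D by (intro AE_I2) (auto simp: abs_mult mult_left_mono)
    qed
    then show ?thesis using m by (auto simp: Linf_def)
  qed
  have sl: "slice (\<lambda>z. v (fst z) * c (snd z)) = (\<lambda>t x. c t * v x)" by (simp add: slice_def fun_eq_iff mult.commute)
  obtain F where F: "\<And>i. simple_function (lebesgue_on I) (F i)" "\<And>x. x \<in> I \<Longrightarrow> (\<lambda>i. F i x) \<longlonglongrightarrow> c x"
    using borel_measurable_implies_sequence_metric[OF cI, of 0] unfolding space_lebesgue_on by blast
  have "bochner_measurable T (Linf \<Omega>) (Linf_norm \<Omega>) (\<lambda>t x. c t * v x)"
    unfolding bochner_measurable_def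
  proof (intro conjI exI[of _ "\<lambda>n t x. F n t * v x"] allI)
    show "AE t in lebesgue_on I. (\<lambda>x. c t * v x) \<in> Linf \<Omega>" using H by simp
    show "simple_function (lebesgue_on I) (\<lambda>t x. F n t * v x)" for n
      using simple_function_compose1[OF F(1)[of n], of "\<lambda>y x. y * v x"] .
    show "(\<lambda>t x. F n t * v x) ` I \<subseteq> Linf \<Omega>" for n using H by auto
    show "AE t in lebesgue_on I. (\<lambda>n. Linf_norm \<Omega> (\<lambda>x. F n t * v x - c t * v x)) \<longlonglongrightarrow> 0"
    proof (rule AE_I2)
      fix t assume "t \<in> space (lebesgue_on I)"
      then have "(\<lambda>n. \<bar>F n t - c t\<bar> * Linf_norm \<Omega> v) \<longlonglongrightarrow> \<bar>c t - c t\<bar> * Linf_norm \<Omega> v"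
        by (intro tendsto_intros F(2)) simp
      then show "(\<lambda>n. Linf_norm \<Omega> (\<lambda>x. F n t * v x - c t * v x)) \<longlonglongrightarrow> 0"
        by (simp add: Linf_norm_cmult left_diff_distrib[symmetric])
    qed
  qed
  moreover have "integrable (lebesgue_on I) (\<lambda>t. \<bar>c t\<bar> * Linf_norm \<Omega> v)"
    using L2_integrable[OF lmeasurable(2) bounded_L2[OF lmeasurable(2) cI C]] by auto
  ultimately show ?thesis by (simp add: bochner_Lp_def sl Linf_norm_cmult)
qed

lemma product_time_value_zero:
  assumes v: "v \<in> L2 \<Omega>" and c: "continuous_on UNIV c" "c T = 0"
  shows "has_time_value \<Omega> T (\<lambda>z. v (fst z) * c (snd z)) T (\<lambda>x. 0)"
  unfolding has_time_value_def
proof (intro exI[of _ "\<lambda>t x. c t * v x"] conjI ballI)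
  show "(\<lambda>x. c t * v x) \<in> L2 \<Omega>" for t by (rule L2_cmult[OF v])
  show "((\<lambda>s. L2_norm \<Omega> (\<lambda>x. c s * v x - c t * v x)) \<longlongrightarrow> 0) (at t within {0..T})" for t
  proof -
    have "(c \<longlongrightarrow> c t) (at t within {0..T})"
      using c(1) by (meson UNIV_I continuous_on_def subset_UNIV tendsto_within_subset)
    then have "((\<lambda>s. \<bar>c s - c t\<bar> * L2_norm \<Omega> v) \<longlongrightarrow> \<bar>c t - c t\<bar> * L2_norm \<Omega> v) (at t within {0..T})"
      by (intro tendsto_intros)
    then show ?thesis by (simp add: L2_norm_cmult left_diff_distrib[symmetric])
  qed
qed (auto simp: c(2) mult.commute)

end

lemma test_function_real_derivative:
  fixes \<eta> :: "real \<Rightarrow> real"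
  assumes "\<eta> \<in> test_functions V"
  shows "(\<eta> has_real_derivative frechet_derivative \<eta> (at t) 1) (at t)"
    and "deriv \<eta> t = frechet_derivative \<eta> (at t) 1"
proof -
  note d = test_functions_has_derivative[OF assms, of t]
  have "frechet_derivative \<eta> (at t) h = frechet_derivative \<eta> (at t) 1 * h" for h
    using linear_scale[OF has_derivative_linear[OF d], of h 1] by (simp add: mult.commute)
  then have "frechet_derivative \<eta> (at t) = (*) (frechet_derivative \<eta> (at t) 1)" by (rule ext)
  then show 1: "(\<eta> has_real_derivative frechet_derivative \<eta> (at t) 1) (at t)"
    using d unfolding has_field_derivative_def by simp
  then show "deriv \<eta> t = frechet_derivative \<eta> (at t) 1" by (rule DERIV_imp_deriv)
qed

context bounded_cylinder
begin

section \<open>The duality pairing with the time derivative\<close>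

lemma product_Q_integral:
  assumes w: "w \<in> L2 Q" and v: "v \<in> L2 \<Omega>" and h: "h \<in> borel_measurable borel" "\<And>t. \<bar>h t\<bar> \<le> c"
  shows "integrable (lebesgue_on Q) (\<lambda>z. w z * (v (fst z) * h (snd z)))"
    and "(\<integral>z. w z * (v (fst z) * h (snd z)) \<partial>lebesgue_on Q) = (\<integral>x. (\<integral>t. h t * w (x, t) \<partial>lebesgue_on I) * v x \<partial>lebesgue_on \<Omega>)"
proof -
  have hI: "h \<in> borel_measurable (lebesgue_on I)" by (rule borel_measurable_lebesgue_onI[OF h(1)])
  have "(\<lambda>z. h (snd z) * v (fst z)) \<in> L2 Q" by (rule L2_bounded_mult[OF L2_fst[OF v] meas_snd[OF hI] h(2)])
  from L2_mult_integrable[OF w this]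
  show i: "integrable (lebesgue_on Q) (\<lambda>z. w z * (v (fst z) * h (snd z)))" by (simp add: mult_ac)
  have "(\<integral>t. w (x, t) * (v x * h t) \<partial>lebesgue_on I) = (\<integral>t. h t * w (x, t) \<partial>lebesgue_on I) * v x" for x
  proof -
    have "(\<lambda>t. w (x, t) * (v x * h t)) = (\<lambda>t. (h t * w (x, t)) * v x)" by (auto simp: mult_ac)
    then show ?thesis by simp
  qed
  then show "(\<integral>z. w z * (v (fst z) * h (snd z)) \<partial>lebesgue_on Q) = (\<integral>x. (\<integral>t. h t * w (x, t) \<partial>lebesgue_on I) * v x \<partial>lebesgue_on \<Omega>)"
    using int_slices(6)[OF i] by simp
qed

text \<open>Once the integration over time is carried out, both sides are continuous functionals of
  \<open>v\<close> in \<open>L\<^sup>2\<close>, and test functions are dense in \<open>H\<^sub>0\<^sup>2\<close>.\<close>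

lemma weak_time_derivative_Hk0:
  assumes w: "w \<in> L2 Q" and g: "g \<in> L2 Q" and wd: "has_weak_deriv Q (0, 1) w g"
    and v: "v \<in> Hk0 2 \<Omega>" and \<eta>: "\<eta> \<in> test_functions I"
  shows "(\<integral>z. w z * (v (fst z) * deriv \<eta> (snd z)) \<partial>lebesgue_on Q) = - (\<integral>z. g z * (v (fst z) * \<eta> (snd z)) \<partial>lebesgue_on Q)"
proof -
  have d: "deriv \<eta> = (\<lambda>t. frechet_derivative \<eta> (at t) 1)" using test_function_real_derivative(2)[OF \<eta>] by auto
  have dt: "deriv \<eta> \<in> test_functions I" unfolding d by (rule test_functions_derivative[OF \<eta>])
  obtain c where c: "\<And>t. \<bar>\<eta> t\<bar> \<le> c" using test_functions_bounded[OF \<eta>] by blast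
  obtain c' where c': "\<And>t. \<bar>deriv \<eta> t\<bar> \<le> c'" using test_functions_bounded[OF dt] by blast
  define W where "W x = (\<integral>t. deriv \<eta> t * w (x, t) \<partial>lebesgue_on I)" for x
  define G where "G x = (\<integral>t. \<eta> t * g (x, t) \<partial>lebesgue_on I)" for x
  have WL: "W \<in> L2 \<Omega>" unfolding W_def[abs_def] by (rule weighted_time_integral_L2(1)[OF w test_functions_borel[OF dt] c'])
  have GL: "G \<in> L2 \<Omega>" unfolding G_def[abs_def] by (rule weighted_time_integral_L2(1)[OF g test_functions_borel[OF \<eta>] c])
  note eqW = product_Q_integral(2)[OF w _ test_functions_borel[OF dt] c', folded W_def]
  note eqG = product_Q_integral(2)[OF g _ test_functions_borel[OF \<eta>] c, folded G_def]
  have test: "(\<integral>x. W x * \<zeta> x \<partial>lebesgue_on \<Omega>) = - (\<integral>x. G x * \<zeta> x \<partial>lebesgue_on \<Omega>)" if \<zeta>: "\<zeta> \<in> test_functions \<Omega>" for \<zeta>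
  proof -
    have t: "(\<lambda>z. \<zeta> (fst z) * \<eta> (snd z)) \<in> test_functions Q"
      using test_functions_product[OF \<zeta> \<eta>] by (simp add: cylinder_def)
    have "(\<integral>z. w z * frechet_derivative (\<lambda>z. \<zeta> (fst z) * \<eta> (snd z)) (at z) (0, 1) \<partial>lebesgue_on Q)
        = - (\<integral>z. g z * (\<zeta> (fst z) * \<eta> (snd z)) \<partial>lebesgue_on Q)"
      using wd t unfolding has_weak_deriv_def by blast
    then have "(\<integral>z. w z * (\<zeta> (fst z) * deriv \<eta> (snd z)) \<partial>lebesgue_on Q) = - (\<integral>z. g z * (\<zeta> (fst z) * \<eta> (snd z)) \<partial>lebesgue_on Q)"
      by (simp only: frechet_derivative_product_time[OF \<zeta> \<eta> test_function_real_derivative(1)[OF \<eta>]] d)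
    then show ?thesis
      using eqW[OF test_functions_L2[OF \<zeta> lmeasurable(1)]] eqG[OF test_functions_L2[OF \<zeta> lmeasurable(1)]] by simp
  qed
  obtain \<zeta> where \<zeta>: "\<And>n. \<zeta> n \<in> test_functions \<Omega>" "(\<lambda>n. Hk_norm 2 \<Omega> (\<lambda>x. \<zeta> n x - v x)) \<longlonglongrightarrow> 0"
    using v by (auto simp: Hk0_def)
  have vL: "v \<in> L2 \<Omega>" using Hk_L2[OF Hk0_Hk[OF v]] .
  have z: "(\<lambda>n. L2_norm \<Omega> (\<lambda>x. \<zeta> n x - v x)) \<longlonglongrightarrow> 0"
    by (rule tendsto_sandwich[OF _ _ tendsto_const \<zeta>(2)]) (simp_all add: L2_norm_nonneg L2_norm_le_Hk_norm)
  note l = L2_inner_tendsto[OF test_functions_L2[OF \<zeta>(1) lmeasurable(1)] vL _ z]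
  have "(\<lambda>n. \<integral>x. \<zeta> n x * W x \<partial>lebesgue_on \<Omega>) \<longlonglongrightarrow> - (\<integral>x. v x * G x \<partial>lebesgue_on \<Omega>)"
    using tendsto_minus[OF l[OF GL]] test[OF \<zeta>(1)] by (simp add: mult.commute)
  with l[OF WL] have "(\<integral>x. v x * W x \<partial>lebesgue_on \<Omega>) = - (\<integral>x. v x * G x \<partial>lebesgue_on \<Omega>)"
    by (rule LIMSEQ_unique)
  then show ?thesis unfolding eqW[OF vL] eqG[OF vL] by (simp add: mult.commute)
qed

lemma dual_section:
  assumes F: "F \<in> bochner_Lp 2 T (Hk_dual 2 \<Omega>) (Hk_dual_norm 2 \<Omega>)" and v: "v \<in> Hk0 2 \<Omega>"
  shows "integrable (lebesgue_on I) (\<lambda>t. F t v)"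
proof -
  interpret fI: finite_measure "lebesgue_on I" by (rule finite_measures)
  have F2: "integrable (lebesgue_on I) (\<lambda>t. (Hk_dual_norm 2 \<Omega> (F t))\<^sup>2)"
    and Fd: "AE t in lebesgue_on I. F t \<in> Hk_dual 2 \<Omega>"
    using F by (auto simp: bochner_Lp_def bochner_measurable_def)
  obtain s where s: "\<And>n. simple_function (lebesgue_on I) (s n)" "\<And>n. s n ` I \<subseteq> Hk_dual 2 \<Omega>"
    "AE t in lebesgue_on I. (\<lambda>n. Hk_dual_norm 2 \<Omega> (\<lambda>v. s n t v - F t v)) \<longlonglongrightarrow> 0"
    using F unfolding bochner_Lp_def bochner_measurable_def by blast
  have m: "(\<lambda>t. F t v) \<in> borel_measurable (lebesgue_on I)"
  proof (rule borel_measurable_lebesgue_on_cong_AE[OF _ _ sets_lebesgue(2)])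
    show "(\<lambda>t. lim (\<lambda>n. s n t v)) \<in> borel_measurable (lebesgue_on I)"
      using borel_measurable_simple_function[OF simple_function_compose1[OF s(1), of "\<lambda>l. l v"]]
      by (intro borel_measurable_lim_metric)
    show "AE t in lebesgue_on I. lim (\<lambda>n. s n t v) = F t v"
      using Fd s(3) AE_space
    proof eventually_elim
      case (elim t)
      then have t: "t \<in> I" by simp
      have "(\<lambda>n. s n t v - F t v) \<longlonglongrightarrow> 0"
      proof (rule tendsto_0_le[OF elim(2), of _ "Hk_norm 2 \<Omega> v"], rule always_eventually, rule allI)
        fix n
        have "s n t \<in> Hk_dual 2 \<Omega>" using s(2) t by blast
        from Hk_dual_norm_bound[OF Hk_dual_diff[OF this elim(1)] v open_\<Omega> lmeasurable(1)]
        show "norm (s n t v - F t v) \<le> norm (Hk_dual_norm 2 \<Omega> (\<lambda>v. s n t v - F t v)) * Hk_norm 2 \<Omega> v"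
          using mult_right_mono[OF abs_ge_self Hk_norm_nonneg[of 2 \<Omega> v]] order_trans by fastforce
      qed
      then have "(\<lambda>n. s n t v) \<longlonglongrightarrow> F t v" by (rule LIM_zero_cancel)
      then show ?case by (rule limI)
    qed
  qed
  show ?thesis
  proof (rule Bochner_Integration.integrable_bound[OF _ m])
    show "integrable (lebesgue_on I) (\<lambda>t. ((Hk_dual_norm 2 \<Omega> (F t))\<^sup>2 + 1) * Hk_norm 2 \<Omega> v)"
      using F2 by auto
    show "AE t in lebesgue_on I. norm (F t v) \<le> norm (((Hk_dual_norm 2 \<Omega> (F t))\<^sup>2 + 1) * Hk_norm 2 \<Omega> v)"
      using Fd
    proof eventually_elim
      case (elim t)
      have "y \<le> y\<^sup>2 + 1" for y :: real
        using zero_le_power2[of "y - 1/2"] by (simp add: power2_eq_square algebra_simps)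
      then have "Hk_dual_norm 2 \<Omega> (F t) * Hk_norm 2 \<Omega> v \<le> ((Hk_dual_norm 2 \<Omega> (F t))\<^sup>2 + 1) * Hk_norm 2 \<Omega> v"
        by (intro mult_right_mono Hk_norm_nonneg)
      then show ?case using Hk_dual_norm_bound[OF elim v open_\<Omega> lmeasurable(1)] by simp
    qed
  qed
qed

text \<open>For each fixed element of \<open>H\<^sub>0\<^sup>2\<close> the two time derivatives agree at almost every time. The exceptional
  times depend on that element, but simple approximations of \<open>\<phi>\<close> take only countably many values altogether, and both
  pairings are continuous on \<open>H\<^sub>0\<^sup>2\<close>.\<close>

lemma dual_time_derivative_pairing:
  assumes w: "w \<in> L2 Q" and g: "g \<in> L2 Q" and wd: "has_weak_deriv Q (0, 1) w g"
    and dd: "has_time_deriv_dual \<Omega> T w F" and F: "F \<in> bochner_Lp 2 T (Hk_dual 2 \<Omega>) (Hk_dual_norm 2 \<Omega>)"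
    and \<phi>: "\<phi> \<in> L2_H20 \<Omega> T"
  shows "(\<integral>t. F t (slice \<phi> t) \<partial>lebesgue_on I) = (\<integral>z. g z * \<phi> z \<partial>lebesgue_on Q)"
proof -
  have fixed: "AE t in lebesgue_on I. F t v = (\<integral>x. g (x, t) * v x \<partial>lebesgue_on \<Omega>)" if v: "v \<in> Hk0 2 \<Omega>" for v
  proof -
    have vL: "v \<in> L2 \<Omega>" using Hk_L2[OF Hk0_Hk[OF v]] .
    have gv: "integrable (lebesgue_on Q) (\<lambda>z. g z * v (fst z))" by (rule L2_mult_integrable[OF g L2_fst[OF vL]])
    have i1: "integrable (lebesgue_on I) (\<lambda>t. F t v)" by (rule dual_section[OF F v])
    have i2: "integrable (lebesgue_on I) (\<lambda>t. \<integral>x. g (x, t) * v x \<partial>lebesgue_on \<Omega>)" using int_slices(2)[OF gv] by simp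
    define R where "R t = F t v - (\<integral>x. g (x, t) * v x \<partial>lebesgue_on \<Omega>)" for t
    have Ri: "integrable (lebesgue_on I) R" unfolding R_def[abs_def] using i1 i2 by auto
    have "AE t in lebesgue_on I. R t = 0"
    proof (rule fundamental_lemma)
      show "locally_integrable I R" by (rule integrable_imp_locally_integrable[OF Ri sets_lebesgue(2)])
      fix \<eta> assume \<eta>: "\<eta> \<in> test_functions I"
      have ti: "integrable (lebesgue_on I) (\<lambda>t. k t * \<eta> t)" if "integrable (lebesgue_on I) k" for k
        by (rule locally_integrable_mult_test[OF integrable_imp_locally_integrable[OF that sets_lebesgue(2)] sets_lebesgue(2) \<eta>])
      obtain c where c: "\<And>t. \<bar>\<eta> t\<bar> \<le> c" using test_functions_bounded[OF \<eta>] by blast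
      note pi = product_Q_integral(1)[OF g vL test_functions_borel[OF \<eta>] c]
      have "(\<integral>t. F t v * \<eta> t \<partial>lebesgue_on I) = - (\<integral>z. w z * (v (fst z) * deriv \<eta> (snd z)) \<partial>lebesgue_on Q)"
        using dd \<eta> v by (simp add: has_time_deriv_dual_def case_prod_unfold mult.assoc)
      also have "\<dots> = (\<integral>z. g z * (v (fst z) * \<eta> (snd z)) \<partial>lebesgue_on Q)"
        using weak_time_derivative_Hk0[OF w g wd v \<eta>] by simp
      also have "\<dots> = (\<integral>t. \<integral>x. g (x, t) * (v x * \<eta> t) \<partial>lebesgue_on \<Omega> \<partial>lebesgue_on I)"
        using int_slices(3)[OF pi] by simp
      also have "\<dots> = (\<integral>t. (\<integral>x. g (x, t) * v x \<partial>lebesgue_on \<Omega>) * \<eta> t \<partial>lebesgue_on I)"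
        by (simp add: mult.assoc[symmetric])
      finally show "(\<integral>t. R t * \<eta> t \<partial>lebesgue_on I) = 0"
        using ti[OF i1] ti[OF i2] by (simp add: R_def left_diff_distrib)
    qed simp
    then show ?thesis by (elim eventually_mono) (simp add: R_def)
  qed
  obtain s where s: "\<And>n. simple_function (lebesgue_on I) (s n)" "\<And>n t. t \<in> I \<Longrightarrow> s n t \<in> Hk0 2 \<Omega>"
    "AE t in lebesgue_on I. (\<lambda>n. Hk_norm 2 \<Omega> (\<lambda>x. s n t x - \<phi> (x, t))) \<longlonglongrightarrow> 0"
    "AE t in lebesgue_on I. slice \<phi> t \<in> Hk0 2 \<Omega>"
    by (rule L2_H20_slices[OF \<phi>]) blast
  have "AE t in lebesgue_on I. \<forall>n. F t (s n t) = (\<integral>x. g (x, t) * s n t x \<partial>lebesgue_on \<Omega>)"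
  proof (subst AE_all_countable, rule allI)
    fix n
    have fin: "finite (s n ` I)" using simple_functionD(1)[OF s(1)[of n]] by simp
    have "AE t in lebesgue_on I. \<forall>v\<in>s n ` I. F t v = (\<integral>x. g (x, t) * v x \<partial>lebesgue_on \<Omega>)"
      using fixed s(2) by (subst AE_finite_all[OF fin]) auto
    with AE_space show "AE t in lebesgue_on I. F t (s n t) = (\<integral>x. g (x, t) * s n t x \<partial>lebesgue_on \<Omega>)"
      by eventually_elim auto
  qed
  moreover have Fd: "AE t in lebesgue_on I. F t \<in> Hk_dual 2 \<Omega>"
    using F by (auto simp: bochner_Lp_def bochner_measurable_def)
  ultimately have "AE t in lebesgue_on I. (\<integral>x. g (x, t) * \<phi> (x, t) \<partial>lebesgue_on \<Omega>) = F t (slice \<phi> t)"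
    using s(3,4) L2_slices_time(2)[OF g] AE_space
  proof eventually_elim
    case (elim t)
    then have t: "t \<in> I" by simp
    note sn = s(2)[OF t]
    have lin: "F t (s n t) - F t (slice \<phi> t) = F t (\<lambda>x. s n t x - \<phi> (x, t))" for n
    proof -
      have "F t (\<lambda>x. 1 * s n t x + (-1) * slice \<phi> t x) = 1 * F t (s n t) + (-1) * F t (slice \<phi> t)"
        using elim(2) sn elim(4) unfolding Hk_dual_def by blast
      then show ?thesis by (simp add: slice_def)
    qed
    have "(\<lambda>n. F t (s n t) - F t (slice \<phi> t)) \<longlonglongrightarrow> 0"
    proof (rule tendsto_0_le[OF elim(3), of _ "Hk_dual_norm 2 \<Omega> (F t)"], rule always_eventually, rule allI)
      fix n
      have "(\<lambda>x. s n t x - \<phi> (x, t)) \<in> Hk0 2 \<Omega>"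
        using Hk0_diff[OF sn elim(4) open_\<Omega> lmeasurable(1), of n] by (simp add: slice_def)
      from Hk_dual_norm_bound[OF elim(2) this open_\<Omega> lmeasurable(1)]
      show "norm (F t (s n t) - F t (slice \<phi> t)) \<le> norm (Hk_norm 2 \<Omega> (\<lambda>x. s n t x - \<phi> (x, t))) * Hk_dual_norm 2 \<Omega> (F t)"
        by (simp add: lin abs_of_nonneg[OF Hk_norm_nonneg] mult.commute)
    qed
    then have 1: "(\<lambda>n. F t (s n t)) \<longlonglongrightarrow> F t (slice \<phi> t)" by (rule LIM_zero_cancel)
    have \<phi>L: "(\<lambda>x. \<phi> (x, t)) \<in> L2 \<Omega>" using Hk_L2[OF Hk0_Hk[OF elim(4)]] by (simp add: slice_def)
    have "(\<lambda>n. L2_norm \<Omega> (\<lambda>x. s n t x - \<phi> (x, t))) \<longlonglongrightarrow> 0"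
      by (rule tendsto_sandwich[OF _ _ tendsto_const elim(3)]) (simp_all add: L2_norm_nonneg L2_norm_le_Hk_norm)
    from L2_inner_tendsto[OF Hk_L2[OF Hk0_Hk[OF sn]] \<phi>L elim(5) this]
    have "(\<lambda>n. F t (s n t)) \<longlonglongrightarrow> (\<integral>x. g (x, t) * \<phi> (x, t) \<partial>lebesgue_on \<Omega>)"
      using elim(1) by (simp add: mult.commute)
    from LIMSEQ_unique[OF this 1] show ?case .
  qed
  from integral_lebesgue_on_cong_AE[OF this sets_lebesgue(2)]
  show ?thesis using int_slices(3)[OF L2_mult_integrable[OF g L2_H20D(1)[OF \<phi>]]] by simp
qed

section \<open>The weak form of the initial condition\<close>

text \<open>The test functions in time vanish near \<open>T\<close> but not at \<open>0\<close>. Integration by parts therefore leaves the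
  boundary term \<open>\<eta>(0) (B - b0)\<close>, and one \<open>\<eta>\<close> with \<open>\<eta>(0) > 0\<close> is enough.\<close>

lemma weak_initial_condition:
  assumes T: "0 < T" and B: "B \<in> L2 \<Omega>" and g: "g \<in> L2 Q" and b0: "b0 \<in> L2 \<Omega>"
    and w: "AE z in lebesgue_on Q. w z = B (fst z) + time_primitive I g z"
    and weak: "\<And>\<zeta> \<eta>. \<zeta> \<in> test_functions \<Omega> \<Longrightarrow> \<eta> \<in> test_functions {..<T} \<Longrightarrow>
      (\<integral>z. g z * (\<zeta> (fst z) * \<eta> (snd z)) \<partial>lebesgue_on Q)
      = (\<integral>z. (b0 (fst z) - w z) * (\<zeta> (fst z) * deriv \<eta> (snd z)) \<partial>lebesgue_on Q)"
  shows "AE x in lebesgue_on \<Omega>. B x = b0 x"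
proof -
  have "cbox (- T/2) (T/2) \<subseteq> {..<T}" using T by auto
  from indicator_box_limit_test_functions[OF this]
  obtain \<beta> where \<beta>: "\<And>n. \<beta> n \<in> test_functions {..<T}" "\<And>x. (\<lambda>n. \<beta> n x) \<longlonglongrightarrow> indicator (box (-T/2) (T/2)) x" by metis
  have "(\<lambda>n. \<beta> n 0) \<longlonglongrightarrow> 1" using \<beta>(2)[of 0] T by simp
  from order_tendstoD(1)[OF this, of 0] obtain n where n: "\<beta> n 0 > 0"
    using eventually_happens'[OF sequentially_bot] by auto
  define \<eta> where "\<eta> = \<beta> n"
  have \<eta>: "\<eta> \<in> test_functions {..<T}" "\<eta> 0 > 0" using \<beta>(1) n by (auto simp: \<eta>_def)
  have \<eta>T: "\<eta> T = 0"
  proof -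
    obtain C where "C \<subseteq> {..<T}" "\<And>x. x \<notin> C \<Longrightarrow> \<eta> x = 0" using test_functions_support[OF \<eta>(1)] by metis
    then show ?thesis by (metis lessThan_iff less_irrefl subsetD)
  qed
  have d: "deriv \<eta> = (\<lambda>t. frechet_derivative \<eta> (at t) 1)" using test_function_real_derivative(2)[OF \<eta>(1)] by auto
  have dt: "deriv \<eta> \<in> test_functions {..<T}" unfolding d by (rule test_functions_derivative[OF \<eta>(1)])
  obtain c where c: "\<And>t. \<bar>\<eta> t\<bar> \<le> c" using test_functions_bounded[OF \<eta>(1)] by blast
  obtain c' where c': "\<And>t. \<bar>deriv \<eta> t\<bar> \<le> c'" using test_functions_bounded[OF dt] by blast
  have ftc: "(\<integral>t. indicator {s<..} t * deriv \<eta> t \<partial>lebesgue_on I) = - \<eta> s" if s: "0 \<le> s" "s < T" for s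
  proof -
    have "(\<integral>t. indicator {s<..} t * deriv \<eta> t \<partial>lebesgue_on I) = (\<integral>t. indicator {s<..<T} t * deriv \<eta> t \<partial>lebesgue_on I)"
      by (rule Bochner_Integration.integral_cong) (auto simp: indicator_def)
    also have "\<dots> = (\<integral>t. indicator {s<..<T} t * deriv \<eta> t \<partial>lborel)"
      using s test_functions_borel[OF dt] by (intro borel_zero_outside(2)[OF sets_borel(2)]) (auto simp: indicator_def)
    also have "\<dots> = (\<integral>t. deriv \<eta> t * indicator {s..T} t \<partial>lborel)"
    proof (rule integral_cong_AE)
      show "AE t in lborel. indicator {s<..<T} t * deriv \<eta> t = deriv \<eta> t * indicator {s..T} t"
        using AE_lborel_singleton[of s] AE_lborel_singleton[of T] by eventually_elim (auto simp: indicator_def)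
    qed (use test_functions_borel[OF dt] in auto)
    also have "\<dots> = \<eta> T - \<eta> s"
      using s test_function_real_derivative[OF \<eta>(1)] test_functions_continuous[OF dt, of UNIV]
      by (intro integral_FTC_Icc_real) (auto simp: continuous_on_eq_continuous_at)
    finally show ?thesis using \<eta>T by simp
  qed
  define D where "D x = \<eta> 0 * (B x - b0 x)" for x
  have DL: "D \<in> L2 \<Omega>" unfolding D_def[abs_def] by (rule L2_cmult[OF L2_diff[OF B b0]])
  define G where "G x = (\<integral>t. \<eta> t * g (x, t) \<partial>lebesgue_on I)" for x
  have GL: "G \<in> L2 \<Omega>" unfolding G_def[abs_def] by (rule weighted_time_integral_L2(1)[OF g test_functions_borel[OF \<eta>(1)] c])
  define W where "W z = (b0 (fst z) - B (fst z)) - time_primitive I g z" for z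
  have WL: "W \<in> L2 Q" unfolding W_def[abs_def]
    by (intro L2_diff time_primitive_L2[OF g] L2_fst b0 B)
  have "AE x in lebesgue_on \<Omega>. D x = 0"
  proof (rule fundamental_lemma[OF open_\<Omega>])
    show "locally_integrable \<Omega> D" by (rule L2_locally_integrable[OF DL lmeasurable(1)])
    fix \<zeta> assume \<zeta>: "\<zeta> \<in> test_functions \<Omega>"
    note \<zeta>L = test_functions_L2[OF \<zeta> lmeasurable(1)]
    have 1: "(\<integral>z. g z * (\<zeta> (fst z) * \<eta> (snd z)) \<partial>lebesgue_on Q) = (\<integral>x. G x * \<zeta> x \<partial>lebesgue_on \<Omega>)"
      using product_Q_integral(2)[OF g \<zeta>L test_functions_borel[OF \<eta>(1)] c] by (simp add: G_def)
    have "(\<integral>z. (b0 (fst z) - w z) * (\<zeta> (fst z) * deriv \<eta> (snd z)) \<partial>lebesgue_on Q)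
        = (\<integral>z. W z * (\<zeta> (fst z) * deriv \<eta> (snd z)) \<partial>lebesgue_on Q)"
      by (rule integral_lebesgue_on_cong_AE[OF _ sets_lebesgue(3)])
         (use w in \<open>elim eventually_mono, simp add: W_def\<close>)
    also have "\<dots> = (\<integral>x. (\<integral>t. deriv \<eta> t * W (x, t) \<partial>lebesgue_on I) * \<zeta> x \<partial>lebesgue_on \<Omega>)"
      by (rule product_Q_integral(2)[OF WL \<zeta>L test_functions_borel[OF dt] c'])
    also have "\<dots> = (\<integral>x. (D x + G x) * \<zeta> x \<partial>lebesgue_on \<Omega>)"
    proof (rule integral_lebesgue_on_cong_AE[OF _ sets_lebesgue(1)])
      show "AE x in lebesgue_on \<Omega>. (D x + G x) * \<zeta> x = (\<integral>t. deriv \<eta> t * W (x, t) \<partial>lebesgue_on I) * \<zeta> x"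
        using int_slices(4)[OF L2_integrable[OF lmeasurable(3) g]]
      proof eventually_elim
        case (elim x)
        have dI: "integrable (lebesgue_on I) (deriv \<eta>)"
          using L2_integrable[OF lmeasurable(2) test_functions_L2[OF dt lmeasurable(2)]] .
        note sw = swap_primitives[OF sets_borel(2) dI elim]
        have "(\<integral>t. deriv \<eta> t \<partial>lebesgue_on I) = (\<integral>t. indicator {0<..} t * deriv \<eta> t \<partial>lebesgue_on I)"
          by (rule Bochner_Integration.integral_cong) auto
        then have d0: "(\<integral>t. deriv \<eta> t \<partial>lebesgue_on I) = - \<eta> 0" using ftc[of 0] T by simp
        have "(\<integral>t. deriv \<eta> t * time_primitive I g (x, t) \<partial>lebesgue_on I)
            = (\<integral>s. g (x, s) * (\<integral>t. indicator {s<..} t * deriv \<eta> t \<partial>lebesgue_on I) \<partial>lebesgue_on I)"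
          using sw(1) by (simp add: time_primitive_def)
        also have "\<dots> = (\<integral>s. - (\<eta> s * g (x, s)) \<partial>lebesgue_on I)"
          by (rule Bochner_Integration.integral_cong) (auto simp: ftc)
        also have "\<dots> = - G x" by (simp add: G_def)
        finally have P: "(\<integral>t. deriv \<eta> t * time_primitive I g (x, t) \<partial>lebesgue_on I) = - G x" .
        have "(\<integral>t. deriv \<eta> t * W (x, t) \<partial>lebesgue_on I)
           = (\<integral>t. (b0 x - B x) * deriv \<eta> t - deriv \<eta> t * time_primitive I g (x, t) \<partial>lebesgue_on I)"
          by (simp add: W_def algebra_simps)
        also have "\<dots> = (b0 x - B x) * (- \<eta> 0) - (- G x)"
          using dI sw(2) P d0 by (simp add: time_primitive_def)
        finally have "(\<integral>t. deriv \<eta> t * W (x, t) \<partial>lebesgue_on I) = D x + G x" by (simp add: D_def algebra_simps)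
        then show ?case by (simp only:)
      qed
    qed
    finally have "(\<integral>x. G x * \<zeta> x \<partial>lebesgue_on \<Omega>) = (\<integral>x. D x * \<zeta> x + G x * \<zeta> x \<partial>lebesgue_on \<Omega>)"
      using weak[OF \<zeta> \<eta>(1)] 1 by (simp add: distrib_right)
    then show "(\<integral>x. D x * \<zeta> x \<partial>lebesgue_on \<Omega>) = 0"
      using L2_mult_integrable[OF DL \<zeta>L] L2_mult_integrable[OF GL \<zeta>L] by simp
  qed
  then show ?thesis by (elim eventually_mono) (use \<eta>(2) in \<open>simp add: D_def\<close>)
qed

end

section \<open>Kirchhoff's transformation\<close>

locale kirchhoff_data =
  fixes S K \<psi> b :: "real \<Rightarrow> real"
  assumes S_C1: "S C1_differentiable_on UNIV" and S_range: "range S \<subseteq> {0<..1}"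
    and S_Lipschitz: "\<exists>L. L-lipschitz_on UNIV S" and S_mono: "strict_mono S"
    and K_C1: "K C1_differentiable_on UNIV" and K_pos: "\<And>s. 0 < K s" and K_mono: "mono K"
    and \<psi>_def: "\<psi> = kirchhoff K S" and b_def: "b = S \<circ> inv \<psi>"
begin

abbreviation "\<theta> \<equiv> inv \<psi>"

lemma C1_on_real:
  fixes f :: "real \<Rightarrow> real"
  assumes "f C1_differentiable_on UNIV"
  obtains f' where "\<And>x. (f has_real_derivative f' x) (at x)" "continuous_on UNIV f'"
  using assms unfolding C1_differentiable_on_def has_real_derivative_iff_has_vector_derivative by auto

lemma S_01: "0 < S y" "S y \<le> 1"
  using S_range by (auto simp: image_subset_iff)

lemma S_continuous: "continuous_on A S"
  by (rule C1_on_real[OF S_C1]) (meson DERIV_isCont continuous_at_imp_continuous_on)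

lemma K_continuous: "continuous_on A K"
  by (rule C1_on_real[OF K_C1]) (meson DERIV_isCont continuous_at_imp_continuous_on)

text \<open>These bounds of the slope of \<open>\<psi>\<close> make \<open>\<psi>\<close> a bijection of the real line that is Lipschitz continuous in both
  directions.\<close>

lemma K_S_bounds: "K 0 \<le> K (S y)" "K (S y) \<le> K 1"
  using K_mono S_01[of y] by (auto simp: mono_def)

lemma K_S_continuous: "continuous_on A (\<lambda>y. K (S y))"
  using continuous_on_compose[OF S_continuous K_continuous] by (simp add: o_def)

lemma \<psi>_DERIV: "(\<psi> has_real_derivative K (S y)) (at y)"
proof -
  define M where "M = \<bar>y\<bar> + 1"
  have "((\<lambda>u. LBINT \<tau>=ereal 0..ereal u. K (S \<tau>)) has_vector_derivative K (S y)) (at y within {-M..M})"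
    by (rule interval_integral_FTC2[OF _ _ K_S_continuous]) (auto simp: M_def)
  moreover have "y \<in> interior {-M..M}" by (auto simp: M_def)
  ultimately show ?thesis using at_within_interior[of y "{-M..M}"]
    by (simp add: \<psi>_def kirchhoff_def[abs_def] has_real_derivative_iff_has_vector_derivative)
qed

lemma \<psi>_0: "\<psi> 0 = 0"
  by (simp add: \<psi>_def kirchhoff_def zero_ereal_def[symmetric])

lemma \<psi>_expansive: "x \<le> y \<Longrightarrow> K 0 * (y - x) \<le> \<psi> y - \<psi> x"
proof -
  assume "x \<le> y"
  then have "\<psi> x - K 0 * x \<le> \<psi> y - K 0 * y"
    by (rule DERIV_nonneg_imp_nondecreasing)
       (use K_S_bounds in \<open>auto intro!: exI[of _ "K (S _) - K 0"] derivative_eq_intros \<psi>_DERIV\<close>)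
  then show ?thesis by (simp add: algebra_simps)
qed

lemma \<psi>_expansive_abs: "K 0 * \<bar>y - x\<bar> \<le> \<bar>\<psi> y - \<psi> x\<bar>"
  using \<psi>_expansive[of x y] \<psi>_expansive[of y x] by (cases "x \<le> y") (auto simp: abs_if)

lemma \<psi>_inj: "inj \<psi>"
proof (rule injI)
  fix x y assume "\<psi> x = \<psi> y"
  then have "K 0 * \<bar>y - x\<bar> \<le> 0" using \<psi>_expansive_abs[of y x] by simp
  then show "x = y" using K_pos[of 0] by (simp add: mult_le_0_iff)
qed

lemma \<psi>_continuous: "continuous_on A \<psi>"
  using \<psi>_DERIV DERIV_isCont continuous_at_imp_continuous_on by blast

lemma \<psi>_surj: "surj \<psi>"
  unfolding surj_def
proof
  fix z
  define r where "r = \<bar>z\<bar> / K 0"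
  have r: "r \<ge> 0" "K 0 * r = \<bar>z\<bar>" using K_pos[of 0] by (auto simp: r_def)
  have "\<psi> (- r) \<le> z" "z \<le> \<psi> r"
    using \<psi>_expansive[of "-r" 0] \<psi>_expansive[of 0 r] r \<psi>_0 by auto
  then show "\<exists>x. z = \<psi> x" using IVT'[of \<psi> "-r" z r] r(1) \<psi>_continuous by auto
qed

lemma \<psi>_\<theta> [simp]: "\<psi> (\<theta> y) = y"
  using \<psi>_surj by (simp add: surj_f_inv_f)

lemma \<theta>_\<psi> [simp]: "\<theta> (\<psi> y) = y"
  using \<psi>_inj by (simp add: inv_f_f)

lemma \<theta>_0: "\<theta> 0 = 0"
  using \<theta>_\<psi>[of 0] \<psi>_0 by simp

lemma \<theta>_Lipschitz: "\<bar>\<theta> y - \<theta> z\<bar> \<le> \<bar>y - z\<bar> / K 0"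
  using \<psi>_expansive_abs[of "\<theta> y" "\<theta> z"] K_pos[of 0] by (simp add: field_simps)

lemma \<theta>_DERIV: "(\<theta> has_real_derivative 1 / K (S (\<theta> y))) (at y)"
proof -
  have c: "isCont \<theta> y"
    unfolding isCont_def
  proof (rule LIM_zero_cancel, rule tendsto_0_le)
    have "((\<lambda>z. z - y) \<longlongrightarrow> y - y) (at y)" by (intro tendsto_intros)
    then show "((\<lambda>z. z - y) \<longlongrightarrow> 0) (at y)" by simp
    show "\<forall>\<^sub>F z in at y. norm (\<theta> z - \<theta> y) \<le> norm (z - y) * (1 / K 0)"
      using \<theta>_Lipschitz[of _ y] by simp
  qed
  have "(\<theta> has_real_derivative inverse (K (S (\<theta> y)))) (at y)"
    by (rule DERIV_inverse_function[where f = \<psi> and a = "y - 1" and b = "y + 1"])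
       (use \<psi>_DERIV K_pos c in \<open>auto simp: less_imp_neq[symmetric]\<close>)
  then show ?thesis by (simp add: inverse_eq_divide)
qed

lemma \<theta>_continuous: "continuous_on A \<theta>"
  using \<theta>_DERIV DERIV_isCont continuous_at_imp_continuous_on by blast

lemma \<theta>_derivative_continuous: "continuous_on UNIV (\<lambda>y. 1 / K (S (\<theta> y)))"
  using continuous_on_compose[OF \<theta>_continuous K_S_continuous] K_pos
  by (intro continuous_on_divide) (auto simp: o_def less_imp_neq[symmetric])

lemma \<theta>_derivative_bound: "\<bar>1 / K (S (\<theta> y))\<bar> \<le> 1 / K 0"
  using K_S_bounds(1)[of "\<theta> y"] K_pos by (simp add: frac_le abs_of_pos)

lemma S_derivative:
  obtains S' L where "\<And>x. (S has_real_derivative S' x) (at x)" "continuous_on UNIV S'" "\<And>x. \<bar>S' x\<bar> \<le> L"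
    "\<And>x y. \<bar>S x - S y\<bar> \<le> L * \<bar>x - y\<bar>"
proof -
  obtain S' where S': "\<And>x. (S has_real_derivative S' x) (at x)" "continuous_on UNIV S'"
    by (rule C1_on_real[OF S_C1]) blast
  obtain L where L: "L-lipschitz_on UNIV S" using S_Lipschitz by blast
  have Lip: "\<bar>S x - S y\<bar> \<le> L * \<bar>x - y\<bar>" for x y
    using lipschitz_onD[OF L, of x y] by (simp add: dist_real_def)
  have "\<bar>S' x\<bar> \<le> L" for x
  proof -
    have "((\<lambda>y. \<bar>(S y - S x) / (y - x)\<bar>) \<longlongrightarrow> \<bar>S' x\<bar>) (at x)"
      using S'(1)[of x] unfolding has_field_derivative_iff by (rule tendsto_rabs)
    then show ?thesis
    proof (rule tendsto_upperbound)
      show "\<forall>\<^sub>F y in at x. \<bar>(S y - S x) / (y - x)\<bar> \<le> L"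
        using Lip by (auto simp: eventually_at_filter abs_divide divide_le_eq)
    qed simp
  qed
  with S' Lip show ?thesis using that by blast
qed

lemma b_01: "0 < b y" "b y \<le> 1"
  using S_01 by (auto simp: b_def)

lemma b_continuous: "continuous_on A b"
  unfolding b_def by (rule continuous_on_compose[OF \<theta>_continuous S_continuous])

lemma b_\<psi> [simp]: "b (\<psi> y) = S y"
  by (simp add: b_def)

lemma \<theta>_strict_mono: "strict_mono \<theta>"
proof (rule strict_monoI, rule ccontr)
  fix x y :: real assume "x < y" "\<not> \<theta> x < \<theta> y"
  then show False using \<psi>_expansive[of "\<theta> y" "\<theta> x"] K_pos[of 0]
    by (simp add: not_less) (metis diff_ge_0_iff_ge less_imp_le linorder_not_less mult_nonneg_nonneg order_trans)
qed

lemma b_strict_mono: "strict_mono b"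
  using S_mono \<theta>_strict_mono by (simp add: b_def strict_mono_def)

lemma b_derivative:
  obtains b' M where "\<And>x. (b has_real_derivative b' x) (at x)" "continuous_on UNIV b'" "\<And>x. \<bar>b' x\<bar> \<le> M"
    "M \<ge> 0" "\<And>x y. \<bar>b x - b y\<bar> \<le> M * \<bar>x - y\<bar>"
proof -
  obtain S' L where S': "\<And>x. (S has_real_derivative S' x) (at x)" "continuous_on UNIV S'" "\<And>x. \<bar>S' x\<bar> \<le> L"
    using S_derivative by metis
  have L: "L \<ge> 0" using S'(3)[of 0] by linarith
  define b' where "b' y = S' (\<theta> y) * (1 / K (S (\<theta> y)))" for y
  have d: "(b has_real_derivative b' y) (at y)" for y
    unfolding b'_def b_def by (rule DERIV_chain[OF S'(1) \<theta>_DERIV])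
  have c: "continuous_on UNIV b'"
    unfolding b'_def[abs_def]
    using continuous_on_compose[OF \<theta>_continuous continuous_on_subset[OF S'(2) subset_UNIV], of UNIV] \<theta>_derivative_continuous
    by (intro continuous_on_mult) (auto simp: o_def)
  have m: "\<bar>b' y\<bar> \<le> L * (1 / K 0)" for y
    unfolding b'_def abs_mult using S'(3) \<theta>_derivative_bound L by (intro mult_mono) auto
  have "L * (1 / K 0) \<ge> 0" using L K_pos[of 0] by simp
  then show ?thesis using that[OF d c m] Lipschitz_if_bounded_derivative[OF d m] by blast
qed

text \<open>Since \<open>K\<close> is Lipschitz continuous on \<open>[0,1]\<close>, the left side is at most a multiple of \<open>(b y - b z)\<^sup>2\<close>; one of the two
  factors is then estimated by the Lipschitz continuity of \<open>b\<close>. This makes the gravity term harmless in the uniqueness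
  proof.\<close>

lemma drift_controlled_by_monotonicity:
  obtains C where "C > 0" "\<And>y z. (K (b y) - K (b z))\<^sup>2 \<le> C * ((b y - b z) * (y - z))"
proof -
  obtain K' where K': "\<And>x. (K has_real_derivative K' x) (at x)" "continuous_on UNIV K'"
    by (rule C1_on_real[OF K_C1]) blast
  have "compact (K' ` {0..1})" using K'(2) by (intro compact_continuous_image) (auto intro: continuous_on_subset)
  then obtain D where D: "\<And>x. x \<in> {0..1} \<Longrightarrow> \<bar>K' x\<bar> \<le> D"
    using compact_imp_bounded bounded_iff by (metis image_eqI real_norm_def)
  have D0: "D \<ge> 0" using D[of 0] by auto
  obtain M where M: "M \<ge> 0" "\<And>x y. \<bar>b x - b y\<bar> \<le> M * \<bar>x - y\<bar>" using b_derivative by metis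
  have KD: "\<bar>K s - K t\<bar> \<le> D * \<bar>s - t\<bar>" if "s \<in> {0..1}" "t \<in> {0..1}" for s t
    using field_differentiable_bound[of "{0..1}" K K' D s t] that K'(1) D
    by (auto intro: has_field_derivative_at_within)
  \<comment> \<open>The summand 1 only keeps the constant positive if \<open>D\<close> or \<open>M\<close> vanishes.\<close>
  have "(K (b y) - K (b z))\<^sup>2 \<le> (D\<^sup>2 * M + 1) * ((b y - b z) * (y - z))" for y z
  proof -
    have pos: "0 \<le> (b y - b z) * (y - z)" "\<bar>b y - b z\<bar> * \<bar>y - z\<bar> = (b y - b z) * (y - z)"
    proof -
      have "y \<le> z \<Longrightarrow> b y \<le> b z" "z \<le> y \<Longrightarrow> b z \<le> b y"
        using strict_mono_less_eq[OF b_strict_mono] by auto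
      then show "0 \<le> (b y - b z) * (y - z)"
        by (cases "y \<le> z") (auto intro: mult_nonpos_nonpos)
      then show "\<bar>b y - b z\<bar> * \<bar>y - z\<bar> = (b y - b z) * (y - z)" by (simp add: abs_mult[symmetric])
    qed
    have "\<bar>K (b y) - K (b z)\<bar> \<le> D * \<bar>b y - b z\<bar>"
      using b_01[of y] b_01[of z] by (intro KD) auto
    from power_mono[OF this abs_ge_zero, of 2]
    have "(K (b y) - K (b z))\<^sup>2 \<le> D\<^sup>2 * (\<bar>b y - b z\<bar> * \<bar>b y - b z\<bar>)"
      by (simp add: power_mult_distrib power2_eq_square[of "b y - b z"])
    also have "\<dots> \<le> D\<^sup>2 * (\<bar>b y - b z\<bar> * (M * \<bar>y - z\<bar>))"
      using M by (intro mult_left_mono) auto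
    also have "\<dots> = (D\<^sup>2 * M) * (\<bar>b y - b z\<bar> * \<bar>y - z\<bar>)" by (simp add: mult_ac)
    also have "\<dots> = (D\<^sup>2 * M) * ((b y - b z) * (y - z))" by (simp only: pos(2))
    also have "\<dots> \<le> (D\<^sup>2 * M + 1) * ((b y - b z) * (y - z))" using pos(1) by (intro mult_right_mono) auto
    finally show ?thesis .
  qed
  moreover have "D\<^sup>2 * M + 1 > 0" using M(1) by (simp add: add_nonneg_pos)
  ultimately show ?thesis using that by blast
qed

end

section \<open>The two formulations\<close>

locale richards = bounded_cylinder \<Omega> T + kirchhoff_data S K \<psi> b
  for \<Omega> T S K \<psi> b +
  fixes \<gamma> :: real and p0 :: "real^3 \<Rightarrow> real"
  assumes T_pos: "0 < T" and \<gamma>_pos: "0 < \<gamma>" and p0: "p0 \<in> Hk0 2 \<Omega>"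
begin

abbreviation "lap \<equiv> laplacian \<Omega> T"
abbreviation "nabla \<equiv> grad \<Omega> T"

lemma nabla_nth: "nabla \<phi> z $ i = DQ i \<phi> z"
  by (simp add: grad_def)

lemma inner_nabla: "nabla u z \<bullet> nabla \<phi> z = (\<Sum>i\<in>UNIV. DQ i u z * DQ i \<phi> z)"
  by (simp add: inner_vec_def nabla_nth)

lemma e3_nabla: "e3 \<bullet> nabla \<phi> z = DQ 3 \<phi> z"
  by (simp add: e3_def inner_axis' nabla_nth)

lemma lap_eq: "lap \<phi> = (\<lambda>z. \<Sum>i\<in>UNIV. DQ i (DQ i \<phi>) z)"
  by (simp add: laplacian_def fun_eq_iff)

lemma lap_L2: "\<phi> \<in> L2_H20 \<Omega> T \<Longrightarrow> lap \<phi> \<in> L2 Q"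
  unfolding lap_eq by (intro L2_sum L2_H20D(6))

lemma inner_nabla_L1:
  "u \<in> L2_H20 \<Omega> T \<Longrightarrow> \<phi> \<in> L2_H20 \<Omega> T \<Longrightarrow> integrable (lebesgue_on Q) (\<lambda>z. \<Sum>i\<in>UNIV. DQ i u z * DQ i \<phi> z)"
  by (intro Bochner_Integration.integrable_sum L2_mult_integrable L2_H20D(3))

lemma continuous_bounded_L2:
  assumes "v \<in> borel_measurable (lebesgue_on Q)" "continuous_on UNIV F" "\<And>y. \<bar>F y\<bar> \<le> c"
  shows "(\<lambda>z. F (v z)) \<in> L2 Q"
  by (rule bounded_L2[OF lmeasurable(3) measurable_compose[OF assms(1) borel_measurable_continuous_onI[OF assms(2)]] assms(3)])

lemma K_b_continuous: "continuous_on A (\<lambda>y. K (b y))"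
  using continuous_on_compose[OF b_continuous K_continuous] by (simp add: o_def)

lemma K_b_le: "\<bar>K (b y)\<bar> \<le> K 1"
  using K_S_bounds(2)[of "\<theta> y"] K_pos[of "b y"] by (simp add: b_def abs_of_pos)

lemma K_b_L2: "v \<in> L2 Q \<Longrightarrow> (\<lambda>z. K (b (v z))) \<in> L2 Q"
  using continuous_bounded_L2[OF L2_measurable K_b_continuous K_b_le] .

lemma b_L2: "v \<in> L2 Q \<Longrightarrow> (\<lambda>z. b (v z)) \<in> L2 Q"
  using continuous_bounded_L2[OF L2_measurable b_continuous, of v 1] b_01 by (auto simp: abs_of_pos)

lemma S_L2: "v \<in> L2 Q \<Longrightarrow> (\<lambda>z. S (v z)) \<in> L2 Q"
  using continuous_bounded_L2[OF L2_measurable S_continuous, of v 1] S_01 by (auto simp: abs_of_pos)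

lemma Hk1D:
  assumes "q \<in> Hk 1 Q" "e \<in> Basis"
  shows "has_weak_deriv Q e q (weak_deriv Q e q)" "weak_deriv Q e q \<in> L2 Q"
proof -
  have "q \<in> Hk (Suc 0) Q" using assms(1) by simp
  from Hk_weak_deriv[OF this assms(2) open_Q]
  show "has_weak_deriv Q e q (weak_deriv Q e q)" "weak_deriv Q e q \<in> L2 Q" by auto
qed

lemma Basis_Q: "(dir i, 0) \<in> Basis" "(0, 1) \<in> (Basis :: ((real^3) \<times> real) set)"
  by (auto simp: Basis_prod_def dir_Basis)

lemma kirchhoff_gradient:
  assumes q: "q \<in> Hk 1 Q"
  shows "AE z in lebesgue_on Q. nabla (\<psi> \<circ> q) z = K (S (q z)) *\<^sub>R nabla q z"
proof -
  have "AE z in lebesgue_on Q. DQ i (\<psi> \<circ> q) z = K (S (q z)) * DQ i q z" for i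
  proof -
    have "\<bar>K (S y)\<bar> \<le> K 1" for y using K_S_bounds(2)[of y] K_pos[of "S y"] by simp
    from has_weak_deriv_chain[OF open_Q Hk1D(1)[OF q Basis_Q(1)] \<psi>_DERIV K_S_continuous this]
    have "has_weak_deriv Q (dir i, 0) (\<psi> \<circ> q) (\<lambda>z. K (S (q z)) * DQ i q z)" by (simp add: o_def)
    from weak_deriv_AE_eq[OF this open_Q] show ?thesis .
  qed
  then have "AE z in lebesgue_on Q. \<forall>i. DQ i (\<psi> \<circ> q) z = K (S (q z)) * DQ i q z"
    by (simp add: AE_all_countable)
  then show ?thesis by (elim eventually_mono) (simp add: vec_eq_iff nabla_nth)
qed

lemma has_weak_div_nabla:
  assumes v: "v \<in> L2_H20 \<Omega> T" shows "has_weak_div \<Omega> T (nabla v) (lap v)"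
  unfolding has_weak_div_def
proof (intro conjI allI ballI)
  have li: "locally_integrable Q (DQ i v)" "locally_integrable Q (DQ i (DQ i v))" "locally_integrable Q (lap v)" for i
    using L2_locally_integrable[OF _ lmeasurable(3)] L2_H20D(3,6)[OF v] lap_L2[OF v] by auto
  show "locally_integrable Q (\<lambda>z. nabla v z $ i)" for i using li(1)[of i] by (simp add: nabla_nth)
  show "locally_integrable Q (lap v)" by (rule li(3))
  fix \<phi> assume t: "\<phi> \<in> test_functions Q"
  have i1: "integrable (lebesgue_on Q) (\<lambda>z. DQ i v z * frechet_derivative \<phi> (at z) (dir i, 0))" for i
    by (rule locally_integrable_mult_test[OF li(1) sets_lebesgue(3) test_functions_derivative[OF t]])
  have i2: "integrable (lebesgue_on Q) (\<lambda>z. DQ i (DQ i v) z * \<phi> z)" for i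
    by (rule locally_integrable_mult_test[OF li(2) sets_lebesgue(3) t])
  have "(\<integral>z. nabla v z \<bullet> (\<chi> i. frechet_derivative \<phi> (at z) (dir i, 0)) \<partial>lebesgue_on Q)
     = (\<integral>z. (\<Sum>i\<in>UNIV. DQ i v z * frechet_derivative \<phi> (at z) (dir i, 0)) \<partial>lebesgue_on Q)"
    by (simp add: inner_vec_def nabla_nth)
  also have "\<dots> = (\<Sum>i\<in>UNIV. \<integral>z. DQ i v z * frechet_derivative \<phi> (at z) (dir i, 0) \<partial>lebesgue_on Q)"
    using i1 by (intro Bochner_Integration.integral_sum)
  also have "\<dots> = (\<Sum>i\<in>UNIV. - (\<integral>z. DQ i (DQ i v) z * \<phi> z \<partial>lebesgue_on Q))"
  proof (rule sum.cong[OF refl])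
    fix i :: 3
    show "(\<integral>z. DQ i v z * frechet_derivative \<phi> (at z) (dir i, 0) \<partial>lebesgue_on Q) = - (\<integral>z. DQ i (DQ i v) z * \<phi> z \<partial>lebesgue_on Q)"
      using L2_H20D(5)[OF v, where i = i and j = i] t unfolding has_weak_deriv_def by blast
  qed
  also have "\<dots> = - (\<integral>z. (\<Sum>i\<in>UNIV. DQ i (DQ i v) z * \<phi> z) \<partial>lebesgue_on Q)"
    using i2 by (subst Bochner_Integration.integral_sum) (auto simp: sum_negf)
  also have "(\<lambda>z. \<Sum>i\<in>UNIV. DQ i (DQ i v) z * \<phi> z) = (\<lambda>z. lap v z * \<phi> z)"
    by (simp add: lap_eq sum_distrib_right)
  finally show "(\<integral>z. nabla v z \<bullet> (\<chi> i. frechet_derivative \<phi> (at z) (dir i, 0)) \<partial>lebesgue_on Q) = - (\<integral>z. lap v z * \<phi> z \<partial>lebesgue_on Q)" .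
qed

lemma has_weak_div_cong_AE:
  assumes "has_weak_div \<Omega> T F g" "AE z in lebesgue_on Q. F z = F' z"
  shows "has_weak_div \<Omega> T F' g"
proof -
  have "locally_integrable Q (\<lambda>z. F' z $ i)" for i
  proof (rule locally_integrable_cong_AE[OF _ _ sets_lebesgue(3)])
    show "locally_integrable Q (\<lambda>z. F z $ i)" using assms(1) by (simp add: has_weak_div_def)
    show "AE z in lebesgue_on Q. F z $ i = F' z $ i" using assms(2) by (elim eventually_mono) simp
  qed
  moreover have "(\<integral>z. F' z \<bullet> \<xi> z \<partial>lebesgue_on Q) = (\<integral>z. F z \<bullet> \<xi> z \<partial>lebesgue_on Q)" for \<xi>
    by (rule integral_lebesgue_on_cong_AE[OF _ sets_lebesgue(3)]) (use assms(2) in \<open>elim eventually_mono, simp\<close>)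
  ultimately show ?thesis using assms(1) by (simp add: has_weak_div_def)
qed

lemma has_weak_div_unique:
  assumes "has_weak_div \<Omega> T F g" "has_weak_div \<Omega> T F h"
  shows "AE z in lebesgue_on Q. g z = h z"
proof -
  have li: "locally_integrable Q g" "locally_integrable Q h" using assms by (auto simp: has_weak_div_def)
  have "AE z in lebesgue_on Q. 1 * g z + (- 1) * h z = 0"
  proof (rule fundamental_lemma[OF open_Q locally_integrable_lincomb[OF li]])
    fix \<phi> assume t: "\<phi> \<in> test_functions Q"
    have "(\<integral>z. g z * \<phi> z \<partial>lebesgue_on Q) = (\<integral>z. h z * \<phi> z \<partial>lebesgue_on Q)"
      using assms t unfolding has_weak_div_def by force
    then show "(\<integral>z. (1 * g z + (- 1) * h z) * \<phi> z \<partial>lebesgue_on Q) = 0"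
      using locally_integrable_mult_test[OF li(1) sets_lebesgue(3) t] locally_integrable_mult_test[OF li(2) sets_lebesgue(3) t]
      by (simp add: left_diff_distrib)
  qed
  then show ?thesis by (elim eventually_mono) simp
qed

text \<open>The common normal form of both problems: the unknown is \<open>v = \<psi>(p)\<close>, the time derivative \<open>g\<close> of the
  saturation is a function, and the initial condition is built into a primitive.\<close>

definition normal_solution :: "((real^3) \<times> real \<Rightarrow> real) \<Rightarrow> ((real^3) \<times> real \<Rightarrow> real) \<Rightarrow> bool" where
  "normal_solution v g \<longleftrightarrow> v \<in> L2_H20 \<Omega> T \<and> g \<in> L2 Q \<and>
     (AE z in lebesgue_on Q. b (v z) = S (p0 (fst z)) + time_primitive I g z) \<and>
     (\<forall>\<phi>\<in>L2_H20 \<Omega> T. (\<integral>z. g z * \<phi> z - K (b (v z)) * DQ 3 \<phi> z + (\<Sum>i\<in>UNIV. DQ i v z * DQ i \<phi> z)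
        + \<gamma> * (lap v z * lap \<phi> z) \<partial>lebesgue_on Q) = 0)"

text \<open>The flux \<open>K(S(q)) \<nabla>q\<close> is the gradient of \<open>\<psi>(q)\<close>, so its weak divergence is the Laplacian of \<open>\<psi>(q)\<close>.\<close>

lemma fourth_order_normal:
  assumes q: "weak_solution_fourth_order \<Omega> T \<gamma> K S p0 q"
  shows "\<exists>g. normal_solution (\<psi> \<circ> q) g"
proof -
  obtain g D where H1: "q \<in> Hk 1 Q" and v: "\<psi> \<circ> q \<in> L2_H20 \<Omega> T" and g: "g \<in> L2 Q" and D: "D \<in> L2 Q"
    and wt: "has_weak_deriv Q (0, 1) (S \<circ> q) g"
    and wD: "has_weak_div \<Omega> T (\<lambda>z. K (S (q z)) *\<^sub>R nabla q z) D"
    and eq: "\<And>\<phi>. \<phi> \<in> L2_H20 \<Omega> T \<Longrightarrow>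
      (\<integral>z. g z * \<phi> z - K (S (q z)) * (e3 \<bullet> nabla \<phi> z) + K (S (q z)) * (nabla q z \<bullet> nabla \<phi> z) \<partial>lebesgue_on Q)
      + \<gamma> * (\<integral>z. D z * lap \<phi> z \<partial>lebesgue_on Q) = 0"
    and init: "\<exists>q0. has_time_value \<Omega> T q 0 q0 \<and> (AE x in lebesgue_on \<Omega>. S (q0 x) = S (p0 x))"
    using q unfolding weak_solution_fourth_order_def \<psi>_def by blast
  define v where "v = \<psi> \<circ> q"
  note v = v[folded v_def]
  have vq: "b (v z) = S (q z)" for z by (simp add: v_def)
  have qL: "q \<in> L2 Q" using Hk_L2[OF H1] .
  note grad = kirchhoff_gradient[OF H1, folded v_def]
  have DL: "AE z in lebesgue_on Q. D z = lap v z"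
  proof -
    have "AE z in lebesgue_on Q. K (S (q z)) *\<^sub>R nabla q z = nabla v z" using grad by (simp add: eq_commute)
    from has_weak_div_unique[OF has_weak_div_cong_AE[OF wD this] has_weak_div_nabla[OF v]] show ?thesis .
  qed
  have wt': "has_weak_deriv Q (0, 1) (\<lambda>z. S (q z)) g" using wt by (simp add: o_def)
  obtain B where B: "B \<in> L2 \<Omega>" "AE z in lebesgue_on Q. S (q z) = B (fst z) + time_primitive I g z"
    using weak_time_derivative_primitive[OF T_pos S_L2[OF qL] g wt'] by blast
  obtain q0 where q0: "has_time_value \<Omega> T q 0 q0" "AE x in lebesgue_on \<Omega>. S (q0 x) = S (p0 x)" using init by blast
  obtain L where L: "\<And>x y. \<bar>S x - S y\<bar> \<le> L * \<bar>x - y\<bar>" using S_derivative by metis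
  have S1: "\<bar>S y\<bar> \<le> 1" for y using S_01[of y] by simp
  have "AE x in lebesgue_on \<Omega>. B x = S (p0 x)"
    using initial_value_unique[OF T_pos q0(1) S_continuous L S1 B(1) g B(2)] q0(2) by eventually_elim simp
  from AE_fst[OF this] B(2) have i: "AE z in lebesgue_on Q. b (v z) = S (p0 (fst z)) + time_primitive I g z"
    by eventually_elim (simp add: vq)
  have "(\<integral>z. g z * \<phi> z - K (b (v z)) * DQ 3 \<phi> z + (\<Sum>i\<in>UNIV. DQ i v z * DQ i \<phi> z)
        + \<gamma> * (lap v z * lap \<phi> z) \<partial>lebesgue_on Q) = 0" if \<phi>: "\<phi> \<in> L2_H20 \<Omega> T" for \<phi>
  proof -
    have i1: "integrable (lebesgue_on Q) (\<lambda>z. g z * \<phi> z)" by (rule L2_mult_integrable[OF g L2_H20D(1)[OF \<phi>]])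
    have i2: "integrable (lebesgue_on Q) (\<lambda>z. K (b (v z)) * DQ 3 \<phi> z)"
      by (rule L2_mult_integrable[OF K_b_L2[OF L2_H20D(1)[OF v]] L2_H20D(3)[OF \<phi>]])
    note i3 = inner_nabla_L1[OF v \<phi>]
    have i4: "integrable (lebesgue_on Q) (\<lambda>z. lap v z * lap \<phi> z)" by (rule L2_mult_integrable[OF lap_L2[OF v] lap_L2[OF \<phi>]])
    have "(\<integral>z. g z * \<phi> z - K (S (q z)) * (e3 \<bullet> nabla \<phi> z) + K (S (q z)) * (nabla q z \<bullet> nabla \<phi> z) \<partial>lebesgue_on Q)
       = (\<integral>z. g z * \<phi> z - K (b (v z)) * DQ 3 \<phi> z + (\<Sum>i\<in>UNIV. DQ i v z * DQ i \<phi> z) \<partial>lebesgue_on Q)"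
    proof (rule integral_lebesgue_on_cong_AE[OF _ sets_lebesgue(3)])
      show "AE z in lebesgue_on Q. g z * \<phi> z - K (b (v z)) * DQ 3 \<phi> z + (\<Sum>i\<in>UNIV. DQ i v z * DQ i \<phi> z)
         = g z * \<phi> z - K (S (q z)) * (e3 \<bullet> nabla \<phi> z) + K (S (q z)) * (nabla q z \<bullet> nabla \<phi> z)"
        using grad
      proof eventually_elim
        case (elim z)
        have "K (S (q z)) * (nabla q z \<bullet> nabla \<phi> z) = nabla v z \<bullet> nabla \<phi> z" by (simp add: elim)
        then show ?case by (simp only: inner_nabla e3_nabla vq)
      qed
    qed
    moreover have "(\<integral>z. D z * lap \<phi> z \<partial>lebesgue_on Q) = (\<integral>z. lap v z * lap \<phi> z \<partial>lebesgue_on Q)"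
      by (rule integral_lebesgue_on_cong_AE[OF _ sets_lebesgue(3)]) (use DL in \<open>elim eventually_mono, simp\<close>)
    ultimately show ?thesis using eq[OF \<phi>] i1 i2 i3 i4 by simp
  qed
  then show ?thesis using v g i unfolding normal_solution_def v_def by blast
qed

text \<open>The chain rule is applied twice: to \<open>\<psi>\<^sup>-\<^sup>1\<close>, which puts \<open>\<psi>\<^sup>-\<^sup>1(u)\<close> into \<open>H\<^sup>1\<close>, and to \<open>b\<close>, which makes \<open>\<partial>\<^sub>t b(u)\<close> a
  function.\<close>

lemma transformed_fourth_order:
  assumes H1: "u \<in> Hk 1 Q" and u: "u \<in> L2_H20 \<Omega> T"
    and w: "weak_solution_transformed \<Omega> T \<gamma> K b (\<psi> \<circ> p0) u"
  shows "weak_solution_fourth_order \<Omega> T \<gamma> K S p0 (\<theta> \<circ> u)"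
proof -
  define p where "p = \<theta> \<circ> u"
  have pu: "\<psi> \<circ> p = u" and Sp: "S (p z) = b (u z)" for z by (auto simp: p_def b_def)
  have uL: "u \<in> L2 Q" by (rule L2_H20D(1)[OF u])
  have pwd: "has_weak_deriv Q e p (\<lambda>z. 1 / K (S (\<theta> (u z))) * weak_deriv Q e u z)" if "e \<in> Basis" for e
    using has_weak_deriv_chain[OF open_Q Hk1D(1)[OF H1 that] \<theta>_DERIV \<theta>_derivative_continuous \<theta>_derivative_bound]
    by (simp add: p_def o_def)
  have p'L: "(\<lambda>z. 1 / K (S (\<theta> (u z))) * weak_deriv Q e u z) \<in> L2 Q" if "e \<in> Basis" for e
    using measurable_compose[OF L2_measurable[OF uL] borel_measurable_continuous_onI[OF \<theta>_derivative_continuous]]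
    by (rule L2_bounded_mult[OF Hk1D(2)[OF H1 that] _ \<theta>_derivative_bound])
  have pL: "p \<in> L2 Q"
  proof -
    have pm: "p \<in> borel_measurable (lebesgue_on Q)"
      using measurable_compose[OF L2_measurable[OF uL] borel_measurable_continuous_onI[OF \<theta>_continuous]]
      by (simp add: p_def o_def)
    have "integrable (lebesgue_on Q) (\<lambda>z. (p z)\<^sup>2)"
    proof (rule Bochner_Integration.integrable_bound)
      show "integrable (lebesgue_on Q) (\<lambda>z. (1 / K 0)\<^sup>2 * (u z)\<^sup>2)" using L2_square[OF uL] by simp
      have "(p z)\<^sup>2 \<le> (1 / K 0)\<^sup>2 * (u z)\<^sup>2" for z
        using power_mono[OF \<theta>_Lipschitz[of "u z" 0] abs_ge_zero, of 2]
        by (simp add: p_def \<theta>_0 power_divide)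
      then show "AE z in lebesgue_on Q. norm ((p z)\<^sup>2) \<le> norm ((1 / K 0)\<^sup>2 * (u z)\<^sup>2)" by (intro AE_I2) simp
    qed (use pm in measurable)
    then show ?thesis using pm by (simp add: L2_def)
  qed
  have "\<forall>e\<in>Basis. \<exists>h\<in>L2 Q. has_weak_deriv Q e p h" using pwd p'L by blast
  then have pH: "p \<in> Hk 1 Q" using pL by simp
  obtain b' M where b': "\<And>x. (b has_real_derivative b' x) (at x)" "continuous_on UNIV b'" "\<And>x. \<bar>b' x\<bar> \<le> M"
    using b_derivative by metis
  define g where "g z = b' (u z) * weak_deriv Q (0, 1) u z" for z
  have gwd: "has_weak_deriv Q (0, 1) (\<lambda>z. b (u z)) g"
    unfolding g_def[abs_def] by (rule has_weak_deriv_chain[OF open_Q Hk1D(1)[OF H1 Basis_Q(2)] b'])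
  have gL: "g \<in> L2 Q"
    unfolding g_def[abs_def]
    using measurable_compose[OF L2_measurable[OF uL] borel_measurable_continuous_onI[OF b'(2)]]
    by (rule L2_bounded_mult[OF Hk1D(2)[OF H1 Basis_Q(2)] _ b'(3)])
  obtain F where dd: "has_time_deriv_dual \<Omega> T (b \<circ> u) F" and F: "F \<in> bochner_Lp 2 T (Hk_dual 2 \<Omega>) (Hk_dual_norm 2 \<Omega>)"
    and eq: "\<And>\<phi>. \<phi> \<in> L2_H20 \<Omega> T \<Longrightarrow> (\<integral>t. F t (slice \<phi> t) \<partial>lebesgue_on I)
       + (\<integral>z. - K (b (u z)) * (e3 \<bullet> nabla \<phi> z) + nabla u z \<bullet> nabla \<phi> z + \<gamma> * (lap u z * lap \<phi> z) \<partial>lebesgue_on Q) = 0"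
    and ini: "\<And>\<phi> \<phi>'. \<phi> \<in> L2_H20 \<Omega> T \<Longrightarrow> has_weak_deriv Q (0, 1) \<phi> \<phi>' \<Longrightarrow>
       slice \<phi>' \<in> bochner_Lp 1 T (Linf \<Omega>) (Linf_norm \<Omega>) \<Longrightarrow> has_time_value \<Omega> T \<phi> T (\<lambda>x. 0) \<Longrightarrow>
       (\<integral>t. F t (slice \<phi> t) \<partial>lebesgue_on I) = (\<integral>z. (case z of (x, t) \<Rightarrow> (b ((\<psi> \<circ> p0) x) - b (u (x, t))) * \<phi>' (x, t)) \<partial>lebesgue_on Q)"
    using w unfolding weak_solution_transformed_def by blast
  have dd': "has_time_deriv_dual \<Omega> T (\<lambda>z. b (u z)) F" using dd by (simp add: o_def)
  note pair = dual_time_derivative_pairing[OF b_L2[OF uL] gL gwd dd' F]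
  obtain B where B: "B \<in> L2 \<Omega>" "AE z in lebesgue_on Q. b (u z) = B (fst z) + time_primitive I g z"
    using weak_time_derivative_primitive[OF T_pos b_L2[OF uL] gL gwd] by blast
  have S1: "\<bar>S y\<bar> \<le> 1" for y using S_01[of y] by simp
  have p0L: "p0 \<in> L2 \<Omega>" using Hk_L2[OF Hk0_Hk[OF p0]] .
  have Sp0: "(\<lambda>x. S (p0 x)) \<in> L2 \<Omega>"
    by (rule bounded_L2[OF lmeasurable(1) measurable_compose[OF L2_measurable[OF p0L] borel_measurable_continuous_onI[OF S_continuous]] S1])
  have BS: "AE x in lebesgue_on \<Omega>. B x = S (p0 x)"
  proof (rule weak_initial_condition[OF T_pos B(1) gL Sp0 B(2)])
    fix \<zeta> \<eta> assume \<zeta>: "\<zeta> \<in> test_functions \<Omega>" and \<eta>: "\<eta> \<in> test_functions {..<T}"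
    define \<phi> where "\<phi> z = \<zeta> (fst z) * \<eta> (snd z)" for z
    define \<phi>' where "\<phi>' z = \<zeta> (fst z) * deriv \<eta> (snd z)" for z
    obtain c where c: "\<And>t. \<bar>\<eta> t\<bar> \<le> c" using test_functions_bounded[OF \<eta>] by blast
    have d: "deriv \<eta> = (\<lambda>t. frechet_derivative \<eta> (at t) 1)" using test_function_real_derivative(2)[OF \<eta>] by auto
    have dt: "deriv \<eta> \<in> test_functions {..<T}" unfolding d by (rule test_functions_derivative[OF \<eta>])
    have \<eta>T: "\<eta> T = 0"
    proof -
      obtain C where "C \<subseteq> {..<T}" "\<And>x. x \<notin> C \<Longrightarrow> \<eta> x = 0" using test_functions_support[OF \<eta>] by metis
      then show ?thesis by (metis lessThan_iff less_irrefl subsetD)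
    qed
    have 1: "\<phi> \<in> L2_H20 \<Omega> T"
      unfolding \<phi>_def[abs_def] by (rule product_L2_H20[OF test_functions_Hk0[OF \<zeta> lmeasurable(1) open_\<Omega>] test_functions_borel[OF \<eta>] c])
    have "frechet_derivative \<phi> (at z) (0, 1) = \<phi>' z" for z
      unfolding \<phi>_def[abs_def] \<phi>'_def d by (rule frechet_derivative_product_time[OF \<zeta> \<eta> test_function_real_derivative(1)[OF \<eta>]])
    then have 2: "has_weak_deriv Q (0, 1) \<phi> \<phi>'"
      using has_weak_deriv_test[OF open_Q test_functions_product[OF \<zeta> \<eta>], of "(0, 1)"] by (simp add: \<phi>_def[abs_def])
    have 3: "slice \<phi>' \<in> bochner_Lp 1 T (Linf \<Omega>) (Linf_norm \<Omega>)"
      unfolding \<phi>'_def[abs_def] by (rule product_bochner_Linf[OF \<zeta> dt])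
    have 4: "has_time_value \<Omega> T \<phi> T (\<lambda>x. 0)"
      unfolding \<phi>_def[abs_def]
      by (rule product_time_value_zero[OF test_functions_L2[OF \<zeta> lmeasurable(1)] test_functions_continuous[OF \<eta>] \<eta>T])
    show "(\<integral>z. g z * (\<zeta> (fst z) * \<eta> (snd z)) \<partial>lebesgue_on Q)
      = (\<integral>z. (S (p0 (fst z)) - b (u z)) * (\<zeta> (fst z) * deriv \<eta> (snd z)) \<partial>lebesgue_on Q)"
      using ini[OF 1 2 3 4] pair[OF 1] by (simp add: \<phi>_def \<phi>'_def case_prod_unfold)
  qed
  obtain Bp where Bp: "Bp \<in> L2 \<Omega>"
    "AE z in lebesgue_on Q. p z = Bp (fst z) + time_primitive I (\<lambda>z. 1 / K (S (\<theta> (u z))) * weak_deriv Q (0, 1) u z) z"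
    using weak_time_derivative_primitive[OF T_pos pL p'L[OF Basis_Q(2)] pwd[OF Basis_Q(2)]] by blast
  note ptv = primitive_has_time_value[OF Bp(1) p'L[OF Basis_Q(2)] Bp(2), of 0]
  obtain L where L: "\<And>x y. \<bar>S x - S y\<bar> \<le> L * \<bar>x - y\<bar>" using S_derivative by metis
  have BS': "AE z in lebesgue_on Q. S (p z) = B (fst z) + time_primitive I g z" using B(2) by (simp add: Sp)
  have init: "AE x in lebesgue_on \<Omega>. S (Bp x + time_primitive I (\<lambda>z. 1 / K (S (\<theta> (u z))) * weak_deriv Q (0, 1) u z) (x, 0)) = S (p0 x)"
    using initial_value_unique[OF T_pos ptv S_continuous L S1 B(1) gL BS'] BS by eventually_elim simp
  note grad = kirchhoff_gradient[OF pH, unfolded pu]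
  have wD: "has_weak_div \<Omega> T (\<lambda>z. K (S (p z)) *\<^sub>R nabla p z) (lap u)"
    by (rule has_weak_div_cong_AE[OF has_weak_div_nabla[OF u] grad])
  have fin: "(\<integral>z. g z * \<phi> z - K (S (p z)) * (e3 \<bullet> nabla \<phi> z) + K (S (p z)) * (nabla p z \<bullet> nabla \<phi> z) \<partial>lebesgue_on Q)
      + \<gamma> * (\<integral>z. lap u z * lap \<phi> z \<partial>lebesgue_on Q) = 0" if \<phi>: "\<phi> \<in> L2_H20 \<Omega> T" for \<phi>
  proof -
    have i1: "integrable (lebesgue_on Q) (\<lambda>z. g z * \<phi> z)" by (rule L2_mult_integrable[OF gL L2_H20D(1)[OF \<phi>]])
    have i2: "integrable (lebesgue_on Q) (\<lambda>z. K (b (u z)) * DQ 3 \<phi> z)"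
      by (rule L2_mult_integrable[OF K_b_L2[OF uL] L2_H20D(3)[OF \<phi>]])
    note i3 = inner_nabla_L1[OF u \<phi>]
    have i4: "integrable (lebesgue_on Q) (\<lambda>z. lap u z * lap \<phi> z)" by (rule L2_mult_integrable[OF lap_L2[OF u] lap_L2[OF \<phi>]])
    have "(\<integral>z. g z * \<phi> z - K (S (p z)) * (e3 \<bullet> nabla \<phi> z) + K (S (p z)) * (nabla p z \<bullet> nabla \<phi> z) \<partial>lebesgue_on Q)
       = (\<integral>z. g z * \<phi> z - K (b (u z)) * DQ 3 \<phi> z + (\<Sum>i\<in>UNIV. DQ i u z * DQ i \<phi> z) \<partial>lebesgue_on Q)"
    proof (rule integral_lebesgue_on_cong_AE[OF _ sets_lebesgue(3)])
      show "AE z in lebesgue_on Q. g z * \<phi> z - K (b (u z)) * DQ 3 \<phi> z + (\<Sum>i\<in>UNIV. DQ i u z * DQ i \<phi> z)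
         = g z * \<phi> z - K (S (p z)) * (e3 \<bullet> nabla \<phi> z) + K (S (p z)) * (nabla p z \<bullet> nabla \<phi> z)"
        using grad
      proof eventually_elim
        case (elim z)
        have "K (S (p z)) * (nabla p z \<bullet> nabla \<phi> z) = nabla u z \<bullet> nabla \<phi> z" by (simp add: elim)
        then show ?case by (simp only: inner_nabla e3_nabla Sp)
      qed
    qed
    then show ?thesis
      using eq[OF \<phi>] pair[OF \<phi>] i1 i2 i3 i4 by (simp add: inner_nabla e3_nabla)
  qed
  have "has_weak_deriv Q (0, 1) (S \<circ> p) g" using gwd by (simp add: o_def Sp)
  moreover have "kirchhoff K S \<circ> p \<in> L2_H20 \<Omega> T" using u pu by (simp add: \<psi>_def[symmetric])
  ultimately have "weak_solution_fourth_order \<Omega> T \<gamma> K S p0 p"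
    unfolding weak_solution_fourth_order_def using pH gL lap_L2[OF u] wD fin ptv init by blast
  then show ?thesis by (simp add: p_def)
qed

end

section \<open>An energy inequality in time\<close>

text \<open>By symmetry the triangle contributes half of the integral of \<open>f s * f t\<close> over the square.\<close>

lemma symmetric_primitive:
  fixes f :: "real \<Rightarrow> real"
  assumes Ib: "I \<in> sets borel" and f: "integrable (lebesgue_on I) f"
  shows "(\<integral>s. f s * (\<integral>t. indicator {s<..} t * f t \<partial>lebesgue_on I) \<partial>lebesgue_on I) = (\<integral>s. f s \<partial>lebesgue_on I)\<^sup>2 / 2"
proof -
  have Il: "I \<in> sets lebesgue" using Ib by simp
  note sw = swap_primitives[OF Ib f f]
  let ?F = "\<integral>s. f s \<partial>lebesgue_on I"
  have ii: "integrable (lebesgue_on I) (\<lambda>t. indicator A t * f t)" if "A \<in> sets borel" for A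
    using integrable_mult_indicator[OF _ f, of "A \<inter> I"] that Ib
    by (subst Bochner_Integration.integrable_cong[OF refl, of _ _ "\<lambda>t. indicator (A \<inter> I) t *\<^sub>R f t"])
       (auto simp: sets_restrict_space_iff indicator_def)
  have split: "(\<integral>s. indicator {..<t} s * f s \<partial>lebesgue_on I) + (\<integral>s. indicator {t<..} s * f s \<partial>lebesgue_on I) = ?F" for t
  proof -
    have "(\<integral>s. indicator {..<t} s * f s \<partial>lebesgue_on I) + (\<integral>s. indicator {t<..} s * f s \<partial>lebesgue_on I)
        = (\<integral>s. indicator {..<t} s * f s + indicator {t<..} s * f s \<partial>lebesgue_on I)"
      using ii by simp
    also have "\<dots> = ?F"
    proof (rule integral_lebesgue_on_cong_AE[OF _ Il])
      show "AE s in lebesgue_on I. f s = indicator {..<t} s * f s + indicator {t<..} s * f s"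
        unfolding AE_lebesgue_on_iff[OF Il] using AE_lborel_singleton[of t] by eventually_elim (auto simp: indicator_def)
    qed
    finally show ?thesis .
  qed
  have "(\<integral>t. f t * (\<integral>s. indicator {..<t} s * f s \<partial>lebesgue_on I) \<partial>lebesgue_on I)
      + (\<integral>s. f s * (\<integral>t. indicator {s<..} t * f t \<partial>lebesgue_on I) \<partial>lebesgue_on I)
      = (\<integral>t. f t * (\<integral>s. indicator {..<t} s * f s \<partial>lebesgue_on I) + f t * (\<integral>s. indicator {t<..} s * f s \<partial>lebesgue_on I) \<partial>lebesgue_on I)"
    using sw(2,3) by simp
  also have "\<dots> = (\<integral>t. f t * ?F \<partial>lebesgue_on I)"
    by (simp only: split distrib_left[symmetric])
  also have "\<dots> = ?F\<^sup>2" by (simp add: power2_eq_square)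
  finally show ?thesis using sw(1) by simp
qed

lemma indicator_exp_mult_integrable:
  fixes g :: "real \<Rightarrow> real"
  assumes g: "integrable (lebesgue_on {0<..<T}) g" and A: "A \<in> sets borel"
  shows "integrable (lebesgue_on {0<..<T}) (\<lambda>t. indicator A t * (exp (c * t) * g t))"
proof (rule Bochner_Integration.integrable_bound)
  show "integrable (lebesgue_on {0<..<T}) (\<lambda>t. exp (\<bar>c\<bar> * \<bar>T\<bar>) * g t)" using g by simp
  have "(\<lambda>t. indicator A t :: real) \<in> borel_measurable (lebesgue_on {0<..<T})"
    by (rule borel_measurable_lebesgue_onI[OF borel_measurable_indicator[OF A]])
  moreover have "(\<lambda>t. exp (c * t)) \<in> borel_measurable (lebesgue_on {0<..<T})"
    by (rule borel_measurable_lebesgue_onI) (auto intro!: borel_measurable_continuous_onI continuous_intros)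
  ultimately show "(\<lambda>t. indicator A t * (exp (c * t) * g t)) \<in> borel_measurable (lebesgue_on {0<..<T})"
    using g by (intro borel_measurable_times) auto
  have "exp (c * t) \<le> exp (\<bar>c\<bar> * \<bar>T\<bar>)" if "t \<in> {0<..<T}" for t
  proof -
    have "c * t \<le> \<bar>c\<bar> * \<bar>t\<bar>" by (metis abs_ge_self abs_mult)
    also have "\<dots> \<le> \<bar>c\<bar> * \<bar>T\<bar>" using that by (intro mult_left_mono) auto
    finally show ?thesis by simp
  qed
  then show "AE t in lebesgue_on {0<..<T}. norm (indicator A t * (exp (c * t) * g t)) \<le> norm (exp (\<bar>c\<bar> * \<bar>T\<bar>) * g t)"
    by (intro AE_I2) (auto simp: abs_mult indicator_def intro!: mult_right_mono)
qed

text \<open>For \<open>\<mu> = 0\<close> this is \<open>symmetric_primitive\<close>, applied after swapping the primitives. In general the swap leaves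
  \<open>g = exp(\<mu> s) h\<close> with \<open>h = exp(-\<mu> s) g\<close> against the primitive \<open>P\<close> of \<open>h\<close>. Write \<open>exp(\<mu> s)\<close> as
  \<open>1\<close> plus the integral of \<open>\<mu> exp(\<mu> r)\<close> over \<open>0 < r < s\<close>, and use \<open>symmetric_primitive\<close> on each interval \<open>(r,T)\<close>.\<close>

lemma weighted_primitive_identity:
  fixes g :: "real \<Rightarrow> real" and \<mu> T :: real
  defines "I \<equiv> {0<..<T}"
  defines "P \<equiv> (\<lambda>s. \<integral>t. indicator {s<..} t * (exp (- \<mu> * t) * g t) \<partial>lebesgue_on I)"
  assumes g: "integrable (lebesgue_on I) g"
  shows "(\<integral>t. exp (- \<mu> * t) * g t * (\<integral>s. indicator {..<t} s * g s \<partial>lebesgue_on I) \<partial>lebesgue_on I)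
      = (\<integral>t. exp (- \<mu> * t) * g t \<partial>lebesgue_on I)\<^sup>2 / 2 + (\<mu> / 2) * (\<integral>r. exp (\<mu> * r) * (P r)\<^sup>2 \<partial>lebesgue_on I)"
proof -
  have Ib: "I \<in> sets borel" by (simp add: I_def)
  define h where "h t = exp (- \<mu> * t) * g t" for t
  have hi: "integrable (lebesgue_on I) h"
    using indicator_exp_mult_integrable[OF g[unfolded I_def], of UNIV "-\<mu>"] by (simp add: h_def[abs_def] I_def)
  have ei: "integrable (lebesgue_on I) (\<lambda>r. \<mu> * exp (\<mu> * r))"
  proof -
    interpret finite_measure "lebesgue_on I" unfolding I_def by (intro finite_measure_lebesgue_on) (auto intro: lmeasurable_open)
    have "integrable (lebesgue_on {0<..<T}) (\<lambda>r. 1 :: real)" using integrable_const[of 1] by (simp add: I_def)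
    from indicator_exp_mult_integrable[OF this, of UNIV \<mu>] show ?thesis by (simp add: I_def)
  qed
  have P: "P = (\<lambda>s. \<integral>t. indicator {s<..} t * h t \<partial>lebesgue_on I)" by (simp add: P_def h_def)
  have hP: "integrable (lebesgue_on I) (\<lambda>s. h s * P s)" unfolding P by (rule swap_primitives(3)[OF Ib hi hi])
  have e: "exp (\<mu> * s) = 1 + (\<integral>r. indicator {..<s} r * (\<mu> * exp (\<mu> * r)) \<partial>lebesgue_on I)" if s: "s \<in> I" for s
  proof -
    have "(\<integral>r. indicator {..<s} r * (\<mu> * exp (\<mu> * r)) \<partial>lebesgue_on I) = (\<integral>r. indicator {0<..<s} r * (\<mu> * exp (\<mu> * r)) \<partial>lebesgue_on I)"
      by (rule Bochner_Integration.integral_cong) (auto simp: I_def indicator_def)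
    also have "\<dots> = (\<integral>r. indicator {0<..<s} r * (\<mu> * exp (\<mu> * r)) \<partial>lborel)"
      using s by (intro borel_zero_outside(2)[OF Ib])
        (auto simp: I_def indicator_def intro!: borel_measurable_times borel_measurable_continuous_onI continuous_intros)
    also have "\<dots> = (\<integral>r. \<mu> * exp (\<mu> * r) * indicator {0..s} r \<partial>lborel)"
    proof (rule integral_cong_AE)
      show "AE r in lborel. indicator {0<..<s} r * (\<mu> * exp (\<mu> * r)) = \<mu> * exp (\<mu> * r) * indicator {0..s} r"
        using AE_lborel_singleton[of 0] AE_lborel_singleton[of s] by eventually_elim (auto simp: indicator_def)
    qed (auto intro!: borel_measurable_times borel_measurable_continuous_onI continuous_intros)
    also have "\<dots> = exp (\<mu> * s) - exp (\<mu> * 0)"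
      using s by (intro integral_FTC_Icc_real) (auto simp: I_def intro!: derivative_eq_intros continuous_intros)
    finally show ?thesis by simp
  qed
  have "(\<integral>t. h t * (\<integral>s. indicator {..<t} s * g s \<partial>lebesgue_on I) \<partial>lebesgue_on I) = (\<integral>s. g s * P s \<partial>lebesgue_on I)"
    unfolding P by (rule swap_primitives(1)[OF Ib hi g])
  also have "\<dots> = (\<integral>s. h s * P s + h s * P s * (\<integral>r. indicator {..<s} r * (\<mu> * exp (\<mu> * r)) \<partial>lebesgue_on I) \<partial>lebesgue_on I)"
  proof (rule Bochner_Integration.integral_cong[OF refl])
    fix s assume "s \<in> space (lebesgue_on I)"
    then have "s \<in> I" by simp
    have "g s = exp (\<mu> * s) * h s" by (simp add: h_def mult.assoc[symmetric] exp_add[symmetric])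
    then show "g s * P s = h s * P s + h s * P s * (\<integral>r. indicator {..<s} r * (\<mu> * exp (\<mu> * r)) \<partial>lebesgue_on I)"
      unfolding e[OF \<open>s \<in> I\<close>] by (simp add: algebra_simps)
  qed
  also have "\<dots> = (\<integral>s. h s * P s \<partial>lebesgue_on I) + (\<integral>s. h s * P s * (\<integral>r. indicator {..<s} r * (\<mu> * exp (\<mu> * r)) \<partial>lebesgue_on I) \<partial>lebesgue_on I)"
    using hP swap_primitives(2)[OF Ib hP ei] by (intro Bochner_Integration.integral_add)
  also have "(\<integral>s. h s * P s \<partial>lebesgue_on I) = (\<integral>s. h s \<partial>lebesgue_on I)\<^sup>2 / 2"
    unfolding P by (rule symmetric_primitive[OF Ib hi])
  also have "(\<integral>s. h s * P s * (\<integral>r. indicator {..<s} r * (\<mu> * exp (\<mu> * r)) \<partial>lebesgue_on I) \<partial>lebesgue_on I)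
      = (\<integral>r. \<mu> * exp (\<mu> * r) * (\<integral>s. indicator {r<..} s * (h s * P s) \<partial>lebesgue_on I) \<partial>lebesgue_on I)"
    by (rule swap_primitives(1)[OF Ib hP ei])
  also have "\<dots> = (\<integral>r. \<mu> / 2 * (exp (\<mu> * r) * (P r)\<^sup>2) \<partial>lebesgue_on I)"
  proof (rule Bochner_Integration.integral_cong[OF refl])
    fix r
    have fi: "integrable (lebesgue_on I) (\<lambda>s. indicator {r<..} s * h s)"
      unfolding h_def I_def by (rule indicator_exp_mult_integrable[OF g[unfolded I_def]]) simp
    have "(\<integral>s. indicator {r<..} s * (h s * P s) \<partial>lebesgue_on I)
       = (\<integral>s. indicator {r<..} s * h s * (\<integral>t. indicator {s<..} t * (indicator {r<..} t * h t) \<partial>lebesgue_on I) \<partial>lebesgue_on I)"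
    proof (rule Bochner_Integration.integral_cong[OF refl])
      fix s
      show "indicator {r<..} s * (h s * P s) = indicator {r<..} s * h s * (\<integral>t. indicator {s<..} t * (indicator {r<..} t * h t) \<partial>lebesgue_on I)"
      proof (cases "r < s")
        case True
        then have "(\<lambda>t. indicator {s<..} t * (indicator {r<..} t * h t)) = (\<lambda>t. indicator {s<..} t * h t)"
          by (auto simp: indicator_def)
        then show ?thesis by (simp add: P)
      qed simp
    qed
    also have "\<dots> = (\<integral>s. indicator {r<..} s * h s \<partial>lebesgue_on I)\<^sup>2 / 2"
      by (rule symmetric_primitive[OF Ib fi])
    finally show "\<mu> * exp (\<mu> * r) * (\<integral>s. indicator {r<..} s * (h s * P s) \<partial>lebesgue_on I) = \<mu> / 2 * (exp (\<mu> * r) * (P r)\<^sup>2)"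
      by (simp add: P)
  qed
  finally show ?thesis by (simp add: h_def)
qed

lemma weighted_primitive_nonneg:
  fixes g :: "real \<Rightarrow> real"
  assumes "integrable (lebesgue_on {0<..<T}) g" "0 \<le> \<mu>"
  shows "0 \<le> (\<integral>t. exp (- \<mu> * t) * g t * (\<integral>s. indicator {..<t} s * g s \<partial>lebesgue_on {0<..<T}) \<partial>lebesgue_on {0<..<T})"
  unfolding weighted_primitive_identity[OF assms(1)] using assms(2) by simp

text \<open>Swapping the integrals moves the primitive from \<open>k\<close> to \<open>exp(-\<mu> t) g\<close>. Young's inequality then leaves
  exactly the square of this primitive that \<open>weighted_primitive_identity\<close> provides.\<close>

lemma weighted_primitive_perturbed:
  fixes g k :: "real \<Rightarrow> real" and T \<mu> :: real
  defines "I \<equiv> {0<..<T}"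
  assumes g: "integrable (lebesgue_on I) g" and k: "k \<in> L2 I" and l: "0 < \<mu>"
  shows "0 \<le> (\<integral>t. exp (- \<mu> * t) * g t * (\<integral>s. indicator {..<t} s * g s \<partial>lebesgue_on I) \<partial>lebesgue_on I)
      - (\<integral>t. exp (- \<mu> * t) * g t * (\<integral>s. indicator {..<t} s * k s \<partial>lebesgue_on I) \<partial>lebesgue_on I)
      + (\<integral>t. exp (- \<mu> * t) * (k t)\<^sup>2 \<partial>lebesgue_on I) / (2 * \<mu>)"
proof -
  have Ib: "I \<in> sets borel" and Im: "I \<in> lmeasurable" by (auto simp: I_def intro: lmeasurable_open)
  define h where "h t = exp (- \<mu> * t) * g t" for t
  have hi: "integrable (lebesgue_on I) h"
    using indicator_exp_mult_integrable[OF g[unfolded I_def], of UNIV "-\<mu>"] by (simp add: h_def[abs_def] I_def)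
  define P where "P s = (\<integral>t. indicator {s<..} t * h t \<partial>lebesgue_on I)" for s
  have ki: "integrable (lebesgue_on I) k" by (rule L2_integrable[OF Im k])
  have kP: "(\<integral>t. h t * (\<integral>s. indicator {..<t} s * k s \<partial>lebesgue_on I) \<partial>lebesgue_on I) = (\<integral>s. k s * P s \<partial>lebesgue_on I)"
    and kPi: "integrable (lebesgue_on I) (\<lambda>s. k s * P s)"
    unfolding P_def using swap_primitives(1,3)[OF Ib hi ki] by auto
  have oi: "integrable (lebesgue_on I) (\<lambda>s. 1 :: real)"
  proof -
    interpret finite_measure "lebesgue_on I" by (rule finite_measure_lebesgue_on[OF Im])
    show ?thesis by simp
  qed
  have Pi: "integrable (lebesgue_on I) P"
    using swap_primitives(3)[OF Ib hi oi] by (simp add: P_def[abs_def])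
  have Pb: "\<bar>P s\<bar> \<le> (\<integral>t. \<bar>h t\<bar> \<partial>lebesgue_on I)" for s
  proof -
    have hi': "integrable (lebesgue_on I) (\<lambda>t. indicator {s<..} t * h t)"
      unfolding h_def I_def by (rule indicator_exp_mult_integrable[OF g[unfolded I_def]]) simp
    have "\<bar>P s\<bar> \<le> (\<integral>t. \<bar>indicator {s<..} t * h t\<bar> \<partial>lebesgue_on I)" unfolding P_def by (rule integral_abs_bound)
    also have "\<dots> \<le> (\<integral>t. \<bar>h t\<bar> \<partial>lebesgue_on I)" using hi hi' by (intro integral_mono) (auto simp: indicator_def)
    finally show ?thesis .
  qed
  have P2: "integrable (lebesgue_on I) (\<lambda>s. (P s)\<^sup>2)"
    by (rule L2_square[OF bounded_L2[OF Im borel_measurable_integrable[OF Pi] Pb]])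
  have i1: "integrable (lebesgue_on I) (\<lambda>s. exp (\<mu> * s) * (P s)\<^sup>2)"
    using indicator_exp_mult_integrable[OF P2[unfolded I_def], of UNIV \<mu>] by (simp add: I_def)
  have i2: "integrable (lebesgue_on I) (\<lambda>s. exp (- \<mu> * s) * (k s)\<^sup>2)"
    using indicator_exp_mult_integrable[OF L2_square[OF k, unfolded I_def], of UNIV "-\<mu>"] by (simp add: I_def)
  have "(\<integral>s. k s * P s \<partial>lebesgue_on I) \<le> (\<integral>s. exp (- \<mu> * s) * (k s)\<^sup>2 / (2 * \<mu>) + \<mu> / 2 * (exp (\<mu> * s) * (P s)\<^sup>2) \<partial>lebesgue_on I)"
  proof (rule integral_mono[OF kPi])
    fix s
    \<comment> \<open>Square root of the weight, distributed over the two factors in Young's inequality.\<close>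
    define a where "a = exp (- \<mu> * s / 2)"
    have a: "a > 0" "exp (- \<mu> * s) = a\<^sup>2" "exp (\<mu> * s) = 1 / a\<^sup>2"
      by (auto simp: a_def power2_eq_square exp_add[symmetric] exp_minus field_simps)
    have "0 \<le> (a * k s - \<mu> * (P s / a))\<^sup>2" by simp
    also have "\<dots> = a\<^sup>2 * (k s)\<^sup>2 + \<mu>\<^sup>2 * ((P s)\<^sup>2 / a\<^sup>2) - 2 * \<mu> * (k s * P s)"
      using a(1) by (simp add: power2_diff power_mult_distrib power_divide)
    finally have "2 * \<mu> * (k s * P s) \<le> a\<^sup>2 * (k s)\<^sup>2 + \<mu>\<^sup>2 * ((P s)\<^sup>2 / a\<^sup>2)" by simp
    then have "k s * P s \<le> (a\<^sup>2 * (k s)\<^sup>2 + \<mu>\<^sup>2 * ((P s)\<^sup>2 / a\<^sup>2)) / (2 * \<mu>)"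
      using l by (simp add: pos_le_divide_eq mult.commute)
    also have "\<dots> = exp (- \<mu> * s) * (k s)\<^sup>2 / (2 * \<mu>) + \<mu> / 2 * (exp (\<mu> * s) * (P s)\<^sup>2)"
      unfolding a(2,3) using l by (simp add: add_divide_distrib power2_eq_square[of \<mu>])
    finally show "k s * P s \<le> exp (- \<mu> * s) * (k s)\<^sup>2 / (2 * \<mu>) + \<mu> / 2 * (exp (\<mu> * s) * (P s)\<^sup>2)" .
  qed (use i1 i2 in auto)
  also have "\<dots> = (\<integral>s. exp (- \<mu> * s) * (k s)\<^sup>2 \<partial>lebesgue_on I) / (2 * \<mu>) + \<mu> / 2 * (\<integral>s. exp (\<mu> * s) * (P s)\<^sup>2 \<partial>lebesgue_on I)"
    using i1 i2 by simp
  finally have "(\<integral>t. h t * (\<integral>s. indicator {..<t} s * k s \<partial>lebesgue_on I) \<partial>lebesgue_on I)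
    \<le> (\<integral>s. exp (- \<mu> * s) * (k s)\<^sup>2 \<partial>lebesgue_on I) / (2 * \<mu>) + \<mu> / 2 * (\<integral>s. exp (\<mu> * s) * (P s)\<^sup>2 \<partial>lebesgue_on I)"
    unfolding kP .
  moreover have "\<mu> / 2 * (\<integral>s. exp (\<mu> * s) * (P s)\<^sup>2 \<partial>lebesgue_on I)
     \<le> (\<integral>t. h t * (\<integral>s. indicator {..<t} s * g s \<partial>lebesgue_on I) \<partial>lebesgue_on I)"
    using weighted_primitive_identity[OF g[unfolded I_def], of \<mu>] by (simp add: h_def P_def I_def)
  ultimately show ?thesis by (simp add: h_def)
qed

section \<open>Uniqueness\<close>

context bounded_cylinder
begin

lemma product_derivatives:
  assumes v: "v \<in> Hk0 2 \<Omega>" and c: "c \<in> borel_measurable borel" "\<And>t. \<bar>c t\<bar> \<le> C"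
  defines "\<phi> \<equiv> \<lambda>z. v (fst z) * c (snd z)"
  shows "AE z in lebesgue_on Q. DQ i \<phi> z = D\<Omega> i v (fst z) * c (snd z)"
    and "AE z in lebesgue_on Q. DQ j (DQ i \<phi>) z = D\<Omega> j (D\<Omega> i v) (fst z) * c (snd z)"
proof -
  have \<phi>: "\<phi> \<in> L2_H20 \<Omega> T" unfolding \<phi>_def by (rule product_L2_H20[OF v c])
  have vH: "v \<in> Hk (Suc (Suc 0)) \<Omega>" using Hk0_Hk[OF v] by (simp add: numeral_2_eq_2 del: Hk.simps)
  have sl: "slice \<phi> t = (\<lambda>x. c t * v x)" for t by (simp add: slice_def \<phi>_def mult.commute)
  have cm: "(\<lambda>z. c (snd z)) \<in> borel_measurable (lebesgue_on Q)" by (rule meas_snd[OF borel_measurable_lebesgue_onI[OF c(1)]])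
  have e1: "AE x in lebesgue_on \<Omega>. D\<Omega> i (slice \<phi> t) x = c t * D\<Omega> i v x" for t
    using weak_deriv_lincomb_AE[OF vH vH open_\<Omega> dir_Basis, of i "c t" 0] by (simp add: sl)
  show "AE z in lebesgue_on Q. DQ i \<phi> z = D\<Omega> i v (fst z) * c (snd z)"
  proof (rule AE_Q_eqI)
    show "DQ i \<phi> \<in> borel_measurable (lebesgue_on Q)" using L2_measurable[OF L2_H20D(3)[OF \<phi>]] .
    show "(\<lambda>z. D\<Omega> i v (fst z) * c (snd z)) \<in> borel_measurable (lebesgue_on Q)"
      using meas_fst[OF L2_measurable[OF Hk2D(2)[OF Hk0_Hk[OF v]]]] cm by (rule borel_measurable_times)
    show "AE t in lebesgue_on I. AE x in lebesgue_on \<Omega>. DQ i \<phi> (x, t) = D\<Omega> i v (fst (x, t)) * c (snd (x, t))"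
      using L2_H20D(4)[OF \<phi>, of i]
    proof eventually_elim
      case (elim t)
      then show ?case using e1[of t] by eventually_elim (simp add: mult.commute)
    qed
  qed
  note dv = Hk_weak_deriv(2)[OF vH dir_Basis open_\<Omega>, of i]
  have e2: "AE x in lebesgue_on \<Omega>. D\<Omega> j (D\<Omega> i (slice \<phi> t)) x = c t * D\<Omega> j (D\<Omega> i v) x" for t
  proof -
    have 1: "has_weak_deriv \<Omega> (dir j) (\<lambda>x. c t * D\<Omega> i v x + 0 * D\<Omega> i v x) (\<lambda>x. c t * D\<Omega> j (D\<Omega> i v) x + 0 * D\<Omega> j (D\<Omega> i v) x)"
      by (rule has_weak_deriv_lincomb[OF Hk_weak_deriv(1)[OF dv dir_Basis open_\<Omega>] Hk_weak_deriv(1)[OF dv dir_Basis open_\<Omega>] open_\<Omega>])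
    have "AE x in lebesgue_on \<Omega>. c t * D\<Omega> i v x + 0 * D\<Omega> i v x = D\<Omega> i (slice \<phi> t) x"
      using e1[of t] by (elim eventually_mono) simp
    from has_weak_deriv_cong_AE[OF 1 this _ open_\<Omega>, of "\<lambda>x. c t * D\<Omega> j (D\<Omega> i v) x"]
    have "has_weak_deriv \<Omega> (dir j) (D\<Omega> i (slice \<phi> t)) (\<lambda>x. c t * D\<Omega> j (D\<Omega> i v) x)" by simp
    from weak_deriv_AE_eq[OF this open_\<Omega>] show ?thesis .
  qed
  show "AE z in lebesgue_on Q. DQ j (DQ i \<phi>) z = D\<Omega> j (D\<Omega> i v) (fst z) * c (snd z)"
  proof (rule AE_Q_eqI)
    show "DQ j (DQ i \<phi>) \<in> borel_measurable (lebesgue_on Q)" using L2_measurable[OF L2_H20D(6)[OF \<phi>]] .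
    show "(\<lambda>z. D\<Omega> j (D\<Omega> i v) (fst z) * c (snd z)) \<in> borel_measurable (lebesgue_on Q)"
      using meas_fst[OF L2_measurable[OF Hk2D(4)[OF Hk0_Hk[OF v]]]] cm by (rule borel_measurable_times)
    show "AE t in lebesgue_on I. AE x in lebesgue_on \<Omega>. DQ j (DQ i \<phi>) (x, t) = D\<Omega> j (D\<Omega> i v) (fst (x, t)) * c (snd (x, t))"
      using L2_H20D(7)[OF \<phi>, of j i]
    proof eventually_elim
      case (elim t)
      then show ?case using e2[of t] by eventually_elim (simp add: mult.commute)
    qed
  qed
qed

text \<open>The inequalities in time, integrated over space.\<close>

lemma weighted_energy:
  assumes g: "g \<in> L2 Q" and k: "k \<in> L2 Q" and l: "0 < \<mu>"
  shows "integrable (lebesgue_on Q) (\<lambda>z. exp (- \<mu> * snd z) * (time_primitive I k z * g z))"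
    and "0 \<le> (\<integral>z. exp (- \<mu> * snd z) * (time_primitive I g z * g z) \<partial>lebesgue_on Q)"
    and "0 \<le> (\<integral>z. exp (- \<mu> * snd z) * (time_primitive I g z * g z) \<partial>lebesgue_on Q)
       - (\<integral>z. exp (- \<mu> * snd z) * (time_primitive I k z * g z) \<partial>lebesgue_on Q)
       + (\<integral>z. exp (- \<mu> * snd z) * (k z)\<^sup>2 \<partial>lebesgue_on Q) / (2 * \<mu>)"
    and "integrable (lebesgue_on Q) (\<lambda>z. exp (- \<mu> * snd z) * (k z)\<^sup>2)"
proof -
  have E: "(\<lambda>z. exp (- \<mu> * snd z)) \<in> borel_measurable (lebesgue_on Q)"
    by (rule borel_measurable_lebesgue_onI) (auto intro!: borel_measurable_continuous_onI continuous_intros)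
  have E1: "\<bar>exp (- \<mu> * snd z)\<bar> \<le> 1" if "z \<in> Q" for z using that l by (auto simp: cylinder_def)
  have w: "integrable (lebesgue_on Q) (\<lambda>z. exp (- \<mu> * snd z) * (f z * h z))" if "f \<in> L2 Q" "h \<in> L2 Q" for f h
    using L2_mult_integrable[OF L2_bounded_mult[OF that(1) E E1] that(2)] by (simp add: mult.assoc)
  note w' = w[OF time_primitive_L2]
  show "integrable (lebesgue_on Q) (\<lambda>z. exp (- \<mu> * snd z) * (time_primitive I k z * g z))" by (rule w'[OF k g])
  show k2: "integrable (lebesgue_on Q) (\<lambda>z. exp (- \<mu> * snd z) * (k z)\<^sup>2)" using w[OF k k] by (simp add: power2_eq_square)
  have rw: "(\<integral>t. exp (- \<mu> * snd (x, t)) * (time_primitive I f (x, t) * h (x, t)) \<partial>lebesgue_on I)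
     = (\<integral>t. exp (- \<mu> * t) * h (x, t) * (\<integral>s. indicator {..<t} s * f (x, s) \<partial>lebesgue_on I) \<partial>lebesgue_on I)" for x f h
    by (simp add: time_primitive_def mult.assoc mult.commute[of "h _"])
  have s: "AE x in lebesgue_on \<Omega>. (\<lambda>t. k (x, t)) \<in> L2 I" "AE x in lebesgue_on \<Omega>. integrable (lebesgue_on I) (\<lambda>t. g (x, t))"
    using L2_slices_time(1)[OF k] int_slices(4)[OF L2_integrable[OF lmeasurable(3) g]] by auto
  show "0 \<le> (\<integral>z. exp (- \<mu> * snd z) * (time_primitive I g z * g z) \<partial>lebesgue_on Q)"
    unfolding int_slices(6)[OF w'[OF g g], symmetric] rw
    by (rule integral_nonneg_AE) (use s(2) in \<open>eventually_elim, intro weighted_primitive_nonneg, use l in auto\<close>)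
  note i = int_slices(5)[OF w'[OF g g]] int_slices(5)[OF w'[OF k g]] int_slices(5)[OF k2]
  have "(\<integral>z. exp (- \<mu> * snd z) * (time_primitive I g z * g z) \<partial>lebesgue_on Q)
       - (\<integral>z. exp (- \<mu> * snd z) * (time_primitive I k z * g z) \<partial>lebesgue_on Q)
       + (\<integral>z. exp (- \<mu> * snd z) * (k z)\<^sup>2 \<partial>lebesgue_on Q) / (2 * \<mu>)
     = (\<integral>x. (\<integral>t. exp (- \<mu> * snd (x, t)) * (time_primitive I g (x, t) * g (x, t)) \<partial>lebesgue_on I)
        - (\<integral>t. exp (- \<mu> * snd (x, t)) * (time_primitive I k (x, t) * g (x, t)) \<partial>lebesgue_on I)
        + (\<integral>t. exp (- \<mu> * snd (x, t)) * (k (x, t))\<^sup>2 \<partial>lebesgue_on I) / (2 * \<mu>) \<partial>lebesgue_on \<Omega>)"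
    unfolding int_slices(6)[OF w'[OF g g], symmetric] int_slices(6)[OF w'[OF k g], symmetric] int_slices(6)[OF k2, symmetric]
    using i by (subst Bochner_Integration.integral_add) (auto simp del: snd_conv)
  also have "\<dots> \<ge> 0"
  proof (rule integral_nonneg_AE)
    show "AE x in lebesgue_on \<Omega>. 0 \<le> (\<integral>t. exp (- \<mu> * snd (x, t)) * (time_primitive I g (x, t) * g (x, t)) \<partial>lebesgue_on I)
        - (\<integral>t. exp (- \<mu> * snd (x, t)) * (time_primitive I k (x, t) * g (x, t)) \<partial>lebesgue_on I)
        + (\<integral>t. exp (- \<mu> * snd (x, t)) * (k (x, t))\<^sup>2 \<partial>lebesgue_on I) / (2 * \<mu>)"
      using s unfolding rw
    proof eventually_elim
      case (elim x)
      from weighted_primitive_perturbed[OF elim(2,1) l] show ?case by simp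
    qed
  qed
  finally show "0 \<le> (\<integral>z. exp (- \<mu> * snd z) * (time_primitive I g z * g z) \<partial>lebesgue_on Q)
       - (\<integral>z. exp (- \<mu> * snd z) * (time_primitive I k z * g z) \<partial>lebesgue_on Q)
       + (\<integral>z. exp (- \<mu> * snd z) * (k z)\<^sup>2 \<partial>lebesgue_on Q) / (2 * \<mu>)" .
qed

end

context richards
begin

text \<open>Test functions in \<open>L\<^sup>2(0,T; H\<^sub>0\<^sup>2)\<close> may jump in time: the equation is tested with \<open>w\<close> up to time \<open>\<tau>\<close> and with zero
  afterwards.\<close>

lemma time_integrated_equation:
  assumes D: "D \<in> L2 Q" and k: "k \<in> L2 Q" and G: "\<And>i. G i \<in> L2 Q" and l: "l \<in> L2 Q"
    and eq: "\<And>\<phi>. \<phi> \<in> L2_H20 \<Omega> T \<Longrightarrow>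
      (\<integral>z. D z * \<phi> z - k z * DQ 3 \<phi> z + (\<Sum>i\<in>UNIV. G i z * DQ i \<phi> z) + \<gamma> * (l z * lap \<phi> z) \<partial>lebesgue_on Q) = 0"
    and w: "w \<in> Hk0 2 \<Omega>"
  shows "(\<integral>x. time_primitive I D (x, \<tau>) * w x - time_primitive I k (x, \<tau>) * D\<Omega> 3 w x
      + (\<Sum>i\<in>UNIV. time_primitive I (G i) (x, \<tau>) * D\<Omega> i w x)
      + \<gamma> * (time_primitive I l (x, \<tau>) * (\<Sum>i\<in>UNIV. D\<Omega> i (D\<Omega> i w) x)) \<partial>lebesgue_on \<Omega>) = 0"
proof -
  define c where "c t = (indicator {..<\<tau>} t :: real)" for t
  have cm: "c \<in> borel_measurable borel" unfolding c_def[abs_def] by (rule borel_measurable_indicator) simp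
  have cb: "\<bar>c t\<bar> \<le> 1" for t by (simp add: c_def indicator_def)
  define \<phi> where "\<phi> z = w (fst z) * c (snd z)" for z
  have \<phi>: "\<phi> \<in> L2_H20 \<Omega> T" unfolding \<phi>_def[abs_def] by (rule product_L2_H20[OF w cm cb])
  have pd: "AE z in lebesgue_on Q. DQ i \<phi> z = D\<Omega> i w (fst z) * c (snd z)"
    "AE z in lebesgue_on Q. DQ j (DQ i \<phi>) z = D\<Omega> j (D\<Omega> i w) (fst z) * c (snd z)" for i j
    unfolding \<phi>_def[abs_def] by (rule product_derivatives[OF w cm cb])+
  have all: "AE z in lebesgue_on Q. \<forall>i. DQ i \<phi> z = D\<Omega> i w (fst z) * c (snd z) \<and> DQ i (DQ i \<phi>) z = D\<Omega> i (D\<Omega> i w) (fst z) * c (snd z)"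
    using pd by (simp add: AE_all_countable)
  define Lw where "Lw x = (\<Sum>i\<in>UNIV. D\<Omega> i (D\<Omega> i w) x)" for x
  have wL: "w \<in> L2 \<Omega>" using Hk_L2[OF Hk0_Hk[OF w]] .
  have dL: "D\<Omega> i w \<in> L2 \<Omega>" for i by (rule Hk2D(2)[OF Hk0_Hk[OF w]])
  have lL: "Lw \<in> L2 \<Omega>" unfolding Lw_def[abs_def] by (intro L2_sum Hk2D(4)[OF Hk0_Hk[OF w]])
  have pr: "(\<integral>z. m z * (v (fst z) * c (snd z)) \<partial>lebesgue_on Q) = (\<integral>x. time_primitive I m (x, \<tau>) * v x \<partial>lebesgue_on \<Omega>)"
    "integrable (lebesgue_on Q) (\<lambda>z. m z * (v (fst z) * c (snd z)))"
    "integrable (lebesgue_on \<Omega>) (\<lambda>x. time_primitive I m (x, \<tau>) * v x)"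
    if "m \<in> L2 Q" "v \<in> L2 \<Omega>" for m v
    using product_Q_integral[OF that cm cb] L2_mult_integrable[OF time_primitive_at[OF that(1)] that(2)]
    by (auto simp: time_primitive_def c_def)
  have "0 = (\<integral>z. D z * \<phi> z - k z * DQ 3 \<phi> z + (\<Sum>i\<in>UNIV. G i z * DQ i \<phi> z) + \<gamma> * (l z * lap \<phi> z) \<partial>lebesgue_on Q)"
    using eq[OF \<phi>] by simp
  also have "\<dots> = (\<integral>z. D z * (w (fst z) * c (snd z)) - k z * (D\<Omega> 3 w (fst z) * c (snd z))
      + (\<Sum>i\<in>UNIV. G i z * (D\<Omega> i w (fst z) * c (snd z))) + \<gamma> * (l z * (Lw (fst z) * c (snd z))) \<partial>lebesgue_on Q)"
  proof (rule integral_lebesgue_on_cong_AE[OF _ sets_lebesgue(3)])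
    show "AE z in lebesgue_on Q. D z * (w (fst z) * c (snd z)) - k z * (D\<Omega> 3 w (fst z) * c (snd z))
      + (\<Sum>i\<in>UNIV. G i z * (D\<Omega> i w (fst z) * c (snd z))) + \<gamma> * (l z * (Lw (fst z) * c (snd z)))
      = D z * \<phi> z - k z * DQ 3 \<phi> z + (\<Sum>i\<in>UNIV. G i z * DQ i \<phi> z) + \<gamma> * (l z * lap \<phi> z)"
      using all by (elim eventually_mono) (simp add: \<phi>_def lap_eq Lw_def sum_distrib_right)
  qed
  also have "\<dots> = (\<integral>x. time_primitive I D (x, \<tau>) * w x \<partial>lebesgue_on \<Omega>) - (\<integral>x. time_primitive I k (x, \<tau>) * D\<Omega> 3 w x \<partial>lebesgue_on \<Omega>)
      + (\<Sum>i\<in>UNIV. \<integral>x. time_primitive I (G i) (x, \<tau>) * D\<Omega> i w x \<partial>lebesgue_on \<Omega>)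
      + \<gamma> * (\<integral>x. time_primitive I l (x, \<tau>) * Lw x \<partial>lebesgue_on \<Omega>)"
    using pr(2)[OF D wL] pr(2)[OF k dL] pr(2)[OF G dL] pr(2)[OF l lL]
    by (simp add: pr(1)[OF D wL] pr(1)[OF k dL] pr(1)[OF G dL] pr(1)[OF l lL])
  also have "\<dots> = (\<integral>x. time_primitive I D (x, \<tau>) * w x - time_primitive I k (x, \<tau>) * D\<Omega> 3 w x
      + (\<Sum>i\<in>UNIV. time_primitive I (G i) (x, \<tau>) * D\<Omega> i w x)
      + \<gamma> * (time_primitive I l (x, \<tau>) * Lw x) \<partial>lebesgue_on \<Omega>)"
    using pr(3)[OF D wL] pr(3)[OF k dL] pr(3)[OF G dL] pr(3)[OF l lL] by simp
  finally show ?thesis by (simp add: Lw_def)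
qed

text \<open>Testing directly with \<open>d = v1 - v2\<close> fails because \<open>g1 - g2\<close> is the derivative of \<open>b(v1) - b(v2)\<close> and not of
  \<open>d\<close>. In the equation integrated in time, \<open>b(v1) - b(v2)\<close> itself meets \<open>d\<close>, which monotonicity makes
  nonnegative.\<close>

lemma normal_solution_unique:
  assumes s1: "normal_solution v1 g1" and s2: "normal_solution v2 g2"
  shows "AE z in lebesgue_on Q. v1 z = v2 z"
proof -
  have v1: "v1 \<in> L2_H20 \<Omega> T" and v2: "v2 \<in> L2_H20 \<Omega> T" and g1: "g1 \<in> L2 Q" and g2: "g2 \<in> L2 Q"
    and i1: "AE z in lebesgue_on Q. b (v1 z) = S (p0 (fst z)) + time_primitive I g1 z"
    and i2: "AE z in lebesgue_on Q. b (v2 z) = S (p0 (fst z)) + time_primitive I g2 z"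
    using s1 s2 by (auto simp: normal_solution_def)
  define D where "D z = g1 z - g2 z" for z
  define k where "k z = K (b (v1 z)) - K (b (v2 z))" for z
  define G where "G i z = DQ i v1 z - DQ i v2 z" for i z
  define l where "l z = lap v1 z - lap v2 z" for z
  define d where "d z = v1 z - v2 z" for z
  note L1 = L2_H20D(1)[OF v1] and L2' = L2_H20D(1)[OF v2]
  have DL: "D \<in> L2 Q" unfolding D_def[abs_def] by (rule L2_diff[OF g1 g2])
  have kL: "k \<in> L2 Q" unfolding k_def[abs_def] by (rule L2_diff[OF K_b_L2[OF L1] K_b_L2[OF L2']])
  have GL: "G i \<in> L2 Q" for i unfolding G_def[abs_def] by (rule L2_diff[OF L2_H20D(3)[OF v1] L2_H20D(3)[OF v2]])
  have lL: "l \<in> L2 Q" unfolding l_def[abs_def] by (rule L2_diff[OF lap_L2[OF v1] lap_L2[OF v2]])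
  have dL: "d \<in> L2 Q" unfolding d_def[abs_def] by (rule L2_diff[OF L1 L2'])
  have eq: "(\<integral>z. D z * \<phi> z - k z * DQ 3 \<phi> z + (\<Sum>i\<in>UNIV. G i z * DQ i \<phi> z) + \<gamma> * (l z * lap \<phi> z) \<partial>lebesgue_on Q) = 0"
    if \<phi>: "\<phi> \<in> L2_H20 \<Omega> T" for \<phi>
  proof -
    have i: "integrable (lebesgue_on Q) (\<lambda>z. g z * \<phi> z - K (b (v z)) * DQ 3 \<phi> z + (\<Sum>i\<in>UNIV. DQ i v z * DQ i \<phi> z) + \<gamma> * (lap v z * lap \<phi> z))"
      if "v \<in> L2_H20 \<Omega> T" "g \<in> L2 Q" for v g
      using L2_mult_integrable[OF that(2) L2_H20D(1)[OF \<phi>]] inner_nabla_L1[OF that(1) \<phi>]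
        L2_mult_integrable[OF K_b_L2[OF L2_H20D(1)[OF that(1)]] L2_H20D(3)[OF \<phi>]]
        L2_mult_integrable[OF lap_L2[OF that(1)] lap_L2[OF \<phi>]] by auto
    have "(\<lambda>z. D z * \<phi> z - k z * DQ 3 \<phi> z + (\<Sum>i\<in>UNIV. G i z * DQ i \<phi> z) + \<gamma> * (l z * lap \<phi> z))
      = (\<lambda>z. (g1 z * \<phi> z - K (b (v1 z)) * DQ 3 \<phi> z + (\<Sum>i\<in>UNIV. DQ i v1 z * DQ i \<phi> z) + \<gamma> * (lap v1 z * lap \<phi> z))
        - (g2 z * \<phi> z - K (b (v2 z)) * DQ 3 \<phi> z + (\<Sum>i\<in>UNIV. DQ i v2 z * DQ i \<phi> z) + \<gamma> * (lap v2 z * lap \<phi> z)))"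
      by (simp add: D_def k_def G_def l_def algebra_simps sum_subtractf)
    then show ?thesis using i[OF v1 g1] i[OF v2 g2] s1 s2 \<phi> by (simp add: normal_solution_def)
  qed
  \<comment> \<open>The equation integrated up to time \<open>\<tau>\<close> is tested with \<open>v1\<close> and \<open>v2\<close> at the same time \<open>\<tau>\<close>.\<close>
  define R where "R z = time_primitive I D z * d z - time_primitive I k z * G 3 z
     + (\<Sum>i\<in>UNIV. time_primitive I (G i) z * G i z) + \<gamma> * (time_primitive I l z * l z)" for z
  note pL = time_primitive_L2
  have slice_eq: "AE t in lebesgue_on I.
      (\<integral>x. time_primitive I D (x, t) * v (x, t) - time_primitive I k (x, t) * DQ 3 v (x, t)
      + (\<Sum>i\<in>UNIV. time_primitive I (G i) (x, t) * DQ i v (x, t)) + \<gamma> * (time_primitive I l (x, t) * lap v (x, t)) \<partial>lebesgue_on \<Omega>) = 0"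
    if v: "v \<in> L2_H20 \<Omega> T" for v
  proof -
    have "AE t in lebesgue_on I. slice v t \<in> Hk0 2 \<Omega>" by (rule L2_H20_slices[OF v]) blast
    moreover have "AE t in lebesgue_on I. \<forall>i. AE x in lebesgue_on \<Omega>. DQ i v (x, t) = D\<Omega> i (slice v t) x"
      using L2_H20D(4)[OF v] by (subst AE_all_countable) auto
    moreover have "AE t in lebesgue_on I. \<forall>i. AE x in lebesgue_on \<Omega>. DQ i (DQ i v) (x, t) = D\<Omega> i (D\<Omega> i (slice v t)) x"
      using L2_H20D(7)[OF v] by (subst AE_all_countable) auto
    ultimately show ?thesis
    proof eventually_elim
      case (elim t)
      have a: "AE x in lebesgue_on \<Omega>. (\<forall>i. DQ i v (x, t) = D\<Omega> i (slice v t) x) \<and> (\<forall>i. DQ i (DQ i v) (x, t) = D\<Omega> i (D\<Omega> i (slice v t)) x)"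
        using elim(2,3) by (simp add: AE_all_countable)
      have "(\<integral>x. time_primitive I D (x, t) * v (x, t) - time_primitive I k (x, t) * DQ 3 v (x, t)
        + (\<Sum>i\<in>UNIV. time_primitive I (G i) (x, t) * DQ i v (x, t)) + \<gamma> * (time_primitive I l (x, t) * lap v (x, t)) \<partial>lebesgue_on \<Omega>)
        = (\<integral>x. time_primitive I D (x, t) * slice v t x - time_primitive I k (x, t) * D\<Omega> 3 (slice v t) x
        + (\<Sum>i\<in>UNIV. time_primitive I (G i) (x, t) * D\<Omega> i (slice v t) x)
        + \<gamma> * (time_primitive I l (x, t) * (\<Sum>i\<in>UNIV. D\<Omega> i (D\<Omega> i (slice v t)) x)) \<partial>lebesgue_on \<Omega>)"
        by (rule integral_lebesgue_on_cong_AE[OF _ sets_lebesgue(1)])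
           (use a in \<open>elim eventually_mono, simp add: lap_eq slice_def\<close>)
      then show ?case using time_integrated_equation[OF DL kL GL lL eq elim(1), of t] by simp
    qed
  qed
  have tI: "integrable (lebesgue_on Q) (\<lambda>z. time_primitive I D z * v z - time_primitive I k z * DQ 3 v z
      + (\<Sum>i\<in>UNIV. time_primitive I (G i) z * DQ i v z) + \<gamma> * (time_primitive I l z * lap v z))"
    if v: "v \<in> L2_H20 \<Omega> T" for v
  proof -
    have "integrable (lebesgue_on Q) (\<lambda>z. \<Sum>i\<in>UNIV. time_primitive I (G i) z * DQ i v z)"
      by (intro Bochner_Integration.integrable_sum L2_mult_integrable[OF pL[OF GL] L2_H20D(3)[OF v]])
    then show ?thesis
      using L2_mult_integrable[OF pL[OF DL] L2_H20D(1)[OF v]] L2_mult_integrable[OF pL[OF kL] L2_H20D(3)[OF v]]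
        L2_mult_integrable[OF pL[OF lL] lap_L2[OF v]] by auto
  qed
  have Rsplit: "R z = (time_primitive I D z * v1 z - time_primitive I k z * DQ 3 v1 z
      + (\<Sum>i\<in>UNIV. time_primitive I (G i) z * DQ i v1 z) + \<gamma> * (time_primitive I l z * lap v1 z))
    - (time_primitive I D z * v2 z - time_primitive I k z * DQ 3 v2 z
      + (\<Sum>i\<in>UNIV. time_primitive I (G i) z * DQ i v2 z) + \<gamma> * (time_primitive I l z * lap v2 z))" for z
    by (simp add: R_def d_def G_def[of _ z] l_def[of z] algebra_simps sum_subtractf)
  have R0: "AE t in lebesgue_on I. (\<integral>x. R (x, t) \<partial>lebesgue_on \<Omega>) = 0"
    using slice_eq[OF v1] slice_eq[OF v2] int_slices(1)[OF tI[OF v1]] int_slices(1)[OF tI[OF v2]]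
    by eventually_elim (simp add: Rsplit)
  obtain C where C: "C > 0" "\<And>y z. (K (b y) - K (b z))\<^sup>2 \<le> C * ((b y - b z) * (y - z))"
    using drift_controlled_by_monotonicity by blast
  \<comment> \<open>With this rate the remainder of the gravity term is half of the monotone term.\<close>
  define E where "E z = exp (- C * snd z)" for z :: "(real^3) \<times> real"
  have Em: "E \<in> borel_measurable (lebesgue_on Q)" unfolding E_def[abs_def]
    by (rule borel_measurable_lebesgue_onI) (auto intro!: borel_measurable_continuous_onI continuous_intros)
  have E1: "\<bar>E z\<bar> \<le> 1" if "z \<in> Q" for z using that C(1) by (auto simp: cylinder_def E_def)
  have Ei: "integrable (lebesgue_on Q) (\<lambda>z. E z * (f z * h z))" if "f \<in> L2 Q" "h \<in> L2 Q" for f h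
    using L2_mult_integrable[OF L2_bounded_mult[OF that(1) Em E1] that(2)] by (simp add: mult.assoc)
  have eD: "integrable (lebesgue_on Q) (\<lambda>z. E z * (time_primitive I D z * d z))" by (rule Ei[OF pL[OF DL] dL])
  have ek: "integrable (lebesgue_on Q) (\<lambda>z. E z * (time_primitive I k z * G 3 z))" by (rule Ei[OF pL[OF kL] GL])
  have eG: "integrable (lebesgue_on Q) (\<lambda>z. E z * (time_primitive I (G i) z * G i z))" for i by (rule Ei[OF pL[OF GL] GL])
  have el: "integrable (lebesgue_on Q) (\<lambda>z. E z * (time_primitive I l z * l z))" by (rule Ei[OF pL[OF lL] lL])
  have kk: "integrable (lebesgue_on Q) (\<lambda>z. E z * (k z)\<^sup>2)" using Ei[OF kL kL] by (simp add: power2_eq_square)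
  have ER: "E z * R z = E z * (time_primitive I D z * d z) - E z * (time_primitive I k z * G 3 z)
     + (\<Sum>i\<in>UNIV. E z * (time_primitive I (G i) z * G i z)) + \<gamma> * (E z * (time_primitive I l z * l z))" for z
    by (simp add: R_def distrib_left right_diff_distrib sum_distrib_left mult.left_commute)
  have ERi: "integrable (lebesgue_on Q) (\<lambda>z. E z * R z)" unfolding ER using eD ek eG el by auto
  have "(\<integral>z. E z * R z \<partial>lebesgue_on Q) = (\<integral>t. \<integral>x. E (x, t) * R (x, t) \<partial>lebesgue_on \<Omega> \<partial>lebesgue_on I)"
    using int_slices(3)[OF ERi] by simp
  also have "\<dots> = (\<integral>t. 0 \<partial>lebesgue_on I)"
    by (rule integral_lebesgue_on_cong_AE[OF _ sets_lebesgue(2)]) (use R0 in \<open>elim eventually_mono, simp add: E_def\<close>)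
  finally have zero: "(\<integral>z. E z * (time_primitive I D z * d z) \<partial>lebesgue_on Q) - (\<integral>z. E z * (time_primitive I k z * G 3 z) \<partial>lebesgue_on Q)
     + (\<Sum>i\<in>UNIV. \<integral>z. E z * (time_primitive I (G i) z * G i z) \<partial>lebesgue_on Q)
     + \<gamma> * (\<integral>z. E z * (time_primitive I l z * l z) \<partial>lebesgue_on Q) = 0"
    unfolding ER using eD ek eG el by simp
  have nonneg: "0 \<le> (\<integral>z. E z * (time_primitive I (G i) z * G i z) \<partial>lebesgue_on Q)" for i
    unfolding E_def using weighted_energy(2)[OF GL kL C(1)] .
  have nonnegl: "0 \<le> (\<integral>z. E z * (time_primitive I l z * l z) \<partial>lebesgue_on Q)"
    unfolding E_def using weighted_energy(2)[OF lL kL C(1)] .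
  have pert: "0 \<le> (\<integral>z. E z * (time_primitive I (G 3) z * G 3 z) \<partial>lebesgue_on Q)
     - (\<integral>z. E z * (time_primitive I k z * G 3 z) \<partial>lebesgue_on Q) + (\<integral>z. E z * (k z)\<^sup>2 \<partial>lebesgue_on Q) / (2 * C)"
    unfolding E_def using weighted_energy(3)[OF GL kL C(1)] .
  have "(\<integral>z. E z * (time_primitive I (G 3) z * G 3 z) \<partial>lebesgue_on Q)
     \<le> (\<Sum>i\<in>UNIV. \<integral>z. E z * (time_primitive I (G i) z * G i z) \<partial>lebesgue_on Q)"
    using nonneg by (intro member_le_sum) auto
  moreover have "0 \<le> \<gamma> * (\<integral>z. E z * (time_primitive I l z * l z) \<partial>lebesgue_on Q)"
    using nonnegl \<gamma>_pos by simp
  ultimately have up: "(\<integral>z. E z * (time_primitive I D z * d z) \<partial>lebesgue_on Q) \<le> (\<integral>z. E z * (k z)\<^sup>2 \<partial>lebesgue_on Q) / (2 * C)"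
    using zero pert by linarith
  have "AE x in lebesgue_on \<Omega>. \<forall>t. time_primitive I D (x, t) = time_primitive I g1 (x, t) - time_primitive I g2 (x, t)"
    using int_slices(4)[OF L2_integrable[OF lmeasurable(3) g1]] int_slices(4)[OF L2_integrable[OF lmeasurable(3) g2]]
  proof eventually_elim
    case (elim x)
    show ?case
    proof
      fix t :: real
      have "integrable (lebesgue_on I) (\<lambda>s. indicator {..<t} s * g (x, s))" if "integrable (lebesgue_on I) (\<lambda>s. g (x, s))" for g :: "(real^3) \<times> real \<Rightarrow> real"
        using indicator_exp_mult_integrable[OF that, of "{..<t}" 0] by simp
      then show "time_primitive I D (x, t) = time_primitive I g1 (x, t) - time_primitive I g2 (x, t)"
        using elim by (simp add: time_primitive_def D_def right_diff_distrib)
    qed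
  qed
  from AE_fst[OF this] i1 i2
  have prim: "AE z in lebesgue_on Q. time_primitive I D z = b (v1 z) - b (v2 z)"
  proof eventually_elim
    case (elim z)
    then show ?case by (cases z) auto
  qed
  have mono: "(k z)\<^sup>2 \<le> C * ((b (v1 z) - b (v2 z)) * d z)" for z
    unfolding k_def d_def by (rule C(2))
  have "(\<integral>z. E z * (k z)\<^sup>2 \<partial>lebesgue_on Q) / (2 * C) = (\<integral>z. E z * (k z)\<^sup>2 / (2 * C) \<partial>lebesgue_on Q)" by simp
  also have "\<dots> \<le> (\<integral>z. E z * (time_primitive I D z * d z) / 2 \<partial>lebesgue_on Q)"
  proof (rule integral_mono_AE)
    show "AE z in lebesgue_on Q. E z * (k z)\<^sup>2 / (2 * C) \<le> E z * (time_primitive I D z * d z) / 2"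
      using prim
    proof eventually_elim
      case (elim z)
      have "E z * (k z)\<^sup>2 \<le> E z * (C * (time_primitive I D z * d z))"
        using mono[of z] unfolding elim by (intro mult_left_mono) (auto simp: E_def)
      then show ?case using C(1) by (simp add: field_simps)
    qed
  qed (use kk eD in auto)
  also have "\<dots> = (\<integral>z. E z * (time_primitive I D z * d z) \<partial>lebesgue_on Q) / 2" by simp
  finally have le: "(\<integral>z. E z * (time_primitive I D z * d z) \<partial>lebesgue_on Q) \<le> 0" using up by linarith
  have pos: "AE z in lebesgue_on Q. 0 \<le> E z * (time_primitive I D z * d z)"
    using prim
  proof eventually_elim
    case (elim z)
    have "0 \<le> (b (v1 z) - b (v2 z)) * d z"
      using order_trans[OF zero_le_power2 mono] C(1) by (simp add: zero_le_mult_iff)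
    then show ?case unfolding elim by (simp add: E_def)
  qed
  have "(\<integral>z. E z * (time_primitive I D z * d z) \<partial>lebesgue_on Q) = 0"
    using le integral_nonneg_AE[OF pos] by linarith
  then have "AE z in lebesgue_on Q. E z * (time_primitive I D z * d z) = 0"
    using integral_nonneg_eq_0_iff_AE[OF eD pos] by simp
  with prim show ?thesis
  proof eventually_elim
    case (elim z)
    then have "(b (v1 z) - b (v2 z)) * d z = 0" by (simp add: E_def)
    then show ?case using strict_mono_eq[OF b_strict_mono, of "v1 z" "v2 z"] by (auto simp: d_def)
  qed
qed

end

theorem theorem16:
  fixes \<Omega> :: "(real^3) set" and T \<gamma> :: real and S K \<psi> b :: "real \<Rightarrow> real"
    and p0 u0 :: "real^3 \<Rightarrow> real" and u p :: "(real^3) \<times> real \<Rightarrow> real"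
  assumes "open \<Omega>" and "bounded \<Omega>" and "connected \<Omega>" and "Ck_boundary 5 \<Omega>"
    and "0 < T" and "0 < \<gamma>"
    and "p0 \<in> Hk0 2 \<Omega>"
    and "S C1_differentiable_on UNIV" and "range S \<subseteq> {0<..1}"
    and "\<exists>L. L-lipschitz_on UNIV S" and "\<forall>x. 0 < S x" and "strict_mono S"
    and "K C1_differentiable_on UNIV" and "\<forall>s. 0 < K s" and "bounded (range K)" and "mono K"
    and "\<psi> = kirchhoff K S" and "b = S \<circ> inv \<psi>" and "u0 = \<psi> \<circ> p0"
    and "u \<in> Hk 1 (cylinder \<Omega> T)" and "u \<in> L2_H20 \<Omega> T"
    and "weak_solution_transformed \<Omega> T \<gamma> K b u0 u"
    and "p = inv \<psi> \<circ> u"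
  shows "weak_solution_fourth_order \<Omega> T \<gamma> K S p0 p \<and>
    (\<forall>q. weak_solution_fourth_order \<Omega> T \<gamma> K S p0 q \<longrightarrow>
      (AE z in lebesgue_on (cylinder \<Omega> T). q z = p z))"
proof -
  interpret richards \<Omega> T S K \<psi> b \<gamma> p0
    by unfold_locales (use assms in auto)
  have ex: "weak_solution_fourth_order \<Omega> T \<gamma> K S p0 p"
    using transformed_fourth_order assms by simp
  have "AE z in lebesgue_on (cylinder \<Omega> T). q z = p z" if q: "weak_solution_fourth_order \<Omega> T \<gamma> K S p0 q" for q
  proof -
    obtain g h where "normal_solution (\<psi> \<circ> q) g" "normal_solution (\<psi> \<circ> p) h"
      using fourth_order_normal[OF q] fourth_order_normal[OF ex] by blast
    from normal_solution_unique[OF this] show ?thesis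
      by (elim eventually_mono) (use \<psi>_inj in \<open>simp add: inj_eq\<close>)
  qed
  with ex show ?thesis by blast
qed

end
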